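(* Let $n\ge0$, let $\nu\in\mathbb C^{n+1}$, ${\rm Int}(\nu)=\{i:\nu_i\in\mathbb Z\}$ and $k=|{\rm Int}(\nu)|$. Assume first that $k>0$. Consider the $G_k$-grading on $\mathcal B(k)=\mathbb C[\theta_1,\dots,\theta_k]/(\theta_i^2-\theta_j^2)_{1\le i,j\le k}$ defined by $\deg(\theta_i)=\delta_i$, where $G_k=\mathbb Z_2^k=\bigoplus_{i=1}^k\mathbb Z_2\delta_i$. Then ${}_{\rm s}^{\rm b}(\mathcal D,\mathcal H)_\nu$-mod is equivalent to the category of finite-dimensional $G_k$-graded $\mathcal B(k)$-modules with nilpotent action of all $\theta_i$. If $k=0$, then ${}_{\rm s}^{\rm b}(\mathcal D,\mathcal H)_\nu$-mod is equivalent to the category of finite-dimensional $\mathbb C[z]$-modules with nilpotent action of $z$.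
   Context: Ground field $\mathbb C$. $\mathcal D=\mathcal D(n+1)$ is the Weyl algebra of differential operators on $\mathbb C[t_0,\dots,t_n]$, $\mathcal H=\mathbb C[t_0\partial_0,\dots,t_n\partial_n]$, and $\mathcal H'\subset\mathcal H$ is the subalgebra generated by all $t_i\partial_i-t_j\partial_j$. A generalized weight $(\mathcal D,\mathcal H)$-module is a $\mathcal D$-module $M=\bigoplus_{\lambda\in\mathbb C^{n+1}}M^{(\lambda)}$, $M^{(\lambda)}=\{m:(t_i\partial_i-\lambda_i)^Nm=0\text{ for some }N>0\text{ and all }i\}$. ${}_{\rm s}^{\rm b}(\mathcal D,\mathcal H)_\nu$-mod is the category of generalized weight $(\mathcal D,\mathcal H)$-modules with support $\{\lambda:M^{(\lambda)}\ne0\}$ in $\nu+\mathbb Z^{n+1}$, with finite-dimensional generalized weight spaces (equivalently, bounded multiplicities), and on which $\mathcal H'$ acts semisimply. *)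

theory Defs
  imports
    Complex_Main
    "HOL-Library.FuncSet"
    "HOL-Library.Poly_Mapping"
    "HOL-Library.Z2"
    "HOL-Algebra.Module"
    "HOL-Algebra.QuotRing"
    "HOL-Algebra.Generated_Rings"
begin

section \<open>Categories and equivalences\<close>

text \<open>Morphisms do not carry their source and target, so composition and the action of functors on
  morphisms take the objects involved as arguments: \<open>Comp C X Y Z g f\<close> is
  \<open>g \<circ> f : X \<rightarrow> Y \<rightarrow> Z\<close>.\<close>

record ('o, 'm) category =
  Obj :: "'o set"
  Hom :: "'o \<Rightarrow> 'o \<Rightarrow> 'm set"
  Idm :: "'o \<Rightarrow> 'm"
  Comp :: "'o \<Rightarrow> 'o \<Rightarrow> 'o \<Rightarrow> 'm \<Rightarrow> 'm \<Rightarrow> 'm"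

definition is_category :: "('o, 'm) category \<Rightarrow> bool" where
  "is_category C \<longleftrightarrow>
     (\<forall>X\<in>Obj C. Idm C X \<in> Hom C X X) \<and>
     (\<forall>X\<in>Obj C. \<forall>Y\<in>Obj C. \<forall>Z\<in>Obj C. \<forall>f\<in>Hom C X Y. \<forall>g\<in>Hom C Y Z.
        Comp C X Y Z g f \<in> Hom C X Z) \<and>
     (\<forall>X\<in>Obj C. \<forall>Y\<in>Obj C. \<forall>f\<in>Hom C X Y.
        Comp C X Y Y (Idm C Y) f = f \<and> Comp C X X Y f (Idm C X) = f) \<and>
     (\<forall>W\<in>Obj C. \<forall>X\<in>Obj C. \<forall>Y\<in>Obj C. \<forall>Z\<in>Obj C.
        \<forall>f\<in>Hom C W X. \<forall>g\<in>Hom C X Y. \<forall>h\<in>Hom C Y Z.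
        Comp C W Y Z h (Comp C W X Y g f) = Comp C W X Z (Comp C X Y Z h g) f)"

definition is_functor ::
  "('o, 'm) category \<Rightarrow> ('p, 'n) category \<Rightarrow> ('o \<Rightarrow> 'p) \<Rightarrow> ('o \<Rightarrow> 'o \<Rightarrow> 'm \<Rightarrow> 'n) \<Rightarrow> bool" where
  "is_functor C D Fo Fm \<longleftrightarrow>
     (\<forall>X\<in>Obj C. Fo X \<in> Obj D) \<and>
     (\<forall>X\<in>Obj C. \<forall>Y\<in>Obj C. \<forall>f\<in>Hom C X Y. Fm X Y f \<in> Hom D (Fo X) (Fo Y)) \<and>
     (\<forall>X\<in>Obj C. Fm X X (Idm C X) = Idm D (Fo X)) \<and>
     (\<forall>X\<in>Obj C. \<forall>Y\<in>Obj C. \<forall>Z\<in>Obj C. \<forall>f\<in>Hom C X Y. \<forall>g\<in>Hom C Y Z.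
        Fm X Z (Comp C X Y Z g f) = Comp D (Fo X) (Fo Y) (Fo Z) (Fm Y Z g) (Fm X Y f))"

definition is_iso :: "('o, 'm) category \<Rightarrow> 'o \<Rightarrow> 'o \<Rightarrow> 'm \<Rightarrow> bool" where
  "is_iso C X Y f \<longleftrightarrow> f \<in> Hom C X Y \<and>
     (\<exists>g\<in>Hom C Y X. Comp C X Y X g f = Idm C X \<and> Comp C Y X Y f g = Idm C Y)"

definition is_natural_iso ::
  "('o, 'm) category \<Rightarrow> ('p, 'n) category \<Rightarrow>
   ('o \<Rightarrow> 'p) \<Rightarrow> ('o \<Rightarrow> 'o \<Rightarrow> 'm \<Rightarrow> 'n) \<Rightarrow> ('o \<Rightarrow> 'p) \<Rightarrow> ('o \<Rightarrow> 'o \<Rightarrow> 'm \<Rightarrow> 'n) \<Rightarrow>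
   ('o \<Rightarrow> 'n) \<Rightarrow> bool" where
  "is_natural_iso C D Fo Fm Go Gm \<eta> \<longleftrightarrow>
     (\<forall>X\<in>Obj C. is_iso D (Fo X) (Go X) (\<eta> X)) \<and>
     (\<forall>X\<in>Obj C. \<forall>Y\<in>Obj C. \<forall>f\<in>Hom C X Y.
        Comp D (Fo X) (Go X) (Go Y) (Gm X Y f) (\<eta> X) =
        Comp D (Fo X) (Fo Y) (Go Y) (\<eta> Y) (Fm X Y f))"

definition equivalent_categories :: "('o, 'm) category \<Rightarrow> ('p, 'n) category \<Rightarrow> bool" where
  "equivalent_categories C D \<longleftrightarrow>
     is_category C \<and> is_category D \<and>
     (\<exists>Fo Fm Go Gm \<eta> \<epsilon>.
        is_functor C D Fo Fm \<and> is_functor D C Go Gm \<and>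
        is_natural_iso C C (\<lambda>X. X) (\<lambda>X Y f. f)
          (\<lambda>X. Go (Fo X)) (\<lambda>X Y f. Gm (Fo X) (Fo Y) (Fm X Y f)) \<eta> \<and>
        is_natural_iso D D (\<lambda>X. Fo (Go X)) (\<lambda>X Y f. Fm (Go X) (Go Y) (Gm X Y f))
          (\<lambda>X. X) (\<lambda>X Y f. f) \<epsilon>)"


section \<open>Modules\<close>

text \<open>The library locale \<open>module\<close> requires a commutative ring; this is the same notion for left
  modules over an arbitrary ring (cf. \<open>left_module_iff_module\<close> below).\<close>

locale left_module = R?: ring R + M?: abelian_group M
  for R :: "('r, 'x) ring_scheme" (structure) and M :: "('r, 'a, 'y) module_scheme" (structure) +
  assumes smult_closed:
      "\<lbrakk>a \<in> carrier R; x \<in> carrier M\<rbrakk> \<Longrightarrow> a \<odot>\<^bsub>M\<^esub> x \<in> carrier M"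
    and smult_l_distr:
      "\<lbrakk>a \<in> carrier R; b \<in> carrier R; x \<in> carrier M\<rbrakk> \<Longrightarrow>
      (a \<oplus>\<^bsub>R\<^esub> b) \<odot>\<^bsub>M\<^esub> x = a \<odot>\<^bsub>M\<^esub> x \<oplus>\<^bsub>M\<^esub> b \<odot>\<^bsub>M\<^esub> x"
    and smult_r_distr:
      "\<lbrakk>a \<in> carrier R; x \<in> carrier M; y \<in> carrier M\<rbrakk> \<Longrightarrow>
      a \<odot>\<^bsub>M\<^esub> (x \<oplus>\<^bsub>M\<^esub> y) = a \<odot>\<^bsub>M\<^esub> x \<oplus>\<^bsub>M\<^esub> a \<odot>\<^bsub>M\<^esub> y"
    and smult_assoc1:
      "\<lbrakk>a \<in> carrier R; b \<in> carrier R; x \<in> carrier M\<rbrakk> \<Longrightarrow>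
      (a \<otimes>\<^bsub>R\<^esub> b) \<odot>\<^bsub>M\<^esub> x = a \<odot>\<^bsub>M\<^esub> (b \<odot>\<^bsub>M\<^esub> x)"
    and smult_one:
      "x \<in> carrier M \<Longrightarrow> \<one>\<^bsub>R\<^esub> \<odot>\<^bsub>M\<^esub> x = x"

lemma left_module_iff_module:
  assumes "cring R" shows "left_module R M \<longleftrightarrow> module R M"
  using assms
  by (auto simp: left_module_def left_module_axioms_def module_def module_axioms_def cring_def)

text \<open>Homomorphisms are extensional, so that equal maps on the carrier are equal morphisms.\<close>

definition module_maps ::
  "('r, 'x) ring_scheme \<Rightarrow> ('r, 'a) module \<Rightarrow> ('r, 'b) module \<Rightarrow> ('a \<Rightarrow> 'b) set" where
  "module_maps R M N = {f \<in> carrier M \<rightarrow>\<^sub>E carrier N.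
     (\<forall>x\<in>carrier M. \<forall>y\<in>carrier M. f (x \<oplus>\<^bsub>M\<^esub> y) = f x \<oplus>\<^bsub>N\<^esub> f y) \<and>
     (\<forall>a\<in>carrier R. \<forall>x\<in>carrier M. f (a \<odot>\<^bsub>M\<^esub> x) = a \<odot>\<^bsub>N\<^esub> f x)}"

text \<open>The full subcategory of left \<open>R\<close>-modules satisfying \<open>P\<close>. The fields \<open>mult\<close> and \<open>one\<close> which a
  module record inherits from the ring record play no role: modules differing only in these fields
  are isomorphic via the identity.\<close>

definition module_category ::
  "('r, 'x) ring_scheme \<Rightarrow> (('r, 'a) module \<Rightarrow> bool) \<Rightarrow> (('r, 'a) module, 'a \<Rightarrow> 'a) category" where
  "module_category R P =
     \<lparr>Obj = {M. left_module R M \<and> P M},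
      Hom = module_maps R,
      Idm = (\<lambda>M. restrict id (carrier M)),
      Comp = (\<lambda>L M N g f. compose (carrier L) g f)\<rparr>"

definition internal_direct_sum ::
  "('a, 'x) ring_scheme \<Rightarrow> 'i set \<Rightarrow> ('i \<Rightarrow> 'a set) \<Rightarrow> bool" where
  "internal_direct_sum M I W \<longleftrightarrow>
     (\<forall>i\<in>I. additive_subgroup (W i) M) \<and>
     (\<forall>m\<in>carrier M. \<exists>!f. f \<in> (\<Pi>\<^sub>E i\<in>I. W i) \<and> finite {i\<in>I. f i \<noteq> \<zero>\<^bsub>M\<^esub>} \<and>
        m = (\<Oplus>\<^bsub>M\<^esub>i\<in>{i\<in>I. f i \<noteq> \<zero>\<^bsub>M\<^esub>}. f i))"

text \<open>For a module \<open>M\<close> over a complex algebra with structure map \<open>\<iota>\<close>: the complex subspace \<open>W\<close> of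
  \<open>M\<close> is finite-dimensional.\<close>

definition finite_dimensional :: "(complex \<Rightarrow> 'r) \<Rightarrow> ('r, 'a) module \<Rightarrow> 'a set \<Rightarrow> bool" where
  "finite_dimensional \<iota> M W \<longleftrightarrow>
     (\<exists>B. finite B \<and> B \<subseteq> W \<and> (\<forall>w\<in>W. \<exists>c. w = (\<Oplus>\<^bsub>M\<^esub>b\<in>B. \<iota> (c b) \<odot>\<^bsub>M\<^esub> b)))"

definition simple_submodule ::
  "'a set \<Rightarrow> ('r, 'x) ring_scheme \<Rightarrow> ('r, 'a) module \<Rightarrow> bool" where
  "simple_submodule S R M \<longleftrightarrow> submodule S R M \<and> S \<noteq> {\<zero>\<^bsub>M\<^esub>} \<and>
     (\<forall>T. submodule T R M \<and> T \<subseteq> S \<longrightarrow> T = {\<zero>\<^bsub>M\<^esub>} \<or> T = S)"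

text \<open>\<open>M\<close> is the sum of its simple submodules.\<close>

definition semisimple_module :: "('r, 'x) ring_scheme \<Rightarrow> ('r, 'a) module \<Rightarrow> bool" where
  "semisimple_module R M \<longleftrightarrow>
     (\<forall>m\<in>carrier M. \<exists>F x. finite F \<and> (\<forall>S\<in>F. simple_submodule S R M \<and> x S \<in> S) \<and>
        m = (\<Oplus>\<^bsub>M\<^esub>S\<in>F. x S))"


section \<open>Polynomials and the Weyl algebra\<close>

text \<open>Complex polynomials in variables indexed by natural numbers, as finitely supported maps from
  monomials (finitely supported exponent vectors) to coefficients.\<close>

type_synonym cpoly = "(nat \<Rightarrow>\<^sub>0 nat) \<Rightarrow>\<^sub>0 complex"

definition Const :: "complex \<Rightarrow> cpoly" where
  "Const c = Poly_Mapping.single 0 c"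

definition Var :: "nat \<Rightarrow> cpoly" where
  "Var i = Poly_Mapping.single (Poly_Mapping.single i 1) 1"

text \<open>The polynomials in the variables with index in \<open>I\<close>.\<close>

definition polys :: "nat set \<Rightarrow> cpoly set" where
  "polys I = {p. \<forall>m\<in>Poly_Mapping.keys p. Poly_Mapping.keys m \<subseteq> I}"

definition poly_ring_on :: "nat set \<Rightarrow> cpoly ring" where
  "poly_ring_on I = \<lparr>carrier = polys I, mult = (*), one = 1, zero = 0, add = (+)\<rparr>"

definition pderivative :: "nat \<Rightarrow> cpoly \<Rightarrow> cpoly" where
  "pderivative i p = (\<Sum>m\<in>Poly_Mapping.keys p.
     Poly_Mapping.single (m - Poly_Mapping.single i 1)
       (of_nat (Poly_Mapping.lookup m i) * Poly_Mapping.lookup p m))"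

definition linear_operators :: "nat set \<Rightarrow> (cpoly \<Rightarrow> cpoly) ring" where
  "linear_operators I =
     \<lparr>carrier = {f \<in> polys I \<rightarrow>\<^sub>E polys I.
        (\<forall>p\<in>polys I. \<forall>q\<in>polys I. f (p + q) = f p + f q) \<and>
        (\<forall>c. \<forall>p\<in>polys I. f (Const c * p) = Const c * f p)},
      mult = compose (polys I),
      one = (\<lambda>p\<in>polys I. p),
      zero = (\<lambda>p\<in>polys I. 0),
      add = (\<lambda>f g. \<lambda>p\<in>polys I. f p + g p)\<rparr>"

definition scalar_op :: "nat \<Rightarrow> complex \<Rightarrow> cpoly \<Rightarrow> cpoly" where
  "scalar_op n c = (\<lambda>p\<in>polys {0..n}. Const c * p)"

definition t_op :: "nat \<Rightarrow> nat \<Rightarrow> cpoly \<Rightarrow> cpoly" where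
  "t_op n i = (\<lambda>p\<in>polys {0..n}. Var i * p)"

definition d_op :: "nat \<Rightarrow> nat \<Rightarrow> cpoly \<Rightarrow> cpoly" where
  "d_op n i = (\<lambda>p\<in>polys {0..n}. pderivative i p)"

text \<open>\<open>weyl n\<close> is the algebra \<open>\<D>(n+1)\<close> of differential operators on
  \<open>\<complex>[t\<^sub>0, \<dots>, t\<^sub>n]\<close>. Subalgebras are obtained as subrings generated by the scalars together with the
  given algebra generators.\<close>

definition weyl :: "nat \<Rightarrow> (cpoly \<Rightarrow> cpoly) ring" where
  "weyl n = (linear_operators {0..n})
     \<lparr>carrier := generate_ring (linear_operators {0..n})
        (range (scalar_op n) \<union> t_op n ` {0..n} \<union> d_op n ` {0..n})\<rparr>"

definition euler_op :: "nat \<Rightarrow> nat \<Rightarrow> cpoly \<Rightarrow> cpoly" where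
  "euler_op n i = t_op n i \<otimes>\<^bsub>weyl n\<^esub> d_op n i"

text \<open>The algebra \<open>\<H>'\<close>.\<close>

definition euler_differences :: "nat \<Rightarrow> (cpoly \<Rightarrow> cpoly) ring" where
  "euler_differences n = (weyl n)
     \<lparr>carrier := generate_ring (weyl n)
        (range (scalar_op n) \<union>
         {euler_op n i \<ominus>\<^bsub>weyl n\<^esub> euler_op n j | i j. i \<in> {0..n} \<and> j \<in> {0..n}})\<rparr>"


section \<open>Generalized weight modules\<close>

text \<open>\<open>\<complex>\<^sup>n\<^sup>+\<^sup>1\<close>, as extensional functions.\<close>

definition weights :: "nat \<Rightarrow> (nat \<Rightarrow> complex) set" where
  "weights n = ({0..n} \<rightarrow>\<^sub>E UNIV)"

definition weight_space ::
  "nat \<Rightarrow> (cpoly \<Rightarrow> cpoly, 'a) module \<Rightarrow> (nat \<Rightarrow> complex) \<Rightarrow> 'a set" where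
  "weight_space n M \<mu> = {m \<in> carrier M. \<exists>N>0. \<forall>i\<in>{0..n}.
     ((euler_op n i \<ominus>\<^bsub>weyl n\<^esub> scalar_op n (\<mu> i)) [^]\<^bsub>weyl n\<^esub> (N::nat)) \<odot>\<^bsub>M\<^esub> m = \<zero>\<^bsub>M\<^esub>}"

definition generalized_weight_module :: "nat \<Rightarrow> (cpoly \<Rightarrow> cpoly, 'a) module \<Rightarrow> bool" where
  "generalized_weight_module n M \<longleftrightarrow>
     left_module (weyl n) M \<and> internal_direct_sum M (weights n) (weight_space n M)"

definition weight_support ::
  "nat \<Rightarrow> (cpoly \<Rightarrow> cpoly, 'a) module \<Rightarrow> (nat \<Rightarrow> complex) set" where
  "weight_support n M = {\<mu> \<in> weights n. weight_space n M \<mu> \<noteq> {\<zero>\<^bsub>M\<^esub>}}"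

text \<open>The category \<open>\<^sub>s\<^sup>b(\<D>, \<H>)\<^sub>\<nu>-mod\<close>, with modules carried by subsets of the type \<open>'a\<close>.\<close>

definition sb_weight_category ::
  "nat \<Rightarrow> (nat \<Rightarrow> complex) \<Rightarrow> ((cpoly \<Rightarrow> cpoly, 'a) module, 'a \<Rightarrow> 'a) category" where
  "sb_weight_category n \<nu> = module_category (weyl n) (\<lambda>M.
     generalized_weight_module n M \<and>
     weight_support n M \<subseteq> {\<mu> \<in> weights n. \<forall>i\<in>{0..n}. \<mu> i - \<nu> i \<in> \<int>} \<and>
     (\<forall>\<mu>\<in>weights n. finite_dimensional (scalar_op n) M (weight_space n M \<mu>)) \<and>
     semisimple_module (euler_differences n) M)"

definition Int_indices :: "nat \<Rightarrow> (nat \<Rightarrow> complex) \<Rightarrow> nat set" where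
  "Int_indices n \<nu> = {i \<in> {0..n}. \<nu> i \<in> \<int>}"


section \<open>The algebra \<open>\<B>(k)\<close> and its graded modules\<close>

definition B_ideal :: "nat \<Rightarrow> cpoly set" where
  "B_ideal k = genideal (poly_ring_on {1..k})
     {Var i ^ 2 - Var j ^ 2 | i j. i \<in> {1..k} \<and> j \<in> {1..k}}"

definition B_algebra :: "nat \<Rightarrow> cpoly set ring" where
  "B_algebra k = poly_ring_on {1..k} Quot B_ideal k"

definition B_class :: "nat \<Rightarrow> cpoly \<Rightarrow> cpoly set" where
  "B_class k p = B_ideal k +>\<^bsub>poly_ring_on {1..k}\<^esub> p"

text \<open>\<open>Gk k\<close> is \<open>\<int>\<^sub>2\<^sup>k\<close>, with \<open>\<delta>\<^sub>i = Poly_Mapping.single i 1\<close>.\<close>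

definition Gk :: "nat \<Rightarrow> (nat \<Rightarrow>\<^sub>0 bit) set" where
  "Gk k = {g. Poly_Mapping.keys g \<subseteq> {1..k}}"

text \<open>The degree of a monomial determined by \<open>deg \<theta>\<^sub>i = \<delta>\<^sub>i\<close>, and the homogeneous components of
  \<open>\<B>(k)\<close>.\<close>

definition monomial_degree :: "(nat \<Rightarrow>\<^sub>0 nat) \<Rightarrow> (nat \<Rightarrow>\<^sub>0 bit)" where
  "monomial_degree m =
     (\<Sum>i\<in>Poly_Mapping.keys m. Poly_Mapping.single i (of_nat (Poly_Mapping.lookup m i)))"

definition B_component :: "nat \<Rightarrow> (nat \<Rightarrow>\<^sub>0 bit) \<Rightarrow> cpoly set set" where
  "B_component k g = B_class k `
     {p \<in> polys {1..k}. \<forall>m\<in>Poly_Mapping.keys p. monomial_degree m = g}"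

text \<open>A graded module is a pair of a module and its family of homogeneous components. The values of
  this family outside \<open>Gk k\<close> play no role.\<close>

definition graded_B_module ::
  "nat \<Rightarrow> (cpoly set, 'b) module \<times> ((nat \<Rightarrow>\<^sub>0 bit) \<Rightarrow> 'b set) \<Rightarrow> bool" where
  "graded_B_module k = (\<lambda>(V, gr).
     left_module (B_algebra k) V \<and> internal_direct_sum V (Gk k) gr \<and>
     (\<forall>g\<in>Gk k. \<forall>h\<in>Gk k. \<forall>a\<in>B_component k g. \<forall>v\<in>gr h. a \<odot>\<^bsub>V\<^esub> v \<in> gr (g + h)))"

text \<open>Morphisms are the module homomorphisms preserving degrees.\<close>

definition graded_B_category ::
  "nat \<Rightarrow> ((cpoly set, 'b) module \<times> ((nat \<Rightarrow>\<^sub>0 bit) \<Rightarrow> 'b set), 'b \<Rightarrow> 'b) category" where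
  "graded_B_category k =
     \<lparr>Obj = {(V, gr). graded_B_module k (V, gr) \<and>
        finite_dimensional (\<lambda>c. B_class k (Const c)) V (carrier V) \<and>
        (\<forall>i\<in>{1..k}. \<exists>N::nat. \<forall>v\<in>carrier V.
           (B_class k (Var i) [^]\<^bsub>B_algebra k\<^esub> N) \<odot>\<^bsub>V\<^esub> v = \<zero>\<^bsub>V\<^esub>)},
      Hom = (\<lambda>(V, gr) (W, gs).
        {f \<in> module_maps (B_algebra k) V W. \<forall>g\<in>Gk k. f ` gr g \<subseteq> gs g}),
      Idm = (\<lambda>(V, gr). restrict id (carrier V)),
      Comp = (\<lambda>(U, gp) (V, gr) (W, gs) g f. compose (carrier U) g f)\<rparr>"


section \<open>Nilpotent modules over \<open>\<complex>[z]\<close>\<close>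

text \<open>\<open>\<complex>[z]\<close> is the polynomial ring in the single variable \<open>z = Var 0\<close>.\<close>

definition nilpotent_Cz_category :: "((cpoly, 'b) module, 'b \<Rightarrow> 'b) category" where
  "nilpotent_Cz_category = module_category (poly_ring_on {0}) (\<lambda>V.
     finite_dimensional Const V (carrier V) \<and>
     (\<exists>N::nat. \<forall>v\<in>carrier V. (Var 0 [^]\<^bsub>poly_ring_on {0}\<^esub> N) \<odot>\<^bsub>V\<^esub> v = \<zero>\<^bsub>V\<^esub>))"

end

(* Semisimplicity over H' means that on the weight space of weight lambda the nilpotent operators
   t_i d_i - lambda_i agree for all i; call this common operator z. The map t_i from weight lambda to
   lambda + e_i is bijective unless lambda_i = -1, so a module is determined by the 2^k weight spaces
   whose integral coordinates all lie in {-1, 0}. On their direct sum, which is graded by Z_2^k, the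
   operator theta_j is t_i from -1 to 0 and d_i from 0 to -1, where i is the j-th integral coordinate;
   then theta_j^2 = z for all j. Conversely, graded data (V, theta, z) yield a weight module with
   weight spaces V_h, where h records the negative integral coordinates, on which t_i is theta_j if
   lambda_i = -1 and the identity otherwise, and d_i is theta_j if lambda_i = 0 and lambda_i + z
   otherwise. The equivalence is obtained from a span of categories: its objects link a module to
   graded data, every object on either side occurs in a link, and morphisms on the two sides
   correspond. *)

theory Submission
imports Defs
begin

section \<open>Category theory: an equivalence from a relation between two categories\<close>

section \<open>Equivalences of categories from spans\<close>

text \<open>No functor is written down. Passing to graded data involves choices (a copy of a direct
  sum inside a given type), while the relation between morphisms can be stated without them; choices
  are made once, in the span argument. Two obstacles shape the rest. Objects must be carried by the
  types \<open>'a\<close> and \<open>'b\<close>: a module of the category is a direct sum of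
  finite-dimensional spaces over at most continuum many weights, and finitely supported families of
  coordinate vectors can be coded by single complex numbers, so any type into which the complex
  numbers inject is large enough. Moreover, the Weyl algebra is a ring of concrete operators, not
  one given by generators and relations. To let it act on a newly built space one must know that the
  canonical relations imply all others; this is the normal form theorem, proved through the action
  on polynomials. The formula for d_i is forced: where t_i is the identity, d_i equals t_i d_i =
  \<lambda>_i + z. Keeping z as a datum besides the \<theta>_j lets one argument serve k > 0 and k =
  0.\<close>

locale category_span =
  fixes C :: "('o, 'm) category" and D :: "('p, 'n) category"
    and E :: "'e set" and s :: "'e \<Rightarrow> 'o" and t :: "'e \<Rightarrow> 'p"
    and R :: "'e \<Rightarrow> 'e \<Rightarrow> 'm \<Rightarrow> 'n \<Rightarrow> bool"
  assumes catC: "is_category C" and catD: "is_category D"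
    and s_Obj: "e \<in> E \<Longrightarrow> s e \<in> Obj C" and t_Obj: "e \<in> E \<Longrightarrow> t e \<in> Obj D"
    and s_surj: "X \<in> Obj C \<Longrightarrow> \<exists>e\<in>E. s e = X" and t_surj: "Y \<in> Obj D \<Longrightarrow> \<exists>e\<in>E. t e = Y"
    and R_ex1: "\<lbrakk>e \<in> E; e' \<in> E; f \<in> Hom C (s e) (s e')\<rbrakk> \<Longrightarrow> \<exists>g\<in>Hom D (t e) (t e'). R e e' f g"
    and R_ex2: "\<lbrakk>e \<in> E; e' \<in> E; g \<in> Hom D (t e) (t e')\<rbrakk> \<Longrightarrow> \<exists>f\<in>Hom C (s e) (s e'). R e e' f g"
    and R_uniq1: "\<lbrakk>e \<in> E; e' \<in> E; f \<in> Hom C (s e) (s e'); g \<in> Hom D (t e) (t e'); g' \<in> Hom D (t e) (t e');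
      R e e' f g; R e e' f g'\<rbrakk> \<Longrightarrow> g = g'"
    and R_uniq2: "\<lbrakk>e \<in> E; e' \<in> E; f \<in> Hom C (s e) (s e'); f' \<in> Hom C (s e) (s e'); g \<in> Hom D (t e) (t e');
      R e e' f g; R e e' f' g\<rbrakk> \<Longrightarrow> f = f'"
    and R_id: "e \<in> E \<Longrightarrow> R e e (Idm C (s e)) (Idm D (t e))"
    and R_comp: "\<lbrakk>e \<in> E; e' \<in> E; e'' \<in> E; f \<in> Hom C (s e) (s e'); g \<in> Hom D (t e) (t e');
      f' \<in> Hom C (s e') (s e''); g' \<in> Hom D (t e') (t e''); R e e' f g; R e' e'' f' g'\<rbrakk> \<Longrightarrow>
      R e e'' (Comp C (s e) (s e') (s e'') f' f) (Comp D (t e) (t e') (t e'') g' g)"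
begin

text \<open>Unambiguous by \<open>R_uniq1\<close>. On links, \<open>push\<close> behaves like a
  functor, although its target objects depend on the links and not only on the sources.\<close>

definition push :: "'e \<Rightarrow> 'e \<Rightarrow> 'm \<Rightarrow> 'n" where
  "push e e' f = (SOME g. g \<in> Hom D (t e) (t e') \<and> R e e' f g)"

definition pull :: "'e \<Rightarrow> 'e \<Rightarrow> 'n \<Rightarrow> 'm" where
  "pull e e' g = (SOME f. f \<in> Hom C (s e) (s e') \<and> R e e' f g)"

lemma push: "\<lbrakk>e \<in> E; e' \<in> E; f \<in> Hom C (s e) (s e')\<rbrakk> \<Longrightarrow> push e e' f \<in> Hom D (t e) (t e') \<and> R e e' f (push e e' f)"
  unfolding push_def using R_ex1 by (rule_tac someI_ex) blast

lemma pull: "\<lbrakk>e \<in> E; e' \<in> E; g \<in> Hom D (t e) (t e')\<rbrakk> \<Longrightarrow> pull e e' g \<in> Hom C (s e) (s e') \<and> R e e' (pull e e' g) g"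
  unfolding pull_def using R_ex2 by (rule_tac someI_ex) blast

text \<open>Uniqueness turns every identity about \<open>push\<close> into the task of exhibiting a
  related pair; functoriality is then \<open>R_id\<close> and \<open>R_comp\<close>.\<close>

lemma push_eq: "\<lbrakk>e \<in> E; e' \<in> E; f \<in> Hom C (s e) (s e'); g \<in> Hom D (t e) (t e'); R e e' f g\<rbrakk> \<Longrightarrow> push e e' f = g"
  using push R_uniq1 by blast

lemma pull_eq: "\<lbrakk>e \<in> E; e' \<in> E; f \<in> Hom C (s e) (s e'); g \<in> Hom D (t e) (t e'); R e e' f g\<rbrakk> \<Longrightarrow> pull e e' g = f"
  using pull R_uniq2 by blast

lemma C_id: "X \<in> Obj C \<Longrightarrow> Idm C X \<in> Hom C X X"
  and D_id: "Y \<in> Obj D \<Longrightarrow> Idm D Y \<in> Hom D Y Y"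
  using catC catD by (auto simp: is_category_def)

lemma C_comp: "\<lbrakk>X \<in> Obj C; Y \<in> Obj C; Z \<in> Obj C; f \<in> Hom C X Y; g \<in> Hom C Y Z\<rbrakk> \<Longrightarrow> Comp C X Y Z g f \<in> Hom C X Z"
  using catC unfolding is_category_def by blast

lemma D_comp: "\<lbrakk>X \<in> Obj D; Y \<in> Obj D; Z \<in> Obj D; f \<in> Hom D X Y; g \<in> Hom D Y Z\<rbrakk> \<Longrightarrow> Comp D X Y Z g f \<in> Hom D X Z"
  using catD unfolding is_category_def by blast

lemma C_idl: "\<lbrakk>X \<in> Obj C; Y \<in> Obj C; f \<in> Hom C X Y\<rbrakk> \<Longrightarrow> Comp C X Y Y (Idm C Y) f = f"
  and C_idr: "\<lbrakk>X \<in> Obj C; Y \<in> Obj C; f \<in> Hom C X Y\<rbrakk> \<Longrightarrow> Comp C X X Y f (Idm C X) = f"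
  using catC unfolding is_category_def by blast+

lemma D_idl: "\<lbrakk>X \<in> Obj D; Y \<in> Obj D; f \<in> Hom D X Y\<rbrakk> \<Longrightarrow> Comp D X Y Y (Idm D Y) f = f"
  and D_idr: "\<lbrakk>X \<in> Obj D; Y \<in> Obj D; f \<in> Hom D X Y\<rbrakk> \<Longrightarrow> Comp D X X Y f (Idm D X) = f"
  using catD unfolding is_category_def by blast+

lemma push_id: "e \<in> E \<Longrightarrow> push e e (Idm C (s e)) = Idm D (t e)"
  by (meson C_id D_id R_id push_eq s_Obj t_Obj)

lemma pull_id: "e \<in> E \<Longrightarrow> pull e e (Idm D (t e)) = Idm C (s e)"
  by (meson C_id D_id R_id pull_eq s_Obj t_Obj)

lemma push_comp:
  assumes "e \<in> E" "e' \<in> E" "e'' \<in> E" "f \<in> Hom C (s e) (s e')" "f' \<in> Hom C (s e') (s e'')"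
  shows "push e e'' (Comp C (s e) (s e') (s e'') f' f) =
    Comp D (t e) (t e') (t e'') (push e' e'' f') (push e e' f)"
  using assms by (intro push_eq R_comp C_comp D_comp s_Obj t_Obj) (auto simp: push)

lemma pull_comp:
  assumes "e \<in> E" "e' \<in> E" "e'' \<in> E" "g \<in> Hom D (t e) (t e')" "g' \<in> Hom D (t e') (t e'')"
  shows "pull e e'' (Comp D (t e) (t e') (t e'') g' g) =
    Comp C (s e) (s e') (s e'') (pull e' e'' g') (pull e e' g)"
  using assms by (intro pull_eq R_comp C_comp D_comp s_Obj t_Obj) (auto simp: pull)

lemma pull_push: "\<lbrakk>e \<in> E; e' \<in> E; f \<in> Hom C (s e) (s e')\<rbrakk> \<Longrightarrow> pull e e' (push e e' f) = f"
  using push pull_eq by blast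

lemma push_pull: "\<lbrakk>e \<in> E; e' \<in> E; g \<in> Hom D (t e) (t e')\<rbrakk> \<Longrightarrow> push e e' (pull e e' g) = g"
  using pull push_eq by blast

text \<open>Two links with the same target have canonically isomorphic sources, by pulling back the
  identity, and vice versa. Both natural isomorphisms arise in this way.\<close>

theorem equivalent: "equivalent_categories C D"
proof -
  \<comment> \<open>\<open>u\<close> picks a link over every object of \<open>C\<close>,
    \<open>v\<close> one over every object of \<open>D\<close>; the functors go to the other end of
    the picked link.\<close>
  obtain u where u: "\<And>X. X \<in> Obj C \<Longrightarrow> u X \<in> E \<and> s (u X) = X" using s_surj by metis
  obtain v where v: "\<And>Y. Y \<in> Obj D \<Longrightarrow> v Y \<in> E \<and> t (v Y) = Y" using t_surj by metis
  define Fo where "Fo X = t (u X)" for X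
  define Go where "Go Y = s (v Y)" for Y
  define Fm where "Fm X X' f = push (u X) (u X') f" for X X' f
  define Gm where "Gm Y Y' g = pull (v Y) (v Y') g" for Y Y' g
  define \<eta> where "\<eta> X = pull (u X) (v (Fo X)) (Idm D (Fo X))" for X
  define \<epsilon> where "\<epsilon> Y = push (u (Go Y)) (v Y) (Idm C (Go Y))" for Y
  note defs = Fo_def Go_def Fm_def Gm_def \<eta>_def \<epsilon>_def
  have Fo: "Fo X \<in> Obj D" if "X \<in> Obj C" for X using u[OF that] t_Obj by (auto simp: defs)
  have Go: "Go X \<in> Obj C" if "X \<in> Obj D" for X using v[OF that] s_Obj by (auto simp: defs)
  have F: "is_functor C D Fo Fm"
    unfolding is_functor_def
  proof (intro conjI ballI)
    fix X assume X: "X \<in> Obj C"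
    show "Fo X \<in> Obj D" using X by (rule Fo)
    show "Fm X X (Idm C X) = Idm D (Fo X)" using u[OF X] push_id[of "u X"] by (simp add: defs)
    fix Y assume Y: "Y \<in> Obj C"
    fix f assume f: "f \<in> Hom C X Y"
    show "Fm X Y f \<in> Hom D (Fo X) (Fo Y)" using u[OF X] u[OF Y] f push[of "u X" "u Y" f] by (simp add: defs)
    fix Z g assume Z: "Z \<in> Obj C" and g: "g \<in> Hom C Y Z"
    show "Fm X Z (Comp C X Y Z g f) = Comp D (Fo X) (Fo Y) (Fo Z) (Fm Y Z g) (Fm X Y f)"
      using push_comp[of "u X" "u Y" "u Z" f g] u[OF X] u[OF Y] u[OF Z] f g by (simp add: defs)
  qed
  have G: "is_functor D C Go Gm"
    unfolding is_functor_def
  proof (intro conjI ballI)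
    fix X assume X: "X \<in> Obj D"
    show "Go X \<in> Obj C" using X by (rule Go)
    show "Gm X X (Idm D X) = Idm C (Go X)" using v[OF X] pull_id[of "v X"] by (simp add: defs)
    fix Y assume Y: "Y \<in> Obj D"
    fix f assume f: "f \<in> Hom D X Y"
    show "Gm X Y f \<in> Hom C (Go X) (Go Y)" using v[OF X] v[OF Y] f pull[of "v X" "v Y" f] by (simp add: defs)
    fix Z g assume Z: "Z \<in> Obj D" and g: "g \<in> Hom D Y Z"
    show "Gm X Z (Comp D X Y Z g f) = Comp C (Go X) (Go Y) (Go Z) (Gm Y Z g) (Gm X Y f)"
      using pull_comp[of "v X" "v Y" "v Z" f g] v[OF X] v[OF Y] v[OF Z] f g by (simp add: defs)
  qed
  have \<eta>: "is_natural_iso C C (\<lambda>X. X) (\<lambda>X Y f. f) (\<lambda>X. Go (Fo X)) (\<lambda>X Y f. Gm (Fo X) (Fo Y) (Fm X Y f)) \<eta>"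
    unfolding is_natural_iso_def is_iso_def
  proof (intro conjI ballI)
    fix X assume X: "X \<in> Obj C"
    note uX = u[OF X] v[OF Fo[OF X]] D_id[OF Fo[OF X]]
    have tX: "t (v (Fo X)) = t (u X)" using uX by (simp add: defs)
    show hX: "\<eta> X \<in> Hom C X (Go (Fo X))"
      using pull[of "u X" "v (Fo X)" "Idm D (Fo X)"] uX by (simp add: defs)
    show "\<exists>g\<in>Hom C (Go (Fo X)) X. Comp C X (Go (Fo X)) X g (\<eta> X) = Idm C X \<and>
              Comp C (Go (Fo X)) X (Go (Fo X)) (\<eta> X) g = Idm C (Go (Fo X))"
    proof (intro bexI conjI)
      \<comment> \<open>\<open>u X\<close> and \<open>v (Fo X)\<close> have the same target, so its
        identity pulls back in both directions, and by \<open>pull_comp\<close> the composites are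
        pull-backs of identities.\<close>
      let ?g = "pull (v (Fo X)) (u X) (Idm D (Fo X))"
      show "?g \<in> Hom C (Go (Fo X)) X" using pull[of "v (Fo X)" "u X" "Idm D (Fo X)"] uX by (simp add: defs)
      show "Comp C X (Go (Fo X)) X ?g (\<eta> X) = Idm C X"
        using pull_comp[of "u X" "v (Fo X)" "u X" "Idm D (Fo X)" "Idm D (Fo X)"] uX pull_id[of "u X"]
          D_idl[of "Fo X" "Fo X" "Idm D (Fo X)"] Fo[OF X]
        by (simp add: defs)
      show "Comp C (Go (Fo X)) X (Go (Fo X)) (\<eta> X) ?g = Idm C (Go (Fo X))"
        using pull_comp[of "v (Fo X)" "u X" "v (Fo X)" "Idm D (Fo X)" "Idm D (Fo X)"] uX pull_id[of "v (Fo X)"]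
          D_idl[of "Fo X" "Fo X" "Idm D (Fo X)"] Fo[OF X]
        by (simp add: defs)
    qed
    fix Y f assume Y: "Y \<in> Obj C" and f: "f \<in> Hom C X Y"
    note uY = u[OF Y] v[OF Fo[OF Y]] D_id[OF Fo[OF Y]]
    let ?g = "push (u X) (u Y) f"
    have g: "?g \<in> Hom D (Fo X) (Fo Y)" using push[of "u X" "u Y" f] f uX uY by (simp add: defs)
    \<comment> \<open>Both sides of the naturality square are pull-backs of the same morphism
      \<open>push (u X) (u Y) f\<close>.\<close>
    have "Comp C X (Go (Fo X)) (Go (Fo Y)) (Gm (Fo X) (Fo Y) (Fm X Y f)) (\<eta> X) = pull (u X) (v (Fo Y)) ?g"
      using pull_comp[of "u X" "v (Fo X)" "v (Fo Y)" "Idm D (Fo X)" ?g] uX uY g D_idr[OF Fo[OF X] Fo[OF Y] g]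
      by (simp add: defs)
    moreover have "Comp C X Y (Go (Fo Y)) (\<eta> Y) f = pull (u X) (v (Fo Y)) ?g"
      using pull_comp[of "u X" "u Y" "v (Fo Y)" ?g "Idm D (Fo Y)"] uX uY g D_idl[OF Fo[OF X] Fo[OF Y] g]
        pull_push[of "u X" "u Y" f] f
      by (simp add: defs)
    ultimately show "Comp C X (Go (Fo X)) (Go (Fo Y)) (Gm (Fo X) (Fo Y) (Fm X Y f)) (\<eta> X)
        = Comp C X Y (Go (Fo Y)) (\<eta> Y) f" by simp
  qed
  have \<epsilon>: "is_natural_iso D D (\<lambda>X. Fo (Go X)) (\<lambda>X Y f. Fm (Go X) (Go Y) (Gm X Y f)) (\<lambda>X. X) (\<lambda>X Y f. f) \<epsilon>"
    unfolding is_natural_iso_def is_iso_def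
  proof (intro conjI ballI)
    fix X assume X: "X \<in> Obj D"
    note uX = v[OF X] u[OF Go[OF X]] C_id[OF Go[OF X]]
    show hX: "\<epsilon> X \<in> Hom D (Fo (Go X)) X"
      using push[of "u (Go X)" "v X" "Idm C (Go X)"] uX by (simp add: defs)
    show "\<exists>g\<in>Hom D X (Fo (Go X)). Comp D (Fo (Go X)) X (Fo (Go X)) g (\<epsilon> X) = Idm D (Fo (Go X)) \<and>
              Comp D X (Fo (Go X)) X (\<epsilon> X) g = Idm D X"
    proof (intro bexI conjI)
      let ?g = "push (v X) (u (Go X)) (Idm C (Go X))"
      show "?g \<in> Hom D X (Fo (Go X))" using push[of "v X" "u (Go X)" "Idm C (Go X)"] uX by (simp add: defs)
      show "Comp D X (Fo (Go X)) X (\<epsilon> X) ?g = Idm D X"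
        using push_comp[of "v X" "u (Go X)" "v X" "Idm C (Go X)" "Idm C (Go X)"] uX push_id[of "v X"]
          C_idl[of "Go X" "Go X" "Idm C (Go X)"] Go[OF X]
        by (simp add: defs)
      show "Comp D (Fo (Go X)) X (Fo (Go X)) ?g (\<epsilon> X) = Idm D (Fo (Go X))"
        using push_comp[of "u (Go X)" "v X" "u (Go X)" "Idm C (Go X)" "Idm C (Go X)"] uX push_id[of "u (Go X)"]
          C_idl[of "Go X" "Go X" "Idm C (Go X)"] Go[OF X]
        by (simp add: defs)
    qed
    fix Y f assume Y: "Y \<in> Obj D" and f: "f \<in> Hom D X Y"
    note uY = v[OF Y] u[OF Go[OF Y]] C_id[OF Go[OF Y]]
    let ?g = "pull (v X) (v Y) f"
    have g: "?g \<in> Hom C (Go X) (Go Y)" using pull[of "v X" "v Y" f] f uX uY by (simp add: defs)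
    have "Comp D (Fo (Go X)) (Fo (Go Y)) Y (\<epsilon> Y) (Fm (Go X) (Go Y) (Gm X Y f)) = push (u (Go X)) (v Y) ?g"
      using push_comp[of "u (Go X)" "u (Go Y)" "v Y" ?g "Idm C (Go Y)"] uX uY g C_idl[OF Go[OF X] Go[OF Y] g]
      by (simp add: defs)
    moreover have "Comp D (Fo (Go X)) X Y f (\<epsilon> X) = push (u (Go X)) (v Y) ?g"
      using push_comp[of "u (Go X)" "v X" "v Y" "Idm C (Go X)" ?g] uX uY g C_idr[OF Go[OF X] Go[OF Y] g]
        push_pull[of "v X" "v Y" f] f
      by (simp add: defs)
    ultimately show "Comp D (Fo (Go X)) X Y f (\<epsilon> X) =
       Comp D (Fo (Go X)) (Fo (Go Y)) Y (\<epsilon> Y) (Fm (Go X) (Go Y) (Gm X Y f))" by simp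
  qed
  show ?thesis
    unfolding equivalent_categories_def using catC catD F G \<eta> \<epsilon> by blast
qed

end

section \<open>Linear algebra on carriers: direct sums, finite dimension, cardinality, monomials in
  operators\<close>

section \<open>Complex vector spaces on abelian groups\<close>

text \<open>The scalar action is a parameter and not the \<open>smult\<close> field, because the
  records at hand carry an action of the Weyl algebra or of a polynomial ring there, or none
  yet.\<close>

locale cspace = abelian_group V for V :: "('v, 'x) ring_scheme" (structure) +
  fixes sc :: "complex \<Rightarrow> 'v \<Rightarrow> 'v"
  assumes sc_closed [simp, intro]: "x \<in> carrier V \<Longrightarrow> sc c x \<in> carrier V"
    and sc_l: "x \<in> carrier V \<Longrightarrow> sc (c + d) x = sc c x \<oplus> sc d x"
    and sc_r: "x \<in> carrier V \<Longrightarrow> y \<in> carrier V \<Longrightarrow> sc c (x \<oplus> y) = sc c x \<oplus> sc c y"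
    and sc_sc [simp]: "x \<in> carrier V \<Longrightarrow> sc c (sc d x) = sc (c * d) x"
    and sc_1 [simp]: "x \<in> carrier V \<Longrightarrow> sc 1 x = x"

definition csub :: "('v, 'x) ring_scheme \<Rightarrow> (complex \<Rightarrow> 'v \<Rightarrow> 'v) \<Rightarrow> 'v set \<Rightarrow> bool" where
  "csub V sc U \<longleftrightarrow> additive_subgroup U V \<and> (\<forall>c. \<forall>x\<in>U. sc c x \<in> U)"

text \<open>Linearity on a subset \<open>U\<close>, with nothing asked elsewhere: the comparison
  maps live on single weight spaces.\<close>

definition lin_on :: "'v set \<Rightarrow> ('v, 'x) ring_scheme \<Rightarrow> (complex \<Rightarrow> 'v \<Rightarrow> 'v) \<Rightarrow>
    ('w, 'y) ring_scheme \<Rightarrow> (complex \<Rightarrow> 'w \<Rightarrow> 'w) \<Rightarrow> ('v \<Rightarrow> 'w) \<Rightarrow> bool" where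
  "lin_on U V sc W sd f \<longleftrightarrow> (\<forall>x\<in>U. f x \<in> carrier W) \<and> (\<forall>x\<in>U. \<forall>y\<in>U. f (x \<oplus>\<^bsub>V\<^esub> y) = f x \<oplus>\<^bsub>W\<^esub> f y) \<and>
     (\<forall>c. \<forall>x\<in>U. f (sc c x) = sd c (f x))"

lemma lin_onD:
  assumes "lin_on U V sc W sd f"
  shows "x \<in> U \<Longrightarrow> f x \<in> carrier W" "x \<in> U \<Longrightarrow> y \<in> U \<Longrightarrow> f (x \<oplus>\<^bsub>V\<^esub> y) = f x \<oplus>\<^bsub>W\<^esub> f y"
    "x \<in> U \<Longrightarrow> f (sc c x) = sd c (f x)"
  using assms by (auto simp: lin_on_def)

lemma lin_onI:
  assumes "\<And>x. x \<in> U \<Longrightarrow> f x \<in> carrier W" "\<And>x y. x \<in> U \<Longrightarrow> y \<in> U \<Longrightarrow> f (x \<oplus>\<^bsub>V\<^esub> y) = f x \<oplus>\<^bsub>W\<^esub> f y"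
    "\<And>c x. x \<in> U \<Longrightarrow> f (sc c x) = sd c (f x)"
  shows "lin_on U V sc W sd f"
  using assms by (auto simp: lin_on_def)

lemma lin_on_subset: "lin_on U V sc W sd f \<Longrightarrow> U' \<subseteq> U \<Longrightarrow> lin_on U' V sc W sd f"
  unfolding lin_on_def by blast

lemma lin_on_comp:
  assumes "lin_on U V sc W sd f" "lin_on U' W sd Z se g" "\<And>x. x \<in> U \<Longrightarrow> f x \<in> U'"
  shows "lin_on U V sc Z se (\<lambda>x. g (f x))"
  using assms unfolding lin_on_def by simp

lemma csubD:
  assumes "csub V sc U"
  shows "U \<subseteq> carrier V" "x \<in> U \<Longrightarrow> y \<in> U \<Longrightarrow> x \<oplus>\<^bsub>V\<^esub> y \<in> U" "\<zero>\<^bsub>V\<^esub> \<in> U" "x \<in> U \<Longrightarrow> \<ominus>\<^bsub>V\<^esub> x \<in> U"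
    "x \<in> U \<Longrightarrow> sc c x \<in> U" "x \<in> U \<Longrightarrow> x \<in> carrier V"
  using assms unfolding csub_def
  by (auto simp: additive_subgroup.a_closed additive_subgroup.zero_closed additive_subgroup.a_inv_closed
      dest: additive_subgroup.a_subset)

lemma lin_on_cong:
  assumes "lin_on U V sc W sd f" "\<And>x. x \<in> U \<Longrightarrow> f x = g x" "csub V sc U"
  shows "lin_on U V sc W sd g"
proof (rule lin_onI)
  fix x assume x: "x \<in> U"
  show "g x \<in> carrier W" using lin_onD(1)[OF assms(1) x] assms(2)[OF x] by simp
  show "g (sc c x) = sd c (g x)" for c
    using lin_onD(3)[OF assms(1) x] assms(2)[OF x] assms(2)[OF csubD(5)[OF assms(3) x]] by simp
  fix y assume y: "y \<in> U"
  show "g (x \<oplus>\<^bsub>V\<^esub> y) = g x \<oplus>\<^bsub>W\<^esub> g y"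
    using lin_onD(2)[OF assms(1) x y] assms(2)[OF x] assms(2)[OF y] assms(2)[OF csubD(2)[OF assms(3) x y]] by simp
qed

context cspace begin

lemma sc_0 [simp]: assumes x: "x \<in> carrier V" shows "sc 0 x = \<zero>"
proof -
  have "sc 0 x \<oplus> sc 0 x = sc 0 x" using sc_l[OF x, of 0 0] by simp
  then show ?thesis using add.r_cancel_one[of "sc 0 x" "sc 0 x"] x by simp
qed

lemma sc_zero [simp]: "sc c \<zero> = \<zero>"
  using sc_sc[of \<zero> c 0] by simp

lemma sc_minus1: assumes x: "x \<in> carrier V" shows "sc (-1) x = \<ominus> x"
proof -
  have "sc (-1) x \<oplus> x = \<zero>" using sc_l[OF x, of "-1" 1] x by simp
  then show ?thesis using minus_equality[of "sc (-1) x" x] x by simp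
qed

lemma sc_minus: "x \<in> carrier V \<Longrightarrow> sc (- c) x = \<ominus> (sc c x)"
  using sc_minus1[of "sc c x"] by simp

lemma sc_cancel: "x \<in> carrier V \<Longrightarrow> sc c x = \<zero> \<Longrightarrow> c \<noteq> 0 \<Longrightarrow> x = \<zero>"
  using sc_sc[of x "1 / c" c] by simp

text \<open>A rewrite system for linear combinations: after sorting with \<open>a_ac\<close>,
  neighbouring multiples of the same vector are merged, both at the end and inside a right-nested
  sum.\<close>

lemma sc_collect:
  assumes "x \<in> carrier V"
  shows "sc c x \<oplus> sc d x = sc (c + d) x" "x \<oplus> sc d x = sc (1 + d) x" "sc d x \<oplus> x = sc (d + 1) x"
    "x \<oplus> x = sc 2 x"
    "y \<in> carrier V \<Longrightarrow> sc c x \<oplus> (sc d x \<oplus> y) = sc (c + d) x \<oplus> y"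
    "y \<in> carrier V \<Longrightarrow> x \<oplus> (sc d x \<oplus> y) = sc (1 + d) x \<oplus> y"
    "y \<in> carrier V \<Longrightarrow> sc d x \<oplus> (x \<oplus> y) = sc (d + 1) x \<oplus> y"
    "y \<in> carrier V \<Longrightarrow> x \<oplus> (x \<oplus> y) = sc 2 x \<oplus> y"
proof -
  have two: "x \<oplus> x = sc 2 x" using sc_l[of x 1 1] assms by simp
  show "sc c x \<oplus> sc d x = sc (c + d) x" "x \<oplus> sc d x = sc (1 + d) x" "sc d x \<oplus> x = sc (d + 1) x"
    "x \<oplus> x = sc 2 x" using assms two by (auto simp: sc_l)
  assume y: "y \<in> carrier V"
  show "sc c x \<oplus> (sc d x \<oplus> y) = sc (c + d) x \<oplus> y"
    "x \<oplus> (sc d x \<oplus> y) = sc (1 + d) x \<oplus> y"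
    "sc d x \<oplus> (x \<oplus> y) = sc (d + 1) x \<oplus> y"
    "x \<oplus> (x \<oplus> y) = sc 2 x \<oplus> y"
    using assms y by (auto simp: sc_l a_assoc simp flip: two)
qed

lemma diff_zero: "x \<in> carrier V \<Longrightarrow> y \<in> carrier V \<Longrightarrow> x \<oplus> sc (-1) y = \<zero> \<Longrightarrow> x = y"
  using minus_equality[of x "sc (-1) y"] by (simp add: sc_minus1)

lemma csubI:
  assumes "U \<subseteq> carrier V" "\<zero> \<in> U" "\<And>x y. x \<in> U \<Longrightarrow> y \<in> U \<Longrightarrow> x \<oplus> y \<in> U" "\<And>c x. x \<in> U \<Longrightarrow> sc c x \<in> U"
  shows "csub V sc U"
proof -
  have "\<ominus> x \<in> U" if "x \<in> U" for x using assms(1) assms(4)[OF that, of "-1"] that by (auto simp: sc_minus1)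
  then have "subgroup U (add_monoid V)"
    using assms by (intro add.subgroupI) (auto simp: a_inv_def)
  then show ?thesis using assms(4) by (simp add: csub_def additive_subgroup_def)
qed

lemma csub_carrier: "csub V sc (carrier V)" by (rule csubI) auto

lemma csub_zero: "csub V sc {\<zero>}" by (rule csubI) auto

lemma csub_finsum:
  assumes U: "csub V sc U" and fin: "finite A" and "\<And>a. a \<in> A \<Longrightarrow> f a \<in> U"
  shows "finsum V f A \<in> U"
  using fin assms(3)
proof (induction A rule: finite_induct)
  case empty then show ?case using csubD(3)[OF U] by simp
next
  case (insert a A)
  then have "finsum V f (insert a A) = f a \<oplus> finsum V f A"
    using csubD(1)[OF U] by (intro finsum_insert) auto
  then show ?case using insert csubD(2)[OF U] by simp
qed

lemma sc_finsum: "finite A \<Longrightarrow> f \<in> A \<rightarrow> carrier V \<Longrightarrow> sc c (finsum V f A) = (\<Oplus>a\<in>A. sc c (f a))"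
proof (induction A rule: finite_induct)
  case (insert a A)
  then have "finsum V f (insert a A) = f a \<oplus> finsum V f A"
    "(\<Oplus>a\<in>insert a A. sc c (f a)) = sc c (f a) \<oplus> (\<Oplus>a\<in>A. sc c (f a))"
    by (auto intro!: finsum_insert)
  then show ?case using insert by (simp add: sc_r Pi_def)
qed auto

lemma finsum_mono_neutral:
  assumes "finite B" "A \<subseteq> B" "f \<in> A \<rightarrow> carrier V" "\<And>b. b \<in> B - A \<Longrightarrow> f b = \<zero>"
  shows "finsum V f A = finsum V f B"
proof (rule add.finprod_mono_neutral_cong_left[OF assms(1,2)])
  show "f \<in> B \<rightarrow> carrier V"
  proof
    fix x assume "x \<in> B" then show "f x \<in> carrier V" using assms(3) assms(4)[of x] by (cases "x \<in> A") auto
  qed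
qed (use assms in auto)

lemma lin_zero:
  assumes "cspace W sd" "lin_on U V sc W sd f" "csub V sc U"
  shows "f \<zero> = \<zero>\<^bsub>W\<^esub>"
proof -
  have "f (sc 0 \<zero>) = sd 0 (f \<zero>)" using assms by (intro lin_onD(3)[OF assms(2)] csubD)
  also have "\<dots> = \<zero>\<^bsub>W\<^esub>" by (rule cspace.sc_0[OF assms(1) lin_onD(1)[OF assms(2) csubD(3)[OF assms(3)]]])
  finally show ?thesis by simp
qed

lemma lin_finsum:
  assumes W: "cspace W sd" and f: "lin_on U V sc W sd f" and U: "csub V sc U"
    and "finite A" "\<And>a. a \<in> A \<Longrightarrow> g a \<in> U"
  shows "f (finsum V g A) = finsum W (\<lambda>a. f (g a)) A"
  using assms(4,5)
proof (induction A rule: finite_induct)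
  interpret W: cspace W sd by fact
  {
    case empty then show ?case using lin_zero[OF W f U] by simp
  next
    case (insert a A)
    have "finsum V g (insert a A) = g a \<oplus> finsum V g A"
      using insert csubD(1)[OF U] by (intro finsum_insert) auto
    moreover have "finsum W (\<lambda>a. f (g a)) (insert a A) = f (g a) \<oplus>\<^bsub>W\<^esub> finsum W (\<lambda>a. f (g a)) A"
      using insert lin_onD(1)[OF f] by (intro W.finsum_insert) auto
    ultimately show ?case using insert lin_onD(2)[OF f] csub_finsum[OF U, of A g] by simp
  }
qed

lemma csub_image:
  assumes W: "cspace W sd" and f: "lin_on U V sc W sd f" and U: "csub V sc U"
  shows "csub W sd (f ` U)"
proof (rule cspace.csubI[OF W])
  show "f ` U \<subseteq> carrier W" using lin_onD(1)[OF f] by auto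
  show "\<zero>\<^bsub>W\<^esub> \<in> f ` U" using lin_zero[OF W f U] csubD(3)[OF U] by force
next
  fix x y assume "x \<in> f ` U" "y \<in> f ` U"
  then obtain a b where "a \<in> U" "b \<in> U" "x = f a" "y = f b" by auto
  then show "x \<oplus>\<^bsub>W\<^esub> y \<in> f ` U" using lin_onD(2)[OF f] csubD(2)[OF U] by (metis imageI)
next
  fix c x assume "x \<in> f ` U"
  then obtain a where "a \<in> U" "x = f a" by auto
  then show "sd c x \<in> f ` U" using lin_onD(3)[OF f] csubD(5)[OF U] by (metis imageI)
qed

lemma lin_inv_into:
  assumes W: "cspace W sd" and f: "lin_on U V sc W sd f" and U: "csub V sc U" and inj: "inj_on f U"
  shows "lin_on (f ` U) W sd V sc (inv_into U f)"
proof (rule lin_onI)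
  fix x assume x: "x \<in> f ` U"
  then show "inv_into U f x \<in> carrier V" using inv_into_into csubD(1)[OF U] by (metis subsetD)
  obtain a where a: "a \<in> U" "x = f a" using x by auto
  fix c show "inv_into U f (sd c x) = sc c (inv_into U f x)"
    using a lin_onD(3)[OF f] csubD(5)[OF U] inj by (metis inv_into_f_f)
next
  fix x y assume "x \<in> f ` U" "y \<in> f ` U"
  then obtain a b where "a \<in> U" "b \<in> U" "x = f a" "y = f b" by auto
  then show "inv_into U f (x \<oplus>\<^bsub>W\<^esub> y) = inv_into U f x \<oplus> inv_into U f y"
    using lin_onD(2)[OF f] csubD(2)[OF U] inj by (metis inv_into_f_f)
qed

lemma lin_inj_on:
  assumes W: "cspace W sd" and f: "lin_on U V sc W sd f" and U: "csub V sc U"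
    and ker: "\<And>x. x \<in> U \<Longrightarrow> f x = \<zero>\<^bsub>W\<^esub> \<Longrightarrow> x = \<zero>"
  shows "inj_on f U"
proof (rule inj_onI)
  interpret W: cspace W sd by fact
  fix x y assume xy: "x \<in> U" "y \<in> U" "f x = f y"
  have my: "sc (-1) y \<in> U" using xy csubD(5)[OF U] by blast
  have "f (x \<oplus> sc (-1) y) = f x \<oplus>\<^bsub>W\<^esub> sd (-1) (f y)"
    using xy my lin_onD(2,3)[OF f] by metis
  also have "\<dots> = \<zero>\<^bsub>W\<^esub>" using xy lin_onD(1)[OF f] by (simp add: W.sc_minus1 W.r_neg)
  finally have "x \<oplus> sc (-1) y = \<zero>" using ker my xy csubD(2)[OF U] by blast
  then show "x = y" using xy csubD(6)[OF U]
    by (metis diff_zero)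
qed

end

section \<open>Direct sums\<close>

text \<open>\<open>internal_direct_sum\<close> speaks of additive subgroups only; stability under
  scalars is added so that the projections become linear.\<close>

locale dsum = cspace V sc for V :: "('v, 'x) ring_scheme" (structure) and sc +
  fixes I :: "'i set" and W :: "'i \<Rightarrow> 'v set"
  assumes sub: "i \<in> I \<Longrightarrow> csub V sc (W i)"
    and ids: "internal_direct_sum V I W"
begin

definition comp :: "'v \<Rightarrow> 'i \<Rightarrow> 'v" where
  "comp m = (THE f. f \<in> (\<Pi>\<^sub>E i\<in>I. W i) \<and> finite {i\<in>I. f i \<noteq> \<zero>} \<and> m = (\<Oplus>i\<in>{i\<in>I. f i \<noteq> \<zero>}. f i))"

definition supp :: "'v \<Rightarrow> 'i set" where
  "supp m = {i\<in>I. comp m i \<noteq> \<zero>}"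

lemma comp_props:
  assumes "m \<in> carrier V"
  shows "comp m \<in> (\<Pi>\<^sub>E i\<in>I. W i)" "finite (supp m)" "m = (\<Oplus>i\<in>supp m. comp m i)"
proof -
  have "\<exists>!f. f \<in> (\<Pi>\<^sub>E i\<in>I. W i) \<and> finite {i\<in>I. f i \<noteq> \<zero>} \<and> m = (\<Oplus>i\<in>{i\<in>I. f i \<noteq> \<zero>}. f i)"
    using ids assms by (simp add: internal_direct_sum_def)
  from theI'[OF this] show "comp m \<in> (\<Pi>\<^sub>E i\<in>I. W i)" "finite (supp m)" "m = (\<Oplus>i\<in>supp m. comp m i)"
    unfolding comp_def supp_def by auto
qed

lemma comp_in [simp]: "m \<in> carrier V \<Longrightarrow> i \<in> I \<Longrightarrow> comp m i \<in> W i"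
  using comp_props(1) by (auto simp: PiE_def)

lemma W_carrier: "i \<in> I \<Longrightarrow> x \<in> W i \<Longrightarrow> x \<in> carrier V"
  using csubD(6)[OF sub] by blast

lemma comp_closed [simp]: "m \<in> carrier V \<Longrightarrow> i \<in> I \<Longrightarrow> comp m i \<in> carrier V"
  using comp_in W_carrier by blast

lemma supp_sub: "supp m \<subseteq> I" by (auto simp: supp_def)

lemma supp_out: "i \<in> I \<Longrightarrow> i \<notin> supp m \<Longrightarrow> comp m i = \<zero>" by (auto simp: supp_def)

lemma comp_sum:
  assumes "m \<in> carrier V" "finite J" "supp m \<subseteq> J" "J \<subseteq> I"
  shows "m = (\<Oplus>i\<in>J. comp m i)"
proof -
  have "(\<Oplus>i\<in>supp m. comp m i) = (\<Oplus>i\<in>J. comp m i)"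
    using assms by (intro finsum_mono_neutral) (auto simp: supp_def)
  then show ?thesis using comp_props(3)[OF assms(1)] by simp
qed

lemma comp_unique:
  assumes "finite J" "J \<subseteq> I" "\<And>i. i \<in> J \<Longrightarrow> f i \<in> W i" "m = (\<Oplus>i\<in>J. f i)" "i \<in> I"
  shows "comp m i = (if i \<in> J then f i else \<zero>)"
proof -
  have fc: "f \<in> J \<rightarrow> carrier V" using assms W_carrier by auto
  then have mc: "m \<in> carrier V" using assms by simp
  \<comment> \<open>The family singled out by \<open>internal_direct_sum\<close> is extensional on
    all of \<open>I\<close>, so the finite family \<open>f\<close> is padded with zeros.\<close>
  define g where "g = (\<lambda>i\<in>I. if i \<in> J then f i else \<zero>)"
  have sg: "{i\<in>I. g i \<noteq> \<zero>} \<subseteq> J" by (auto simp: g_def)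
  have "(\<Oplus>i\<in>{i\<in>I. g i \<noteq> \<zero>}. g i) = (\<Oplus>i\<in>J. g i)"
    using assms sg fc by (intro finsum_mono_neutral) (auto simp: g_def)
  also have "\<dots> = m" unfolding assms(4) using assms fc by (intro finsum_cong') (auto simp: g_def)
  finally have m: "m = (\<Oplus>i\<in>{i\<in>I. g i \<noteq> \<zero>}. g i)" by simp
  have g: "g \<in> (\<Pi>\<^sub>E i\<in>I. W i)" using assms csubD(3)[OF sub] by (auto simp: g_def)
  have ex1: "\<exists>!f. f \<in> (\<Pi>\<^sub>E i\<in>I. W i) \<and> finite {i\<in>I. f i \<noteq> \<zero>} \<and> m = (\<Oplus>i\<in>{i\<in>I. f i \<noteq> \<zero>}. f i)"
    using ids mc by (simp add: internal_direct_sum_def)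
  have "comp m = g"
    unfolding comp_def by (rule the1_equality[OF ex1]) (use g m sg assms(1) finite_subset in blast)
  then show ?thesis using assms by (simp add: g_def)
qed

lemma comp_W: 
  assumes "i \<in> I" "x \<in> W i" "j \<in> I" shows "comp x j = (if j = i then x else \<zero>)"
proof -
  have "x = (\<Oplus>k\<in>{i}. x)" using assms W_carrier by simp
  from comp_unique[OF _ _ _ this assms(3)] assms show ?thesis by auto
qed

lemma comp_add: "x \<in> carrier V \<Longrightarrow> y \<in> carrier V \<Longrightarrow> i \<in> I \<Longrightarrow> comp (x \<oplus> y) i = comp x i \<oplus> comp y i"
proof -
  assume xy: "x \<in> carrier V" "y \<in> carrier V" and i: "i \<in> I"
  let ?J = "insert i (supp x \<union> supp y)"
  have J: "finite ?J" "?J \<subseteq> I" using comp_props(2) xy i supp_sub by auto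
  have x: "x = (\<Oplus>i\<in>?J. comp x i)" using xy J by (intro comp_sum) auto
  have y: "y = (\<Oplus>i\<in>?J. comp y i)" using xy J by (intro comp_sum) auto
  have "x \<oplus> y = (\<Oplus>i\<in>?J. comp x i) \<oplus> (\<Oplus>i\<in>?J. comp y i)" using x y by simp
  also have "\<dots> = (\<Oplus>i\<in>?J. comp x i \<oplus> comp y i)"
    using J xy by (intro finsum_addf[symmetric]) (auto dest: comp_closed)
  finally have eq: "x \<oplus> y = (\<Oplus>i\<in>?J. comp x i \<oplus> comp y i)" .
  have "comp (x \<oplus> y) i = (if i \<in> ?J then comp x i \<oplus> comp y i else \<zero>)"
    using J xy by (intro comp_unique[OF _ _ _ eq i] csubD(2)[OF sub]) (auto dest: comp_in)
  then show ?thesis by simp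
qed

lemma comp_sc: "x \<in> carrier V \<Longrightarrow> i \<in> I \<Longrightarrow> comp (sc c x) i = sc c (comp x i)"
proof -
  assume x: "x \<in> carrier V" and i: "i \<in> I"
  let ?J = "insert i (supp x)"
  have J: "finite ?J" "?J \<subseteq> I" using comp_props(2) x i supp_sub by auto
  have "x = (\<Oplus>i\<in>?J. comp x i)" using x J by (intro comp_sum) auto
  then have "sc c x = sc c (\<Oplus>i\<in>?J. comp x i)" by simp
  also have "\<dots> = (\<Oplus>i\<in>?J. sc c (comp x i))"
    using J x by (intro sc_finsum) (auto dest: comp_closed)
  finally have eq: "sc c x = (\<Oplus>i\<in>?J. sc c (comp x i))" .
  have "comp (sc c x) i = (if i \<in> ?J then sc c (comp x i) else \<zero>)"
    using J x by (intro comp_unique[OF _ _ _ eq i] csubD(5)[OF sub]) (auto dest: comp_in)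
  then show ?thesis by simp
qed

lemma lin_comp: "i \<in> I \<Longrightarrow> lin_on (carrier V) V sc V sc (\<lambda>x. comp x i)"
  by (rule lin_onI) (auto simp: comp_add comp_sc)

lemma dsum_induct:
  assumes "m \<in> carrier V" "P \<zero>" "\<And>i x. i \<in> I \<Longrightarrow> x \<in> W i \<Longrightarrow> P x"
    "\<And>x y. x \<in> carrier V \<Longrightarrow> y \<in> carrier V \<Longrightarrow> P x \<Longrightarrow> P y \<Longrightarrow> P (x \<oplus> y)"
  shows "P m"
proof -
  have "P (\<Oplus>i\<in>J. comp m i)" if "finite J" "J \<subseteq> I" for J
    using that
  proof (induction J rule: finite_induct)
    case empty then show ?case using assms by simp
  next
    case (insert i J)
    have "(\<Oplus>i\<in>insert i J. comp m i) = comp m i \<oplus> (\<Oplus>i\<in>J. comp m i)"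
      using insert assms(1) by (intro finsum_insert) (auto dest: comp_closed)
    moreover have "(\<Oplus>i\<in>J. comp m i) \<in> carrier V" using insert assms(1) by (intro finsum_closed) auto
    moreover have "P (comp m i)" using insert assms(1) by (intro assms(3)[of i]) auto
    ultimately show ?case using insert assms(4)[of "comp m i"] assms(1) by simp
  qed
  then show ?thesis using comp_props[OF assms(1)] supp_sub by metis
qed

lemma comp_zero: "i \<in> I \<Longrightarrow> comp \<zero> i = \<zero>"
  using comp_W[OF _ csubD(3)[OF sub]] by auto

lemma eq_on_W:
  assumes N: "cspace N sd" and f: "lin_on (carrier V) V sc N sd f" and g: "lin_on (carrier V) V sc N sd g"
    and eq: "\<And>i x. i \<in> I \<Longrightarrow> x \<in> W i \<Longrightarrow> f x = g x" and m: "m \<in> carrier V"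
  shows "f m = g m"
  using m
proof (induction m rule: dsum_induct)
  case 1
  show ?case using m .
next
  case 2
  show ?case using lin_zero[OF N f csub_carrier] lin_zero[OF N g csub_carrier] by simp
next
  case (4 x y)
  then show ?case using lin_onD(2)[OF f] lin_onD(2)[OF g] by simp
qed (use eq in auto)

text \<open>The extension sends \<open>m\<close> to the sum of the images of its components. The
  work is to compare sums over the different supports of \<open>x\<close>, \<open>y\<close> and
  their sum.\<close>

lemma linear_extension:
  assumes N: "cspace N sd" and h: "\<And>i. i \<in> I \<Longrightarrow> lin_on (W i) V sc N sd (h i)"
  shows "\<exists>f. lin_on (carrier V) V sc N sd f \<and> (\<forall>i\<in>I. \<forall>x\<in>W i. f x = h i x)"
proof -
  interpret N: cspace N sd by fact
  define f where "f m = (\<Oplus>\<^bsub>N\<^esub>i\<in>supp m. h i (comp m i))" for m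
  have hz: "h i \<zero> = \<zero>\<^bsub>N\<^esub>" if "i \<in> I" for i using lin_zero[OF N h sub] that by blast
  have hc: "h i (comp m i) \<in> carrier N" if "i \<in> I" "m \<in> carrier V" for i m
    using lin_onD(1)[OF h] comp_in that by blast
  \<comment> \<open>Since \<open>h i\<close> kills zero, any finite index set containing the support
    will do; this provides one index set for several vectors.\<close>
  have f: "f m = (\<Oplus>\<^bsub>N\<^esub>i\<in>J. h i (comp m i))" if "finite J" "supp m \<subseteq> J" "J \<subseteq> I" "m \<in> carrier V" for J m
    unfolding f_def using that supp_out[of _ m] hz hc by (intro N.finsum_mono_neutral) (auto simp: subset_iff)
  have "lin_on (carrier V) V sc N sd f"
  proof (rule lin_onI)
    fix x assume x: "x \<in> carrier V"
    show "f x \<in> carrier N" unfolding f_def using hc x supp_sub by (intro N.finsum_closed) (auto simp: subset_iff)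
    fix y assume y: "y \<in> carrier V"
    let ?J = "supp x \<union> supp y \<union> supp (x \<oplus> y)"
    have J: "finite ?J" "?J \<subseteq> I" using comp_props(2) x y supp_sub by auto
    have f3: "f x = (\<Oplus>\<^bsub>N\<^esub>i\<in>?J. h i (comp x i))" "f y = (\<Oplus>\<^bsub>N\<^esub>i\<in>?J. h i (comp y i))"
      "f (x \<oplus> y) = (\<Oplus>\<^bsub>N\<^esub>i\<in>?J. h i (comp (x \<oplus> y) i))"
      by (rule f[OF J(1) _ J(2)]; use x y in blast)+
    have JI: "i \<in> I" if "i \<in> ?J" for i using J(2) that by blast
    note f3(3)
    also have "(\<Oplus>\<^bsub>N\<^esub>i\<in>?J. h i (comp (x \<oplus> y) i)) = (\<Oplus>\<^bsub>N\<^esub>i\<in>?J. h i (comp x i) \<oplus>\<^bsub>N\<^esub> h i (comp y i))"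
    proof (rule N.finsum_cong')
      show "(\<lambda>i. h i (comp x i) \<oplus>\<^bsub>N\<^esub> h i (comp y i)) \<in> ?J \<rightarrow> carrier N"
        by (intro Pi_I N.a_closed hc JI x y)
      fix i assume "i \<in> ?J"
      then have i: "i \<in> I" by (rule JI)
      show "h i (comp (x \<oplus> y) i) = h i (comp x i) \<oplus>\<^bsub>N\<^esub> h i (comp y i)"
        unfolding comp_add[OF x y i] by (rule lin_onD(2)[OF h[OF i] comp_in[OF x i] comp_in[OF y i]])
    qed simp
    also have "\<dots> = f x \<oplus>\<^bsub>N\<^esub> f y"
      unfolding f3(1,2) by (intro N.finsum_addf Pi_I hc JI x y)
    finally show "f (x \<oplus> y) = f x \<oplus>\<^bsub>N\<^esub> f y" .
  next
    fix c x assume x: "x \<in> carrier V"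
    let ?J = "supp x \<union> supp (sc c x)"
    have J: "finite ?J" "?J \<subseteq> I" using comp_props(2) x supp_sub by auto
    have f2: "f x = (\<Oplus>\<^bsub>N\<^esub>i\<in>?J. h i (comp x i))"
      "f (sc c x) = (\<Oplus>\<^bsub>N\<^esub>i\<in>?J. h i (comp (sc c x) i))"
      by (rule f[OF J(1) _ J(2)]; use x in blast)+
    have JI: "i \<in> I" if "i \<in> ?J" for i using J(2) that by blast
    note f2(2)
    also have "(\<Oplus>\<^bsub>N\<^esub>i\<in>?J. h i (comp (sc c x) i)) = (\<Oplus>\<^bsub>N\<^esub>i\<in>?J. sd c (h i (comp x i)))"
    proof (rule N.finsum_cong')
      show "(\<lambda>i. sd c (h i (comp x i))) \<in> ?J \<rightarrow> carrier N"
        by (intro Pi_I N.sc_closed hc JI x)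
      fix i assume "i \<in> ?J"
      then have i: "i \<in> I" by (rule JI)
      show "h i (comp (sc c x) i) = sd c (h i (comp x i))"
        unfolding comp_sc[OF x i] by (rule lin_onD(3)[OF h[OF i] comp_in[OF x i]])
    qed simp
    also have "\<dots> = sd c (f x)"
      unfolding f2(1) by (intro N.sc_finsum[symmetric] J(1) Pi_I hc JI x)
    finally show "f (sc c x) = sd c (f x)" .
  qed
  moreover have "f x = h i x" if "i \<in> I" "x \<in> W i" for i x
  proof -
    have "supp x \<subseteq> {i}" using comp_W[OF that] by (auto simp: supp_def split: if_splits)
    then have "f x = (\<Oplus>\<^bsub>N\<^esub>j\<in>{i}. h j (comp x j))" using that W_carrier by (intro f) auto
    then show ?thesis using that comp_W[OF that] lin_onD(1)[OF h] by simp
  qed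
  ultimately show ?thesis by blast
qed

text \<open>Both sides are linear in \<open>m\<close>, so it is enough to compare them on the
  summands.\<close>

lemma comp_commute:
  assumes f: "lin_on (carrier V) V sc V sc f" and fW: "\<And>i x. i \<in> I \<Longrightarrow> x \<in> W i \<Longrightarrow> f x \<in> W i"
    and "m \<in> carrier V" "i \<in> I"
  shows "comp (f m) i = f (comp m i)"
proof -
  have "cspace V sc" by unfold_locales
  show ?thesis
  proof (rule eq_on_W[OF \<open>cspace V sc\<close> _ _ _ assms(3)])
    show "lin_on (carrier V) V sc V sc (\<lambda>m. comp (f m) i)"
      using lin_on_comp[OF f lin_comp[OF assms(4)]] lin_onD(1)[OF f] by blast
    show "lin_on (carrier V) V sc V sc (\<lambda>m. f (comp m i))"
      using lin_on_comp[OF lin_comp[OF assms(4)] f] assms(4) by simp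
    fix j x assume "j \<in> I" "x \<in> W j"
    then show "comp (f x) i = f (comp x i)"
      using comp_W[of j x i] comp_W[of j "f x" i] fW assms(4) lin_zero[OF \<open>cspace V sc\<close> f csub_carrier] by auto
  qed
qed

end

lemma (in cspace) dsumI:
  assumes sub: "\<And>i. i \<in> I \<Longrightarrow> csub V sc (W i)"
    and ex: "\<And>m. m \<in> carrier V \<Longrightarrow> \<exists>J f. finite J \<and> J \<subseteq> I \<and> (\<forall>i\<in>J. f i \<in> W i) \<and> m = (\<Oplus>i\<in>J. f i)"
    and indep: "\<And>J f. finite J \<Longrightarrow> J \<subseteq> I \<Longrightarrow> (\<And>i. i \<in> J \<Longrightarrow> f i \<in> W i) \<Longrightarrow> (\<Oplus>i\<in>J. f i) = \<zero> \<Longrightarrow> \<forall>i\<in>J. f i = \<zero>"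
  shows "dsum V sc I W"
proof (unfold_locales, fact sub)
  have Wc: "\<And>i x. i \<in> I \<Longrightarrow> x \<in> W i \<Longrightarrow> x \<in> carrier V" using csubD(6)[OF sub] by blast
  show "internal_direct_sum V I W"
    unfolding internal_direct_sum_def
  proof (intro conjI ballI)
    show "\<And>i. i \<in> I \<Longrightarrow> additive_subgroup (W i) V" using sub by (simp add: csub_def)
    fix m assume m: "m \<in> carrier V"
    obtain J f where J: "finite J" "J \<subseteq> I" "\<And>i. i \<in> J \<Longrightarrow> f i \<in> W i" "m = (\<Oplus>i\<in>J. f i)"
      using ex[OF m] by blast
    define g where "g = (\<lambda>i\<in>I. if i \<in> J then f i else \<zero>)"
    have fc: "f \<in> J \<rightarrow> carrier V" using J Wc by auto
    have sg: "{i\<in>I. g i \<noteq> \<zero>} \<subseteq> J" by (auto simp: g_def)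
    have "(\<Oplus>i\<in>{i\<in>I. g i \<noteq> \<zero>}. g i) = (\<Oplus>i\<in>J. g i)"
      using J sg fc by (intro finsum_mono_neutral) (auto simp: g_def)
    also have "\<dots> = m" unfolding J(4) using J fc by (intro finsum_cong') (auto simp: g_def)
    finally have mg: "m = (\<Oplus>i\<in>{i\<in>I. g i \<noteq> \<zero>}. g i)" by simp
    have g: "g \<in> (\<Pi>\<^sub>E i\<in>I. W i)" using J csubD(3)[OF sub] by (auto simp: g_def)
    show "\<exists>!f. f \<in> (\<Pi>\<^sub>E i\<in>I. W i) \<and> finite {i\<in>I. f i \<noteq> \<zero>} \<and> m = (\<Oplus>i\<in>{i\<in>I. f i \<noteq> \<zero>}. f i)"
    proof (rule ex1I[of _ g])
      show "g \<in> (\<Pi>\<^sub>E i\<in>I. W i) \<and> finite {i\<in>I. g i \<noteq> \<zero>} \<and> m = (\<Oplus>i\<in>{i\<in>I. g i \<noteq> \<zero>}. g i)"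
        using g mg J(1) sg finite_subset by blast
      fix h assume h: "h \<in> (\<Pi>\<^sub>E i\<in>I. W i) \<and> finite {i\<in>I. h i \<noteq> \<zero>} \<and> m = (\<Oplus>i\<in>{i\<in>I. h i \<noteq> \<zero>}. h i)"
      let ?K = "{i\<in>I. g i \<noteq> \<zero>} \<union> {i\<in>I. h i \<noteq> \<zero>}"
      have K: "finite ?K" "?K \<subseteq> I" using h J(1) sg finite_subset by blast+
      have gc: "\<And>i. i \<in> I \<Longrightarrow> g i \<in> carrier V" and hc: "\<And>i. i \<in> I \<Longrightarrow> h i \<in> carrier V"
        using g h Wc by (auto simp: PiE_def Pi_def)
      have 1: "m = (\<Oplus>i\<in>?K. g i)" unfolding mg using K gc by (intro finsum_mono_neutral) auto
      have "(\<Oplus>i\<in>{i\<in>I. h i \<noteq> \<zero>}. h i) = (\<Oplus>i\<in>?K. h i)"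
        using K hc by (intro finsum_mono_neutral) auto
      then have 2: "m = (\<Oplus>i\<in>?K. h i)" using h by simp
      \<comment> \<open>Two decompositions of \<open>m\<close> differ by a family with sum zero,
        which \<open>indep\<close> makes vanish.\<close>
      have "(\<Oplus>i\<in>?K. g i \<oplus> sc (-1) (h i)) = (\<Oplus>i\<in>?K. g i) \<oplus> (\<Oplus>i\<in>?K. sc (-1) (h i))"
        using gc hc by (intro finsum_addf) auto
      also have "(\<Oplus>i\<in>?K. sc (-1) (h i)) = sc (-1) (\<Oplus>i\<in>?K. h i)"
        using K hc by (intro sc_finsum[symmetric]) auto
      finally have "(\<Oplus>i\<in>?K. g i \<oplus> sc (-1) (h i)) = \<zero>"
        using 1 2 m by (simp add: sc_minus1 r_neg)
      moreover have "g i \<oplus> sc (-1) (h i) \<in> W i" if "i \<in> ?K" for i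
        using that g h csubD(2,5)[OF sub] K(2) by (auto simp: PiE_def Pi_def)
      ultimately have z: "\<forall>i\<in>?K. g i \<oplus> sc (-1) (h i) = \<zero>" by (intro indep[OF K])
      show "h = g"
      proof (rule PiE_ext[of _ I W])
        show "h \<in> (\<Pi>\<^sub>E i\<in>I. W i)" "g \<in> (\<Pi>\<^sub>E i\<in>I. W i)" using g h by auto
        fix i assume i: "i \<in> I"
        show "h i = g i"
        proof (cases "i \<in> ?K")
          case True
          with z have "g i \<oplus> sc (-1) (h i) = \<zero>" by blast
          then show ?thesis using diff_zero[OF gc[OF i] hc[OF i]] by simp
        qed (use i in auto)
      qed
    qed
  qed
qed

definition fd :: "('v, 'x) ring_scheme \<Rightarrow> (complex \<Rightarrow> 'v \<Rightarrow> 'v) \<Rightarrow> 'v set \<Rightarrow> bool" where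
  "fd V sc U \<longleftrightarrow> (\<exists>B. finite B \<and> B \<subseteq> U \<and> (\<forall>w\<in>U. \<exists>c. w = (\<Oplus>\<^bsub>V\<^esub>b\<in>B. sc (c b) b)))"

lemma finite_dimensional_iff: "finite_dimensional \<iota> M U \<longleftrightarrow> fd M (\<lambda>c. smult M (\<iota> c)) U"
  by (simp add: fd_def finite_dimensional_def)

context cspace begin

lemma fd_zero: "fd V sc {\<zero>}"
  unfolding fd_def by (rule exI[of _ "{}"]) simp

lemma fd_image:
  assumes W: "cspace W sd" and f: "lin_on U V sc W sd f" and U: "csub V sc U" and fd: "fd V sc U"
  shows "fd W sd (f ` U)"
proof -
  interpret W: cspace W sd by fact
  obtain B where B: "finite B" "B \<subseteq> U" "\<And>w. w \<in> U \<Longrightarrow> \<exists>c. w = (\<Oplus>b\<in>B. sc (c b) b)"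
    using fd unfolding fd_def by blast
  have "\<exists>c. w = (\<Oplus>\<^bsub>W\<^esub>b\<in>f ` B. sd (c b) b)" if w: "w \<in> f ` U" for w
  proof -
    obtain v where v: "v \<in> U" "w = f v" using w by blast
    obtain c where c: "v = (\<Oplus>b\<in>B. sc (c b) b)" using B(3)[OF v(1)] by blast
    have fB: "f b \<in> carrier W" if "b \<in> B" for b using that B lin_onD(1)[OF f] by blast
    have "w = (\<Oplus>\<^bsub>W\<^esub>b\<in>B. f (sc (c b) b))"
      unfolding v(2) c using B csubD(5)[OF U] by (intro lin_finsum[OF W f U]) auto
    also have "\<dots> = (\<Oplus>\<^bsub>W\<^esub>b\<in>B. sd (c b) (f b))"
      using B fB by (intro W.finsum_cong') (auto intro!: lin_onD(3)[OF f])
    \<comment> \<open>Spanning sets are sets, so when \<open>f\<close> identifies vectors of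
      \<open>B\<close> their coefficients have to be added up.\<close>
    also have "\<exists>d. (\<Oplus>\<^bsub>W\<^esub>b\<in>B. sd (c b) (f b)) = (\<Oplus>\<^bsub>W\<^esub>b\<in>f ` B. sd (d b) b)"
      using B(1) fB
    proof (induction B rule: finite_induct)
      case empty then show ?case by simp
    next
      case (insert x F)
      then obtain d where d: "(\<Oplus>\<^bsub>W\<^esub>b\<in>F. sd (c b) (f b)) = (\<Oplus>\<^bsub>W\<^esub>b\<in>f ` F. sd (d b) b)" by auto
      have s: "(\<Oplus>\<^bsub>W\<^esub>b\<in>insert x F. sd (c b) (f b)) = sd (c x) (f x) \<oplus>\<^bsub>W\<^esub> (\<Oplus>\<^bsub>W\<^esub>b\<in>f ` F. sd (d b) b)"
        using insert d by (subst W.finsum_insert) auto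
      show ?case
      proof (cases "f x \<in> f ` F")
        case True
        let ?G = "f ` F - {f x}"
        have G: "f ` F = insert (f x) ?G" "f x \<notin> ?G" "finite ?G" using True insert by auto
        have Gc: "\<And>b. b \<in> ?G \<Longrightarrow> b \<in> carrier W" and fx: "f x \<in> carrier W" using insert.prems by auto
        have eq: "(\<Oplus>\<^bsub>W\<^esub>b\<in>f ` F. sd (d' b) b) = sd (d' (f x)) (f x) \<oplus>\<^bsub>W\<^esub> (\<Oplus>\<^bsub>W\<^esub>b\<in>?G. sd (d' b) b)" for d'
        proof -
          have "(\<Oplus>\<^bsub>W\<^esub>b\<in>f ` F. sd (d' b) b) = (\<Oplus>\<^bsub>W\<^esub>b\<in>insert (f x) ?G. sd (d' b) b)"
            by (rule arg_cong[OF G(1)])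
          also have "\<dots> = sd (d' (f x)) (f x) \<oplus>\<^bsub>W\<^esub> (\<Oplus>\<^bsub>W\<^esub>b\<in>?G. sd (d' b) b)"
            using G(2,3) Gc fx by (intro W.finsum_insert) auto
          finally show ?thesis .
        qed
        let ?d = "d(f x := c x + d (f x))"
        have "(\<Oplus>\<^bsub>W\<^esub>b\<in>?G. sd (?d b) b) = (\<Oplus>\<^bsub>W\<^esub>b\<in>?G. sd (d b) b)"
          using Gc by (intro W.finsum_cong') auto
        moreover have "(\<Oplus>\<^bsub>W\<^esub>b\<in>?G. sd (d b) b) \<in> carrier W" using Gc by (intro W.finsum_closed) auto
        ultimately have "(\<Oplus>\<^bsub>W\<^esub>b\<in>insert x F. sd (c b) (f b)) = (\<Oplus>\<^bsub>W\<^esub>b\<in>f ` F. sd (?d b) b)"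
          unfolding s eq using fx by (simp add: W.sc_l W.a_assoc)
        moreover have "f ` insert x F = f ` F" using True by auto
        ultimately show ?thesis by (intro exI[of _ ?d]) simp
      next
        case False
        let ?d = "d(f x := c x)"
        have "(\<Oplus>\<^bsub>W\<^esub>b\<in>f ` insert x F. sd (?d b) b) = sd (c x) (f x) \<oplus>\<^bsub>W\<^esub> (\<Oplus>\<^bsub>W\<^esub>b\<in>f ` F. sd (?d b) b)"
          using False insert by (simp, subst W.finsum_insert) auto
        also have "(\<Oplus>\<^bsub>W\<^esub>b\<in>f ` F. sd (?d b) b) = (\<Oplus>\<^bsub>W\<^esub>b\<in>f ` F. sd (d b) b)"
        proof (rule W.finsum_cong')
          show "sd (?d b) b = sd (d b) b" if "b \<in> f ` F" for b
          proof -
            have "b \<noteq> f x" using that False by blast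
            then show ?thesis by simp
          qed
        qed (use insert in auto)
        finally show ?thesis unfolding s by (intro exI[of _ ?d]) simp
      qed
    qed
    finally show ?thesis .
  qed
  then show ?thesis unfolding fd_def using B by (intro exI[of _ "f ` B"]) blast
qed

lemma fd_add:
  assumes U: "csub V sc U" "fd V sc U" and U': "csub V sc U'" "fd V sc U'"
    and T: "U \<subseteq> T" "U' \<subseteq> T" "\<And>w. w \<in> T \<Longrightarrow> \<exists>u\<in>U. \<exists>u'\<in>U'. w = u \<oplus> u'"
  shows "fd V sc T"
proof -
  obtain B where B: "finite B" "B \<subseteq> U" "\<And>w. w \<in> U \<Longrightarrow> \<exists>c. w = (\<Oplus>b\<in>B. sc (c b) b)"
    using U unfolding fd_def by blast
  obtain B' where B': "finite B'" "B' \<subseteq> U'" "\<And>w. w \<in> U' \<Longrightarrow> \<exists>c. w = (\<Oplus>b\<in>B'. sc (c b) b)"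
    using U' unfolding fd_def by blast
  have BB: "b \<in> carrier V" if "b \<in> B \<union> B'" for b using that B(2) B'(2) csubD(1)[OF U(1)] csubD(1)[OF U'(1)] by blast
  have "\<exists>c. w = (\<Oplus>b\<in>B \<union> B'. sc (c b) b)" if w: "w \<in> T" for w
  proof -
    obtain u u' where u: "u \<in> U" "u' \<in> U'" "w = u \<oplus> u'" using T(3)[OF w] by blast
    obtain c where c: "u = (\<Oplus>b\<in>B. sc (c b) b)" using B(3)[OF u(1)] by blast
    obtain c' where c': "u' = (\<Oplus>b\<in>B'. sc (c' b) b)" using B'(3)[OF u(2)] by blast
    \<comment> \<open>Extending both coefficient families by zero makes a vector lying in both
      \<open>B\<close> and \<open>B'\<close> receive the sum of its two coefficients.\<close>
    let ?d = "\<lambda>b. if b \<in> B then c b else 0" and ?d' = "\<lambda>b. if b \<in> B' then c' b else 0"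
    have "u = (\<Oplus>b\<in>B. sc (?d b) b)" unfolding c using BB by (intro finsum_cong') auto
    also have "\<dots> = (\<Oplus>b\<in>B \<union> B'. sc (?d b) b)" using B(1) B'(1) BB by (intro finsum_mono_neutral) auto
    finally have 1: "u = (\<Oplus>b\<in>B \<union> B'. sc (?d b) b)" .
    have "u' = (\<Oplus>b\<in>B'. sc (?d' b) b)" unfolding c' using BB by (intro finsum_cong') auto
    also have "\<dots> = (\<Oplus>b\<in>B \<union> B'. sc (?d' b) b)" using B(1) B'(1) BB by (intro finsum_mono_neutral) auto
    finally have 2: "u' = (\<Oplus>b\<in>B \<union> B'. sc (?d' b) b)" .
    have "w = (\<Oplus>b\<in>B \<union> B'. sc (?d b) b \<oplus> sc (?d' b) b)"
      using u(3) 1 2 BB by (simp only:) (rule finsum_addf[symmetric]; auto)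
    also have "\<dots> = (\<Oplus>b\<in>B \<union> B'. sc (?d b + ?d' b) b)"
      using BB by (intro finsum_cong') (auto simp: sc_l)
    finally show ?thesis by (intro exI[of _ "\<lambda>b. ?d b + ?d' b"])
  qed
  then show ?thesis unfolding fd_def using B B' T(1,2) by (intro exI[of _ "B \<union> B'"]) blast
qed

text \<open>Coordinates with respect to a finite spanning set, chosen once per vector: the first
  half of the cardinality bound needed to realize modules inside a given type.\<close>

lemma fd_inj_list:
  assumes "csub V sc U" "fd V sc U"
  shows "\<exists>g :: 'v \<Rightarrow> complex list. inj_on g U"
proof -
  obtain B where B: "finite B" "B \<subseteq> U" "\<And>w. w \<in> U \<Longrightarrow> \<exists>c. w = (\<Oplus>b\<in>B. sc (c b) b)"
    using assms unfolding fd_def by blast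
  obtain bs where bs: "set bs = B" using finite_list[OF B(1)] by blast
  obtain c where c: "\<And>w. w \<in> U \<Longrightarrow> w = (\<Oplus>b\<in>B. sc (c w b) b)" using B(3) by metis
  have "inj_on (\<lambda>w. map (c w) bs) U"
  proof (rule inj_onI)
    fix x y assume "x \<in> U" "y \<in> U" "map (c x) bs = map (c y) bs"
    then have "\<And>b. b \<in> B \<Longrightarrow> c x b = c y b" using bs by auto
    then have "(\<Oplus>b\<in>B. sc (c x b) b) = (\<Oplus>b\<in>B. sc (c y b) b)"
      using B(2) csubD(1)[OF assms(1)] by (intro finsum_cong') auto
    then show "x = y" using c \<open>x \<in> U\<close> \<open>y \<in> U\<close> by metis
  qed
  then show ?thesis by blast
qed

end

lemma (in dsum) fd_finite_sum:
  assumes "finite I" "\<And>i. i \<in> I \<Longrightarrow> fd V sc (W i)"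
  shows "fd V sc (carrier V)"
proof -
  \<comment> \<open>The induction runs over the subspaces of vectors supported in \<open>J\<close>,
    adding one summand at a time.\<close>
  have ind: "csub V sc {m \<in> carrier V. supp m \<subseteq> J} \<and> fd V sc {m \<in> carrier V. supp m \<subseteq> J}" if "finite J" "J \<subseteq> I" for J
    using that
  proof (induction J rule: finite_induct)
    case empty
    have "m = \<zero>" if "m \<in> carrier V" "supp m \<subseteq> {}" for m
      using comp_sum[OF that(1) _ that(2)] by simp
    then have "{m \<in> carrier V. supp m \<subseteq> {}} = {\<zero>}"
      using comp_zero by (auto simp: supp_def)
    then show ?case using csub_zero fd_zero by simp
  next
    case (insert i J)
    let ?U = "\<lambda>J. {m \<in> carrier V. supp m \<subseteq> J}"
    have i: "i \<in> I" using insert by simp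
    have "?U (insert i J) = {m \<in> carrier V. \<forall>j\<in>I - insert i J. comp m j = \<zero>}"
      by (auto simp: supp_def)
    moreover have "csub V sc {m \<in> carrier V. \<forall>j\<in>I - insert i J. comp m j = \<zero>}"
      by (rule csubI) (auto simp: comp_add comp_sc comp_zero)
    ultimately have "csub V sc (?U (insert i J))" by simp
    moreover have "fd V sc (?U (insert i J))"
    proof (rule fd_add[of "W i" "?U J"])
      show "W i \<subseteq> ?U (insert i J)" using i W_carrier comp_W[OF i] by (auto simp: supp_def split: if_splits)
      fix w assume w: "w \<in> ?U (insert i J)"
      have wc: "w \<in> carrier V" using w by simp
      \<comment> \<open>Remove the component at \<open>i\<close>; what remains is supported in
        \<open>J\<close>.\<close>
      let ?w = "w \<oplus> sc (-1) (comp w i)"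
      have "supp ?w \<subseteq> J"
      proof
        fix j assume j: "j \<in> supp ?w"
        then have jI: "j \<in> I" and nz: "comp ?w j \<noteq> \<zero>" by (auto simp: supp_def)
        have e: "comp ?w j = comp w j \<oplus> sc (-1) (if j = i then comp w i else \<zero>)"
          using wc i jI by (simp add: comp_add comp_sc comp_W[OF i comp_in[OF wc i] jI])
        have "j \<noteq> i" using e nz wc i by (auto simp: sc_minus1 r_neg)
        moreover have "comp w j \<noteq> \<zero>" using e nz \<open>j \<noteq> i\<close> by auto
        ultimately show "j \<in> J" using w jI by (auto simp: supp_def)
      qed
      moreover have "w = comp w i \<oplus> ?w"
        using wc i comp_closed[OF wc i] by (simp add: sc_minus1 a_lcomm r_neg)
      ultimately show "\<exists>u\<in>W i. \<exists>u'\<in>?U J. w = u \<oplus> u'" using wc i comp_in[OF wc i] by (intro bexI[of _ "comp w i"] bexI[of _ ?w]) auto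
    qed (use insert sub assms(2)[OF i] i in auto)
    ultimately show ?case by blast
  qed
  have "{m \<in> carrier V. supp m \<subseteq> I} = carrier V" using supp_sub by auto
  then show ?thesis using ind[OF assms(1)] by simp
qed

text \<open>A summand is the image of the whole space under its projection.\<close>

lemma (in dsum) fd_summand:
  assumes "fd V sc (carrier V)" "i \<in> I"
  shows "fd V sc (W i)"
proof -
  have "(\<lambda>m. comp m i) ` carrier V = W i"
    using comp_W[OF assms(2) _ assms(2)] W_carrier[OF assms(2)] comp_in assms(2) by (auto simp: image_iff) metis
  moreover have "cspace V sc" by unfold_locales
  ultimately show ?thesis using fd_image[OF _ lin_comp[OF assms(2)] csub_carrier assms(1)] by simp
qed

section \<open>Cardinalities\<close>

text \<open>Lists of a fixed length are at most continuum many because \<complex> \<times>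
  \<complex> is no larger than \<complex>, and there are only countably many lengths.\<close>

lemma inj_list_complex:
  includes cardinal_syntax
  shows "\<exists>e :: complex list \<Rightarrow> complex. inj e"
proof -
  let ?C = "UNIV :: complex set"
  have inf: "\<not> finite ?C" by (rule infinite_UNIV_char_0)
  have len: "|{xs :: complex list. length xs = n}| \<le>o |?C|" for n
  proof (induction n)
    case 0
    have "{xs :: complex list. length xs = 0} = {[]}" by auto
    then show ?case by (simp add: card_of_ordLeq[symmetric])
  next
    case (Suc n)
    have "|{xs :: complex list. length xs = Suc n}| \<le>o |?C \<times> {xs :: complex list. length xs = n}|"
    proof (rule card_of_ordLeqI[of "\<lambda>xs. (hd xs, tl xs)"])
      show "inj_on (\<lambda>xs :: complex list. (hd xs, tl xs)) {xs. length xs = Suc n}"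
      proof (rule inj_onI)
        fix xs ys :: "complex list"
        assume "xs \<in> {xs. length xs = Suc n}" "ys \<in> {xs. length xs = Suc n}" "(hd xs, tl xs) = (hd ys, tl ys)"
        then show "xs = ys" by (cases xs; cases ys) simp_all
      qed
    qed auto
    also have "|?C \<times> {xs :: complex list. length xs = n}| \<le>o |?C|"
      by (rule card_of_Times_ordLeq_infinite_Field[OF _ _ Suc])
        (simp_all add: inf card_of_card_order_on Field_card_of card_of_mono1)
    finally show ?case .
  qed
  have "|\<Union>n\<in>UNIV :: nat set. {xs :: complex list. length xs = n}| \<le>o |?C|"
    by (rule card_of_UNION_ordLeq_infinite) (use inf len infinite_iff_card_of_nat in auto)
  moreover have "(\<Union>n\<in>UNIV :: nat set. {xs :: complex list. length xs = n}) = UNIV" by auto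
  ultimately have "|UNIV :: complex list set| \<le>o |?C|" by simp
  then show ?thesis unfolding card_of_ordLeq[symmetric] by blast
qed

text \<open>The external direct sum as functions on the whole index type that are zero off
  \<open>I\<close>; with this padding, equality of functions is equality of families.\<close>

definition ext_sum :: "('v, 'x) ring_scheme \<Rightarrow> 'i set \<Rightarrow> ('i \<Rightarrow> 'v set) \<Rightarrow> ('i \<Rightarrow> 'v) set" where
  "ext_sum V I W = {f. (\<forall>i\<in>I. f i \<in> W i) \<and> (\<forall>i. i \<notin> I \<longrightarrow> f i = \<zero>\<^bsub>V\<^esub>) \<and> finite {i. f i \<noteq> \<zero>\<^bsub>V\<^esub>}}"

text \<open>A family is coded by the list of its nonzero entries, each entry by its index followed
  by its coordinates; nested lists collapse to a complex number by
  \<open>inj_list_complex\<close>.\<close>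

lemma ext_sum_embeds:
  assumes h: "\<exists>h :: 'i \<Rightarrow> complex. inj_on h I"
    and g: "\<And>i. i \<in> I \<Longrightarrow> \<exists>g :: 'v \<Rightarrow> complex list. inj_on g (W i)"
    and u: "\<exists>u :: complex \<Rightarrow> 'y. inj u"
  shows "\<exists>u :: ('i \<Rightarrow> 'v) \<Rightarrow> 'y. inj_on u (ext_sum V I W)"
proof -
  obtain e :: "complex list \<Rightarrow> complex" where e: "inj e" using inj_list_complex by blast
  obtain h :: "'i \<Rightarrow> complex" where h: "inj_on h I" using h by blast
  obtain g :: "'i \<Rightarrow> 'v \<Rightarrow> complex list" where g: "\<And>i. i \<in> I \<Longrightarrow> inj_on (g i) (W i)" using g by metis
  obtain u :: "complex \<Rightarrow> 'y" where u: "inj u" using u by blast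
  define L where "L f = (SOME xs. set xs = {i. f i \<noteq> \<zero>\<^bsub>V\<^esub>})" for f :: "'i \<Rightarrow> 'v"
  have L: "set (L f) = {i. f i \<noteq> \<zero>\<^bsub>V\<^esub>}" if "f \<in> ext_sum V I W" for f
    unfolding L_def by (rule someI_ex) (use that finite_list in \<open>auto simp: ext_sum_def\<close>)
  define E where "E f = map (\<lambda>i. e (h i # g i (f i))) (L f)" for f
  \<comment> \<open>The order of the list is arbitrary, so decoding goes entry by entry: the index
    \<open>h i\<close> identifies the entry. Zero entries leave no trace, which is why this is
    applied in both directions.\<close>
  have half: "f i = f' i" if f: "f \<in> ext_sum V I W" and f': "f' \<in> ext_sum V I W" and EE: "E f = E f'" and nz: "f i \<noteq> \<zero>\<^bsub>V\<^esub>" for f f' i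
  proof -
    have I: "i \<in> I" using f nz by (auto simp: ext_sum_def)
    have "e (h i # g i (f i)) \<in> set (E f)" using nz L[OF f] by (auto simp: E_def)
    then obtain j where j: "j \<in> set (L f')" "e (h i # g i (f i)) = e (h j # g j (f' j))"
      unfolding EE by (auto simp: E_def)
    then have eq: "h i = h j" "g i (f i) = g j (f' j)" using e by (auto dest: injD)
    have "j \<in> I" using j L[OF f'] f' by (auto simp: ext_sum_def)
    then have "i = j" using eq(1) h I by (auto dest: inj_onD)
    then show ?thesis using eq(2) g[OF I] f f' I by (auto simp: ext_sum_def dest: inj_onD)
  qed
  have "inj_on (\<lambda>f. u (e (E f))) (ext_sum V I W)"
  proof (rule inj_onI)
    fix f f' assume f: "f \<in> ext_sum V I W" "f' \<in> ext_sum V I W" and "u (e (E f)) = u (e (E f'))"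
    then have "E f = E f'" using u e by (auto dest: injD)
    then have "f i = f' i" for i using half[OF f, of i] half[OF f(2,1), of i] by metis
    then show "f = f'" by auto
  qed
  then show ?thesis by blast
qed

theorem (in cspace) external_direct_sum:
  fixes u :: "('i \<Rightarrow> 'v) \<Rightarrow> 'y"
  assumes sub: "\<And>i. i \<in> I \<Longrightarrow> csub V sc (W i)" and u: "inj_on u (ext_sum V I W)"
  shows "\<exists>(Y :: ('r, 'y) module) sd \<iota>. dsum Y sd I (\<lambda>i. \<iota> i ` W i) \<and>
    (\<forall>i\<in>I. lin_on (W i) V sc Y sd (\<iota> i) \<and> inj_on (\<iota> i) (W i))"
proof -
  let ?D = "ext_sum V I W"
  define v where "v = inv_into ?D u"
  have vu[simp]: "v (u f) = f" if "f \<in> ?D" for f using u that by (simp add: v_def)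
  have Wc: "\<And>i x. i \<in> I \<Longrightarrow> x \<in> W i \<Longrightarrow> x \<in> carrier V" using csubD(6)[OF sub] by blast
  have Dc: "f i \<in> carrier V" if "f \<in> ?D" for f i
    using that Wc by (cases "i \<in> I") (auto simp: ext_sum_def)
  have D0: "(\<lambda>_. \<zero>) \<in> ?D" using csubD(3)[OF sub] by (auto simp: ext_sum_def)
  have Da: "(\<lambda>i. f i \<oplus> g i) \<in> ?D" if f: "f \<in> ?D" and g: "g \<in> ?D" for f g
  proof -
    have "{i. f i \<oplus> g i \<noteq> \<zero>} \<subseteq> {i. f i \<noteq> \<zero>} \<union> {i. g i \<noteq> \<zero>}" by auto
    then have "finite {i. f i \<oplus> g i \<noteq> \<zero>}"
      using f g by (auto simp: ext_sum_def elim: finite_subset)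
    then show ?thesis using f g csubD(2)[OF sub] by (auto simp: ext_sum_def)
  qed
  have Ds: "(\<lambda>i. sc c (f i)) \<in> ?D" if f: "f \<in> ?D" for f c
  proof -
    have "{i. sc c (f i) \<noteq> \<zero>} \<subseteq> {i. f i \<noteq> \<zero>}" by auto
    then have "finite {i. sc c (f i) \<noteq> \<zero>}"
      using f by (auto simp: ext_sum_def elim: finite_subset)
    then show ?thesis using f csubD(5)[OF sub] by (auto simp: ext_sum_def)
  qed
  define Y :: "('r, 'y) module" where "Y = \<lparr>carrier = u ` ?D, mult = (\<lambda>x y. x), one = u (\<lambda>_. \<zero>),
     zero = u (\<lambda>_. \<zero>), add = (\<lambda>x y. u (\<lambda>i. v x i \<oplus> v y i)), smult = (\<lambda>a x. x)\<rparr>"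
  define sd where "sd c y = u (\<lambda>i. sc c (v y i))" for c y
  define \<iota> where "\<iota> i x = u (\<lambda>j. if j = i then x else \<zero>)" for i x
  have Yabel: "abelian_group Y"
  proof (rule abelian_groupI)
    fix x y z assume "x \<in> carrier Y" "y \<in> carrier Y" "z \<in> carrier Y"
    then obtain f g h where fgh: "f \<in> ?D" "g \<in> ?D" "h \<in> ?D" "x = u f" "y = u g" "z = u h"
      by (auto simp: Y_def)
    show "x \<oplus>\<^bsub>Y\<^esub> y \<oplus>\<^bsub>Y\<^esub> z = x \<oplus>\<^bsub>Y\<^esub> (y \<oplus>\<^bsub>Y\<^esub> z)"
      using fgh Da Dc by (simp add: Y_def a_assoc)
  next
    fix x y assume "x \<in> carrier Y" "y \<in> carrier Y"
    then obtain f g where fg: "f \<in> ?D" "g \<in> ?D" "x = u f" "y = u g" by (auto simp: Y_def)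
    show "x \<oplus>\<^bsub>Y\<^esub> y \<in> carrier Y" using fg Da by (simp add: Y_def)
    show "x \<oplus>\<^bsub>Y\<^esub> y = y \<oplus>\<^bsub>Y\<^esub> x" using fg Dc by (simp add: Y_def a_comm)
  next
    fix x assume "x \<in> carrier Y"
    then obtain f where f: "f \<in> ?D" "x = u f" by (auto simp: Y_def)
    show "\<zero>\<^bsub>Y\<^esub> \<oplus>\<^bsub>Y\<^esub> x = x" using f D0 Dc by (simp add: Y_def)
    show "\<exists>y\<in>carrier Y. y \<oplus>\<^bsub>Y\<^esub> x = \<zero>\<^bsub>Y\<^esub>"
      using f Ds[OF f(1), of "-1"] Dc[OF f(1)]
      by (intro bexI[of _ "u (\<lambda>i. sc (-1) (f i))"]) (simp_all add: Y_def sc_minus1 l_neg)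
  qed (use D0 in \<open>simp add: Y_def\<close>)
  have Y: "cspace Y sd"
  proof (intro cspace.intro Yabel cspace_axioms.intro)
    fix x c d assume "x \<in> carrier Y"
    then obtain f where f: "f \<in> ?D" "x = u f" by (auto simp: Y_def)
    show "sd c x \<in> carrier Y" using f Ds by (simp add: Y_def sd_def)
    show "sd (c + d) x = sd c x \<oplus>\<^bsub>Y\<^esub> sd d x" using f Ds Dc by (simp add: Y_def sd_def sc_l)
    show "sd c (sd d x) = sd (c * d) x" using f Ds Dc by (simp add: Y_def sd_def)
    show "sd 1 x = x" using f Dc by (simp add: sd_def)
    fix y assume "y \<in> carrier Y"
    then obtain g where g: "g \<in> ?D" "y = u g" by (auto simp: Y_def)
    show "sd c (x \<oplus>\<^bsub>Y\<^esub> y) = sd c x \<oplus>\<^bsub>Y\<^esub> sd c y" using f g Ds Da Dc by (simp add: Y_def sd_def sc_r)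
  qed
  interpret Y: cspace Y sd by (rule Y)
  have V: "cspace V sc" by unfold_locales
  have D\<iota>: "(\<lambda>j. if j = i then x else \<zero>) \<in> ?D" if "i \<in> I" "x \<in> W i" for i x
  proof -
    have "finite {j. (if j = i then x else \<zero>) \<noteq> \<zero>}" by (rule finite_subset[of _ "{i}"]) auto
    then show ?thesis using that csubD(3)[OF sub] by (auto simp: ext_sum_def)
  qed
  have \<iota>: "lin_on (W i) V sc Y sd (\<iota> i)" "inj_on (\<iota> i) (W i)" if i: "i \<in> I" for i
  proof -
    show "lin_on (W i) V sc Y sd (\<iota> i)"
    proof (rule lin_onI)
      fix x assume x: "x \<in> W i"
      show "\<iota> i x \<in> carrier Y" using D\<iota>[OF i x] by (simp add: \<iota>_def Y_def)
      show "\<iota> i (sc c x) = sd c (\<iota> i x)" for c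
        using D\<iota>[OF i x] by (simp add: \<iota>_def sd_def if_distrib cong: if_cong)
      fix y assume y: "y \<in> W i"
      have "(\<lambda>j. if j = i then x \<oplus> y else \<zero>) = (\<lambda>j. (if j = i then x else \<zero>) \<oplus> (if j = i then y else \<zero>))" by auto
      then show "\<iota> i (x \<oplus> y) = \<iota> i x \<oplus>\<^bsub>Y\<^esub> \<iota> i y"
        using D\<iota>[OF i x] D\<iota>[OF i y] by (simp add: \<iota>_def Y_def)
    qed
    show "inj_on (\<iota> i) (W i)"
    proof (rule inj_onI)
      fix x y assume x: "x \<in> W i" and y: "y \<in> W i" and eq: "\<iota> i x = \<iota> i y"
      have "v (\<iota> i x) i = v (\<iota> i y) i" using eq by simp
      then show "x = y" using D\<iota>[OF i x] D\<iota>[OF i y] by (simp add: \<iota>_def)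
    qed
  qed
  \<comment> \<open>The coordinates \<open>v y k\<close> are linear and separate the points of
    \<open>Y\<close>; existence and independence of decompositions are both read off from
    them.\<close>
  have \<pi>: "lin_on (carrier Y) Y sd V sc (\<lambda>y. v y k)" for k
  proof (rule lin_onI)
    fix x assume "x \<in> carrier Y"
    then obtain f where f: "f \<in> ?D" "x = u f" by (auto simp: Y_def)
    show "v x k \<in> carrier V" using f Dc by simp
    show "v (sd c x) k = sc c (v x k)" for c using f Ds by (simp add: sd_def)
    fix y assume "y \<in> carrier Y"
    then obtain g where g: "g \<in> ?D" "y = u g" by (auto simp: Y_def)
    show "v (x \<oplus>\<^bsub>Y\<^esub> y) k = v x k \<oplus> v y k" using f g Da by (simp add: Y_def)
  qed
  have v\<iota>: "v (\<iota> i x) k = (if k = i then x else \<zero>)" if "i \<in> I" "x \<in> W i" for i x k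
    using D\<iota>[OF that] by (simp add: \<iota>_def)
  have \<pi>sum: "v (\<Oplus>\<^bsub>Y\<^esub>i\<in>J. \<iota> i (x i)) k = (if k \<in> J then x k else \<zero>)"
    if J: "finite J" "J \<subseteq> I" "\<And>i. i \<in> J \<Longrightarrow> x i \<in> W i" for J x k
  proof -
    have xc: "\<And>i. i \<in> J \<Longrightarrow> \<iota> i (x i) \<in> carrier Y" using J lin_onD(1)[OF \<iota>(1)] by blast
    have "v (\<Oplus>\<^bsub>Y\<^esub>i\<in>J. \<iota> i (x i)) k = (\<Oplus>i\<in>J. v (\<iota> i (x i)) k)"
      using J xc by (intro Y.lin_finsum[OF V \<pi> Y.csub_carrier]) auto
    also have "\<dots> = (\<Oplus>i\<in>J. if k = i then x i else \<zero>)"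
      using J v\<iota> Wc by (intro finsum_cong') (auto simp: subset_iff)
    also have "\<dots> = (if k \<in> J then x k else \<zero>)"
    proof (cases "k \<in> J")
      case True
      have "(\<Oplus>i\<in>{k}. if k = i then x i else \<zero>) = (\<Oplus>i\<in>J. if k = i then x i else \<zero>)"
        using True J Wc by (intro finsum_mono_neutral) auto
      moreover have "x k \<in> carrier V" using True J Wc by blast
      then have "(\<Oplus>i\<in>{k}. if k = i then x i else \<zero>) = x k" by simp
      ultimately show ?thesis using True by simp
    next
      case False
      have "(\<Oplus>i\<in>{}. if k = i then x i else \<zero>) = (\<Oplus>i\<in>J. if k = i then x i else \<zero>)"
        using False J Wc by (intro finsum_mono_neutral) auto
      then show ?thesis using False by simp
    qed
    finally show ?thesis .
  qed
  have eqv: "x = y" if xy: "x \<in> carrier Y" "y \<in> carrier Y" and vk: "\<And>k. v x k = v y k" for x y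
  proof -
    obtain f g where "f \<in> ?D" "x = u f" "g \<in> ?D" "y = u g" using xy by (auto simp: Y_def)
    moreover from this have "f = g" using vk by (intro ext) simp
    ultimately show ?thesis by simp
  qed
  have "dsum Y sd I (\<lambda>i. \<iota> i ` W i)"
  proof (rule Y.dsumI)
    show "csub Y sd (\<iota> i ` W i)" if "i \<in> I" for i by (rule csub_image[OF Y \<iota>(1)[OF that] sub[OF that]])
  next
    fix m assume m: "m \<in> carrier Y"
    then obtain f where f: "f \<in> ?D" "m = u f" by (auto simp: Y_def)
    let ?J = "{i. f i \<noteq> \<zero>}"
    have J: "finite ?J" "?J \<subseteq> I" "\<And>i. i \<in> ?J \<Longrightarrow> f i \<in> W i" using f(1) by (auto simp: ext_sum_def)
    have xc: "(\<Oplus>\<^bsub>Y\<^esub>i\<in>?J. \<iota> i (f i)) \<in> carrier Y"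
      using J lin_onD(1)[OF \<iota>(1)] by (intro Y.finsum_closed) (auto simp: subset_iff)
    have "m = (\<Oplus>\<^bsub>Y\<^esub>i\<in>?J. \<iota> i (f i))"
      by (rule eqv[OF m xc]) (use \<pi>sum[OF J] f in auto)
    then show "\<exists>J f. finite J \<and> J \<subseteq> I \<and> (\<forall>i\<in>J. f i \<in> \<iota> i ` W i) \<and> m = finsum Y f J"
      using J by (intro exI[of _ ?J] exI[of _ "\<lambda>i. \<iota> i (f i)"]) auto
  next
    fix J f assume J: "finite J" "J \<subseteq> I" "\<And>i. i \<in> J \<Longrightarrow> f i \<in> \<iota> i ` W i" and z: "finsum Y f J = \<zero>\<^bsub>Y\<^esub>"
    have "\<forall>i\<in>J. \<exists>x. x \<in> W i \<and> f i = \<iota> i x" using J(3) by blast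
    from bchoice[OF this] obtain x where x: "\<And>i. i \<in> J \<Longrightarrow> x i \<in> W i \<and> f i = \<iota> i (x i)"
      by blast
    have xc: "\<And>i. i \<in> J \<Longrightarrow> \<iota> i (x i) \<in> carrier Y" using J x lin_onD(1)[OF \<iota>(1)] by blast
    have "finsum Y f J = (\<Oplus>\<^bsub>Y\<^esub>i\<in>J. \<iota> i (x i))" using x xc by (intro Y.finsum_cong') auto
    then have "x k = \<zero>" if "k \<in> J" for k
      using \<pi>sum[OF J(1,2), of x k] x z that D0 by (simp add: Y_def)
    then show "\<forall>i\<in>J. f i = \<zero>\<^bsub>Y\<^esub>"
      using x J lin_zero[OF Y \<iota>(1) sub] by (auto simp: subset_iff)
  qed
  then show ?thesis using \<iota> by blast
qed

section \<open>Linear combinations of operators\<close>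

text \<open>The coefficient of the monomial is arbitrary while its key stays in the support of the
  original \<open>p\<close>, so conditions on the exponents of \<open>p\<close> survive the
  induction.\<close>

lemma poly_mapping_induct_add:
  fixes p :: "'k \<Rightarrow>\<^sub>0 'c::comm_monoid_add"
  assumes "P 0" "\<And>k c. k \<in> Poly_Mapping.keys p \<Longrightarrow> P (Poly_Mapping.single k c)" "\<And>p q. P p \<Longrightarrow> P q \<Longrightarrow> P (p + q)"
  shows "P p"
proof -
  have "P (\<Sum>k\<in>S. Poly_Mapping.single k (Poly_Mapping.lookup p k))" if "finite S" "S \<subseteq> Poly_Mapping.keys p" for S
    using that by (induction S rule: finite_induct) (auto intro: assms)
  moreover have "(\<Sum>k\<in>Poly_Mapping.keys p. Poly_Mapping.single k (Poly_Mapping.lookup p k)) = p"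
  proof (rule poly_mapping_eqI)
    fix k
    have "Poly_Mapping.lookup (\<Sum>k\<in>Poly_Mapping.keys p. Poly_Mapping.single k (Poly_Mapping.lookup p k)) k =
      (\<Sum>k'\<in>Poly_Mapping.keys p. if k' = k then Poly_Mapping.lookup p k' else 0)"
      by (simp add: lookup_sum lookup_single when_def)
    also have "\<dots> = Poly_Mapping.lookup p k" by (simp add: in_keys_iff)
    finally show "Poly_Mapping.lookup (\<Sum>k\<in>Poly_Mapping.keys p. Poly_Mapping.single k (Poly_Mapping.lookup p k)) k =
      Poly_Mapping.lookup p k" .
  qed
  ultimately show ?thesis by (metis finite_keys order_refl)
qed

text \<open>The monomial in the first \<open>K\<close> operators with exponents \<open>a\<close>,
  factor 0 applied first. The factors are arbitrary maps; commutation is assumed only on a set, in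
  the lemmas.\<close>

primrec mop :: "(nat \<Rightarrow> 'v \<Rightarrow> 'v) \<Rightarrow> nat \<Rightarrow> (nat \<Rightarrow> nat) \<Rightarrow> 'v \<Rightarrow> 'v" where
  "mop T 0 a v = v"
| "mop T (Suc K) a v = (T K ^^ a K) (mop T K a v)"

lemma funpow_closed: "(\<And>x. x \<in> S \<Longrightarrow> f x \<in> S) \<Longrightarrow> x \<in> S \<Longrightarrow> (f ^^ m) x \<in> S"
  by (induction m) auto

lemma funpow_commute:
  assumes "\<And>x. x \<in> S \<Longrightarrow> f x \<in> S" "\<And>x. x \<in> S \<Longrightarrow> g (f x) = f (g x)" "x \<in> S"
  shows "g ((f ^^ m) x) = (f ^^ m) (g x)"
proof (induction m)
  case (Suc m)
  have "(f ^^ m) x \<in> S" by (rule funpow_closed) (use assms in auto)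
  then show ?case using Suc assms(2) by simp
qed simp

lemma mop_cong: "(\<And>i. i < K \<Longrightarrow> a i = b i) \<Longrightarrow> mop T K a v = mop T K b v"
  by (induction K) auto

lemma mop_0 [simp]: "mop T K (\<lambda>_. 0) v = v"
  by (induction K) auto

lemma mop_lookup_0 [simp]: "mop T K (Poly_Mapping.lookup 0) v = v"
  by (induction K) auto

lemma mop_closed:
  assumes "\<And>i x. i < K \<Longrightarrow> x \<in> S \<Longrightarrow> T i x \<in> S" "x \<in> S"
  shows "mop T K a x \<in> S"
  using assms by (induction K) (auto intro!: funpow_closed)

lemma mop_commute:
  assumes "\<And>i x. i < K \<Longrightarrow> x \<in> S \<Longrightarrow> T i x \<in> S" "\<And>x. x \<in> S \<Longrightarrow> g x \<in> S"
    "\<And>i x. i < K \<Longrightarrow> x \<in> S \<Longrightarrow> g (T i x) = T i (g x)" "x \<in> S"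
  shows "g (mop T K a x) = mop T K a (g x)"
  using assms(1,3)
proof (induction K)
  case (Suc K)
  have "mop T K a x \<in> S" by (rule mop_closed) (use Suc assms in auto)
  then have "g (mop T (Suc K) a x) = (T K ^^ a K) (g (mop T K a x))"
    using Suc.prems by (auto intro!: funpow_commute[where S=S])
  then show ?case using Suc by simp
qed simp

lemma mop_upd:
  assumes "\<And>i x. i < K \<Longrightarrow> x \<in> S \<Longrightarrow> T i x \<in> S"
    "\<And>i j x. i < K \<Longrightarrow> j < K \<Longrightarrow> x \<in> S \<Longrightarrow> T i (T j x) = T j (T i x)" "x \<in> S" "i < K"
  shows "T i (mop T K a x) = mop T K (a(i := Suc (a i))) x"
  using assms(1,2,4)
proof (induction K)
  case (Suc K)
  have m: "mop T K a x \<in> S" by (rule mop_closed) (use Suc assms in auto)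
  show ?case
  proof (cases "i = K")
    case True
    have "mop T K (a(K := Suc (a K))) x = mop T K a x" by (rule mop_cong) auto
    then show ?thesis unfolding True mop.simps by simp
  next
    case False
    have "T i ((T K ^^ a K) (mop T K a x)) = (T K ^^ a K) (T i (mop T K a x))"
      by (rule funpow_commute[where S=S]) (use m Suc.prems in auto)
    then show ?thesis using False Suc by simp
  qed
qed simp

lemma mop_swap_upd:
  assumes "\<And>i x. i < K \<Longrightarrow> x \<in> S \<Longrightarrow> T i x \<in> S"
    "\<And>i j x. i < K \<Longrightarrow> j < K \<Longrightarrow> x \<in> S \<Longrightarrow> T i (T j x) = T j (T i x)" "x \<in> S" "i < K"
  shows "mop T K a (T i x) = mop T K (a(i := Suc (a i))) x"
proof -
  have "T i (mop T K a x) = mop T K a (T i x)"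
    by (rule mop_commute[where S=S]) (use assms in auto)
  moreover have "T i (mop T K a x) = mop T K (a(i := Suc (a i))) x"
    by (rule mop_upd[where S=S]) (use assms in auto)
  ultimately show ?thesis by simp
qed

lemma mop_add:
  assumes "\<And>i x. i < K \<Longrightarrow> x \<in> S \<Longrightarrow> T i x \<in> S"
    "\<And>i j x. i < K \<Longrightarrow> j < K \<Longrightarrow> x \<in> S \<Longrightarrow> T i (T j x) = T j (T i x)" "x \<in> S"
  shows "mop T K (\<lambda>i. a i + b i) x = mop T K a (mop T K b x)"
  using assms(1,2)
proof (induction K)
  case (Suc K)
  have m: "mop T K b x \<in> S" by (rule mop_closed) (use Suc assms in auto)
  have m': "mop T K a (mop T K b x) \<in> S" by (rule mop_closed) (use Suc m in auto)
  have "mop T K a ((T K ^^ b K) (mop T K b x)) = (T K ^^ b K) (mop T K a (mop T K b x))"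
    by (rule mop_commute[where S=S, symmetric])
     (use Suc.prems m in \<open>auto intro!: funpow_closed funpow_commute[where S=S, symmetric]\<close>)
  then show ?case using Suc by (simp add: funpow_add)
qed simp

context cspace begin

abbreviation endo :: "('v \<Rightarrow> 'v) \<Rightarrow> bool" where "endo f \<equiv> lin_on (carrier V) V sc V sc f"

lemma endo_comp: assumes "endo f" "endo g" shows "endo (\<lambda>x. g (f x))"
  by (rule lin_on_comp[OF assms lin_onD(1)[OF assms(1)]])

lemma endo_id: "endo (\<lambda>x. x)" by (rule lin_onI) auto

lemma endo_funpow: "endo f \<Longrightarrow> endo (f ^^ m)"
proof (induction m)
  case 0 then show ?case using endo_id by (simp add: id_def)
next
  case (Suc m)
  then show ?case using endo_comp[of "f ^^ m" f] by (simp add: comp_def)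
qed

lemma endo_sc: "endo (sc c)"
  by (rule lin_onI) (auto simp: sc_r mult.commute)

lemma endo_add: assumes f: "endo f" and g: "endo g" shows "endo (\<lambda>x. f x \<oplus> g x)"
proof (rule lin_onI)
  fix x assume x: "x \<in> carrier V"
  note fx = lin_onD(1)[OF f x] lin_onD(1)[OF g x]
  show "f x \<oplus> g x \<in> carrier V" using fx by simp
  show "f (sc c x) \<oplus> g (sc c x) = sc c (f x \<oplus> g x)" for c
    using fx lin_onD(3)[OF f x] lin_onD(3)[OF g x] by (simp add: sc_r)
  fix y assume y: "y \<in> carrier V"
  show "f (x \<oplus> y) \<oplus> g (x \<oplus> y) = f x \<oplus> g x \<oplus> (f y \<oplus> g y)"
    using fx lin_onD(1)[OF f y] lin_onD(1)[OF g y] lin_onD(2)[OF f x y] lin_onD(2)[OF g x y]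
    by (simp add: a_ac)
qed

lemma endo_mop: "(\<And>i. i < K \<Longrightarrow> endo (T i)) \<Longrightarrow> endo (mop T K a)"
proof (induction K)
  case 0 then show ?case using endo_id by (simp add: lin_on_def)
next
  case (Suc K)
  have "endo (\<lambda>x. (T K ^^ a K) (mop T K a x))"
    by (rule endo_comp[OF Suc.IH endo_funpow]) (simp_all add: Suc.prems)
  then show ?case by (simp add: lin_on_def)
qed

text \<open>A finite linear combination of operators, used both for the normally ordered monomials
  of the Weyl algebra and for commutative monomials.\<close>

definition ev :: "('k \<Rightarrow> 'v \<Rightarrow> 'v) \<Rightarrow> ('k \<Rightarrow>\<^sub>0 complex) \<Rightarrow> 'v \<Rightarrow> 'v" where
  "ev X p v = (\<Oplus>k\<in>Poly_Mapping.keys p. sc (Poly_Mapping.lookup p k) (X k v))"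

lemma ev_superset:
  assumes "\<And>k. X k v \<in> carrier V" "finite S" "Poly_Mapping.keys p \<subseteq> S"
  shows "ev X p v = (\<Oplus>k\<in>S. sc (Poly_Mapping.lookup p k) (X k v))"
  unfolding ev_def using assms by (intro finsum_mono_neutral) (auto simp: in_keys_iff)

lemma ev_closed [simp]: "(\<And>k. X k v \<in> carrier V) \<Longrightarrow> ev X p v \<in> carrier V"
  unfolding ev_def by (intro finsum_closed) auto

lemma ev_0 [simp]: "ev X 0 v = \<zero>" by (simp add: ev_def)

lemma ev_single [simp]: "(\<And>k. X k v \<in> carrier V) \<Longrightarrow> ev X (Poly_Mapping.single k c) v = sc c (X k v)"
  using ev_superset[of X v "{k}" "Poly_Mapping.single k c"] by simp

lemma ev_add:
  assumes X: "\<And>k. X k v \<in> carrier V"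
  shows "ev X (p + q) v = ev X p v \<oplus> ev X q v"
proof -
  let ?S = "Poly_Mapping.keys p \<union> Poly_Mapping.keys q"
  have "ev X (p + q) v = (\<Oplus>k\<in>?S. sc (Poly_Mapping.lookup p k) (X k v) \<oplus> sc (Poly_Mapping.lookup q k) (X k v))"
    using X Poly_Mapping.keys_add[of p q]
    by (subst ev_superset[of X v ?S]) (auto simp: lookup_add sc_l intro!: finsum_cong')
  also have "\<dots> = (\<Oplus>k\<in>?S. sc (Poly_Mapping.lookup p k) (X k v)) \<oplus> (\<Oplus>k\<in>?S. sc (Poly_Mapping.lookup q k) (X k v))"
    using X by (intro finsum_addf) auto
  also have "(\<Oplus>k\<in>?S. sc (Poly_Mapping.lookup p k) (X k v)) = ev X p v"
    using X by (intro ev_superset[symmetric]) auto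
  also have "(\<Oplus>k\<in>?S. sc (Poly_Mapping.lookup q k) (X k v)) = ev X q v"
    using X by (intro ev_superset[symmetric]) auto
  finally show ?thesis .
qed

lemma endo_ev:
  assumes X: "\<And>k. endo (X k)" shows "endo (ev X p)"
proof -
  have c: "X k v \<in> carrier V" if "v \<in> carrier V" for k v using lin_onD(1)[OF X] that .
  show ?thesis
  proof (induction p rule: poly_mapping_induct_add)
    case 1 show ?case by (rule lin_onI) auto
  next
    case (2 k a)
    show ?case by (rule lin_on_cong[OF endo_comp[OF X endo_sc] _ csub_carrier]) (simp add: c)
  next
    case (3 p q)
    show ?case by (rule lin_on_cong[OF endo_add[OF 3] _ csub_carrier]) (simp add: c ev_add)
  qed
qed

end

section \<open>The Weyl algebra: normal forms, and modules from the canonical relations\<close>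

section \<open>Actions of the Weyl algebra relations\<close>

text \<open>Operators satisfying the canonical commutation relations. That such operators give a
  module over the concrete ring \<open>weyl n\<close> is the content of
  \<open>weyl_module_of_ops\<close>.\<close>

locale weyl_ops = cspace V sc for V :: "('v, 'x) ring_scheme" (structure) and sc +
  fixes n :: nat and T D :: "nat \<Rightarrow> 'v \<Rightarrow> 'v"
  assumes T_lin: "i \<le> n \<Longrightarrow> lin_on (carrier V) V sc V sc (T i)"
    and D_lin: "i \<le> n \<Longrightarrow> lin_on (carrier V) V sc V sc (D i)"
    and TT: "i \<le> n \<Longrightarrow> j \<le> n \<Longrightarrow> x \<in> carrier V \<Longrightarrow> T i (T j x) = T j (T i x)"
    and DD: "i \<le> n \<Longrightarrow> j \<le> n \<Longrightarrow> x \<in> carrier V \<Longrightarrow> D i (D j x) = D j (D i x)"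
    and DT: "i \<le> n \<Longrightarrow> j \<le> n \<Longrightarrow> i \<noteq> j \<Longrightarrow> x \<in> carrier V \<Longrightarrow> D i (T j x) = T j (D i x)"
    and DTi: "i \<le> n \<Longrightarrow> x \<in> carrier V \<Longrightarrow> D i (T i x) = T i (D i x) \<oplus> x"
begin

lemma T_closed [simp, intro]: "i \<le> n \<Longrightarrow> x \<in> carrier V \<Longrightarrow> T i x \<in> carrier V"
  using lin_onD(1)[OF T_lin] .

lemma D_closed [simp, intro]: "i \<le> n \<Longrightarrow> x \<in> carrier V \<Longrightarrow> D i x \<in> carrier V"
  using lin_onD(1)[OF D_lin] .

lemma T_add: "i \<le> n \<Longrightarrow> x \<in> carrier V \<Longrightarrow> y \<in> carrier V \<Longrightarrow> T i (x \<oplus> y) = T i x \<oplus> T i y"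
  using lin_onD(2)[OF T_lin] .
lemma D_add: "i \<le> n \<Longrightarrow> x \<in> carrier V \<Longrightarrow> y \<in> carrier V \<Longrightarrow> D i (x \<oplus> y) = D i x \<oplus> D i y"
  using lin_onD(2)[OF D_lin] .
lemma T_sc: "i \<le> n \<Longrightarrow> x \<in> carrier V \<Longrightarrow> T i (sc c x) = sc c (T i x)"
  using lin_onD(3)[OF T_lin] .
lemma D_sc: "i \<le> n \<Longrightarrow> x \<in> carrier V \<Longrightarrow> D i (sc c x) = sc c (D i x)"
  using lin_onD(3)[OF D_lin] .
lemma T_zero: "i \<le> n \<Longrightarrow> T i \<zero> = \<zero>" using T_sc[of i \<zero> 0] by simp
lemma D_zero: "i \<le> n \<Longrightarrow> D i \<zero> = \<zero>" using D_sc[of i \<zero> 0] by simp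

text \<open>The normally ordered monomial t^a \<partial>^b, with all derivations applied
  first.\<close>

definition nrm :: "(nat \<Rightarrow>\<^sub>0 nat) \<times> (nat \<Rightarrow>\<^sub>0 nat) \<Rightarrow> 'v \<Rightarrow> 'v" where
  "nrm k x = mop T (Suc n) (Poly_Mapping.lookup (fst k)) (mop D (Suc n) (Poly_Mapping.lookup (snd k)) x)"

lemma endo_nrm: "endo (nrm k)"
proof -
  have "endo (\<lambda>x. mop T (Suc n) (Poly_Mapping.lookup (fst k)) (mop D (Suc n) (Poly_Mapping.lookup (snd k)) x))"
    by (rule endo_comp[OF endo_mop endo_mop]) (simp_all add: T_lin D_lin)
  then show ?thesis unfolding nrm_def[abs_def] .
qed

lemma nrm_closed [simp]: "x \<in> carrier V \<Longrightarrow> nrm k x \<in> carrier V"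
  using lin_onD(1)[OF endo_nrm] .

lemma T_nrm: "i \<le> n \<Longrightarrow> x \<in> carrier V \<Longrightarrow> T i (nrm (a, b) x) = nrm (a + Poly_Mapping.single i 1, b) x"
proof -
  assume i: "i \<le> n" and x: "x \<in> carrier V"
  have d: "mop D (Suc n) (Poly_Mapping.lookup b) x \<in> carrier V"
    using x by (intro mop_closed) auto
  have e: "(Poly_Mapping.lookup a)(i := Suc (Poly_Mapping.lookup a i)) = Poly_Mapping.lookup (a + Poly_Mapping.single i 1)"
    by (auto simp: lookup_add lookup_single when_def)
  show ?thesis
    unfolding nrm_def fst_conv snd_conv e[symmetric]
    by (rule mop_upd[where S="carrier V"]) (use d TT i in auto)
qed

text \<open>The commutator of \<partial>_i with t^a is a_i t^(a - e_i); the conditional accounts for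
  variable \<open>i\<close> not yet occurring among the first \<open>K\<close>.\<close>

lemma D_mop_T:
  assumes i: "i \<le> n" and x: "x \<in> carrier V" and K: "K \<le> Suc n"
  shows "D i (mop T K a x) = mop T K a (D i x) \<oplus> sc (if i < K then of_nat (a i) else 0) (mop T K (a(i := a i - 1)) x)"
  using K
proof (induction K)
  case 0 then show ?case using i x by simp
next
  case (Suc K)
  have cl: "mop T K a y \<in> carrier V" if "y \<in> carrier V" for a y
    using that Suc by (intro mop_closed) auto
  have clT: "(T K ^^ m) y \<in> carrier V" if "y \<in> carrier V" for m y using that Suc by (intro funpow_closed) auto
  show ?case
  proof (cases "i = K")
    case True
    have pw: "D K ((T K ^^ m) y) = (T K ^^ m) (D K y) \<oplus> sc (of_nat m) ((T K ^^ (m - 1)) y)" if y: "y \<in> carrier V" for m y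
    proof (induction m)
      case 0 then show ?case using y Suc by simp
    next
      case (Suc m)
      have Kn: "K \<le> n" using Suc.prems \<open>Suc K \<le> Suc n\<close> by simp
      \<comment> \<open>For \<open>m = 0\<close> the truncated exponent is harmless because the
        coefficient vanishes.\<close>
      have mm: "T K (sc (of_nat m) ((T K ^^ (m - 1)) y)) = sc (of_nat m) ((T K ^^ m) y)"
        using T_sc[OF Kn clT[OF y]] clT[OF y] T_zero[OF Kn] y
        by (cases m) auto
      have "D K ((T K ^^ Suc m) y) = T K (D K ((T K ^^ m) y)) \<oplus> (T K ^^ m) y"
        using DTi[OF Kn clT[OF y]] by simp
      also have "\<dots> = T K ((T K ^^ m) (D K y)) \<oplus> sc (of_nat m) ((T K ^^ m) y) \<oplus> (T K ^^ m) y"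
        using Suc mm T_add[OF Kn] clT y Kn by simp
      also have "\<dots> = (T K ^^ Suc m) (D K y) \<oplus> sc (of_nat (Suc m)) ((T K ^^ m) y)"
        using clT y Kn clT[of "D K y"] by (simp add: a_assoc sc_collect add.commute)
      finally show ?case by simp
    qed
    have c1: "mop T K (a(K := a K - 1)) x = mop T K a x" by (rule mop_cong) auto
    have IH: "D K (mop T K a x) = mop T K a (D K x)"
      using Suc True cl x i by simp
    show ?thesis unfolding True mop.simps pw[OF cl[OF x]] IH c1 by simp
  next
    case False
    have "D i ((T K ^^ a K) (mop T K a x)) = (T K ^^ a K) (D i (mop T K a x))"
      by (rule funpow_commute[where S="carrier V"]) (use DT[OF i] False Suc.prems cl x in auto)
    also have "(T K ^^ a K) (D i (mop T K a x)) = (T K ^^ a K) (mop T K a (D i x)) \<oplus>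
       sc (if i < K then of_nat (a i) else 0) ((T K ^^ a K) (mop T K (a(i := a i - 1)) x))"
    proof -
      have "endo (T K ^^ a K)" using Suc.prems by (intro endo_funpow T_lin) auto
      from lin_onD(2,3)[OF this] show ?thesis using Suc cl x i by (simp del: fun_upd_apply)
    qed
    finally have "D i ((T K ^^ a K) (mop T K a x)) = (T K ^^ a K) (mop T K a (D i x)) \<oplus>
       sc (if i < K then of_nat (a i) else 0) ((T K ^^ a K) (mop T K (a(i := a i - 1)) x))" .
    moreover have "(a(i := a i - Suc 0)) K = a K" using False by simp
    ultimately show ?thesis using False by (auto simp: less_Suc_eq simp del: fun_upd_apply)
  qed
qed

lemma D_nrm:
  assumes i: "i \<le> n" and x: "x \<in> carrier V"
  shows "D i (nrm (a, b) x) = nrm (a, b + Poly_Mapping.single i 1) x \<oplus>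
    sc (of_nat (Poly_Mapping.lookup a i)) (nrm (a - Poly_Mapping.single i 1, b) x)"
proof -
  let ?y = "mop D (Suc n) (Poly_Mapping.lookup b) x"
  have d: "?y \<in> carrier V" using x by (intro mop_closed) auto
  have e: "(Poly_Mapping.lookup b)(i := Suc (Poly_Mapping.lookup b i)) = Poly_Mapping.lookup (b + Poly_Mapping.single i 1)"
    by (auto simp: lookup_add lookup_single when_def)
  have e': "(Poly_Mapping.lookup a)(i := Poly_Mapping.lookup a i - 1) = Poly_Mapping.lookup (a - Poly_Mapping.single i 1)"
    by (auto simp: lookup_minus lookup_single when_def)
  have "D i ?y = mop D (Suc n) (Poly_Mapping.lookup (b + Poly_Mapping.single i 1)) x"
    unfolding e[symmetric] by (rule mop_upd[where S="carrier V"]) (use DD i x in auto)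
  then show ?thesis
    using D_mop_T[OF i d order_refl, of "Poly_Mapping.lookup a"] i unfolding nrm_def fst_conv snd_conv e' by simp
qed

end

text \<open>\<open>nrm\<close> ignores exponents of variables beyond \<open>n\<close>, so without
  this bound distinct normal forms could act identically and independence would fail.\<close>

definition nf_good :: "nat \<Rightarrow> ((nat \<Rightarrow>\<^sub>0 nat) \<times> (nat \<Rightarrow>\<^sub>0 nat) \<Rightarrow>\<^sub>0 complex) \<Rightarrow> bool" where
  "nf_good n p \<longleftrightarrow> (\<forall>(a, b)\<in>Poly_Mapping.keys p. Poly_Mapping.keys a \<subseteq> {0..n} \<and> Poly_Mapping.keys b \<subseteq> {0..n})"

lemma nf_good_0: "nf_good n 0" by (simp add: nf_good_def)

lemma nf_good_add: "nf_good n p \<Longrightarrow> nf_good n q \<Longrightarrow> nf_good n (p + q)"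
  using Poly_Mapping.keys_add[of p q] by (fastforce simp: nf_good_def)

lemma nf_good_single: "Poly_Mapping.keys a \<subseteq> {0..n} \<Longrightarrow> Poly_Mapping.keys b \<subseteq> {0..n} \<Longrightarrow> nf_good n (Poly_Mapping.single (a, b) c)"
  by (simp add: nf_good_def)

text \<open>Bringing a word into normal form uses only the commutation relations, so one normal form
  is valid in both representations at once. The first one will be the polynomials.\<close>

locale weyl_ops_pair = A: weyl_ops V sc n T D + B: weyl_ops V' sc' n T' D'
  for V :: "('v, 'x) ring_scheme" and sc n T D and V' :: "('w, 'y) ring_scheme" and sc' T' D'
begin

text \<open>\<open>P\<close> and \<open>P'\<close> act on normal forms by the same left multiplication.\<close>

definition nf_rel :: "('v \<Rightarrow> 'v) \<Rightarrow> ('w \<Rightarrow> 'w) \<Rightarrow> bool" where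
  "nf_rel P P' \<longleftrightarrow> A.endo P \<and> B.endo P' \<and> (\<forall>p. nf_good n p \<longrightarrow> (\<exists>p'. nf_good n p' \<and>
     (\<forall>x\<in>carrier V. P (A.ev A.nrm p x) = A.ev A.nrm p' x) \<and>
     (\<forall>x\<in>carrier V'. P' (B.ev B.nrm p x) = B.ev B.nrm p' x)))"

text \<open>Linearity reduces the search for the new normal form to single monomials.\<close>

lemma nf_rel_by_monomials:
  assumes P: "A.endo P" and P': "B.endo P'"
    and mon: "\<And>a b c. Poly_Mapping.keys a \<subseteq> {0..n} \<Longrightarrow> Poly_Mapping.keys b \<subseteq> {0..n} \<Longrightarrow> \<exists>p'. nf_good n p' \<and>
     (\<forall>x\<in>carrier V. sc c (P (A.nrm (a, b) x)) = A.ev A.nrm p' x) \<and>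
     (\<forall>x\<in>carrier V'. sc' c (P' (B.nrm (a, b) x)) = B.ev B.nrm p' x)"
  shows "nf_rel P P'"
proof -
  have Z: "P \<zero>\<^bsub>V\<^esub> = \<zero>\<^bsub>V\<^esub>" "P' \<zero>\<^bsub>V'\<^esub> = \<zero>\<^bsub>V'\<^esub>"
    using A.lin_zero[OF _ P A.csub_carrier] B.lin_zero[OF _ P' B.csub_carrier] A.cspace_axioms B.cspace_axioms by auto
  have "\<exists>p'. nf_good n p' \<and>
     (\<forall>x\<in>carrier V. P (A.ev A.nrm p x) = A.ev A.nrm p' x) \<and>
     (\<forall>x\<in>carrier V'. P' (B.ev B.nrm p x) = B.ev B.nrm p' x)" if good: "nf_good n p" for p
  proof (induction p rule: poly_mapping_induct_add)
    case 1
    then show ?case using Z by (intro exI[of _ 0]) (simp add: nf_good_0)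
  next
    case (2 k c)
    obtain a b where k: "k = (a, b)" by (cases k)
    have ab: "Poly_Mapping.keys a \<subseteq> {0..n}" "Poly_Mapping.keys b \<subseteq> {0..n}"
      using 2(1) good k by (auto simp: nf_good_def)
    show ?case using mon[OF ab, of c] unfolding k
      by (simp add: lin_onD(3)[OF P] lin_onD(3)[OF P'])
  next
    case (3 p q)
    then obtain p' q' where
      p': "nf_good n p'" "\<forall>x\<in>carrier V. P (A.ev A.nrm p x) = A.ev A.nrm p' x" "\<forall>x\<in>carrier V'. P' (B.ev B.nrm p x) = B.ev B.nrm p' x" and
      q': "nf_good n q'" "\<forall>x\<in>carrier V. P (A.ev A.nrm q x) = A.ev A.nrm q' x" "\<forall>x\<in>carrier V'. P' (B.ev B.nrm q x) = B.ev B.nrm q' x"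
      by blast
    show ?case
      by (rule exI[of _ "p' + q'"])
       (use p' q' in \<open>simp add: nf_good_add A.ev_add B.ev_add lin_onD(2)[OF P] lin_onD(2)[OF P']\<close>)
  qed
  then show ?thesis using P P' by (simp add: nf_rel_def)
qed

lemma nf_rel_T: assumes i: "i \<le> n" shows "nf_rel (T i) (T' i)"
proof (rule nf_rel_by_monomials[OF A.T_lin[OF i] B.T_lin[OF i]])
  fix a b :: "nat \<Rightarrow>\<^sub>0 nat" and c :: complex
  assume ab: "Poly_Mapping.keys a \<subseteq> {0..n}" "Poly_Mapping.keys b \<subseteq> {0..n}"
  have "Poly_Mapping.keys (a + Poly_Mapping.single i 1) \<subseteq> {0..n}"
    using Poly_Mapping.keys_add[of a "Poly_Mapping.single i 1"] ab i by (auto split: if_splits)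
  then show "\<exists>p'. nf_good n p' \<and> (\<forall>x\<in>carrier V. sc c (T i (A.nrm (a, b) x)) = A.ev A.nrm p' x) \<and>
     (\<forall>x\<in>carrier V'. sc' c (T' i (B.nrm (a, b) x)) = B.ev B.nrm p' x)"
    using ab i by (intro exI[of _ "Poly_Mapping.single (a + Poly_Mapping.single i 1, b) c"])
      (simp add: A.T_nrm B.T_nrm nf_good_single)
qed

lemma nf_rel_D: assumes i: "i \<le> n" shows "nf_rel (D i) (D' i)"
proof (rule nf_rel_by_monomials[OF A.D_lin[OF i] B.D_lin[OF i]])
  fix a b :: "nat \<Rightarrow>\<^sub>0 nat" and c :: complex
  assume ab: "Poly_Mapping.keys a \<subseteq> {0..n}" "Poly_Mapping.keys b \<subseteq> {0..n}"
  have 1: "Poly_Mapping.keys (b + Poly_Mapping.single i 1) \<subseteq> {0..n}"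
    using Poly_Mapping.keys_add[of b "Poly_Mapping.single i 1"] ab i by (auto split: if_splits)
  have 2: "Poly_Mapping.keys (a - Poly_Mapping.single i 1) \<subseteq> {0..n}"
    using ab by (auto simp: in_keys_iff lookup_minus subset_iff)
  let ?p = "Poly_Mapping.single (a, b + Poly_Mapping.single i 1) c +
     Poly_Mapping.single (a - Poly_Mapping.single i 1, b) (c * of_nat (Poly_Mapping.lookup a i))"
  have "nf_good n ?p" by (intro nf_good_add nf_good_single ab 1 2)
  then show "\<exists>p'. nf_good n p' \<and> (\<forall>x\<in>carrier V. sc c (D i (A.nrm (a, b) x)) = A.ev A.nrm p' x) \<and>
     (\<forall>x\<in>carrier V'. sc' c (D' i (B.nrm (a, b) x)) = B.ev B.nrm p' x)"
    using i by (intro exI[of _ ?p]) (simp add: A.D_nrm B.D_nrm A.ev_add B.ev_add A.sc_r B.sc_r)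
qed

lemma nf_rel_sc: "nf_rel (sc d) (sc' d)"
proof (rule nf_rel_by_monomials[OF A.endo_sc B.endo_sc])
  fix a b :: "nat \<Rightarrow>\<^sub>0 nat" and c :: complex
  assume ab: "Poly_Mapping.keys a \<subseteq> {0..n}" "Poly_Mapping.keys b \<subseteq> {0..n}"
  then show "\<exists>p'. nf_good n p' \<and> (\<forall>x\<in>carrier V. sc c (sc d (A.nrm (a, b) x)) = A.ev A.nrm p' x) \<and>
     (\<forall>x\<in>carrier V'. sc' c (sc' d (B.nrm (a, b) x)) = B.ev B.nrm p' x)"
    by (intro exI[of _ "Poly_Mapping.single (a, b) (c * d)"]) (simp add: nf_good_single)
qed

lemma nf_rel_comp:
  assumes "nf_rel P P'" "nf_rel Q Q'" shows "nf_rel (\<lambda>x. P (Q x)) (\<lambda>x. P' (Q' x))"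
  unfolding nf_rel_def
proof (intro conjI allI impI)
  show "A.endo (\<lambda>x. P (Q x))" "B.endo (\<lambda>x. P' (Q' x))"
    using assms A.endo_comp[of Q P] B.endo_comp[of Q' P'] by (auto simp: nf_rel_def)
  fix p assume "nf_good n p"
  then obtain q where q: "nf_good n q" "\<forall>x\<in>carrier V. Q (A.ev A.nrm p x) = A.ev A.nrm q x"
    "\<forall>x\<in>carrier V'. Q' (B.ev B.nrm p x) = B.ev B.nrm q x"
    using assms(2) unfolding nf_rel_def by blast
  then show "\<exists>p'. nf_good n p' \<and> (\<forall>x\<in>carrier V. P (Q (A.ev A.nrm p x)) = A.ev A.nrm p' x) \<and>
    (\<forall>x\<in>carrier V'. P' (Q' (B.ev B.nrm p x)) = B.ev B.nrm p' x)"
    using assms(1) unfolding nf_rel_def by simp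
qed

lemma nf_rel_add:
  assumes P: "nf_rel P P'" and Q: "nf_rel Q Q'" shows "nf_rel (\<lambda>x. P x \<oplus>\<^bsub>V\<^esub> Q x) (\<lambda>x. P' x \<oplus>\<^bsub>V'\<^esub> Q' x)"
  unfolding nf_rel_def
proof (intro conjI allI impI)
  show "A.endo (\<lambda>x. P x \<oplus>\<^bsub>V\<^esub> Q x)" "B.endo (\<lambda>x. P' x \<oplus>\<^bsub>V'\<^esub> Q' x)"
    using assms A.endo_add[of P Q] B.endo_add[of P' Q'] by (auto simp: nf_rel_def)
  fix p assume p: "nf_good n p"
  obtain q where q: "nf_good n q" "\<forall>x\<in>carrier V. Q (A.ev A.nrm p x) = A.ev A.nrm q x"
    "\<forall>x\<in>carrier V'. Q' (B.ev B.nrm p x) = B.ev B.nrm q x"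
    using Q p unfolding nf_rel_def by blast
  obtain r where r: "nf_good n r" "\<forall>x\<in>carrier V. P (A.ev A.nrm p x) = A.ev A.nrm r x"
    "\<forall>x\<in>carrier V'. P' (B.ev B.nrm p x) = B.ev B.nrm r x"
    using P p unfolding nf_rel_def by blast
  show "\<exists>p'. nf_good n p' \<and> (\<forall>x\<in>carrier V. P (A.ev A.nrm p x) \<oplus>\<^bsub>V\<^esub> Q (A.ev A.nrm p x) = A.ev A.nrm p' x) \<and>
    (\<forall>x\<in>carrier V'. P' (B.ev B.nrm p x) \<oplus>\<^bsub>V'\<^esub> Q' (B.ev B.nrm p x) = B.ev B.nrm p' x)"
    by (rule exI[of _ "r + q"]) (use q r in \<open>simp add: nf_good_add A.ev_add B.ev_add\<close>)
qed

text \<open>The left multiplication is evaluated at the normal form of the identity.\<close>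

lemma nf_rel_form:
  assumes "nf_rel P P'"
  shows "\<exists>p. nf_good n p \<and> (\<forall>x\<in>carrier V. P x = A.ev A.nrm p x) \<and> (\<forall>x\<in>carrier V'. P' x = B.ev B.nrm p x)"
proof -
  have g: "nf_good n (Poly_Mapping.single (0, 0) 1)" by (simp add: nf_good_def)
  have 1: "A.ev A.nrm (Poly_Mapping.single (0, 0) 1) x = x" if "x \<in> carrier V" for x
    using that by (simp add: A.ev_single) (simp add: A.nrm_def del: mop.simps)
  have 2: "B.ev B.nrm (Poly_Mapping.single (0, 0) 1) x = x" if "x \<in> carrier V'" for x
    using that by (simp add: B.ev_single) (simp add: B.nrm_def del: mop.simps)
  show ?thesis using assms g 1 2 unfolding nf_rel_def by (metis (no_types, lifting))
qed

end

section \<open>The Weyl algebra\<close>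

lemma polys_0 [simp]: "0 \<in> polys I" by (simp add: polys_def)

lemma polys_1 [simp]: "1 \<in> polys I" by (simp add: polys_def)

lemma polys_add [simp]: "p \<in> polys I \<Longrightarrow> q \<in> polys I \<Longrightarrow> p + q \<in> polys I"
  using Poly_Mapping.keys_add[of p q] by (auto simp: polys_def)

lemma polys_mult [simp]: "p \<in> polys I \<Longrightarrow> q \<in> polys I \<Longrightarrow> p * q \<in> polys I"
proof -
  assume pq: "p \<in> polys I" "q \<in> polys I"
  have "Poly_Mapping.keys m \<subseteq> I" if m: "m \<in> Poly_Mapping.keys (p * q)" for m
  proof -
    obtain a b where ab: "a \<in> Poly_Mapping.keys p" "b \<in> Poly_Mapping.keys q" "m = a + b"
      using subsetD[OF keys_mult m] by blast
    then show ?thesis using Poly_Mapping.keys_add[of a b] pq by (auto simp: polys_def)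
  qed
  then show ?thesis by (simp add: polys_def)
qed

lemma polys_uminus [simp]: "p \<in> polys I \<Longrightarrow> - p \<in> polys I"
  by (auto simp: polys_def in_keys_iff)

lemma polys_minus [simp]: "p \<in> polys I \<Longrightarrow> q \<in> polys I \<Longrightarrow> p - q \<in> polys I"
  using polys_add[of p I "- q"] by simp

lemma polys_Const [simp]: "Const c \<in> polys I" by (simp add: polys_def Const_def)

lemma polys_Var [simp]: "i \<in> I \<Longrightarrow> Var i \<in> polys I" by (simp add: polys_def Var_def)

lemma polys_single: "Poly_Mapping.keys m \<subseteq> I \<Longrightarrow> Poly_Mapping.single m c \<in> polys I"
  by (simp add: polys_def)

lemma Const_add: "Const (c + d) = Const c + Const d" by (simp add: Const_def single_add)
lemma Const_mult: "Const (c * d) = Const c * Const d" by (simp add: Const_def mult_single)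
lemma Const_1 [simp]: "Const 1 = 1" by (simp add: Const_def)
lemma Const_0 [simp]: "Const 0 = 0" by (simp add: Const_def)
lemma Const_minus1 [simp]: "Const (-1) = -1"
  using Const_add[of "-1" 1] by (simp add: eq_neg_iff_add_eq_0)

lemma cring_poly_ring_on: "cring (poly_ring_on I)"
proof (rule cringI)
  show "abelian_group (poly_ring_on I)"
  proof (rule abelian_groupI)
    fix x assume "x \<in> carrier (poly_ring_on I)"
    then show "\<exists>y\<in>carrier (poly_ring_on I). y \<oplus>\<^bsub>poly_ring_on I\<^esub> x = \<zero>\<^bsub>poly_ring_on I\<^esub>"
      by (intro bexI[of _ "- x"]) (auto simp: poly_ring_on_def)
  qed (auto simp: poly_ring_on_def algebra_simps)
  show "comm_monoid (poly_ring_on I)"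
    by (rule comm_monoidI) (auto simp: poly_ring_on_def algebra_simps)
qed (auto simp: poly_ring_on_def algebra_simps)

lemma cspace_poly: "cspace (poly_ring_on I) (\<lambda>c p. Const c * p)"
proof -
  interpret cring "poly_ring_on I" by (rule cring_poly_ring_on)
  show ?thesis
    by unfold_locales (auto simp: poly_ring_on_def Const_add Const_mult algebra_simps)
qed

lemma finsum_poly_ring_on:
  assumes "finite A" "\<And>a. a \<in> A \<Longrightarrow> f a \<in> polys I"
  shows "finsum (poly_ring_on I) f A = sum f A"
proof -
  interpret cring "poly_ring_on I" by (rule cring_poly_ring_on)
  show ?thesis using assms
  proof (induction A rule: finite_induct)
    case empty
    have "finsum (poly_ring_on I) f {} = \<zero>\<^bsub>poly_ring_on I\<^esub>" by (rule finsum_empty)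
    then show ?case by (simp add: poly_ring_on_def)
  next
    case (insert a A)
    then have "finsum (poly_ring_on I) f (insert a A) = f a \<oplus>\<^bsub>poly_ring_on I\<^esub> finsum (poly_ring_on I) f A"
      by (intro finsum_insert) (auto simp: poly_ring_on_def)
    then show ?case using insert by (simp add: poly_ring_on_def)
  qed
qed

lemma pderivative_superset:
  assumes "finite S" "Poly_Mapping.keys p \<subseteq> S"
  shows "pderivative i p = (\<Sum>m\<in>S. Poly_Mapping.single (m - Poly_Mapping.single i 1)
     (of_nat (Poly_Mapping.lookup m i) * Poly_Mapping.lookup p m))"
  unfolding pderivative_def using assms by (intro sum.mono_neutral_left) (auto simp: in_keys_iff)

lemma pderivative_add: "pderivative i (p + q) = pderivative i p + pderivative i q"
proof -
  let ?S = "Poly_Mapping.keys p \<union> Poly_Mapping.keys q"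
  have S: "finite ?S" by simp
  show ?thesis
    using pderivative_superset[OF S, of "p + q"] pderivative_superset[OF S, of p] pderivative_superset[OF S, of q]
      Poly_Mapping.keys_add[of p q]
    by (simp add: lookup_add distrib_left single_add sum.distrib)
qed

lemma pderivative_single:
  "pderivative i (Poly_Mapping.single m c) = Poly_Mapping.single (m - Poly_Mapping.single i 1) (of_nat (Poly_Mapping.lookup m i) * c)"
  using pderivative_superset[of "{m}" "Poly_Mapping.single m c" i] by simp

lemma pderivative_0 [simp]: "pderivative i 0 = 0" by (simp add: pderivative_def)

lemma pderivative_Const: "pderivative i (Const c * p) = Const c * pderivative i p"
proof (induction p rule: poly_mapping_induct_add)
  case (2 k a)
  then show ?case by (simp add: Const_def mult_single pderivative_single mult.left_commute)
next
  case (3 p q)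
  then show ?case by (simp add: pderivative_add algebra_simps)
qed simp

lemma single_sub_add: "Poly_Mapping.lookup m i > 0 \<Longrightarrow> Poly_Mapping.single i 1 + (m - Poly_Mapping.single i (1::nat)) = m"
  by (rule poly_mapping_eqI) (auto simp: lookup_add lookup_minus lookup_single when_def)

text \<open>The Leibniz rule for multiplication by a variable; the case split is whether the
  truncated subtraction of exponents is exact.\<close>

lemma pderivative_Var_same: "pderivative i (Var i * p) = Var i * pderivative i p + p"
proof (induction p rule: poly_mapping_induct_add)
  case (2 m a)
  show ?case
  proof (cases "Poly_Mapping.lookup m i = 0")
    case True
    then show ?thesis
      by (simp add: Var_def mult_single pderivative_single lookup_add)
  next
    case False
    then have "Poly_Mapping.single i 1 + (m - Poly_Mapping.single i 1) = m" by (intro single_sub_add) simp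
    then show ?thesis
      by (simp add: Var_def mult_single pderivative_single lookup_add flip: single_add) (simp add: algebra_simps)
  qed
next
  case (3 p q)
  then show ?case by (simp add: pderivative_add algebra_simps)
qed simp

lemma pderivative_Var_other: "i \<noteq> j \<Longrightarrow> pderivative i (Var j * p) = Var j * pderivative i p"
proof (induction p rule: poly_mapping_induct_add)
  case (2 m a)
  have "Poly_Mapping.single j 1 + m - Poly_Mapping.single i 1 = Poly_Mapping.single j 1 + (m - Poly_Mapping.single i 1)"
    using \<open>i \<noteq> j\<close> by (intro poly_mapping_eqI) (auto simp: lookup_add lookup_minus lookup_single when_def)
  then show ?case using \<open>i \<noteq> j\<close>
    by (simp add: Var_def mult_single pderivative_single lookup_add lookup_single)
next
  case (3 p q)
  then show ?case by (simp add: pderivative_add algebra_simps)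
qed simp

lemma pderivative_commute: "pderivative i (pderivative j p) = pderivative j (pderivative i p)"
proof (induction p rule: poly_mapping_induct_add)
  case (2 m a)
  have "m - Poly_Mapping.single i 1 - Poly_Mapping.single j 1 = m - Poly_Mapping.single j 1 - Poly_Mapping.single i 1"
    by (intro poly_mapping_eqI) (auto simp: lookup_minus)
  then show ?case
    by (cases "i = j") (simp_all add: pderivative_single lookup_minus lookup_single mult.left_commute)
next
  case (3 p q)
  then show ?case by (simp add: pderivative_add)
qed simp

lemma polys_pderivative [simp]: "p \<in> polys I \<Longrightarrow> pderivative i p \<in> polys I"
proof -
  assume p: "p \<in> polys I"
  show ?thesis
  proof (induction p rule: poly_mapping_induct_add)
    case (2 m c)
    then have "Poly_Mapping.keys (m - Poly_Mapping.single i 1) \<subseteq> I"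
      using p by (fastforce simp: polys_def in_keys_iff lookup_minus subset_iff)
    then show ?case by (simp add: pderivative_single polys_single)
  qed (simp_all add: pderivative_add)
qed

lemma weyl_ops_poly: "weyl_ops (poly_ring_on {0..n}) (\<lambda>c p. Const c * p) n (\<lambda>i p. Var i * p) pderivative"
proof -
  interpret cspace "poly_ring_on {0..n}" "\<lambda>c p. Const c * p" by (rule cspace_poly)
  show ?thesis
    by unfold_locales
      (auto simp: lin_on_def poly_ring_on_def pderivative_add pderivative_Const pderivative_Var_same
        pderivative_Var_other pderivative_commute distrib_left mult.left_commute)
qed

text \<open>A product of falling factorials, the coefficient produced by applying \<partial>^b to
  t^m. Truncated subtraction yields the right zero: if \<open>b i\<close> exceeds the exponent, the
  factor whose \<open>j\<close> equals the exponent vanishes.\<close>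

definition falling :: "nat \<Rightarrow> (nat \<Rightarrow> nat) \<Rightarrow> (nat \<Rightarrow>\<^sub>0 nat) \<Rightarrow> complex" where
  "falling K b m = (\<Prod>i<K. \<Prod>j<b i. of_nat (Poly_Mapping.lookup m i - j))"

lemma falling_eq_0_iff: "falling K b m = 0 \<longleftrightarrow> (\<exists>i<K. Poly_Mapping.lookup m i < b i)"
  by (auto simp: falling_def)

lemma lookup_sum_single:
  fixes K :: nat
  shows "Poly_Mapping.lookup (\<Sum>i<K. Poly_Mapping.single i (b i :: nat)) j = (if j < K then b j else 0)"
proof -
  have "Poly_Mapping.lookup (\<Sum>i<K. Poly_Mapping.single i (b i)) j = (\<Sum>i<K. if i = j then b i else 0)"
    by (simp add: lookup_sum lookup_single when_def)
  also have "\<dots> = (if j < K then b j else 0)" by (simp add: sum.delta')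
  finally show ?thesis .
qed

lemma mop_pderivative_single:
  "mop pderivative K b (Poly_Mapping.single m c) =
    Poly_Mapping.single (m - (\<Sum>i<K. Poly_Mapping.single i (b i))) (falling K b m * c)"
proof (induction K)
  case 0 then show ?case by (simp add: falling_def)
next
  case (Suc K)
  have pw: "(pderivative K ^^ r) (Poly_Mapping.single m' c') =
     Poly_Mapping.single (m' - Poly_Mapping.single K r) ((\<Prod>j<r. of_nat (Poly_Mapping.lookup m' K - j)) * c')" for r m' c'
  proof (induction r)
    case (Suc r)
    have "m' - Poly_Mapping.single K r - Poly_Mapping.single K 1 = m' - Poly_Mapping.single K (Suc r)"
      by (intro poly_mapping_eqI) (auto simp: lookup_minus lookup_single when_def)
    then show ?case using Suc by (simp add: pderivative_single lookup_minus algebra_simps)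
  qed simp
  have "m - (\<Sum>i<K. Poly_Mapping.single i (b i)) - Poly_Mapping.single K (b K) = m - (\<Sum>i<Suc K. Poly_Mapping.single i (b i))"
    by (intro poly_mapping_eqI) (simp add: lookup_minus lookup_add)
  moreover have "Poly_Mapping.lookup (m - (\<Sum>i<K. Poly_Mapping.single i (b i))) K = Poly_Mapping.lookup m K"
    by (simp add: lookup_minus lookup_sum_single)
  ultimately show ?case by (simp add: Suc pw falling_def algebra_simps)
qed

lemma mop_Var_single:
  "mop (\<lambda>i p. Var i * p) K a (Poly_Mapping.single m c) = Poly_Mapping.single (m + (\<Sum>i<K. Poly_Mapping.single i (a i))) c"
proof (induction K)
  case (Suc K)
  have pw: "((\<lambda>p. Var K * p) ^^ r) (Poly_Mapping.single m' c') = Poly_Mapping.single (m' + Poly_Mapping.single K r) c'" for r m' c'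
  proof (induction r)
    case (Suc r)
    have "Poly_Mapping.single K 1 + (m' + Poly_Mapping.single K r) = m' + Poly_Mapping.single K (Suc r)"
      by (intro poly_mapping_eqI) (auto simp: lookup_add lookup_single when_def)
    then show ?case using Suc by (simp add: Var_def mult_single)
  qed simp
  show ?case by (simp add: Suc pw add.assoc)
qed simp

interpretation poly: weyl_ops "poly_ring_on {0..n}" "\<lambda>c p. Const c * p" n "\<lambda>i p. Var i * p" pderivative for n
  by (rule weyl_ops_poly)

lemma sum_single_keys: "Poly_Mapping.keys a \<subseteq> {0..n} \<Longrightarrow> (\<Sum>i<Suc n. Poly_Mapping.single i (Poly_Mapping.lookup a i)) = (a :: nat \<Rightarrow>\<^sub>0 nat)"
  by (rule poly_mapping_eqI, subst lookup_sum_single) (force simp: in_keys_iff)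

lemma nrm_poly_single:
  assumes "Poly_Mapping.keys a \<subseteq> {0..n}" "Poly_Mapping.keys b \<subseteq> {0..n}"
  shows "poly.nrm n (a, b) (Poly_Mapping.single m c) =
    Poly_Mapping.single (m - b + a) (falling (Suc n) (Poly_Mapping.lookup b) m * c)"
  unfolding poly.nrm_def fst_conv snd_conv mop_pderivative_single mop_Var_single
    sum_single_keys[OF assms(1)] sum_single_keys[OF assms(2)] ..

text \<open>Applied to a monomial \<open>t\<^sup>b\<close> with \<open>b\<close> of least degree among the exponents of the derivations,
  all terms die except those with exactly these derivations.\<close>

lemma normal_monomials_independent:
  assumes good: "nf_good n p" and z: "\<And>q. q \<in> polys {0..n} \<Longrightarrow> poly.ev n (poly.nrm n) p q = 0"
  shows "p = 0"
proof (rule ccontr)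
  assume "p \<noteq> 0"
  then have ne: "Poly_Mapping.keys p \<noteq> {}" by simp
  define sz where "sz b = (\<Sum>i<Suc n. Poly_Mapping.lookup b i)" for b :: "nat \<Rightarrow>\<^sub>0 nat"
  obtain k0 where k0: "k0 \<in> Poly_Mapping.keys p" "\<And>k. k \<in> Poly_Mapping.keys p \<Longrightarrow> sz (snd k0) \<le> sz (snd k)"
  proof (rule that)
    let ?f = "\<lambda>k :: (nat \<Rightarrow>\<^sub>0 nat) \<times> (nat \<Rightarrow>\<^sub>0 nat). sz (snd k)"
    show "arg_min_on ?f (Poly_Mapping.keys p) \<in> Poly_Mapping.keys p"
      by (rule arg_min_if_finite(1)[OF finite_keys ne])
    show "?f (arg_min_on ?f (Poly_Mapping.keys p)) \<le> ?f k" if "k \<in> Poly_Mapping.keys p" for k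
      by (rule arg_min_least[OF finite_keys ne that])
  qed
  obtain a0 b0 where k0': "k0 = (a0, b0)" by (cases k0)
  have gk: "Poly_Mapping.keys a \<subseteq> {0..n}" "Poly_Mapping.keys b \<subseteq> {0..n}" if "(a, b) \<in> Poly_Mapping.keys p" for a b
    using good that by (auto simp: nf_good_def)
  let ?q = "Poly_Mapping.single b0 (1::complex)"
  have q: "?q \<in> polys {0..n}" using gk k0 k0' by (intro polys_single) auto
  have nrmq: "poly.nrm n k ?q \<in> polys {0..n}" for k
    using poly.nrm_closed[of ?q n k] q by (simp add: poly_ring_on_def)
  have "poly.ev n (poly.nrm n) p ?q = (\<Sum>k\<in>Poly_Mapping.keys p. Const (Poly_Mapping.lookup p k) * poly.nrm n k ?q)"
    unfolding poly.ev_def using nrmq by (intro finsum_poly_ring_on) auto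
  \<comment> \<open>Read off the coefficient of t^a0: a term with derivations \<open>b0\<close>
    turns t^b0 into a multiple of t^a, and only \<open>a = a0\<close> contributes.\<close>
  then have "0 = Poly_Mapping.lookup (\<Sum>k\<in>Poly_Mapping.keys p. Const (Poly_Mapping.lookup p k) * poly.nrm n k ?q) a0"
    using z[OF q] by simp
  also have "\<dots> = (\<Sum>k\<in>Poly_Mapping.keys p. if k = k0 then Poly_Mapping.lookup p k0 * falling (Suc n) (Poly_Mapping.lookup b0) b0 else 0)"
    unfolding lookup_sum
  proof (rule sum.cong[OF refl])
    fix k assume k: "k \<in> Poly_Mapping.keys p"
    obtain a b where kk: "k = (a, b)" by (cases k)
    have g: "Poly_Mapping.keys a \<subseteq> {0..n}" "Poly_Mapping.keys b \<subseteq> {0..n}" using gk k kk by auto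
    have e: "Poly_Mapping.lookup (Const (Poly_Mapping.lookup p k) * poly.nrm n k ?q) a0 =
      (if b0 - b + a = a0 then Poly_Mapping.lookup p k * falling (Suc n) (Poly_Mapping.lookup b) b0 else 0)"
      unfolding kk nrm_poly_single[OF g] by (simp add: Const_def mult_single lookup_single when_def)
    show "Poly_Mapping.lookup (Const (Poly_Mapping.lookup p k) * poly.nrm n k ?q) a0 =
      (if k = k0 then Poly_Mapping.lookup p k0 * falling (Suc n) (Poly_Mapping.lookup b0) b0 else 0)"
    proof (cases "falling (Suc n) (Poly_Mapping.lookup b) b0 = 0")
      case True
      then have "k \<noteq> k0" using kk k0' by (auto simp: falling_eq_0_iff)
      then show ?thesis using e True by simp
    next
      case False
      \<comment> \<open>The entries of \<open>b\<close> are at most those of \<open>b0\<close>,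
        whose total is minimal, so they agree.\<close>
      then have le: "\<And>i. i < Suc n \<Longrightarrow> Poly_Mapping.lookup b i \<le> Poly_Mapping.lookup b0 i"
        by (force simp: falling_eq_0_iff)
      have "sz b0 \<le> sz b" using k0(2)[OF k] kk k0' by simp
      have "Poly_Mapping.lookup b i = Poly_Mapping.lookup b0 i" if i: "i < Suc n" for i
      proof (rule ccontr)
        assume "Poly_Mapping.lookup b i \<noteq> Poly_Mapping.lookup b0 i"
        then have "sz b < sz b0" unfolding sz_def using le i
          by (intro sum_strict_mono_ex1) (auto intro!: bexI[of _ i] simp: le_neq_trans)
        then show False using \<open>sz b0 \<le> sz b\<close> by simp
      qed
      then have "(\<Sum>i<Suc n. Poly_Mapping.single i (Poly_Mapping.lookup b i)) =
          (\<Sum>i<Suc n. Poly_Mapping.single i (Poly_Mapping.lookup b0 i))" by (intro sum.cong) auto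
      moreover have "Poly_Mapping.keys b0 \<subseteq> {0..n}" using gk k0 k0' by blast
      ultimately have "b = b0" using sum_single_keys[OF g(2)] sum_single_keys[of b0 n] by simp
      then show ?thesis using e kk k0' by auto
    qed
  qed
  also have "\<dots> = Poly_Mapping.lookup p k0 * falling (Suc n) (Poly_Mapping.lookup b0) b0"
    using k0(1) by simp
  also have "\<dots> \<noteq> 0" using k0(1) by (auto simp: falling_eq_0_iff in_keys_iff)
  finally show False by simp
qed

lemma ring_linear_operators: "ring (linear_operators I)"
proof (rule ringI)
  let ?L = "linear_operators I"
  note ld = linear_operators_def
  show "abelian_group ?L"
  proof (rule abelian_groupI)
    fix x y assume x: "x \<in> carrier ?L" and y: "y \<in> carrier ?L"
    show "x \<oplus>\<^bsub>?L\<^esub> y \<in> carrier ?L" using x y by (auto simp: ld algebra_simps PiE_def Pi_def)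
    show "x \<oplus>\<^bsub>?L\<^esub> y = y \<oplus>\<^bsub>?L\<^esub> x" by (auto simp: ld add.commute)
  next
    fix x y z assume "x \<in> carrier ?L" "y \<in> carrier ?L" "z \<in> carrier ?L"
    then show "x \<oplus>\<^bsub>?L\<^esub> y \<oplus>\<^bsub>?L\<^esub> z = x \<oplus>\<^bsub>?L\<^esub> (y \<oplus>\<^bsub>?L\<^esub> z)"
      by (auto simp: ld add.assoc restrict_def)
  next
    fix x assume x: "x \<in> carrier ?L"
    show "\<zero>\<^bsub>?L\<^esub> \<oplus>\<^bsub>?L\<^esub> x = x" using x
      by (intro ext) (auto simp: ld PiE_def extensional_def restrict_def)
    show "\<exists>y\<in>carrier ?L. y \<oplus>\<^bsub>?L\<^esub> x = \<zero>\<^bsub>?L\<^esub>"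
      using x by (intro bexI[of _ "\<lambda>p\<in>polys I. - x p"]) (auto simp: ld PiE_def Pi_def restrict_def extensional_def)
  qed (auto simp: ld)
  show "monoid ?L"
  proof (rule monoidI)
    fix x y assume x: "x \<in> carrier ?L" and y: "y \<in> carrier ?L"
    show "x \<otimes>\<^bsub>?L\<^esub> y \<in> carrier ?L" using x y by (auto simp: ld compose_def PiE_def Pi_def)
  next
    fix x y z assume "x \<in> carrier ?L" "y \<in> carrier ?L" "z \<in> carrier ?L"
    then show "x \<otimes>\<^bsub>?L\<^esub> y \<otimes>\<^bsub>?L\<^esub> z = x \<otimes>\<^bsub>?L\<^esub> (y \<otimes>\<^bsub>?L\<^esub> z)"
      by (auto simp: ld compose_def restrict_def PiE_def Pi_def)
  next
    fix x assume x: "x \<in> carrier ?L"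
    show "\<one>\<^bsub>?L\<^esub> \<otimes>\<^bsub>?L\<^esub> x = x" "x \<otimes>\<^bsub>?L\<^esub> \<one>\<^bsub>?L\<^esub> = x" using x
      by (auto simp: ld compose_def restrict_def PiE_def Pi_def extensional_def fun_eq_iff)
  qed (auto simp: ld)
  fix x y z assume "x \<in> carrier ?L" "y \<in> carrier ?L" "z \<in> carrier ?L"
  then show "(x \<oplus>\<^bsub>?L\<^esub> y) \<otimes>\<^bsub>?L\<^esub> z = x \<otimes>\<^bsub>?L\<^esub> z \<oplus>\<^bsub>?L\<^esub> y \<otimes>\<^bsub>?L\<^esub> z"
    "z \<otimes>\<^bsub>?L\<^esub> (x \<oplus>\<^bsub>?L\<^esub> y) = z \<otimes>\<^bsub>?L\<^esub> x \<oplus>\<^bsub>?L\<^esub> z \<otimes>\<^bsub>?L\<^esub> y"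
    by (auto simp: ld compose_def restrict_def PiE_def Pi_def fun_eq_iff)
qed

abbreviation weyl_gens :: "nat \<Rightarrow> (cpoly \<Rightarrow> cpoly) set" where
  "weyl_gens n \<equiv> range (scalar_op n) \<union> t_op n ` {0..n} \<union> d_op n ` {0..n}"

lemma weyl_gens_closed: "weyl_gens n \<subseteq> carrier (linear_operators {0..n})"
  by (auto simp: linear_operators_def scalar_op_def t_op_def d_op_def distrib_left mult.left_commute pderivative_add pderivative_Const)

lemma weyl_fields [simp]:
  "mult (weyl n) = compose (polys {0..n})" "one (weyl n) = (\<lambda>p\<in>polys {0..n}. p)"
  "zero (weyl n) = (\<lambda>p\<in>polys {0..n}. 0)" "add (weyl n) = (\<lambda>f g. \<lambda>p\<in>polys {0..n}. f p + g p)"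
  by (simp_all add: weyl_def linear_operators_def)

lemma carrier_weyl: "carrier (weyl n) = generate_ring (linear_operators {0..n}) (weyl_gens n)"
  by (simp add: weyl_def)

lemma ring_weyl: "ring (weyl n)"
  unfolding weyl_def by (rule ring.generate_ring_is_ring[OF ring_linear_operators weyl_gens_closed])

lemma weyl_carrier_sub: "f \<in> carrier (weyl n) \<Longrightarrow> f \<in> carrier (linear_operators {0..n})"
  unfolding carrier_weyl by (rule ring.generate_ring_in_carrier[OF ring_linear_operators weyl_gens_closed])

lemma weyl_gen [simp]: "scalar_op n c \<in> carrier (weyl n)" "i \<le> n \<Longrightarrow> t_op n i \<in> carrier (weyl n)"
  "i \<le> n \<Longrightarrow> d_op n i \<in> carrier (weyl n)"
  unfolding carrier_weyl by (auto intro: generate_ring.incl)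

lemma weyl_induct [consumes 1, case_names scalar t d neg add mult]:
  assumes f: "f \<in> carrier (weyl n)"
    and "\<And>c. P (scalar_op n c)" "\<And>i. i \<le> n \<Longrightarrow> P (t_op n i)" "\<And>i. i \<le> n \<Longrightarrow> P (d_op n i)"
    and "\<And>f. f \<in> carrier (weyl n) \<Longrightarrow> P f \<Longrightarrow> P (\<ominus>\<^bsub>weyl n\<^esub> f)"
    and "\<And>f g. f \<in> carrier (weyl n) \<Longrightarrow> g \<in> carrier (weyl n) \<Longrightarrow> P f \<Longrightarrow> P g \<Longrightarrow> P (f \<oplus>\<^bsub>weyl n\<^esub> g)"
    and "\<And>f g. f \<in> carrier (weyl n) \<Longrightarrow> g \<in> carrier (weyl n) \<Longrightarrow> P f \<Longrightarrow> P g \<Longrightarrow> P (f \<otimes>\<^bsub>weyl n\<^esub> g)"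
  shows "P f"
proof -
  interpret L: ring "linear_operators {0..n}" by (rule ring_linear_operators)
  have sub: "subring (carrier (weyl n)) (linear_operators {0..n})"
    unfolding carrier_weyl by (rule L.generate_ring_is_subring[OF weyl_gens_closed])
  \<comment> \<open>Negatives are defined relative to the carrier, so those of the subring and of
    the full operator ring have to be identified by uniqueness.\<close>
  have inv: "\<ominus>\<^bsub>weyl n\<^esub> h = \<ominus>\<^bsub>linear_operators {0..n}\<^esub> h" if "h \<in> carrier (weyl n)" for h
  proof -
    interpret W: ring "weyl n" by (rule ring_weyl)
    have h': "\<ominus>\<^bsub>linear_operators {0..n}\<^esub> h \<in> carrier (weyl n)" using subringE(5)[OF sub that] .
    have "\<ominus>\<^bsub>linear_operators {0..n}\<^esub> h \<oplus>\<^bsub>linear_operators {0..n}\<^esub> h = \<zero>\<^bsub>linear_operators {0..n}\<^esub>"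
      using L.l_neg weyl_carrier_sub[OF that] by simp
    then have "\<ominus>\<^bsub>linear_operators {0..n}\<^esub> h \<oplus>\<^bsub>weyl n\<^esub> h = \<zero>\<^bsub>weyl n\<^esub>" by (simp add: linear_operators_def)
    then show ?thesis using W.minus_equality h' that by blast
  qed
  show ?thesis
    using f unfolding carrier_weyl
  proof (induction rule: generate_ring.induct)
    case one
    have "scalar_op n 1 = \<one>\<^bsub>linear_operators {0..n}\<^esub>" by (simp add: scalar_op_def linear_operators_def)
    then show ?case using assms(2)[of 1] by simp
  next
    case (incl h)
    then show ?case using assms by auto
  next
    case (a_inv h)
    then show ?case using assms(5)[of h] inv[of h] by (simp add: carrier_weyl)
  next
    case (eng_add h1 h2)
    then show ?case using assms(6)[of h1 h2] by (simp add: carrier_weyl weyl_def)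
  next
    case (eng_mult h1 h2)
    then show ?case using assms(7)[of h1 h2] by (simp add: carrier_weyl weyl_def)
  qed
qed

section \<open>Modules over the Weyl algebra\<close>

context left_module begin

lemma smult_zero_l: "x \<in> carrier M \<Longrightarrow> \<zero>\<^bsub>R\<^esub> \<odot>\<^bsub>M\<^esub> x = \<zero>\<^bsub>M\<^esub>"
proof -
  assume x: "x \<in> carrier M"
  have "\<zero>\<^bsub>R\<^esub> \<odot>\<^bsub>M\<^esub> x \<oplus>\<^bsub>M\<^esub> \<zero>\<^bsub>R\<^esub> \<odot>\<^bsub>M\<^esub> x = \<zero>\<^bsub>R\<^esub> \<odot>\<^bsub>M\<^esub> x"
    using smult_l_distr[of "\<zero>\<^bsub>R\<^esub>" "\<zero>\<^bsub>R\<^esub>" x] x by simp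
  then show ?thesis using M.add.r_cancel_one smult_closed x by simp
qed

lemma smult_neg_l: "a \<in> carrier R \<Longrightarrow> x \<in> carrier M \<Longrightarrow> (\<ominus>\<^bsub>R\<^esub> a) \<odot>\<^bsub>M\<^esub> x = \<ominus>\<^bsub>M\<^esub> (a \<odot>\<^bsub>M\<^esub> x)"
proof -
  assume a: "a \<in> carrier R" and x: "x \<in> carrier M"
  have "(\<ominus>\<^bsub>R\<^esub> a) \<odot>\<^bsub>M\<^esub> x \<oplus>\<^bsub>M\<^esub> a \<odot>\<^bsub>M\<^esub> x = \<zero>\<^bsub>M\<^esub>"
    using smult_l_distr[of "\<ominus>\<^bsub>R\<^esub> a" a x] a x smult_zero_l R.l_neg by simp
  then show ?thesis using M.minus_equality smult_closed a x by simp
qed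

lemma smult_diff_l: "a \<in> carrier R \<Longrightarrow> b \<in> carrier R \<Longrightarrow> x \<in> carrier M \<Longrightarrow> (a \<ominus>\<^bsub>R\<^esub> b) \<odot>\<^bsub>M\<^esub> x = a \<odot>\<^bsub>M\<^esub> x \<ominus>\<^bsub>M\<^esub> b \<odot>\<^bsub>M\<^esub> x"
  using smult_l_distr[of a "\<ominus>\<^bsub>R\<^esub> b" x] by (simp add: R.minus_eq M.minus_eq smult_neg_l)

lemma smult_pow: "a \<in> carrier R \<Longrightarrow> x \<in> carrier M \<Longrightarrow> (a [^]\<^bsub>R\<^esub> (N::nat)) \<odot>\<^bsub>M\<^esub> x = ((\<lambda>y. a \<odot>\<^bsub>M\<^esub> y) ^^ N) x"
proof (induction N arbitrary: x)
  case 0 then show ?case by (simp add: smult_one)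
next
  case (Suc N)
  then have "(a [^]\<^bsub>R\<^esub> Suc N) \<odot>\<^bsub>M\<^esub> x = (a [^]\<^bsub>R\<^esub> N) \<odot>\<^bsub>M\<^esub> (a \<odot>\<^bsub>M\<^esub> x)"
    by (simp add: smult_assoc1)
  then show ?case using Suc smult_closed by (simp add: funpow_swap1)
qed

end

lemma weyl_relations:
  "scalar_op n (c + d) = scalar_op n c \<oplus>\<^bsub>weyl n\<^esub> scalar_op n d"
  "scalar_op n (c * d) = scalar_op n c \<otimes>\<^bsub>weyl n\<^esub> scalar_op n d"
  "scalar_op n 1 = \<one>\<^bsub>weyl n\<^esub>"
  "i \<le> n \<Longrightarrow> t_op n i \<otimes>\<^bsub>weyl n\<^esub> scalar_op n c = scalar_op n c \<otimes>\<^bsub>weyl n\<^esub> t_op n i"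
  "i \<le> n \<Longrightarrow> d_op n i \<otimes>\<^bsub>weyl n\<^esub> scalar_op n c = scalar_op n c \<otimes>\<^bsub>weyl n\<^esub> d_op n i"
  "i \<le> n \<Longrightarrow> j \<le> n \<Longrightarrow> t_op n i \<otimes>\<^bsub>weyl n\<^esub> t_op n j = t_op n j \<otimes>\<^bsub>weyl n\<^esub> t_op n i"
  "i \<le> n \<Longrightarrow> j \<le> n \<Longrightarrow> d_op n i \<otimes>\<^bsub>weyl n\<^esub> d_op n j = d_op n j \<otimes>\<^bsub>weyl n\<^esub> d_op n i"
  "i \<le> n \<Longrightarrow> j \<le> n \<Longrightarrow> i \<noteq> j \<Longrightarrow> d_op n i \<otimes>\<^bsub>weyl n\<^esub> t_op n j = t_op n j \<otimes>\<^bsub>weyl n\<^esub> d_op n i"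
  "i \<le> n \<Longrightarrow> d_op n i \<otimes>\<^bsub>weyl n\<^esub> t_op n i = t_op n i \<otimes>\<^bsub>weyl n\<^esub> d_op n i \<oplus>\<^bsub>weyl n\<^esub> \<one>\<^bsub>weyl n\<^esub>"
  by (auto simp: fun_eq_iff compose_def scalar_op_def t_op_def d_op_def restrict_def Const_add Const_mult
      distrib_right mult.assoc mult.left_commute pderivative_Const pderivative_commute pderivative_Var_other pderivative_Var_same)

abbreviation wsc :: "nat \<Rightarrow> (cpoly \<Rightarrow> cpoly, 'a) module \<Rightarrow> complex \<Rightarrow> 'a \<Rightarrow> 'a" where
  "wsc n M c \<equiv> smult M (scalar_op n c)"

abbreviation wt :: "nat \<Rightarrow> (cpoly \<Rightarrow> cpoly, 'a) module \<Rightarrow> nat \<Rightarrow> 'a \<Rightarrow> 'a" where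
  "wt n M i \<equiv> smult M (t_op n i)"

abbreviation wd :: "nat \<Rightarrow> (cpoly \<Rightarrow> cpoly, 'a) module \<Rightarrow> nat \<Rightarrow> 'a \<Rightarrow> 'a" where
  "wd n M i \<equiv> smult M (d_op n i)"

lemma weyl_module_ops:
  assumes "left_module (weyl n) M"
  shows "weyl_ops M (wsc n M) n (wt n M) (wd n M)"
proof -
  interpret left_module "weyl n" M by fact
  have m: "smult M a (smult M b x) = smult M (a \<otimes>\<^bsub>weyl n\<^esub> b) x"
    if "a \<in> carrier (weyl n)" "b \<in> carrier (weyl n)" "x \<in> carrier M" for a b x
    using smult_assoc1[OF that] by simp
  have tt: "t_op n i \<otimes>\<^bsub>weyl n\<^esub> d_op n i \<in> carrier (weyl n)" if "i \<le> n" for i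
    using that by (intro R.m_closed weyl_gen) auto
  show ?thesis
  proof (intro weyl_ops.intro cspace.intro cspace_axioms.intro weyl_ops_axioms.intro lin_onI)
    show "abelian_group M" by (rule M.abelian_group_axioms)
  next
    fix x and c d :: complex assume x: "x \<in> carrier M"
    show "wsc n M (c + d) x = wsc n M c x \<oplus>\<^bsub>M\<^esub> wsc n M d x"
      unfolding weyl_relations(1) by (rule smult_l_distr) (use x in auto)
    show "wsc n M c (wsc n M d x) = wsc n M (c * d) x"
      unfolding weyl_relations(2) by (rule smult_assoc1[symmetric]) (use x in auto)
    show "wsc n M 1 x = x" unfolding weyl_relations(3) by (rule smult_one[OF x])
  next
    fix i x assume i: "i \<le> n" and x: "x \<in> carrier M"
    show "wt n M i (wsc n M c x) = wsc n M c (wt n M i x)" for c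
      using i x weyl_relations(4)[OF i] by (subst (1 2) m) auto
    show "wd n M i (wsc n M c x) = wsc n M c (wd n M i x)" for c
      using i x weyl_relations(5)[OF i] by (subst (1 2) m) auto
    show "wd n M i (wt n M i x) = wt n M i (wd n M i x) \<oplus>\<^bsub>M\<^esub> x"
      using i x tt[OF i] smult_l_distr[of "t_op n i \<otimes>\<^bsub>weyl n\<^esub> d_op n i" "\<one>\<^bsub>weyl n\<^esub>" x] weyl_relations(9)[OF i] smult_one[OF x]
      by (subst (1 2) m) (auto simp del: weyl_fields)
    fix j assume j: "j \<le> n"
    show "wt n M i (wt n M j x) = wt n M j (wt n M i x)"
      using i j x weyl_relations(6)[OF i j] by (subst (1 2) m) auto
    show "wd n M i (wd n M j x) = wd n M j (wd n M i x)"
      using i j x weyl_relations(7)[OF i j] by (subst (1 2) m) auto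
    assume "i \<noteq> j"
    then show "wd n M i (wt n M j x) = wt n M j (wd n M i x)"
      using i j x weyl_relations(8)[OF i j] by (subst (1 2) m) auto
  qed (auto intro!: smult_closed smult_r_distr)
qed

text \<open>Commutation with the generators propagates to sums, products and negatives, so over
  \<open>weyl n\<close> a homomorphism need only be tested on scalars, t_i and \<partial>_i.\<close>

lemma weyl_module_maps_iff:
  assumes M: "left_module (weyl n) M" and N: "left_module (weyl n) N"
  shows "f \<in> module_maps (weyl n) M N \<longleftrightarrow> f \<in> carrier M \<rightarrow>\<^sub>E carrier N \<and>
    lin_on (carrier M) M (wsc n M) N (wsc n N) f \<and>
    (\<forall>i\<le>n. \<forall>x\<in>carrier M. f (wt n M i x) = wt n N i (f x) \<and> f (wd n M i x) = wd n N i (f x))"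
proof
  assume "f \<in> module_maps (weyl n) M N"
  then show "f \<in> carrier M \<rightarrow>\<^sub>E carrier N \<and>
    lin_on (carrier M) M (wsc n M) N (wsc n N) f \<and>
    (\<forall>i\<le>n. \<forall>x\<in>carrier M. f (wt n M i x) = wt n N i (f x) \<and> f (wd n M i x) = wd n N i (f x))"
    by (auto simp: module_maps_def lin_on_def)
next
  interpret M: left_module "weyl n" M by fact
  interpret N: left_module "weyl n" N by fact
  assume f: "f \<in> carrier M \<rightarrow>\<^sub>E carrier N \<and>
    lin_on (carrier M) M (wsc n M) N (wsc n N) f \<and>
    (\<forall>i\<le>n. \<forall>x\<in>carrier M. f (wt n M i x) = wt n N i (f x) \<and> f (wd n M i x) = wd n N i (f x))"
  have cl: "\<And>x. x \<in> carrier M \<Longrightarrow> f x \<in> carrier N"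
    and ad: "\<And>x y. x \<in> carrier M \<Longrightarrow> y \<in> carrier M \<Longrightarrow> f (x \<oplus>\<^bsub>M\<^esub> y) = f x \<oplus>\<^bsub>N\<^esub> f y"
    using f by (auto simp: lin_on_def)
  have fz: "f \<zero>\<^bsub>M\<^esub> = \<zero>\<^bsub>N\<^esub>"
    using ad[of "\<zero>\<^bsub>M\<^esub>" "\<zero>\<^bsub>M\<^esub>"] cl[of "\<zero>\<^bsub>M\<^esub>"] N.M.add.r_cancel_one by simp
  have "\<forall>x\<in>carrier M. f (smult M a x) = smult N a (f x)" if "a \<in> carrier (weyl n)" for a
    using that
  proof (induction a rule: weyl_induct)
    case (neg a)
    show ?case
    proof
      fix x assume x: "x \<in> carrier M"
      have "f (smult M a x \<oplus>\<^bsub>M\<^esub> \<ominus>\<^bsub>M\<^esub> smult M a x) = f (smult M a x) \<oplus>\<^bsub>N\<^esub> f (\<ominus>\<^bsub>M\<^esub> smult M a x)"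
        using x neg M.smult_closed by (intro ad) auto
      then have "f (smult M a x) \<oplus>\<^bsub>N\<^esub> f (\<ominus>\<^bsub>M\<^esub> smult M a x) = \<zero>\<^bsub>N\<^esub>"
        using M.smult_closed[OF neg(1) x] by (simp add: M.M.r_neg fz)
      moreover have "f (smult M a x) \<in> carrier N" "f (\<ominus>\<^bsub>M\<^esub> smult M a x) \<in> carrier N"
        using M.smult_closed[OF neg(1) x] cl by auto
      ultimately have "f (\<ominus>\<^bsub>M\<^esub> smult M a x) \<oplus>\<^bsub>N\<^esub> f (smult M a x) = \<zero>\<^bsub>N\<^esub>"
        using N.M.a_comm by simp
      then have "\<ominus>\<^bsub>N\<^esub> (f (smult M a x)) = f (\<ominus>\<^bsub>M\<^esub> smult M a x)"
        using M.smult_closed[OF neg(1) x] cl by (intro N.M.minus_equality) auto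
      then show "f (smult M (\<ominus>\<^bsub>weyl n\<^esub> a) x) = smult N (\<ominus>\<^bsub>weyl n\<^esub> a) (f x)"
        using x neg cl by (simp add: M.smult_neg_l N.smult_neg_l)
    qed
  next
    case (add a b)
    then show ?case using M.smult_closed cl ad
      by (simp add: M.smult_l_distr N.smult_l_distr del: weyl_fields)
  next
    case (mult a b)
    then show ?case using M.smult_closed cl
      by (simp add: M.smult_assoc1 N.smult_assoc1 del: weyl_fields)
  qed (use f in \<open>auto simp: lin_on_def\<close>)
  then show "f \<in> module_maps (weyl n) M N" using f ad by (auto simp: module_maps_def)
qed

text \<open>Words in the generators act on \<open>Y\<close> through their normal forms, which are determined by their
  action on polynomials. Hence an element of the Weyl algebra has only one action on \<open>Y\<close>.\<close>

theorem weyl_module_of_ops: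
  fixes Y :: "(cpoly \<Rightarrow> cpoly, 'a) module"
  assumes Y: "weyl_ops Y sd n T D"
  shows "\<exists>s. left_module (weyl n) (Y\<lparr>smult := s\<rparr>) \<and> (\<forall>x\<in>carrier Y. (\<forall>c. s (scalar_op n c) x = sd c x) \<and>
    (\<forall>i\<le>n. s (t_op n i) x = T i x \<and> s (d_op n i) x = D i x))"
proof -
  interpret Y: weyl_ops Y sd n T D by fact
  interpret weyl_ops_pair "poly_ring_on {0..n}" "\<lambda>c p. Const c * p" n "\<lambda>i p. Var i * p" pderivative Y sd T D
    by unfold_locales
  have PC: "carrier (poly_ring_on {0..n}) = polys {0..n}" by (simp add: poly_ring_on_def)
  \<comment> \<open>Elements of \<open>weyl n\<close> are extensional while the operators of the
    polynomial representation are not; \<open>nf_rel\<close> only sees values on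
    polynomials.\<close>
  have cong: "nf_rel Q E" if "nf_rel P E" "\<And>p. p \<in> polys {0..n} \<Longrightarrow> P p = Q p" for P Q E
  proof -
    have "poly.endo n P" using that by (simp add: nf_rel_def)
    then have "poly.endo n Q" by (rule lin_on_cong[OF _ _ poly.csub_carrier]) (simp add: PC that(2))
    moreover have "poly.ev n (poly.nrm n) p x \<in> polys {0..n}" if "x \<in> polys {0..n}" for p x
      proof -
      have "poly.nrm n k x \<in> carrier (poly_ring_on {0..n})" for k using that by (intro poly.nrm_closed) (simp add: PC)
      from poly.ev_closed[where X="poly.nrm n", OF this] show ?thesis unfolding PC .
    qed
    ultimately show ?thesis using that unfolding nf_rel_def PC by simp
  qed
  have ex: "\<exists>E. nf_rel P E" if "P \<in> carrier (weyl n)" for P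
    using that
  proof (induction P rule: weyl_induct)
    case (scalar c)
    show ?case by (rule exI, rule cong[OF nf_rel_sc[of c]]) (simp add: scalar_op_def)
  next
    case (t i)
    show ?case by (rule exI, rule cong[OF nf_rel_T[OF t]]) (simp add: t_op_def)
  next
    case (d i)
    show ?case by (rule exI, rule cong[OF nf_rel_D[OF d]]) (simp add: d_op_def)
  next
    case (neg f)
    interpret W: ring "weyl n" by (rule ring_weyl)
    obtain E where "nf_rel f E" using neg by blast
    moreover have "Const (-1) * f p = (\<ominus>\<^bsub>weyl n\<^esub> f) p" if p: "p \<in> polys {0..n}" for p
    proof -
      have "f \<oplus>\<^bsub>weyl n\<^esub> \<ominus>\<^bsub>weyl n\<^esub> f = \<zero>\<^bsub>weyl n\<^esub>" by (rule W.r_neg[OF neg(1)])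
      from fun_cong[OF this, of p] p show ?thesis by (simp add: add_eq_0_iff)
    qed
    ultimately show ?case using cong[OF nf_rel_comp[OF nf_rel_sc[of "-1"]], of f E "\<ominus>\<^bsub>weyl n\<^esub> f"] by blast
  next
    case (add f g)
    then obtain E F where "nf_rel f E" "nf_rel g F" by blast
    note r = nf_rel_add[OF this]
    show ?case by (rule exI, rule cong[OF r]) (simp add: poly_ring_on_def)
  next
    case (mult f g)
    then obtain E F where "nf_rel f E" "nf_rel g F" by blast
    note r = nf_rel_comp[OF this]
    show ?case by (rule exI, rule cong[OF r]) (simp add: compose_def)
  qed
  \<comment> \<open>Two actions of the same operator have normal forms acting alike on polynomials,
    hence equal normal forms, hence they agree on \<open>Y\<close>.\<close>
  have uniq: "E x = F x" if E: "nf_rel P E" and F: "nf_rel P F" and x: "x \<in> carrier Y" for P E F x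
  proof -
    obtain p where p: "nf_good n p" "\<And>q. q \<in> polys {0..n} \<Longrightarrow> P q = poly.ev n (poly.nrm n) p q" "\<And>y. y \<in> carrier Y \<Longrightarrow> E y = Y.ev Y.nrm p y"
      using nf_rel_form[OF E] unfolding PC by blast
    obtain r where r: "nf_good n r" "\<And>q. q \<in> polys {0..n} \<Longrightarrow> P q = poly.ev n (poly.nrm n) r q" "\<And>y. y \<in> carrier Y \<Longrightarrow> F y = Y.ev Y.nrm r y"
      using nf_rel_form[OF F] unfolding PC by blast
    have "Poly_Mapping.keys (p - r) \<subseteq> Poly_Mapping.keys p \<union> Poly_Mapping.keys r" by (auto simp: in_keys_iff lookup_minus)
    then have g: "nf_good n (p - r)" using p(1) r(1) by (fastforce simp: nf_good_def)
    have "poly.ev n (poly.nrm n) (p - r) q = 0" if q: "q \<in> polys {0..n}" for q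
    proof -
      have "poly.ev n (poly.nrm n) (r + (p - r)) q = poly.ev n (poly.nrm n) r q + poly.ev n (poly.nrm n) (p - r) q"
      proof -
        have "poly.nrm n k q \<in> carrier (poly_ring_on {0..n})" for k using q by (intro poly.nrm_closed) (simp add: PC)
        from poly.ev_add[where X="poly.nrm n", OF this, where p=r and q="p - r"] show ?thesis by (simp add: poly_ring_on_def)
      qed
      then show ?thesis using p(2)[OF q] r(2)[OF q] by simp
    qed
    then have "p - r = 0" by (rule normal_monomials_independent[OF g])
    then show ?thesis using p(3)[OF x] r(3)[OF x] by simp
  qed
  \<comment> \<open>Any choice of action will do: the sum or composite of two actions is an action
    of the sum or product, so the module laws follow from uniqueness.\<close>
  define s where "s P x = (SOME E. nf_rel P E) x" for P x
  have s: "nf_rel P (s P)" if "P \<in> carrier (weyl n)" for P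
    unfolding s_def using someI_ex[OF ex[OF that]] by simp
  have seq: "s P x = E x" if "nf_rel P E" "P \<in> carrier (weyl n)" "x \<in> carrier Y" for P E x
    using uniq[OF s that(1)] that by blast
  have gens: "s (scalar_op n c) x = sd c x" "i \<le> n \<Longrightarrow> s (t_op n i) x = T i x" "i \<le> n \<Longrightarrow> s (d_op n i) x = D i x"
    if x: "x \<in> carrier Y" for c x i
  proof -
    show "s (scalar_op n c) x = sd c x"
      by (rule seq[OF _ weyl_gen(1) x], rule cong[OF nf_rel_sc[of c]]) (simp add: scalar_op_def)
    show "s (t_op n i) x = T i x" if i: "i \<le> n"
      by (rule seq[OF _ weyl_gen(2)[OF i] x], rule cong[OF nf_rel_T[OF i]]) (simp add: t_op_def)
    show "s (d_op n i) x = D i x" if i: "i \<le> n"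
      by (rule seq[OF _ weyl_gen(3)[OF i] x], rule cong[OF nf_rel_D[OF i]]) (simp add: d_op_def)
  qed
  have "left_module (weyl n) (Y\<lparr>smult := s\<rparr>)"
  proof (intro left_module.intro ring_weyl left_module_axioms.intro)
    interpret W: ring "weyl n" by (rule ring_weyl)
    show "abelian_group (Y\<lparr>smult := s\<rparr>)"
      using Y.abelian_group_axioms
      by (simp add: abelian_group_def abelian_monoid_def abelian_group_axioms_def)
    fix a x assume a: "a \<in> carrier (weyl n)" and "x \<in> carrier (Y\<lparr>smult := s\<rparr>)"
    then have x: "x \<in> carrier Y" by simp
    have la: "Y.endo (s a)" using s[OF a] by (simp add: nf_rel_def)
    show "a \<odot>\<^bsub>Y\<lparr>smult := s\<rparr>\<^esub> x \<in> carrier (Y\<lparr>smult := s\<rparr>)" using lin_onD(1)[OF la x] by simp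
    { fix y assume "y \<in> carrier (Y\<lparr>smult := s\<rparr>)"
      then show "a \<odot>\<^bsub>Y\<lparr>smult := s\<rparr>\<^esub> (x \<oplus>\<^bsub>Y\<lparr>smult := s\<rparr>\<^esub> y) = a \<odot>\<^bsub>Y\<lparr>smult := s\<rparr>\<^esub> x \<oplus>\<^bsub>Y\<lparr>smult := s\<rparr>\<^esub> a \<odot>\<^bsub>Y\<lparr>smult := s\<rparr>\<^esub> y"
        using lin_onD(2)[OF la x] by simp }
    fix b assume b: "b \<in> carrier (weyl n)"
    have "s (a \<oplus>\<^bsub>weyl n\<^esub> b) x = s a x \<oplus>\<^bsub>Y\<^esub> s b x"
      by (rule seq[OF cong[OF nf_rel_add[OF s[OF a] s[OF b]]] W.a_closed[OF a b] x]) (simp add: poly_ring_on_def)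
    then show "(a \<oplus>\<^bsub>weyl n\<^esub> b) \<odot>\<^bsub>Y\<lparr>smult := s\<rparr>\<^esub> x = a \<odot>\<^bsub>Y\<lparr>smult := s\<rparr>\<^esub> x \<oplus>\<^bsub>Y\<lparr>smult := s\<rparr>\<^esub> b \<odot>\<^bsub>Y\<lparr>smult := s\<rparr>\<^esub> x"
      by (simp del: weyl_fields)
    have "s (a \<otimes>\<^bsub>weyl n\<^esub> b) x = s a (s b x)"
      by (rule seq[OF cong[OF nf_rel_comp[OF s[OF a] s[OF b]]] W.m_closed[OF a b] x]) (simp add: compose_def)
    then show "(a \<otimes>\<^bsub>weyl n\<^esub> b) \<odot>\<^bsub>Y\<lparr>smult := s\<rparr>\<^esub> x = a \<odot>\<^bsub>Y\<lparr>smult := s\<rparr>\<^esub> (b \<odot>\<^bsub>Y\<lparr>smult := s\<rparr>\<^esub> x)"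
      by (simp del: weyl_fields)
  next
    fix x assume "x \<in> carrier (Y\<lparr>smult := s\<rparr>)"
    then show "\<one>\<^bsub>weyl n\<^esub> \<odot>\<^bsub>Y\<lparr>smult := s\<rparr>\<^esub> x = x"
      using gens(1)[of x 1] unfolding weyl_relations(3)[symmetric] by simp
  qed
  then show ?thesis using gens by blast
qed

section \<open>Weight theory: steps between weight spaces, and semisimplicity as an equation\<close>

section \<open>Generalized weight spaces\<close>

definition weight_lattice :: "nat \<Rightarrow> (nat \<Rightarrow> complex) \<Rightarrow> (nat \<Rightarrow> complex) set" where
  "weight_lattice n \<nu> = {\<mu> \<in> weights n. \<forall>i\<in>{0..n}. \<mu> i - \<nu> i \<in> \<int>}"

lemma weights_upd [simp]: "\<mu> \<in> weights n \<Longrightarrow> i \<le> n \<Longrightarrow> \<mu>(i := c) \<in> weights n"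
  by (auto simp: weights_def PiE_def extensional_def)

lemma lattice_weights: "\<mu> \<in> weight_lattice n \<nu> \<Longrightarrow> \<mu> \<in> weights n" by (simp add: weight_lattice_def)

lemma lattice_upd: "\<mu> \<in> weight_lattice n \<nu> \<Longrightarrow> i \<le> n \<Longrightarrow> c - \<nu> i \<in> \<int> \<Longrightarrow> \<mu>(i := c) \<in> weight_lattice n \<nu>"
  by (auto simp: weight_lattice_def)

lemma lattice_up [simp]: "\<mu> \<in> weight_lattice n \<nu> \<Longrightarrow> i \<le> n \<Longrightarrow> \<mu>(i := \<mu> i + 1) \<in> weight_lattice n \<nu>"
proof (rule lattice_upd)
  assume "\<mu> \<in> weight_lattice n \<nu>" "i \<le> n"
  then have "(\<mu> i - \<nu> i) + 1 \<in> \<int>" by (intro Ints_add) (simp_all add: weight_lattice_def)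
  then show "\<mu> i + 1 - \<nu> i \<in> \<int>" by (simp add: algebra_simps)
qed

lemma lattice_down [simp]: "\<mu> \<in> weight_lattice n \<nu> \<Longrightarrow> i \<le> n \<Longrightarrow> \<mu>(i := \<mu> i - 1) \<in> weight_lattice n \<nu>"
proof (rule lattice_upd)
  assume a: "\<mu> \<in> weight_lattice n \<nu>" "i \<le> n"
  have "(\<mu> i - \<nu> i) - 1 \<in> \<int>" by (rule Ints_diff) (use a in \<open>simp_all add: weight_lattice_def\<close>)
  then show "\<mu> i - 1 - \<nu> i \<in> \<int>" by (simp add: algebra_simps)
qed

context cspace begin

lemma sc_collect_mid:
  assumes x: "x \<in> carrier V" and p: "p \<in> carrier V"
  shows "x \<oplus> (p \<oplus> sc d x) = p \<oplus> sc (1 + d) x" "sc c x \<oplus> (p \<oplus> sc d x) = p \<oplus> sc (c + d) x"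
  using x p by (simp_all add: a_lcomm[of _ p] sc_collect)

definition nil :: "('v \<Rightarrow> 'v) \<Rightarrow> 'v \<Rightarrow> bool" where
  "nil f x \<longleftrightarrow> (\<exists>N. (f ^^ N) x = \<zero>)"

lemma endo_zero: "endo f \<Longrightarrow> f \<zero> = \<zero>"
  using lin_zero[OF _ _ csub_carrier, of V sc f] cspace_axioms by blast

lemma endo_pow_closed [simp]: "endo f \<Longrightarrow> x \<in> carrier V \<Longrightarrow> (f ^^ N) x \<in> carrier V"
  using lin_onD(1)[OF endo_funpow] .

lemma pow_zero_mono:
  assumes "endo f" "(f ^^ N) x = \<zero>" "N \<le> M" shows "(f ^^ M) x = \<zero>"
proof -
  have "(f ^^ M) x = (f ^^ (M - N)) ((f ^^ N) x)"
    using assms(3) by (metis comp_apply funpow_add le_add_diff_inverse2)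
  then show ?thesis using assms endo_zero[OF endo_funpow] by simp
qed

lemma nil_add: "endo f \<Longrightarrow> x \<in> carrier V \<Longrightarrow> y \<in> carrier V \<Longrightarrow> nil f x \<Longrightarrow> nil f y \<Longrightarrow> nil f (x \<oplus> y)"
proof -
  assume f: "endo f" and x: "x \<in> carrier V" and y: "y \<in> carrier V" and "nil f x" "nil f y"
  then obtain N M where "(f ^^ N) x = \<zero>" "(f ^^ M) y = \<zero>" by (auto simp: nil_def)
  then have "(f ^^ max N M) x = \<zero>" "(f ^^ max N M) y = \<zero>" using pow_zero_mono[OF f] by simp_all
  then have "(f ^^ max N M) (x \<oplus> y) = \<zero>" using lin_onD(2)[OF endo_funpow[OF f] x y] by simp
  then show ?thesis by (auto simp: nil_def)
qed

text \<open>The weight may change along \<open>g\<close>, therefore the operator that is nilpotent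
  at \<open>g x\<close> is allowed to differ from \<open>f\<close>.\<close>

lemma nil_intertwine:
  assumes f: "endo f" and g: "g \<zero> = \<zero>" and gf: "\<And>y. y \<in> carrier V \<Longrightarrow> f' (g y) = g (f y)"
    and x: "x \<in> carrier V" and "nil f x"
  shows "nil f' (g x)"
proof -
  have "(f' ^^ N) (g x) = g ((f ^^ N) x)" for N
    by (induction N) (use gf f x in auto)
  moreover obtain N where "(f ^^ N) x = \<zero>" using assms(5) by (auto simp: nil_def)
  ultimately have "(f' ^^ N) (g x) = \<zero>" using g by simp
  then show ?thesis by (auto simp: nil_def)
qed

lemma nil_sc: "endo f \<Longrightarrow> x \<in> carrier V \<Longrightarrow> nil f x \<Longrightarrow> nil f (sc c x)"
  by (rule nil_intertwine[where f=f]) (auto simp: lin_onD(3))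

lemma nil_zero: "nil f \<zero>" unfolding nil_def by (rule exI[of _ 0]) simp

lemma nil_eigen:
  assumes f: "endo f" and x: "x \<in> carrier V" "nil f x" and e: "f x = sc d x" "d \<noteq> 0"
  shows "x = \<zero>"
proof -
  have "(f ^^ N) x = sc (d ^ N) x" for N
    by (induction N) (use x e lin_onD(3)[OF f x(1)] in \<open>auto simp: mult.commute\<close>)
  then obtain N where "sc (d ^ N) x = \<zero>" using x(2) by (auto simp: nil_def)
  then show ?thesis using sc_cancel[OF x(1)] e(2) by simp
qed

text \<open>A nilpotent operator plus a nonzero scalar is invertible; stability of \<open>U\<close>
  keeps the solution in the given weight space.\<close>

lemma nil_shift_surj:
  assumes f: "endo f" and U: "csub V sc U" and fU: "\<And>y. y \<in> U \<Longrightarrow> f y \<in> U"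
    and x: "x \<in> U" "nil f x" and d: "d \<noteq> 0"
  shows "\<exists>y\<in>U. f y \<oplus> sc d y = x"
proof -
  obtain N where "(f ^^ N) x = \<zero>" using x by (auto simp: nil_def)
  then show ?thesis using x(1)
  proof (induction N arbitrary: x)
    case 0 then show ?case using csubD(3)[OF U] endo_zero[OF f] by (intro bexI[of _ \<zero>]) auto
  next
    case (Suc N)
    have "(f ^^ N) (f x) = \<zero>" using Suc.prems by (simp add: funpow_swap1)
    then obtain y where y: "y \<in> U" "f y \<oplus> sc d y = f x" using Suc.IH fU Suc.prems by blast
    \<comment> \<open>If f y + d y = f x, then (x - y) / d solves the equation for x.\<close>
    let ?y = "sc (1 / d) (x \<oplus> sc (-1) y)"
    have yU: "?y \<in> U" using y Suc.prems csubD(2,5)[OF U] by simp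
    have c: "x \<in> carrier V" "y \<in> carrier V" "f x \<in> carrier V" "f y \<in> carrier V"
      using y Suc.prems csubD(6)[OF U] lin_onD(1)[OF f] by auto
    have "f ?y \<oplus> sc d ?y = x"
      using c d lin_onD(2,3)[OF f] y(2)[symmetric]
      by (simp add: sc_r a_ac sc_collect)
    then show ?case using yU by blast
  qed
qed

text \<open>The binomial argument for commuting nilpotents, as an induction on the sum of the two
  exponents: applying f or g to x lowers one of them.\<close>

lemma nil_diff:
  assumes f: "endo f" and g: "endo g" and fg: "\<And>x. x \<in> carrier V \<Longrightarrow> f (g x) = g (f x)"
    and x: "x \<in> carrier V" and nf: "nil f x" and ng: "nil g x"
  shows "nil (\<lambda>x. f x \<oplus> sc (-1) (g x)) x"
proof -
  let ?h = "\<lambda>x. f x \<oplus> sc (-1) (g x)"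
  have h: "endo ?h" by (rule endo_add[OF f endo_comp[OF g endo_sc]])
  have "(?h ^^ (N + M)) x = \<zero>" if "(f ^^ N) x = \<zero>" "(g ^^ M) x = \<zero>" "x \<in> carrier V" for N M x
    using that
  proof (induction "N + M" arbitrary: N M x)
    case 0 then show ?case by simp
  next
    case (Suc k)
    show ?case
    proof (cases "N = 0 \<or> M = 0")
      case True
      then have "x = \<zero>" using Suc.prems by auto
      then show ?thesis using endo_zero[OF endo_funpow[OF h]] by simp
    next
      case False
      then obtain N' M' where NM: "N = Suc N'" "M = Suc M'" by (metis not0_implies_Suc)
      have fx: "f x \<in> carrier V" and gx: "g x \<in> carrier V" using lin_onD(1)[OF f] lin_onD(1)[OF g] Suc.prems by auto
      have 1: "(f ^^ N') (f x) = \<zero>" "(g ^^ M') (g x) = \<zero>" using Suc.prems NM by (auto simp: funpow_swap1)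
      have gp: "(g ^^ M) (f x) = f ((g ^^ M) x)"
        by (rule funpow_commute[where S="carrier V", symmetric]) (use fg lin_onD(1)[OF g] Suc.prems in auto)
      have fp: "(f ^^ N) (g x) = g ((f ^^ N) x)"
        by (rule funpow_commute[where S="carrier V", symmetric]) (use fg lin_onD(1)[OF f] Suc.prems in auto)
      have 2: "(g ^^ M) (f x) = \<zero>" "(f ^^ N) (g x) = \<zero>" using gp fp Suc.prems endo_zero f g by auto
      have "(?h ^^ (N' + M)) (f x) = \<zero>" using Suc.hyps(1)[of N' M "f x"] Suc.hyps(2) NM 1 2 fx by simp
      moreover have "(?h ^^ (N + M')) (g x) = \<zero>" using Suc.hyps(1)[of N M' "g x"] Suc.hyps(2) NM 1 2 gx by simp
      ultimately have "(?h ^^ k) (f x) = \<zero>" "(?h ^^ k) (g x) = \<zero>" using NM Suc.hyps(2) by auto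
      then have "(?h ^^ k) (?h x) = \<zero>"
        using lin_onD(2,3)[OF endo_funpow[OF h]] fx gx by simp
      then show ?thesis unfolding Suc.hyps(2)[symmetric] funpow_Suc_right comp_apply .
    qed
  qed
  then show ?thesis using nf ng x unfolding nil_def by blast
qed

end

context weyl_ops begin

definition A :: "nat \<Rightarrow> complex \<Rightarrow> 'v \<Rightarrow> 'v" where
  "A i c x = T i (D i x) \<oplus> sc (- c) x"

lemma endo_A: "i \<le> n \<Longrightarrow> endo (A i c)"
  unfolding A_def[abs_def] by (rule endo_add[OF endo_comp[OF D_lin T_lin] endo_sc])

lemma A_closed [simp]: "i \<le> n \<Longrightarrow> x \<in> carrier V \<Longrightarrow> A i c x \<in> carrier V"
  using lin_onD(1)[OF endo_A] .

lemma TD_A: "i \<le> n \<Longrightarrow> x \<in> carrier V \<Longrightarrow> T i (D i x) = A i c x \<oplus> sc c x"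
  by (simp add: A_def a_ac sc_collect)

text \<open>The commutator of \<partial>_j with t_j is absorbed by the shift of the weight, so the
  cases i = j and i \<noteq> j share one formula.\<close>

lemma A_T: "i \<le> n \<Longrightarrow> j \<le> n \<Longrightarrow> x \<in> carrier V \<Longrightarrow> A i ((\<mu>(j := \<mu> j + 1)) i) (T j x) = T j (A i (\<mu> i) x)"
proof (cases "i = j")
  case True
  assume "i \<le> n" "j \<le> n" "x \<in> carrier V"
  then show ?thesis using True by (simp add: A_def DTi T_add T_sc a_ac sc_collect sc_collect_mid)
next
  case False
  assume "i \<le> n" "j \<le> n" "x \<in> carrier V"
  then show ?thesis using False by (simp add: A_def DT T_add T_sc TT)
qed

lemma A_D: "i \<le> n \<Longrightarrow> j \<le> n \<Longrightarrow> x \<in> carrier V \<Longrightarrow> A i ((\<mu>(j := \<mu> j - 1)) i) (D j x) = D j (A i (\<mu> i) x)"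
proof (cases "i = j")
  case True
  assume "i \<le> n" "j \<le> n" "x \<in> carrier V"
  then show ?thesis using True by (simp add: A_def DTi D_add D_sc a_ac sc_collect sc_collect_mid)
next
  case False
  assume ij: "i \<le> n" "j \<le> n" and x: "x \<in> carrier V"
  have "D j (T i (D i x)) = T i (D j (D i x))" using False ij x by (intro DT) auto
  then show ?thesis using False ij x by (simp add: A_def D_add D_sc DD[of i j])
qed

lemma A_A: "i \<le> n \<Longrightarrow> j \<le> n \<Longrightarrow> x \<in> carrier V \<Longrightarrow> A i c (A j d x) = A j d (A i c x)"
proof -
  assume i: "i \<le> n" and j: "j \<le> n" and x: "x \<in> carrier V"
  have e: "T i (D i (T j (D j x))) = T j (D j (T i (D i x)))"
  proof (cases "i = j")
    case False
    have "T i (D i (T j (D j x))) = T j (T i (D i (D j x)))"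
      using False i j x DT[of i j "D j x"] TT[of i j] by simp
    also have "\<dots> = T j (T i (D j (D i x)))" using DD[OF i j x] by simp
    also have "\<dots> = T j (D j (T i (D i x)))" using False i j x DT[of j i "D i x"] by simp
    finally show ?thesis .
  qed simp
  show ?thesis using i j x e by (simp add: A_def T_add D_add T_sc D_sc sc_r a_ac mult.commute)
qed

text \<open>One exponent per coordinate, in contrast to the common exponent in
  \<open>weight_space\<close>; with finitely many coordinates the two agree
  (\<open>weight_space_Wt\<close>).\<close>

definition Wt :: "(nat \<Rightarrow> complex) \<Rightarrow> 'v set" where
  "Wt \<mu> = {x \<in> carrier V. \<forall>i\<le>n. nil (A i (\<mu> i)) x}"

lemma Wt_carrier: "x \<in> Wt \<mu> \<Longrightarrow> x \<in> carrier V" by (simp add: Wt_def)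

lemma Wt_nil: "x \<in> Wt \<mu> \<Longrightarrow> i \<le> n \<Longrightarrow> nil (A i (\<mu> i)) x" by (simp add: Wt_def)

lemma csub_Wt: "csub V sc (Wt \<mu>)"
  by (rule csubI) (auto simp: Wt_def nil_zero nil_add nil_sc endo_A)

lemma T_Wt:
  assumes j: "j \<le> n" and x: "x \<in> Wt \<mu>" shows "T j x \<in> Wt (\<mu>(j := \<mu> j + 1))"
proof -
  have "nil (A i ((\<mu>(j := \<mu> j + 1)) i)) (T j x)" if i: "i \<le> n" for i
    by (rule nil_intertwine[where f="A i (\<mu> i)" and g="T j", OF endo_A[OF i] T_zero[OF j] A_T[OF i j, where \<mu>=\<mu>] Wt_carrier[OF x] Wt_nil[OF x i]])
  then show ?thesis using j Wt_carrier[OF x] by (simp add: Wt_def del: fun_upd_apply)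
qed

lemma D_Wt:
  assumes j: "j \<le> n" and x: "x \<in> Wt \<mu>" shows "D j x \<in> Wt (\<mu>(j := \<mu> j - 1))"
proof -
  have "nil (A i ((\<mu>(j := \<mu> j - 1)) i)) (D j x)" if i: "i \<le> n" for i
    by (rule nil_intertwine[where f="A i (\<mu> i)" and g="D j", OF endo_A[OF i] D_zero[OF j] A_D[OF i j, where \<mu>=\<mu>] Wt_carrier[OF x] Wt_nil[OF x i]])
  then show ?thesis using j Wt_carrier[OF x] by (simp add: Wt_def del: fun_upd_apply)
qed

lemma A_Wt:
  assumes j: "j \<le> n" and x: "x \<in> Wt \<mu>" shows "A j c x \<in> Wt \<mu>"
proof -
  have "nil (A i (\<mu> i)) (A j c x)" if i: "i \<le> n" for i
    by (rule nil_intertwine[where f="A i (\<mu> i)" and g="A j c", OF endo_A[OF i] endo_zero[OF endo_A[OF j]] A_A[OF i j] Wt_carrier[OF x] Wt_nil[OF x i]])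
  then show ?thesis using j Wt_carrier[OF x] by (simp add: Wt_def del: fun_upd_apply)
qed

text \<open>If t_j x = 0 then t_j \<partial>_j x = -x, yet \<mu>_j is the only eigenvalue of t_j
  \<partial>_j on this weight space.\<close>

lemma T_inj:
  assumes j: "j \<le> n" and "\<mu> j \<noteq> -1" shows "inj_on (T j) (Wt \<mu>)"
proof (rule lin_inj_on)
  show "cspace V sc" by unfold_locales
  show "lin_on (Wt \<mu>) V sc V sc (T j)" using lin_on_subset[OF T_lin[OF j]] Wt_carrier by blast
  show "csub V sc (Wt \<mu>)" by (rule csub_Wt)
  fix x assume x: "x \<in> Wt \<mu>" and "T j x = \<zero>"
  then have "T j (D j x) \<oplus> x = \<zero>" using DTi[OF j, of x] D_zero[OF j] Wt_carrier by simp
  then have "T j (D j x) = sc (-1) x" using j Wt_carrier[OF x] minus_equality[of "T j (D j x)" x] by (simp add: sc_minus1)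
  then have "A j (\<mu> j) x = sc (-1 - \<mu> j) x" using Wt_carrier[OF x] by (simp add: A_def sc_collect)
  moreover have "-1 - \<mu> j \<noteq> 0" using assms(2) by auto
  ultimately show "x = \<zero>" by (rule nil_eigen[OF endo_A[OF j] Wt_carrier[OF x] Wt_nil[OF x j]])
qed

text \<open>On the target space t_j \<partial>_j is \<mu>_j + 1 plus a nilpotent operator, hence
  onto, and \<partial>_j leads back to \<open>Wt \<mu>\<close>.\<close>

lemma T_surj:
  assumes j: "j \<le> n" and c: "\<mu> j \<noteq> -1" and y: "y \<in> Wt (\<mu>(j := \<mu> j + 1))"
  shows "\<exists>x\<in>Wt \<mu>. T j x = y"
proof -
  let ?\<mu> = "\<mu>(j := \<mu> j + 1)"
  have "\<exists>w\<in>Wt ?\<mu>. A j (?\<mu> j) w \<oplus> sc (?\<mu> j) w = y"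
  proof (rule nil_shift_surj[OF endo_A[OF j] csub_Wt _ y Wt_nil[OF y j]])
    show "?\<mu> j \<noteq> 0" using c by (simp add: eq_neg_iff_add_eq_0)
  qed (rule A_Wt[OF j])
  then obtain w where w: "w \<in> Wt ?\<mu>" "A j (?\<mu> j) w \<oplus> sc (?\<mu> j) w = y" by blast
  then have "T j (D j w) = y" using TD_A[OF j Wt_carrier[OF w(1)], of "?\<mu> j"] by simp
  moreover have "D j w \<in> Wt \<mu>" using D_Wt[OF j w(1)] by simp
  ultimately show ?thesis by blast
qed

end

text \<open>The defining conditions of the category in terms of operators alone; \<open>W_eq\<close>
  will turn out to be semisimplicity over the Euler differences.\<close>

locale weight_ops = weyl_ops V sc n T D for V :: "('v, 'x) ring_scheme" (structure) and sc n T D +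
  fixes \<nu> :: "nat \<Rightarrow> complex"
  assumes W_ids: "internal_direct_sum V (weights n) Wt"
    and W_supp: "\<mu> \<in> weights n \<Longrightarrow> Wt \<mu> \<noteq> {\<zero>} \<Longrightarrow> \<mu> \<in> weight_lattice n \<nu>"
    and W_fd: "\<mu> \<in> weights n \<Longrightarrow> fd V sc (Wt \<mu>)"
    and W_eq: "\<mu> \<in> weights n \<Longrightarrow> x \<in> Wt \<mu> \<Longrightarrow> i \<le> n \<Longrightarrow> j \<le> n \<Longrightarrow> A i (\<mu> i) x = A j (\<mu> j) x"

sublocale weight_ops \<subseteq> dsum V sc "weights n" Wt
  by unfold_locales (auto intro: csub_Wt W_ids)

section \<open>Semisimplicity over the Euler differences\<close>

text \<open>The spectral theory of one operator, in the amount required for Schur's lemma on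
  possibly infinite-dimensional modules.\<close>

locale endo_cspace = cspace V sc for V :: "('v, 'x) ring_scheme" (structure) and sc +
  fixes h :: "'v \<Rightarrow> 'v"
  assumes h: "lin_on (carrier V) V sc V sc h"
begin

definition sh :: "complex \<Rightarrow> 'v \<Rightarrow> 'v" where "sh c x = h x \<oplus> sc (- c) x"

text \<open>\<open>kill cs\<close> is the polynomial in \<open>h\<close> with the listed roots;
  polynomials are handled through their roots throughout.\<close>

primrec kill :: "complex list \<Rightarrow> 'v \<Rightarrow> 'v" where
  "kill [] x = x" | "kill (c # cs) x = kill cs (sh c x)"

lemma h_closed [simp]: "x \<in> carrier V \<Longrightarrow> h x \<in> carrier V" using lin_onD(1)[OF h] .

lemma endo_sh: "endo (sh c)"
  unfolding sh_def[abs_def] by (rule endo_add[OF h endo_sc])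

lemma sh_closed [simp]: "x \<in> carrier V \<Longrightarrow> sh c x \<in> carrier V" by (simp add: sh_def)

lemma kill_closed [simp]: "x \<in> carrier V \<Longrightarrow> kill cs x \<in> carrier V"
  by (induction cs arbitrary: x) auto

lemma endo_kill: "endo (kill cs)"
proof (induction cs)
  case Nil show ?case using endo_id by (simp add: lin_on_def)
next
  case (Cons c cs)
  show ?case using endo_comp[OF endo_sh Cons, of c] by (simp add: lin_on_def)
qed

lemma sh_sh: "x \<in> carrier V \<Longrightarrow> sh c (sh d x) = sh d (sh c x)"
  by (simp add: sh_def lin_onD(2,3)[OF h] sc_r a_ac mult.commute)

lemma kill_sh: "x \<in> carrier V \<Longrightarrow> kill cs (sh c x) = sh c (kill cs x)"
proof (induction cs arbitrary: x)
  case (Cons a cs)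
  then show ?case by (simp add: sh_sh[of x a c])
qed simp

lemma kill_append: "kill (cs @ ds) x = kill ds (kill cs x)"
  by (induction cs arbitrary: x) auto

lemma kill_kill: "x \<in> carrier V \<Longrightarrow> kill cs (kill ds x) = kill ds (kill cs x)"
  by (induction ds arbitrary: x) (auto simp: kill_sh)

lemma kill_zero [simp]: "kill cs \<zero> = \<zero>" using endo_zero[OF endo_kill] .

definition alg :: "'v \<Rightarrow> bool" where "alg x \<longleftrightarrow> (\<exists>cs. kill cs x = \<zero>)"

lemma alg_add: assumes "x \<in> carrier V" "y \<in> carrier V" "alg x" "alg y" shows "alg (x \<oplus> y)"
proof -
  obtain cs ds where "kill cs x = \<zero>" "kill ds y = \<zero>" using assms by (auto simp: alg_def)
  then have "kill (cs @ ds) (x \<oplus> y) = \<zero>"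
    using assms lin_onD(2)[OF endo_kill] kill_kill[of y ds cs] by (simp add: kill_append)
  then show ?thesis by (auto simp: alg_def)
qed

lemma alg_zero: "alg \<zero>" by (auto simp: alg_def)

lemma nil_alg: "nil (sh c) x \<Longrightarrow> alg x"
proof -
  have "kill (replicate N c) y = (sh c ^^ N) y" for N y
    by (induction N arbitrary: y) (auto simp: funpow_swap1)
  then show "nil (sh c) x \<Longrightarrow> alg x" unfolding nil_def alg_def by metis
qed

text \<open>Apply the factors of an annihilating product one by one: the last nonzero vector is an
  eigenvector, and it never leaves \<open>S\<close>.\<close>

lemma eigenvector_exists:
  assumes S: "\<And>c x. x \<in> S \<Longrightarrow> sh c x \<in> S" and "alg s" "s \<in> S" "s \<noteq> \<zero>"
  shows "\<exists>c. \<exists>t\<in>S. t \<noteq> \<zero> \<and> sh c t = \<zero>"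
proof -
  obtain cs where "kill cs s = \<zero>" using assms by (auto simp: alg_def)
  then show ?thesis using assms(3,4)
  proof (induction cs arbitrary: s)
    case (Cons c cs)
    show ?case
    proof (cases "sh c s = \<zero>")
      case True then show ?thesis using Cons.prems by blast
    next
      case False then show ?thesis using Cons.IH[of "sh c s"] Cons.prems S by simp
    qed
  qed simp
qed

text \<open>A power of \<open>h - c\<close> and a product of factors with other roots are coprime,
  so a vector killed by both is zero.\<close>

lemma nil_kill_zero:
  assumes "nil (sh c) w" "kill cs w = \<zero>" "c \<notin> set cs" "w \<in> carrier V"
  shows "w = \<zero>"
  using assms
proof (induction cs arbitrary: w)
  case (Cons d ds)
  have "nil (sh c) (sh d w)"
    by (rule nil_intertwine[where g="sh d" and f="sh c", OF endo_sh endo_zero[OF endo_sh] _ Cons.prems(4,1)]) (rule sh_sh)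
  then have z: "sh d w = \<zero>" using Cons.IH[of "sh d w"] Cons.prems by simp
  have "sh c w = sh d w \<oplus> sc (d - c) w"
    using Cons.prems(4) by (simp add: sh_def a_assoc sc_collect)
  then have "sh c w = sc (d - c) w" using z Cons.prems(4) by simp
  then show ?case using nil_eigen[OF endo_sh Cons.prems(4,1)] Cons.prems(3) by auto
qed simp

end

context weyl_ops begin

definition Hd :: "nat \<Rightarrow> nat \<Rightarrow> 'v \<Rightarrow> 'v" where
  "Hd i j x = T i (D i x) \<oplus> sc (-1) (T j (D j x))"

lemma endo_Hd: "i \<le> n \<Longrightarrow> j \<le> n \<Longrightarrow> endo (Hd i j)"
  unfolding Hd_def[abs_def] by (rule endo_add[OF endo_comp[OF D_lin T_lin] endo_comp[OF endo_comp[OF D_lin T_lin] endo_sc]])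

lemma Hd_closed [simp]: "i \<le> n \<Longrightarrow> j \<le> n \<Longrightarrow> x \<in> carrier V \<Longrightarrow> Hd i j x \<in> carrier V"
  using lin_onD(1)[OF endo_Hd] .

lemma Hd_A: "i \<le> n \<Longrightarrow> j \<le> n \<Longrightarrow> x \<in> carrier V \<Longrightarrow>
  Hd i j x \<oplus> sc (- (c - d)) x = A i c x \<oplus> sc (-1) (A j d x)"
  by (simp add: Hd_def A_def sc_r a_ac sc_collect sc_collect_mid)

lemma Hd_Hd: "i \<le> n \<Longrightarrow> j \<le> n \<Longrightarrow> k \<le> n \<Longrightarrow> l \<le> n \<Longrightarrow> x \<in> carrier V \<Longrightarrow> Hd i j (Hd k l x) = Hd k l (Hd i j x)"
proof -
  assume le: "i \<le> n" "j \<le> n" "k \<le> n" "l \<le> n" and x: "x \<in> carrier V"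
  have "A p 0 y = T p (D p y)" if "p \<le> n" "y \<in> carrier V" for p y using that by (simp add: A_def)
  then have "T p (D p (T q (D q x))) = T q (D q (T p (D p x)))" if "p \<le> n" "q \<le> n" for p q
    using A_A[of p q x 0 0] that x by simp
  then show ?thesis
    using le x by (simp add: Hd_def T_add D_add T_sc D_sc sc_r a_ac)
qed

text \<open>The difference of the commuting nilpotent operators t_i \<partial>_i - \<mu>_i and t_j
  \<partial>_j - \<mu>_j is nilpotent by \<open>nil_diff\<close>.\<close>

lemma Wt_nil_Hd:
  assumes "i \<le> n" "j \<le> n" "x \<in> Wt \<mu>"
  shows "nil (endo_cspace.sh V sc (Hd i j) (\<mu> i - \<mu> j)) x"
proof -
  interpret E: endo_cspace V sc "Hd i j" by unfold_locales (rule endo_Hd[OF assms(1,2)])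
  have x: "x \<in> carrier V" using Wt_carrier[OF assms(3)] .
  have "nil (\<lambda>x. A i (\<mu> i) x \<oplus> sc (-1) (A j (\<mu> j) x)) x"
    using assms x by (intro nil_diff endo_A A_A Wt_nil)
  from nil_intertwine[where g="\<lambda>x. x" and f'="E.sh (\<mu> i - \<mu> j)", OF _ _ _ x this]
  show ?thesis
    using endo_add[OF endo_A[OF assms(1)] endo_comp[OF endo_A[OF assms(2)] endo_sc]] Hd_A[OF assms(1,2)]
    by (simp add: E.sh_def)
qed

lemma Wt_Hd:
  assumes "i \<le> n" "j \<le> n" "x \<in> Wt \<mu>" "A i (\<mu> i) x = A j (\<mu> j) x"
  shows "Hd i j x = sc (\<mu> i - \<mu> j) x"
proof -
  have x: "x \<in> carrier V" using Wt_carrier[OF assms(3)] .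
  have "Hd i j x \<oplus> sc (- (\<mu> i - \<mu> j)) x = \<zero>"
    unfolding Hd_A[OF assms(1,2) x] using assms x by (simp add: sc_minus1 r_neg)
  then have "Hd i j x \<oplus> sc (-1) (sc (\<mu> i - \<mu> j) x) = \<zero>" using x by simp
  then show ?thesis using diff_zero[of "Hd i j x" "sc (\<mu> i - \<mu> j) x"] x assms by simp
qed

end

locale weyl_module = left_module "weyl n" M for n and M :: "(cpoly \<Rightarrow> cpoly, 'a) module"

sublocale weyl_module \<subseteq> weyl_ops M "wsc n M" n "wt n M" "wd n M"
  by (rule weyl_module_ops) unfold_locales

context weyl_module begin

lemma euler_closed: "i \<le> n \<Longrightarrow> euler_op n i \<in> carrier (weyl n)"
  unfolding euler_op_def by (intro R.m_closed weyl_gen)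

lemma euler_act: "i \<le> n \<Longrightarrow> x \<in> carrier M \<Longrightarrow> smult M (euler_op n i) x = wt n M i (wd n M i x)"
  unfolding euler_op_def by (rule smult_assoc1) auto

lemma euler_shift_act: "i \<le> n \<Longrightarrow> x \<in> carrier M \<Longrightarrow> smult M (euler_op n i \<ominus>\<^bsub>weyl n\<^esub> scalar_op n c) x = A i c x"
  using smult_diff_l[OF euler_closed[of i] weyl_gen(1)[of n c], of x] M.minus_eq[of "smult M (euler_op n i) x"]
  by (simp add: euler_act A_def sc_minus)

lemma weight_space_Wt: "weight_space n M \<mu> = Wt \<mu>"
proof -
  have pw: "smult M ((euler_op n i \<ominus>\<^bsub>weyl n\<^esub> scalar_op n (\<mu> i)) [^]\<^bsub>weyl n\<^esub> N) x = (A i (\<mu> i) ^^ N) x"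
    if i: "i \<le> n" and x: "x \<in> carrier M" for i N x
  proof -
    have "((\<lambda>y. smult M (euler_op n i \<ominus>\<^bsub>weyl n\<^esub> scalar_op n (\<mu> i)) y) ^^ N) x = (A i (\<mu> i) ^^ N) x"
      by (induction N) (use i x endo_A euler_shift_act in auto)
    then show ?thesis using smult_pow[OF R.minus_closed[OF euler_closed[OF i] weyl_gen(1)] x] by simp
  qed
  show ?thesis
  proof (intro subset_antisym subsetI)
    fix x assume "x \<in> weight_space n M \<mu>"
    then show "x \<in> Wt \<mu>" unfolding weight_space_def Wt_def nil_def using pw by fastforce
  next
    fix x assume x: "x \<in> Wt \<mu>"
    then have xc: "x \<in> carrier M" by (rule Wt_carrier)
    have "\<forall>i\<in>{0..n}. \<exists>N. (A i (\<mu> i) ^^ N) x = \<zero>\<^bsub>M\<^esub>" using x by (auto simp: Wt_def nil_def)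
    from bchoice[OF this] obtain N where N: "\<And>i. i \<in> {0..n} \<Longrightarrow> (A i (\<mu> i) ^^ N i) x = \<zero>\<^bsub>M\<^esub>" by blast
    \<comment> \<open>The sum of the exponents bounds each of them, and \<open>Suc\<close> makes the
      common exponent positive.\<close>
    have "(A i (\<mu> i) ^^ (Suc (\<Sum>i\<in>{0..n}. N i))) x = \<zero>\<^bsub>M\<^esub>" if i: "i \<in> {0..n}" for i
    proof (rule pow_zero_mono[OF endo_A N[OF i]])
      show "N i \<le> Suc (\<Sum>i\<in>{0..n}. N i)" using member_le_sum[OF i, of N] by simp
    qed (use i in auto)
    then show "x \<in> weight_space n M \<mu>"
      unfolding weight_space_def using pw xc by (auto intro!: exI[of _ "Suc (\<Sum>i\<in>{0..n}. N i)"])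
  qed
qed

lemma Hd_act: "i \<le> n \<Longrightarrow> j \<le> n \<Longrightarrow> x \<in> carrier M \<Longrightarrow> smult M (euler_op n i \<ominus>\<^bsub>weyl n\<^esub> euler_op n j) x = Hd i j x"
  using smult_diff_l[OF euler_closed[of i] euler_closed[of j], of x] M.minus_eq[of "smult M (euler_op n i) x"]
  by (simp add: euler_act Hd_def sc_minus1)

abbreviation dgens :: "(cpoly \<Rightarrow> cpoly) set" where
  "dgens \<equiv> range (scalar_op n) \<union> {euler_op n i \<ominus>\<^bsub>weyl n\<^esub> euler_op n j | i j. i \<in> {0..n} \<and> j \<in> {0..n}}"

text \<open>\<open>euler_differences\<close> is generated by the scalars and the differences, so
  stability may be tested on these.\<close>

lemma submodule_differences_iff:
  "submodule S (euler_differences n) M \<longleftrightarrow> csub M (wsc n M) S \<and> (\<forall>i\<le>n. \<forall>j\<le>n. \<forall>x\<in>S. Hd i j x \<in> S)"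
proof
  have car: "carrier (euler_differences n) = generate_ring (weyl n) dgens" by (simp add: euler_differences_def)
  have gc: "dgens \<subseteq> carrier (weyl n)" using euler_closed by (auto intro!: R.minus_closed)
  {
    assume S: "submodule S (euler_differences n) M"
    then have sub: "additive_subgroup S M" by (simp add: submodule_def additive_subgroup_def)
    have cl: "smult M a x \<in> S" if "a \<in> dgens" "x \<in> S" for a x
      using submodule.smult_closed[OF S, of a x] that generate_ring.incl[OF that(1)] unfolding car by blast
    have "Hd i j x \<in> S" if "i \<le> n" "j \<le> n" "x \<in> S" for i j x
    proof -
      have "euler_op n i \<ominus>\<^bsub>weyl n\<^esub> euler_op n j \<in> dgens" using that by auto
      from cl[OF this that(3)] show ?thesis
        using Hd_act[of i j x] that additive_subgroup.a_subset[OF sub] by auto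
    qed
    then show "csub M (wsc n M) S \<and> (\<forall>i\<le>n. \<forall>j\<le>n. \<forall>x\<in>S. Hd i j x \<in> S)"
      using sub cl by (auto simp: csub_def)
  next
    assume S: "csub M (wsc n M) S \<and> (\<forall>i\<le>n. \<forall>j\<le>n. \<forall>x\<in>S. Hd i j x \<in> S)"
    then have c: "csub M (wsc n M) S" by blast
    have "\<forall>x\<in>S. smult M a x \<in> S" if "a \<in> generate_ring (weyl n) dgens" for a
      using that
    proof (induction a rule: generate_ring.induct)
      case one then show ?case using csubD(6)[OF c] by (simp add: smult_one del: weyl_fields)
    next
      case (incl a)
      then show ?case using S csubD(5,6)[OF c] by (auto simp: Hd_act)
    next
      case (a_inv a)
      then have "a \<in> carrier (weyl n)" using R.generate_ring_in_carrier[OF gc] by blast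
      then show ?case using a_inv csubD(4,6)[OF c] by (simp add: smult_neg_l)
    next
      case (eng_add a b)
      then have "a \<in> carrier (weyl n)" "b \<in> carrier (weyl n)" using R.generate_ring_in_carrier[OF gc] by blast+
      then show ?case using eng_add csubD(2,6)[OF c] by (simp add: smult_l_distr del: weyl_fields)
    next
      case (eng_mult a b)
      then have "a \<in> carrier (weyl n)" "b \<in> carrier (weyl n)" using R.generate_ring_in_carrier[OF gc] by blast+
      then show ?case using eng_mult csubD(6)[OF c] by (simp add: smult_assoc1 del: weyl_fields)
    qed
    moreover have "subgroup S (add_monoid M)" using c by (simp add: csub_def additive_subgroup_def)
    ultimately show "submodule S (euler_differences n) M"
      unfolding submodule_def submodule_axioms_def car by blast
  }
qed

text \<open>By Schur's lemma every difference of Euler operators is diagonalizable on a semisimple module, so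
  its only eigenvalue on the weight space of \<open>\<mu>\<close> being \<open>\<mu> i - \<mu> j\<close>, it acts there by this scalar.\<close>

lemma semisimple_imp_eq:
  assumes ss: "semisimple_module (euler_differences n) M"
    and ids: "internal_direct_sum M (weights n) Wt"
    and \<mu>: "\<mu> \<in> weights n" and m: "m \<in> Wt \<mu>" and i: "i \<le> n" and j: "j \<le> n"
  shows "A i (\<mu> i) m = A j (\<mu> j) m"
proof -
  interpret E: endo_cspace M "wsc n M" "Hd i j" by unfold_locales (rule endo_Hd[OF i j])
  interpret W: dsum M "wsc n M" "weights n" Wt by unfold_locales (auto intro: csub_Wt ids)
  \<comment> \<open>Annihilating products exist on weight spaces by nilpotency and pass to sums,
    although \<open>M\<close> may be infinite-dimensional.\<close>
  have alg: "E.alg x" if xc: "x \<in> carrier M" for x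
  proof (rule W.dsum_induct[OF xc, of E.alg])
    show "E.alg \<zero>\<^bsub>M\<^esub>" by (rule E.alg_zero)
    show "E.alg x" if "x \<in> Wt \<mu>" for \<mu> x using E.nil_alg Wt_nil_Hd[OF i j that] by blast
    show "E.alg (x \<oplus>\<^bsub>M\<^esub> y)" if "x \<in> carrier M" "y \<in> carrier M" "E.alg x" "E.alg y" for x y using E.alg_add that .
  qed
  have mc: "m \<in> carrier M" by (rule Wt_carrier[OF m])
  have scal: "\<exists>c. \<forall>s\<in>S. E.sh c s = \<zero>\<^bsub>M\<^esub>" if simple: "simple_submodule S (euler_differences n) M" for S
  proof -
    have "submodule S (euler_differences n) M" "S \<noteq> {\<zero>\<^bsub>M\<^esub>}" using simple by (auto simp: simple_submodule_def)
    then have S: "csub M (wsc n M) S" "\<And>p q x. p \<le> n \<Longrightarrow> q \<le> n \<Longrightarrow> x \<in> S \<Longrightarrow> Hd p q x \<in> S" and ne: "S \<noteq> {\<zero>\<^bsub>M\<^esub>}"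
      unfolding submodule_differences_iff by auto
    obtain s where s: "s \<in> S" "s \<noteq> \<zero>\<^bsub>M\<^esub>" using ne csubD(3)[OF S(1)] by auto
    have Ssh: "E.sh c x \<in> S" if "x \<in> S" for c x
      unfolding E.sh_def using csubD(2,5)[OF S(1)] S(2)[OF i j that] that by simp
    obtain c t where t: "t \<in> S" "t \<noteq> \<zero>\<^bsub>M\<^esub>" "E.sh c t = \<zero>\<^bsub>M\<^esub>"
      using E.eigenvector_exists[OF Ssh alg s] csubD(6)[OF S(1) s(1)] by blast
    \<comment> \<open>The eigenspace inside \<open>S\<close> is a submodule because the Euler
      differences commute; by simplicity it is all of \<open>S\<close>.\<close>
    let ?T = "{x \<in> S. E.sh c x = \<zero>\<^bsub>M\<^esub>}"
    have Sc: "x \<in> carrier M" if "x \<in> S" for x using csubD(6)[OF S(1) that] .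
    have "csub M (wsc n M) ?T"
      using csubD(2,3,5)[OF S(1)] Sc lin_onD(2,3)[OF E.endo_sh[of c]] endo_zero[OF E.endo_sh[of c]]
      by (intro csubI) auto
    moreover have "Hd p q x \<in> ?T" if pq: "p \<le> n" "q \<le> n" and x: "x \<in> ?T" for p q x
    proof -
      have "E.sh c (Hd p q x) = Hd p q (E.sh c x)"
      proof -
        have xM: "x \<in> carrier M" using x Sc by blast
        then show ?thesis
          using i j lin_onD(2,3)[OF endo_Hd[OF pq]] Hd_Hd[OF i j pq xM] by (simp add: E.sh_def)
      qed
      then show ?thesis using x S(2)[OF pq] endo_zero[OF endo_Hd[OF pq]] by simp
    qed
    ultimately have "submodule ?T (euler_differences n) M" unfolding submodule_differences_iff by blast
    moreover have "?T \<noteq> {\<zero>\<^bsub>M\<^esub>}" using t by blast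
    ultimately have "?T = S" using simple unfolding simple_submodule_def by blast
    then show ?thesis by blast
  qed
  from bspec[OF ss[unfolded semisimple_module_def] mc]
  obtain F x where Fx: "finite F \<and> (\<forall>S\<in>F. simple_submodule S (euler_differences n) M \<and> x S \<in> S) \<and>
    m = (\<Oplus>\<^bsub>M\<^esub>S\<in>F. x S)" by (elim exE)
  then have F: "finite F" "\<And>S. S \<in> F \<Longrightarrow> simple_submodule S (euler_differences n) M \<and> x S \<in> S"
    "m = (\<Oplus>\<^bsub>M\<^esub>S\<in>F. x S)" by auto
  have "\<forall>S\<in>F. \<exists>c. E.sh c (x S) = \<zero>\<^bsub>M\<^esub>"
  proof
    fix S assume S: "S \<in> F"
    obtain c where "\<forall>s\<in>S. E.sh c s = \<zero>\<^bsub>M\<^esub>" using scal F(2)[OF S] by blast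
    then show "\<exists>c. E.sh c (x S) = \<zero>\<^bsub>M\<^esub>" using F(2)[OF S] by blast
  qed
  from bchoice[OF this] obtain cc where cc: "\<And>S. S \<in> F \<Longrightarrow> E.sh (cc S) (x S) = \<zero>\<^bsub>M\<^esub>" by blast
  have xc: "x S \<in> carrier M" if "S \<in> F" for S
  proof -
    have "csub M (wsc n M) S" "x S \<in> S"
      using F(2)[OF that] unfolding simple_submodule_def submodule_differences_iff by blast+
    then show ?thesis by (rule csubD(6))
  qed
  let ?c = "\<mu> i - \<mu> j"
  \<comment> \<open>The other eigenvalues occurring in the decomposition of \<open>m\<close>.
    Summands with eigenvalue \<open>?c\<close> die under \<open>E.sh ?c\<close>, the remaining ones
    under \<open>E.kill cs\<close>.\<close>
  obtain cs where cs: "set cs = cc ` F - {?c}" using finite_list[of "cc ` F - {?c}"] F(1) by blast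
  have kill0: "E.kill ds y = \<zero>\<^bsub>M\<^esub>" if "E.sh d y = \<zero>\<^bsub>M\<^esub>" "d \<in> set ds" "y \<in> carrier M" for d ds y
    using that
  proof (induction ds arbitrary: y)
    case (Cons e es)
    show ?case
    proof (cases "d = e")
      case False
      have "E.sh d (E.sh e y) = \<zero>\<^bsub>M\<^esub>" using E.sh_sh[of y d e] Cons.prems endo_zero[OF E.endo_sh] by simp
      then show ?thesis using Cons False by simp
    qed (use Cons in simp)
  qed simp
  have "E.kill cs (E.sh ?c m) = (\<Oplus>\<^bsub>M\<^esub>S\<in>F. E.kill cs (E.sh ?c (x S)))"
    unfolding F(3) using F(1) xc cspace_axioms
    by (intro lin_finsum[OF _ endo_comp[OF E.endo_sh E.endo_kill] csub_carrier]) auto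
  also have "\<dots> = (\<Oplus>\<^bsub>M\<^esub>S\<in>F. \<zero>\<^bsub>M\<^esub>)"
  proof (intro finsum_cong')
    fix S assume S: "S \<in> F"
    show "E.kill cs (E.sh ?c (x S)) = \<zero>\<^bsub>M\<^esub>"
    proof (cases "cc S = ?c")
      case True then show ?thesis using cc[OF S] by simp
    next
      case False
      then have "cc S \<in> set cs" using cs S by auto
      then have "E.kill cs (x S) = \<zero>\<^bsub>M\<^esub>" using kill0 cc[OF S] xc[OF S] by blast
      then show ?thesis using E.kill_sh[OF xc[OF S]] endo_zero[OF E.endo_sh] by simp
    qed
  qed auto
  finally have k: "E.kill cs (E.sh ?c m) = \<zero>\<^bsub>M\<^esub>" by simp
  \<comment> \<open>Thus \<open>E.sh ?c m\<close> is killed both by a power of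
    \<open>E.sh ?c\<close> and by factors with roots other than \<open>?c\<close>.\<close>
  have "nil (E.sh ?c) (E.sh ?c m)"
    by (rule nil_intertwine[where g="E.sh ?c" and f="E.sh ?c", OF E.endo_sh endo_zero[OF E.endo_sh] refl mc Wt_nil_Hd[OF i j m]])
  then have "E.sh ?c m = \<zero>\<^bsub>M\<^esub>" using E.nil_kill_zero[OF _ k] cs mc by simp
  then have "A i (\<mu> i) m \<oplus>\<^bsub>M\<^esub> wsc n M (-1) (A j (\<mu> j) m) = \<zero>\<^bsub>M\<^esub>"
    using Hd_A[OF i j mc] by (simp add: E.sh_def)
  then show ?thesis using diff_zero i j mc by simp
qed

text \<open>Now the Euler differences act by scalars on weight spaces, so every line in a weight space is a
  simple submodule.\<close>

lemma eq_imp_semisimple: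
  assumes ids: "internal_direct_sum M (weights n) Wt"
    and eq: "\<And>\<mu> x i j. \<mu> \<in> weights n \<Longrightarrow> x \<in> Wt \<mu> \<Longrightarrow> i \<le> n \<Longrightarrow> j \<le> n \<Longrightarrow> A i (\<mu> i) x = A j (\<mu> j) x"
  shows "semisimple_module (euler_differences n) M"
  unfolding semisimple_module_def
proof
  interpret W: dsum M "wsc n M" "weights n" Wt by unfold_locales (auto intro: csub_Wt ids)
  fix m assume m: "m \<in> carrier M"
  define line where "line x = (\<lambda>c. wsc n M c x) ` UNIV" for x
  have xl: "x \<in> line x" if "x \<in> carrier M" for x
    unfolding line_def by (rule image_eqI[of _ _ 1]) (use that in auto)
  have simple: "simple_submodule (line x) (euler_differences n) M"
    if \<mu>: "\<mu> \<in> weights n" and x: "x \<in> Wt \<mu>" "x \<noteq> \<zero>\<^bsub>M\<^esub>" for \<mu> x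
    unfolding simple_submodule_def
  proof (intro conjI allI impI)
    have xc: "x \<in> carrier M" using Wt_carrier x by blast
    have z: "\<zero>\<^bsub>M\<^esub> \<in> line x" unfolding line_def by (rule image_eqI[of _ _ 0]) (use xc in auto)
    have "csub M (wsc n M) (line x)"
    proof (rule csubI)
      show "line x \<subseteq> carrier M" using xc by (auto simp: line_def)
      show "a \<oplus>\<^bsub>M\<^esub> b \<in> line x" if ab: "a \<in> line x" "b \<in> line x" for a b
      proof -
        obtain c d where "a = wsc n M c x" "b = wsc n M d x" using ab by (auto simp: line_def)
        then have "a \<oplus>\<^bsub>M\<^esub> b = wsc n M (c + d) x" using sc_l[OF xc] by simp
        then show ?thesis unfolding line_def by blast
      qed
      show "wsc n M c a \<in> line x" if ab: "a \<in> line x" for a c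
      proof -
        obtain d where "a = wsc n M d x" using ab by (auto simp: line_def)
        then have "wsc n M c a = wsc n M (c * d) x" using sc_sc[OF xc] by simp
        then show ?thesis unfolding line_def by blast
      qed
    qed (rule z)
    moreover have "Hd p q y \<in> line x" if pq: "p \<le> n" "q \<le> n" and y: "y \<in> line x" for p q y
    proof -
      obtain c where c: "y = wsc n M c x" using y by (auto simp: line_def)
      have "Hd p q y = wsc n M c (Hd p q x)" unfolding c using lin_onD(3)[OF endo_Hd[OF pq] xc] .
      also have "Hd p q x = wsc n M (\<mu> p - \<mu> q) x" by (rule Wt_Hd[OF pq x(1) eq[OF \<mu> x(1) pq]])
      finally show ?thesis using xc by (simp add: line_def)
    qed
    ultimately show "submodule (line x) (euler_differences n) M" unfolding submodule_differences_iff by blast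
    show "line x \<noteq> {\<zero>\<^bsub>M\<^esub>}" using xl[OF xc] x by blast
    fix T assume T: "submodule T (euler_differences n) M \<and> T \<subseteq> line x"
    then have Tc: "csub M (wsc n M) T" unfolding submodule_differences_iff by blast
    show "T = {\<zero>\<^bsub>M\<^esub>} \<or> T = line x"
    proof (cases "T = {\<zero>\<^bsub>M\<^esub>}")
      case False
      then obtain t where t: "t \<in> T" "t \<noteq> \<zero>\<^bsub>M\<^esub>" using csubD(3)[OF Tc] by blast
      obtain c where c: "t = wsc n M c x" using T t by (auto simp: line_def)
      have "c \<noteq> 0" using c t xc by auto
      have "wsc n M d x \<in> T" for d
        using csubD(5)[OF Tc t(1), of "d / c"] \<open>c \<noteq> 0\<close> xc unfolding c by simp
      then show ?thesis using T by (auto simp: line_def)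
    qed simp
  qed
  let ?S = "W.supp m" and ?l = "\<lambda>\<mu>. line (W.comp m \<mu>)"
  have S: "\<mu> \<in> weights n" "W.comp m \<mu> \<in> Wt \<mu>" "W.comp m \<mu> \<noteq> \<zero>\<^bsub>M\<^esub>" if "\<mu> \<in> ?S" for \<mu>
    using that m W.comp_in by (auto simp: W.supp_def)
  \<comment> \<open>\<open>semisimple_module\<close> indexes the summands by the submodules
    themselves, so components of different weights must span different lines.\<close>
  have inj: "inj_on ?l ?S"
  proof (rule inj_onI)
    fix \<mu> \<mu>' assume a: "\<mu> \<in> ?S" "\<mu>' \<in> ?S" "?l \<mu> = ?l \<mu>'"
    then have "W.comp m \<mu> \<in> ?l \<mu>'" using xl[OF Wt_carrier[OF S(2)[OF a(1)]]] by simp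
    then have "W.comp m \<mu> \<in> Wt \<mu>'" using csubD(5)[OF csub_Wt S(2)[OF a(2)]] by (auto simp: line_def)
    then show "\<mu> = \<mu>'"
      using W.comp_W[OF S(1)[OF a(1)] S(2)[OF a(1)] S(1)[OF a(1)]] W.comp_W[OF S(1)[OF a(2)] _ S(1)[OF a(1)], of "W.comp m \<mu>"]
        S(3)[OF a(1)] by (auto split: if_splits)
  qed
  let ?x = "\<lambda>L. W.comp m (inv_into ?S ?l L)"
  have x: "?x (?l \<mu>) = W.comp m \<mu>" if "\<mu> \<in> ?S" for \<mu> using inv_into_f_f[OF inj that] by simp
  have cl: "W.comp m \<mu> \<in> carrier M" if "\<mu> \<in> ?S" for \<mu> using Wt_carrier[OF S(2)[OF that]] .
  have "(\<Oplus>\<^bsub>M\<^esub>L\<in>?l ` ?S. ?x L) = (\<Oplus>\<^bsub>M\<^esub>\<mu>\<in>?S. ?x (?l \<mu>))"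
    by (rule finsum_reindex) (use inj x cl in auto)
  also have "\<dots> = (\<Oplus>\<^bsub>M\<^esub>\<mu>\<in>?S. W.comp m \<mu>)"
    by (rule finsum_cong') (use x cl in auto)
  also have "\<dots> = m" using W.comp_props(3)[OF m] by simp
  finally have "m = (\<Oplus>\<^bsub>M\<^esub>L\<in>?l ` ?S. ?x L)" by simp
  moreover have "simple_submodule L (euler_differences n) M \<and> ?x L \<in> L" if L: "L \<in> ?l ` ?S" for L
  proof -
    obtain \<mu> where \<mu>: "\<mu> \<in> ?S" "L = ?l \<mu>" using L by blast
    then show ?thesis using simple[OF S[OF \<mu>(1)]] x[OF \<mu>(1)] xl[OF cl[OF \<mu>(1)]] by simp
  qed
  ultimately show "\<exists>F x. finite F \<and> (\<forall>S\<in>F. simple_submodule S (euler_differences n) M \<and> x S \<in> S) \<and> m = (\<Oplus>\<^bsub>M\<^esub>S\<in>F. x S)"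
    using W.comp_props(2)[OF m] by (intro exI[of _ "?l ` ?S"] exI[of _ ?x]) blast
qed

end

text \<open>Combines \<open>semisimple_imp_eq\<close> and \<open>eq_imp_semisimple\<close>; the
  remaining conditions translate one by one.\<close>

theorem sb_Obj_iff:
  "M \<in> Obj (sb_weight_category n \<nu>) \<longleftrightarrow> left_module (weyl n) M \<and> weight_ops M (wsc n M) n (wt n M) (wd n M) \<nu>"
proof (cases "left_module (weyl n) M")
  case True
  then interpret left_module "weyl n" M .
  interpret weyl_module n M by unfold_locales
  have supp: "weight_support n M \<subseteq> {\<mu> \<in> weights n. \<forall>i\<in>{0..n}. \<mu> i - \<nu> i \<in> \<int>} \<longleftrightarrow>
    (\<forall>\<mu>\<in>weights n. Wt \<mu> \<noteq> {\<zero>\<^bsub>M\<^esub>} \<longrightarrow> \<mu> \<in> weight_lattice n \<nu>)"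
    unfolding weight_support_def weight_space_Wt weight_lattice_def by blast
  have "M \<in> Obj (sb_weight_category n \<nu>) \<longleftrightarrow> internal_direct_sum M (weights n) Wt \<and>
    (\<forall>\<mu>\<in>weights n. Wt \<mu> \<noteq> {\<zero>\<^bsub>M\<^esub>} \<longrightarrow> \<mu> \<in> weight_lattice n \<nu>) \<and> (\<forall>\<mu>\<in>weights n. fd M (wsc n M) (Wt \<mu>)) \<and>
    semisimple_module (euler_differences n) M"
    using True supp
    by (simp add: sb_weight_category_def module_category_def generalized_weight_module_def
      weight_space_Wt[abs_def] finite_dimensional_iff)
  also have "\<dots> \<longleftrightarrow> weight_ops M (wsc n M) n (wt n M) (wd n M) \<nu>"
  proof
    assume a: "internal_direct_sum M (weights n) Wt \<and>
      (\<forall>\<mu>\<in>weights n. Wt \<mu> \<noteq> {\<zero>\<^bsub>M\<^esub>} \<longrightarrow> \<mu> \<in> weight_lattice n \<nu>) \<and> (\<forall>\<mu>\<in>weights n. fd M (wsc n M) (Wt \<mu>)) \<and>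
      semisimple_module (euler_differences n) M"
    show "weight_ops M (wsc n M) n (wt n M) (wd n M) \<nu>"
    proof (intro weight_ops.intro weyl_ops_axioms weight_ops_axioms.intro)
      fix \<mu> x i j assume "\<mu> \<in> weights n" "x \<in> Wt \<mu>" "i \<le> n" "j \<le> n"
      then show "A i (\<mu> i) x = A j (\<mu> j) x" using a by (intro semisimple_imp_eq) blast+
    qed (use a in blast)+
  next
    assume "weight_ops M (wsc n M) n (wt n M) (wd n M) \<nu>"
    then interpret w: weight_ops M "wsc n M" n "wt n M" "wd n M" \<nu> .
    show "internal_direct_sum M (weights n) Wt \<and>
      (\<forall>\<mu>\<in>weights n. Wt \<mu> \<noteq> {\<zero>\<^bsub>M\<^esub>} \<longrightarrow> \<mu> \<in> weight_lattice n \<nu>) \<and> (\<forall>\<mu>\<in>weights n. fd M (wsc n M) (Wt \<mu>)) \<and>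
      semisimple_module (euler_differences n) M"
    proof (intro conjI ballI impI)
      show "semisimple_module (euler_differences n) M"
        by (rule eq_imp_semisimple[OF w.W_ids w.W_eq])
    qed (use w.W_ids w.W_supp w.W_fd in blast)+
  qed
  finally show ?thesis using True by simp
next
  case False
  then show ?thesis by (simp add: sb_weight_category_def module_category_def)
qed

section \<open>Combinatorics of the weight lattice: classes, representatives and paths\<close>

section \<open>Classes of weights\<close>

text \<open>The enumeration \<open>idx\<close> matches the integral coordinates with the generators
  \<theta>_1, ..., \<theta>_k.\<close>

locale int_index =
  fixes n k :: nat and \<nu> :: "nat \<Rightarrow> complex" and idx :: "nat \<Rightarrow> nat"
  assumes nu: "\<nu> \<in> weights n" and idx: "bij_betw idx {1..k} (Int_indices n \<nu>)"
begin

abbreviation "\<Lambda> \<equiv> weight_lattice n \<nu>"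

definition jx :: "nat \<Rightarrow> nat" where "jx i = inv_into {1..k} idx i"

text \<open>For \<open>\<mu>\<close> in the lattice, \<open>cl \<mu>\<close> records which of the integral coordinates are negative. The map
  \<open>t\<^sub>i\<close> is bijective on a weight space unless it changes this class.\<close>

definition cl :: "(nat \<Rightarrow> complex) \<Rightarrow> (nat \<Rightarrow>\<^sub>0 bit)" where
  "cl \<mu> = (\<Sum>j\<in>{1..k}. Poly_Mapping.single j (if Re (\<mu> (idx j)) < 0 then 1 else 0))"

text \<open>The values -1 and 0 are the two ends of the one step at which t_i may fail to be
  bijective, so representatives of neighbouring classes are joined by exactly that step.\<close>

definition rep :: "(nat \<Rightarrow>\<^sub>0 bit) \<Rightarrow> nat \<Rightarrow> complex" where
  "rep h = (\<lambda>i\<in>{0..n}. if i \<in> Int_indices n \<nu> then (if Poly_Mapping.lookup h (jx i) = 1 then -1 else 0) else \<nu> i)"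

lemma idx_in: "j \<in> {1..k} \<Longrightarrow> idx j \<in> Int_indices n \<nu>" using idx by (auto simp: bij_betw_def)

lemma idx_le: "j \<in> {1..k} \<Longrightarrow> idx j \<le> n" using idx_in by (auto simp: Int_indices_def)

lemma jx_idx [simp]: "j \<in> {1..k} \<Longrightarrow> jx (idx j) = j"
  unfolding jx_def using idx by (auto simp: bij_betw_def)

lemma idx_jx: "i \<in> Int_indices n \<nu> \<Longrightarrow> jx i \<in> {1..k} \<and> idx (jx i) = i"
  unfolding jx_def using idx by (metis bij_betw_def f_inv_into_f inv_into_into)

lemma idx_inj: "j \<in> {1..k} \<Longrightarrow> j' \<in> {1..k} \<Longrightarrow> idx j = idx j' \<longleftrightarrow> j = j'"
  by (metis jx_idx)

lemma lookup_cl: "Poly_Mapping.lookup (cl \<mu>) j = (if j \<in> {1..k} \<and> Re (\<mu> (idx j)) < 0 then 1 else 0)"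
proof -
  have "Poly_Mapping.lookup (cl \<mu>) j = (\<Sum>j'\<in>{1..k}. if j' = j then (if Re (\<mu> (idx j)) < 0 then 1 else 0) else 0)"
    unfolding cl_def lookup_sum lookup_single when_def by (rule sum.cong) auto
  then show ?thesis by (simp add: sum.delta)
qed

lemma cl_Gk [simp]: "cl \<mu> \<in> Gk k"
  by (auto simp: Gk_def in_keys_iff lookup_cl split: if_splits)

lemma lattice_diff: "\<mu> \<in> \<Lambda> \<Longrightarrow> i \<le> n \<Longrightarrow> \<mu> i - \<nu> i \<in> \<int>"
  unfolding weight_lattice_def by simp

lemma lattice_Int: "\<mu> \<in> \<Lambda> \<Longrightarrow> i \<in> Int_indices n \<nu> \<Longrightarrow> \<mu> i \<in> \<int>"
proof -
  assume "\<mu> \<in> \<Lambda>" "i \<in> Int_indices n \<nu>"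
  then have "\<mu> \<in> \<Lambda>" and i: "i \<le> n" "\<nu> i \<in> \<int>" by (simp_all add: Int_indices_def)
  have "\<mu> i - \<nu> i \<in> \<int>" using lattice_diff[OF \<open>\<mu> \<in> \<Lambda>\<close> i(1)] .
  from this i(2) have "(\<mu> i - \<nu> i) + \<nu> i \<in> \<int>" by (rule Ints_add)
  then show ?thesis by simp
qed

lemma lattice_not_Int: "\<mu> \<in> \<Lambda> \<Longrightarrow> i \<le> n \<Longrightarrow> i \<notin> Int_indices n \<nu> \<Longrightarrow> \<mu> i \<notin> \<int>"
proof
  assume a: "\<mu> \<in> \<Lambda>" "i \<le> n" "i \<notin> Int_indices n \<nu>" "\<mu> i \<in> \<int>"
  then have "\<mu> i - (\<mu> i - \<nu> i) \<in> \<int>" using Ints_diff lattice_diff by blast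
  then show False using a by (simp add: Int_indices_def)
qed

lemma Int_of_Ints: "\<mu> \<in> \<Lambda> \<Longrightarrow> i \<le> n \<Longrightarrow> \<mu> i \<in> \<int> \<Longrightarrow> i \<in> Int_indices n \<nu>"
  using lattice_not_Int by blast

lemma rep_lattice [simp]: "rep h \<in> \<Lambda>"
proof -
  have "rep h i - \<nu> i \<in> \<int>" if "i \<le> n" for i
  proof (cases "i \<in> Int_indices n \<nu>")
    case True
    then have "\<nu> i \<in> \<int>" by (simp add: Int_indices_def)
    then show ?thesis using that True by (auto simp: rep_def intro!: Ints_diff)
  qed (use that in \<open>simp add: rep_def\<close>)
  then show ?thesis by (auto simp: weight_lattice_def weights_def rep_def)
qed

lemma rep_idx: "j \<in> {1..k} \<Longrightarrow> rep h (idx j) = (if Poly_Mapping.lookup h j = 1 then -1 else 0)"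
  using idx_in[of j] idx_le[of j] by (simp add: rep_def)

lemma cl_rep [simp]: "h \<in> Gk k \<Longrightarrow> cl (rep h) = h"
proof (rule poly_mapping_eqI)
  fix j assume h: "h \<in> Gk k"
  show "Poly_Mapping.lookup (cl (rep h)) j = Poly_Mapping.lookup h j"
  proof (cases "j \<in> {1..k}")
    case True
    then show ?thesis by (cases "Poly_Mapping.lookup h j") (auto simp: lookup_cl rep_idx)
  next
    case False
    then have "Poly_Mapping.lookup h j = 0" using h by (auto simp: Gk_def in_keys_iff)
    then show ?thesis using False by (auto simp: lookup_cl)
  qed
qed

text \<open>Adding 1 to an integer changes whether it is negative only at -1.\<close>

lemma cl_up: "\<mu> \<in> \<Lambda> \<Longrightarrow> i \<le> n \<Longrightarrow> \<mu> i \<noteq> -1 \<Longrightarrow> cl (\<mu>(i := \<mu> i + 1)) = cl \<mu>"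
proof (rule poly_mapping_eqI)
  fix j assume \<mu>: "\<mu> \<in> \<Lambda>" and i: "i \<le> n" and ne: "\<mu> i \<noteq> -1"
  have "Re (\<mu> i + 1) < 0 \<longleftrightarrow> Re (\<mu> i) < 0" if "j \<in> {1..k}" "idx j = i"
  proof -
    have "\<mu> i \<in> \<int>" using lattice_Int[OF \<mu>] idx_in that by blast
    then obtain m :: int where m: "\<mu> i = of_int m" by (auto elim: Ints_cases)
    then have "m \<noteq> -1" using ne by auto
    then show ?thesis using m by auto
  qed
  then show "Poly_Mapping.lookup (cl (\<mu>(i := \<mu> i + 1))) j = Poly_Mapping.lookup (cl \<mu>) j"
    by (auto simp: lookup_cl)
qed

lemma cross_Int: "\<mu> \<in> \<Lambda> \<Longrightarrow> i \<le> n \<Longrightarrow> \<mu> i \<in> \<int> \<Longrightarrow> jx i \<in> {1..k} \<and> idx (jx i) = i"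
  using Int_of_Ints idx_jx by blast

lemma cl_cross: "\<mu> \<in> \<Lambda> \<Longrightarrow> i \<le> n \<Longrightarrow> \<mu> i = -1 \<Longrightarrow> cl (\<mu>(i := \<mu> i + 1)) = cl \<mu> + Poly_Mapping.single (jx i) 1"
proof (rule poly_mapping_eqI)
  fix j assume \<mu>: "\<mu> \<in> \<Lambda>" and i: "i \<le> n" and e: "\<mu> i = -1"
  have J: "jx i \<in> {1..k} \<and> idx (jx i) = i" by (rule cross_Int[OF \<mu> i]) (simp add: e)
  show "Poly_Mapping.lookup (cl (\<mu>(i := \<mu> i + 1))) j = Poly_Mapping.lookup (cl \<mu> + Poly_Mapping.single (jx i) 1) j"
  proof (cases "j = jx i")
    case True then show ?thesis using J e by (simp add: lookup_cl lookup_add)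
  next
    case False
    then have "j \<in> {1..k} \<Longrightarrow> idx j \<noteq> i" by auto
    then show ?thesis using False by (auto simp: lookup_cl lookup_add lookup_single)
  qed
qed

lemma bit_single_twice: "(g :: nat \<Rightarrow>\<^sub>0 bit) + Poly_Mapping.single j 1 + Poly_Mapping.single j 1 = g"
  by (rule poly_mapping_eqI) (simp only: lookup_add lookup_single when_def, simp add: add.assoc)

lemma cl_down: "\<mu> \<in> \<Lambda> \<Longrightarrow> i \<le> n \<Longrightarrow> \<mu> i \<noteq> 0 \<Longrightarrow> cl (\<mu>(i := \<mu> i - 1)) = cl \<mu>"
  using cl_up[OF lattice_down, of \<mu> i i] by (simp add: fun_upd_idem del: fun_upd_apply) simp

lemma cl_cross_down: "\<mu> \<in> \<Lambda> \<Longrightarrow> i \<le> n \<Longrightarrow> \<mu> i = 0 \<Longrightarrow> cl (\<mu>(i := \<mu> i - 1)) = cl \<mu> + Poly_Mapping.single (jx i) 1"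
proof -
  assume a: "\<mu> \<in> \<Lambda>" "i \<le> n" "\<mu> i = 0"
  have "cl \<mu> = cl (\<mu>(i := \<mu> i - 1)) + Poly_Mapping.single (jx i) 1"
    using cl_cross[OF lattice_down[OF a(1,2)] a(2)] a(3) by (simp add: fun_upd_idem)
  then show ?thesis using bit_single_twice by metis
qed

text \<open>The displacement of \<mu> from the representative of its class. For lattice weights the
  difference is an integer, so the floor only converts types.\<close>

definition off :: "(nat \<Rightarrow> complex) \<Rightarrow> nat \<Rightarrow> int" where
  "off \<mu> i = \<lfloor>Re (\<mu> i - rep (cl \<mu>) i)\<rfloor>"

lemma off: "\<mu> \<in> \<Lambda> \<Longrightarrow> i \<le> n \<Longrightarrow> \<mu> i = rep (cl \<mu>) i + of_int (off \<mu> i)"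
proof -
  assume \<mu>: "\<mu> \<in> \<Lambda>" and i: "i \<le> n"
  have "(\<mu> i - \<nu> i) - (rep (cl \<mu>) i - \<nu> i) \<in> \<int>"
    using Ints_diff[OF lattice_diff[OF \<mu> i] lattice_diff[OF rep_lattice i]] .
  then have "\<mu> i - rep (cl \<mu>) i \<in> \<int>" by simp
  then obtain m :: int where m: "\<mu> i - rep (cl \<mu>) i = of_int m" by (auto elim: Ints_cases)
  then have "off \<mu> i = m" by (simp add: off_def)
  then show ?thesis using m by (simp add: algebra_simps)
qed

lemma off_Int:
  assumes "\<mu> \<in> \<Lambda>" "i \<in> Int_indices n \<nu>"
  shows "if Re (\<mu> i) < 0 then rep (cl \<mu>) i = -1 \<and> off \<mu> i \<le> 0 else rep (cl \<mu>) i = 0 \<and> off \<mu> i \<ge> 0"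
proof -
  have i: "i \<le> n" using assms by (auto simp: Int_indices_def)
  have J: "jx i \<in> {1..k}" "idx (jx i) = i" using idx_jx[OF assms(2)] by auto
  have r: "rep (cl \<mu>) i = (if Re (\<mu> i) < 0 then -1 else 0)"
    using rep_idx[OF J(1), of "cl \<mu>"] J by (simp add: lookup_cl)
  obtain m :: int where m: "\<mu> i = of_int m" using lattice_Int[OF assms] by (auto elim: Ints_cases)
  then show ?thesis using r by (auto simp: off_def)
qed

text \<open>For an integral coordinate a positive displacement means that the path starts at 0 and
  rises; a nonintegral coordinate never meets -1.\<close>

lemma no_cross_above:
  assumes "\<mu> \<in> \<Lambda>" "i \<le> n" "m < nat (off \<mu> i)" shows "rep (cl \<mu>) i + of_nat m \<noteq> -1"
proof (cases "i \<in> Int_indices n \<nu>")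
  case True
  have "rep (cl \<mu>) i = 0" using off_Int[OF assms(1) True] assms(3) by (auto split: if_splits)
  then have "rep (cl \<mu>) i + of_nat m + 1 = of_nat (Suc m)" by simp
  also have "\<dots> \<noteq> 0" using of_nat_neq_0 by blast
  finally show ?thesis by auto
next
  case False
  show ?thesis
  proof
    assume "rep (cl \<mu>) i + of_nat m = -1"
    then have "rep (cl \<mu>) i = of_int (- 1 - int m)" by (simp add: algebra_simps eq_diff_eq)
    then have "rep (cl \<mu>) i \<in> \<int>" by simp
    then show False using lattice_not_Int[OF rep_lattice assms(2) False] by blast
  qed
qed

text \<open>An integral coordinate rises here from a negative integer and ends at -1, so every step
  starts strictly below -1.\<close>

lemma no_cross_below:
  assumes "\<mu> \<in> \<Lambda>" "i \<le> n" "m < nat (- off \<mu> i)" shows "\<mu> i + of_nat m \<noteq> -1"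
proof
  assume e: "\<mu> i + of_nat m = -1"
  then have "\<mu> i = of_int (- 1 - int m)" by (simp add: algebra_simps eq_diff_eq)
  then have "\<mu> i \<in> \<int>" by simp
  then have I: "i \<in> Int_indices n \<nu>" using Int_of_Ints assms by blast
  have r: "rep (cl \<mu>) i = -1" using off_Int[OF assms(1) I] assms(3) by (auto split: if_splits)
  have "of_int (off \<mu> i + int m) = (0 :: complex)" using off[OF assms(1,2)] e r by simp
  then have "off \<mu> i + int m = 0" by (simp only: of_int_eq_0_iff)
  then show False using assms(3) by auto
qed

text \<open>Any weight is joined to its representative by steps that do not cross from -1 to 0,
  along which \<open>P\<close> is invariant by assumption.\<close>

lemma connected_to_rep:
  assumes step: "\<And>\<mu> i. \<mu> \<in> \<Lambda> \<Longrightarrow> i \<le> n \<Longrightarrow> \<mu> i \<noteq> -1 \<Longrightarrow> P \<mu> \<longleftrightarrow> P (\<mu>(i := \<mu> i + 1))"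
    and \<mu>: "\<mu> \<in> \<Lambda>"
  shows "P \<mu> \<longleftrightarrow> P (rep (cl \<mu>))"
proof -
  have steps: "\<kappa>(i := \<kappa> i + of_nat N) \<in> \<Lambda> \<and> (P \<kappa> \<longleftrightarrow> P (\<kappa>(i := \<kappa> i + of_nat N)))"
    if "\<kappa> \<in> \<Lambda>" "i \<le> n" "\<And>m. m < N \<Longrightarrow> \<kappa> i + of_nat m \<noteq> -1" for \<kappa> i N
    using that(3)
  proof (induction N)
    case 0 then show ?case using that by simp
  next
    case (Suc N)
    let ?\<kappa> = "\<kappa>(i := \<kappa> i + of_nat N)"
    have "\<kappa> i + of_nat m \<noteq> -1" if "m < N" for m using Suc.prems[OF less_SucI[OF that]] .
    note IH' = Suc.IH[OF this]
    have IH: "?\<kappa> \<in> \<Lambda>" using IH' by (rule conjunct1)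
    have IH2: "P \<kappa> \<longleftrightarrow> P ?\<kappa>" using IH' by (rule conjunct2)
    have "?\<kappa> i \<noteq> -1" using Suc.prems[of N] by simp
    have "?\<kappa>(i := ?\<kappa> i + 1) = \<kappa>(i := \<kappa> i + of_nat (Suc N))" by (simp add: algebra_simps)
    then show ?case using step[OF IH that(2) \<open>?\<kappa> i \<noteq> -1\<close>] lattice_up[OF IH that(2)] IH2 by metis
  qed
  let ?\<rho> = "rep (cl \<mu>)"
  \<comment> \<open>\<open>mix K\<close> has its first \<open>K\<close> coordinates already moved to
    the representative.\<close>
  define mix where "mix K = (\<lambda>i. if i < K then ?\<rho> i else \<mu> i)" for K
  have mixL: "mix K \<in> \<Lambda>" for K
  proof -
    have "\<mu> \<in> \<Lambda>" "?\<rho> \<in> \<Lambda>" using \<mu> by auto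
    then show ?thesis unfolding weight_lattice_def weights_def mix_def
      by (auto simp: PiE_def extensional_def)
  qed
  have "P \<mu> \<longleftrightarrow> P (mix K)" if "K \<le> Suc n" for K
    using that
  proof (induction K)
    case 0 then show ?case by (simp add: mix_def)
  next
    case (Suc K)
    have K: "K \<le> n" using Suc by simp
    have e: "mix (Suc K) = (mix K)(K := ?\<rho> K)" "mix K = (mix (Suc K))(K := \<mu> K)" by (auto simp: mix_def)
    have mK: "mix K K = \<mu> K" "mix (Suc K) K = ?\<rho> K" by (auto simp: mix_def)
    \<comment> \<open>The available steps go upwards, so a coordinate above its representative value
      is reached from it, and one below is moved up to it.\<close>
    have "P (mix K) \<longleftrightarrow> P (mix (Suc K))"
    proof (cases "off \<mu> K \<ge> 0")
      case True
      then have "\<mu> K = ?\<rho> K + of_nat (nat (off \<mu> K))" using off[OF \<mu> K] by simp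
      then show ?thesis
        using steps[OF mixL[of "Suc K"] K, of "nat (off \<mu> K)"] no_cross_above[OF \<mu> K] mK e(2) by simp
    next
      case False
      then have "?\<rho> K = \<mu> K + of_nat (nat (- off \<mu> K))" using off[OF \<mu> K] by simp
      then show ?thesis
        using steps[OF mixL[of K] K, of "nat (- off \<mu> K)"] no_cross_below[OF \<mu> K] mK e(1) by simp
    qed
    then show ?case using Suc by simp
  qed
  moreover have "mix (Suc n) = ?\<rho>"
  proof
    fix i
    have "\<mu> i = undefined" "?\<rho> i = undefined" if "i > n"
      using that lattice_weights[OF \<mu>] by (auto simp: weights_def PiE_def extensional_def rep_def)
    then show "mix (Suc n) i = ?\<rho> i" by (auto simp: mix_def)
  qed
  ultimately show ?thesis by (metis order_refl)
qed

end

section \<open>Monomials in the variables on weight spaces\<close>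

definition wplus :: "(nat \<Rightarrow> complex) \<Rightarrow> (nat \<Rightarrow> nat) \<Rightarrow> nat \<Rightarrow> (nat \<Rightarrow> complex)" where
  "wplus \<mu> a K = (\<lambda>i. if i < K then \<mu> i + of_nat (a i) else \<mu> i)"

context weyl_ops begin

lemma T_pow_bij:
  assumes i: "i \<le> n" and nc: "\<And>m. m < N \<Longrightarrow> \<mu> i + of_nat m \<noteq> -1"
  shows "bij_betw (T i ^^ N) (Wt \<mu>) (Wt (\<mu>(i := \<mu> i + of_nat N)))"
  using nc
proof (induction N)
  case 0 then show ?case by (simp add: bij_betw_def)
next
  case (Suc N)
  let ?\<mu> = "\<mu>(i := \<mu> i + of_nat N)"
  have ne: "?\<mu> i \<noteq> -1" using Suc.prems[of N] by simp
  have "T i ` Wt ?\<mu> = Wt (?\<mu>(i := ?\<mu> i + 1))"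
    using T_Wt[OF i] T_surj[of i ?\<mu>, OF i ne] by (force simp: image_iff)
  then have "bij_betw (T i) (Wt ?\<mu>) (Wt (?\<mu>(i := ?\<mu> i + 1)))"
    using T_inj[of i ?\<mu>, OF i ne] by (simp add: bij_betw_def)
  moreover have "?\<mu>(i := ?\<mu> i + 1) = \<mu>(i := \<mu> i + of_nat (Suc N))" by (simp add: algebra_simps)
  moreover have "\<mu> i + of_nat m \<noteq> -1" if "m < N" for m using Suc.prems[OF less_SucI[OF that]] .
  note Suc.IH[OF this]
  ultimately show ?case using bij_betw_trans by (metis funpow.simps(2))
qed

text \<open>Raising one coordinate leaves the others alone, so the bijections for the single
  coordinates can be composed.\<close>

lemma mop_T_bij:
  assumes "\<And>i m. i \<le> n \<Longrightarrow> m < a i \<Longrightarrow> \<mu> i + of_nat m \<noteq> -1" "K \<le> Suc n"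
  shows "bij_betw (mop T K a) (Wt \<mu>) (Wt (wplus \<mu> a K))"
  using assms(2)
proof (induction K)
  case 0
  have "mop T 0 a = id" by auto
  then show ?case by (simp add: wplus_def bij_betw_def)
next
  case (Suc K)
  let ?\<mu> = "wplus \<mu> a K"
  have e: "?\<mu>(K := ?\<mu> K + of_nat (a K)) = wplus \<mu> a (Suc K)" by (auto simp: wplus_def)
  have "bij_betw (T K ^^ a K) (Wt ?\<mu>) (Wt (wplus \<mu> a (Suc K)))"
    unfolding e[symmetric] by (rule T_pow_bij) (use Suc assms in \<open>auto simp: wplus_def\<close>)
  from bij_betw_trans[OF Suc.IH this] Suc.prems have "bij_betw ((T K ^^ a K) \<circ> mop T K a) (Wt \<mu>) (Wt (wplus \<mu> a (Suc K)))" by simp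
  moreover have "(T K ^^ a K) \<circ> mop T K a = mop T (Suc K) a" by auto
  ultimately show ?case by (simp only:)
qed

end

section \<open>Links between weight modules and graded data, and their construction from either
  side\<close>

section \<open>Graded data\<close>

text \<open>\<open>z\<close> is a separate datum since for \<open>k = 0\<close> there is no
  \<theta>_j to produce it. Nilpotency is asked of \<open>z\<close>; it passes to every \<theta>_j
  through \<open>th_sq\<close>.\<close>

locale graded_data = dsum V sc "Gk k" gr
  for V :: "('v, 'x) ring_scheme" (structure) and sc and k :: nat and gr :: "(nat \<Rightarrow>\<^sub>0 bit) \<Rightarrow> 'v set" +
  fixes th :: "nat \<Rightarrow> 'v \<Rightarrow> 'v" and z :: "'v \<Rightarrow> 'v"
  assumes th_lin: "j \<in> {1..k} \<Longrightarrow> lin_on (carrier V) V sc V sc (th j)"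
    and z_lin: "lin_on (carrier V) V sc V sc z"
    and th_gr: "j \<in> {1..k} \<Longrightarrow> h \<in> Gk k \<Longrightarrow> v \<in> gr h \<Longrightarrow> th j v \<in> gr (h + Poly_Mapping.single j 1)"
    and z_gr: "h \<in> Gk k \<Longrightarrow> v \<in> gr h \<Longrightarrow> z v \<in> gr h"
    and th_th: "i \<in> {1..k} \<Longrightarrow> j \<in> {1..k} \<Longrightarrow> v \<in> carrier V \<Longrightarrow> th i (th j v) = th j (th i v)"
    and th_sq: "j \<in> {1..k} \<Longrightarrow> v \<in> carrier V \<Longrightarrow> th j (th j v) = z v"
    and z_th: "j \<in> {1..k} \<Longrightarrow> v \<in> carrier V \<Longrightarrow> z (th j v) = th j (z v)"
    and z_nil: "v \<in> carrier V \<Longrightarrow> nil z v"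
    and V_fd: "fd V sc (carrier V)"
begin

lemma th_closed [simp]: "j \<in> {1..k} \<Longrightarrow> v \<in> carrier V \<Longrightarrow> th j v \<in> carrier V"
  using lin_onD(1)[OF th_lin] .
lemma z_closed [simp]: "v \<in> carrier V \<Longrightarrow> z v \<in> carrier V"
  using lin_onD(1)[OF z_lin] .
lemmas th_add = lin_onD(2)[OF th_lin] and th_sc = lin_onD(3)[OF th_lin]
  and z_add = lin_onD(2)[OF z_lin] and z_sc = lin_onD(3)[OF z_lin]

end

lemma Gk_single [simp]: "h \<in> Gk k \<Longrightarrow> j \<in> {1..k} \<Longrightarrow> h + Poly_Mapping.single j 1 \<in> Gk k"
  using Poly_Mapping.keys_add[of h "Poly_Mapping.single j 1"] by (auto simp: Gk_def split: if_splits)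

text \<open>The comparison maps \<open>\<phi> \<mu> : M\<^sup>(\<^sup>\<mu>\<^sup>) \<rightarrow> V\<^bsub>cl \<mu>\<^esub>\<close>, normalized such that \<open>t\<^sub>i\<close> becomes the identity
  whenever it does not change the class.\<close>

locale weight_link = int_index n k \<nu> idx + M: weight_ops M sc n T D \<nu> + V: graded_data V sd k gr th z
  for n k \<nu> idx and M :: "('m, 'x) ring_scheme" and sc T D and V :: "('v, 'y) ring_scheme" and sd gr th z +
  fixes \<phi> :: "(nat \<Rightarrow> complex) \<Rightarrow> 'm \<Rightarrow> 'v"
  assumes phi_lin: "\<mu> \<in> \<Lambda> \<Longrightarrow> lin_on (M.Wt \<mu>) M sc V sd (\<phi> \<mu>)"
    and phi_bij: "\<mu> \<in> \<Lambda> \<Longrightarrow> bij_betw (\<phi> \<mu>) (M.Wt \<mu>) (gr (cl \<mu>))"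
    and phi_T: "\<mu> \<in> \<Lambda> \<Longrightarrow> i \<le> n \<Longrightarrow> x \<in> M.Wt \<mu> \<Longrightarrow>
      \<phi> (\<mu>(i := \<mu> i + 1)) (T i x) = (if \<mu> i = -1 then th (jx i) (\<phi> \<mu> x) else \<phi> \<mu> x)"
    and phi_D: "\<mu> \<in> \<Lambda> \<Longrightarrow> i \<le> n \<Longrightarrow> x \<in> M.Wt \<mu> \<Longrightarrow>
      \<phi> (\<mu>(i := \<mu> i - 1)) (D i x) = (if \<mu> i = 0 then th (jx i) (\<phi> \<mu> x) else sd (\<mu> i) (\<phi> \<mu> x) \<oplus>\<^bsub>V\<^esub> z (\<phi> \<mu> x))"
    and phi_z: "\<mu> \<in> \<Lambda> \<Longrightarrow> i \<le> n \<Longrightarrow> x \<in> M.Wt \<mu> \<Longrightarrow> \<phi> \<mu> (M.A i (\<mu> i) x) = z (\<phi> \<mu> x)"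

section \<open>Homomorphisms between linked modules\<close>

context weight_link begin

lemma phi_in: "\<mu> \<in> \<Lambda> \<Longrightarrow> x \<in> M.Wt \<mu> \<Longrightarrow> \<phi> \<mu> x \<in> gr (cl \<mu>)"
  using phi_bij by (auto simp: bij_betw_def)

definition psi :: "(nat \<Rightarrow> complex) \<Rightarrow> 'v \<Rightarrow> 'm" where "psi \<mu> = inv_into (M.Wt \<mu>) (\<phi> \<mu>)"

lemma psi_in: "\<mu> \<in> \<Lambda> \<Longrightarrow> v \<in> gr (cl \<mu>) \<Longrightarrow> psi \<mu> v \<in> M.Wt \<mu>"
  unfolding psi_def using phi_bij[of \<mu>] by (auto simp: bij_betw_def inv_into_into)

lemma phi_psi [simp]: "\<mu> \<in> \<Lambda> \<Longrightarrow> v \<in> gr (cl \<mu>) \<Longrightarrow> \<phi> \<mu> (psi \<mu> v) = v"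
  unfolding psi_def using phi_bij[of \<mu>] by (auto simp: bij_betw_def f_inv_into_f)

lemma psi_phi [simp]: "\<mu> \<in> \<Lambda> \<Longrightarrow> x \<in> M.Wt \<mu> \<Longrightarrow> psi \<mu> (\<phi> \<mu> x) = x"
  unfolding psi_def using phi_bij[of \<mu>] by (auto simp: bij_betw_def)

lemma phi_inj: "\<mu> \<in> \<Lambda> \<Longrightarrow> x \<in> M.Wt \<mu> \<Longrightarrow> y \<in> M.Wt \<mu> \<Longrightarrow> \<phi> \<mu> x = \<phi> \<mu> y \<Longrightarrow> x = y"
  using psi_phi by metis

lemma Mcs: "cspace M sc" and Vcs: "cspace V sd" by unfold_locales

lemma psi_lin: "\<mu> \<in> \<Lambda> \<Longrightarrow> lin_on (gr (cl \<mu>)) V sd M sc (psi \<mu>)"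
  using M.lin_inv_into[OF Vcs phi_lin M.csub_Wt, of \<mu>] phi_bij[of \<mu>] unfolding psi_def bij_betw_def by simp

lemma Wt_off_lattice: "\<mu> \<in> weights n \<Longrightarrow> \<mu> \<notin> \<Lambda> \<Longrightarrow> x \<in> M.Wt \<mu> \<Longrightarrow> x = \<zero>\<^bsub>M\<^esub>"
  using M.W_supp by blast

end

locale weight_link_pair =
  L: weight_link n k \<nu> idx M sc T D V sd gr th z \<phi> + L': weight_link n k \<nu> idx M' sc' T' D' V' sd' gr' th' z' \<phi>'
  for n k \<nu> idx and M :: "('m, 'x) ring_scheme" and sc T D and V :: "('v, 'y) ring_scheme" and sd gr th z \<phi>
    and M' :: "('m2, 'x2) ring_scheme" and sc' T' D' and V' :: "('v2, 'y2) ring_scheme" and sd' gr' th' z' \<phi>'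
begin

definition whom :: "('m \<Rightarrow> 'm2) \<Rightarrow> bool" where
  "whom f \<longleftrightarrow> lin_on (carrier M) M sc M' sc' f \<and>
    (\<forall>i\<le>n. \<forall>x\<in>carrier M. f (T i x) = T' i (f x) \<and> f (D i x) = D' i (f x))"

definition ghom :: "('v \<Rightarrow> 'v2) \<Rightarrow> bool" where
  "ghom g \<longleftrightarrow> lin_on (carrier V) V sd V' sd' g \<and> (\<forall>h\<in>Gk k. g ` gr h \<subseteq> gr' h) \<and>
    (\<forall>v\<in>carrier V. (\<forall>j\<in>{1..k}. g (th j v) = th' j (g v)) \<and> g (z v) = z' (g v))"

text \<open>Commutation with the comparison maps, weight by weight; there is no global map from a
  module to its graded data.\<close>

definition corr :: "('m \<Rightarrow> 'm2) \<Rightarrow> ('v \<Rightarrow> 'v2) \<Rightarrow> bool" where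
  "corr f g \<longleftrightarrow> (\<forall>\<mu>\<in>L.\<Lambda>. \<forall>x\<in>L.M.Wt \<mu>. \<phi>' \<mu> (f x) = g (\<phi> \<mu> x))"

lemma whom_A: "whom f \<Longrightarrow> i \<le> n \<Longrightarrow> x \<in> carrier M \<Longrightarrow> f (L.M.A i c x) = L'.M.A i c (f x)"
proof -
  assume f: "whom f" and i: "i \<le> n" and x: "x \<in> carrier M"
  have "lin_on (carrier M) M sc M' sc' f" using f by (simp add: whom_def)
  from lin_onD(2,3)[OF this] show ?thesis using f i x by (simp add: whom_def L.M.A_def L'.M.A_def)
qed

lemma whom_Wt:
  assumes f: "whom f" and x: "x \<in> L.M.Wt \<mu>" shows "f x \<in> L'.M.Wt \<mu>"
proof -
  have xc: "x \<in> carrier M" using L.M.Wt_carrier x by blast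
  have fl: "lin_on (carrier M) M sc M' sc' f" using f by (simp add: whom_def)
  have "L'.M.nil (L'.M.A i (\<mu> i)) (f x)" if i: "i \<le> n" for i
  proof -
    have "(L'.M.A i (\<mu> i) ^^ N) (f x) = f ((L.M.A i (\<mu> i) ^^ N) x)" for N
      by (induction N) (use whom_A[OF f i] L.M.endo_pow_closed[OF L.M.endo_A[OF i] xc] in auto)
    moreover obtain N where "(L.M.A i (\<mu> i) ^^ N) x = \<zero>\<^bsub>M\<^esub>" using L.M.Wt_nil[OF x i] by (auto simp: L.M.nil_def)
    moreover have "f \<zero>\<^bsub>M\<^esub> = \<zero>\<^bsub>M'\<^esub>" by (rule L.M.lin_zero[OF L'.Mcs fl L.M.csub_carrier])
    ultimately show ?thesis unfolding L'.M.nil_def by metis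
  qed
  then show ?thesis using xc lin_onD(1)[OF fl] by (simp add: L'.M.Wt_def)
qed

text \<open>On each weight space \<open>f\<close> induces a map of graded pieces. It is unchanged
  along steps that do not cross, hence depends on the class only, and \<open>g\<close> is glued from
  its values at the representatives.\<close>

lemma corr_ex_ghom:
  assumes f: "whom f" shows "\<exists>g. ghom g \<and> corr f g"
proof -
  have fl: "lin_on (carrier M) M sc M' sc' f" using f by (simp add: whom_def)
  have fT: "\<And>i x. i \<le> n \<Longrightarrow> x \<in> carrier M \<Longrightarrow> f (T i x) = T' i (f x)"
    and fD: "\<And>i x. i \<le> n \<Longrightarrow> x \<in> carrier M \<Longrightarrow> f (D i x) = D' i (f x)" using f by (auto simp: whom_def)
  define G where "G \<mu> v = \<phi>' \<mu> (f (L.psi \<mu> v))" for \<mu> v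
  have Glin: "lin_on (gr (L.cl \<mu>)) V sd V' sd' (G \<mu>)" if \<mu>: "\<mu> \<in> L.\<Lambda>" for \<mu>
    unfolding G_def
  proof (rule lin_on_comp[OF _ L'.phi_lin[OF \<mu>]])
    show "lin_on (gr (L.cl \<mu>)) V sd M' sc' (\<lambda>v. f (L.psi \<mu> v))"
      by (rule lin_on_comp[OF L.psi_lin[OF \<mu>] fl]) (use L.psi_in[OF \<mu>] L.M.Wt_carrier in blast)
    show "f (L.psi \<mu> x) \<in> L'.M.Wt \<mu>" if "x \<in> gr (L.cl \<mu>)" for x
      using whom_Wt[OF f L.psi_in[OF \<mu> that]] .
  qed
  have step: "G (\<mu>(i := \<mu> i + 1)) v = G \<mu> v"
    if \<mu>: "\<mu> \<in> L.\<Lambda>" and i: "i \<le> n" and ne: "\<mu> i \<noteq> -1" and v: "v \<in> gr (L.cl \<mu>)" for \<mu> i v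
  proof -
    let ?\<mu> = "\<mu>(i := \<mu> i + 1)"
    have p: "L.psi \<mu> v \<in> L.M.Wt \<mu>" by (rule L.psi_in[OF \<mu> v])
    have up: "?\<mu> \<in> L.\<Lambda>" using \<mu> i by simp
    have Tp: "T i (L.psi \<mu> v) \<in> L.M.Wt ?\<mu>" by (rule L.M.T_Wt[OF i p])
    have "\<phi> ?\<mu> (T i (L.psi \<mu> v)) = v" using L.phi_T[OF \<mu> i p] ne L.phi_psi[OF \<mu> v] by simp
    then have "L.psi ?\<mu> v = T i (L.psi \<mu> v)" using L.psi_phi[OF up Tp] by simp
    then show ?thesis
      unfolding G_def using L'.phi_T[OF \<mu> i whom_Wt[OF f p]] ne fT[OF i L.M.Wt_carrier[OF p]] by simp
  qed
  have Grep: "G \<mu> v = G (L.rep (L.cl \<mu>)) v" if \<mu>: "\<mu> \<in> L.\<Lambda>" and v: "v \<in> gr (L.cl \<mu>)" for \<mu> v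
  proof -
    \<comment> \<open>Quantified over \<open>v\<close>, so that the property depends on the weight
      alone, as \<open>connected_to_rep\<close> requires.\<close>
    let ?P = "\<lambda>\<mu>. \<forall>v\<in>gr (L.cl \<mu>). G \<mu> v = G (L.rep (L.cl \<mu>)) v"
    have "?P \<mu> \<longleftrightarrow> ?P (L.rep (L.cl \<mu>))"
    proof (rule L.connected_to_rep[OF _ \<mu>])
      fix \<kappa> i assume a: "\<kappa> \<in> L.\<Lambda>" "i \<le> n" "\<kappa> i \<noteq> -1"
      show "?P \<kappa> \<longleftrightarrow> ?P (\<kappa>(i := \<kappa> i + 1))"
        unfolding L.cl_up[OF a] using step[OF a] by simp
    qed
    then show ?thesis using v by simp
  qed
  have "lin_on (gr h) V sd V' sd' (G (L.rep h))" if "h \<in> Gk k" for h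
    using Glin[OF L.rep_lattice, of h] that by simp
  then obtain g where g: "lin_on (carrier V) V sd V' sd' g" "\<And>h v. h \<in> Gk k \<Longrightarrow> v \<in> gr h \<Longrightarrow> g v = G (L.rep h) v"
    using L.V.linear_extension[OF L'.Vcs, of "\<lambda>h. G (L.rep h)"] by blast
  have corr: "\<phi>' \<mu> (f x) = g (\<phi> \<mu> x)" if \<mu>: "\<mu> \<in> L.\<Lambda>" and x: "x \<in> L.M.Wt \<mu>" for \<mu> x
    using g(2)[OF L.cl_Gk L.phi_in[OF \<mu> x]] Grep[OF \<mu> L.phi_in[OF \<mu> x]] L.psi_phi[OF \<mu> x] by (simp add: G_def)
  have surj: "\<exists>x\<in>L.M.Wt (L.rep h). v = \<phi> (L.rep h) x" if "h \<in> Gk k" "v \<in> gr h" for h v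
    using L.psi_in[OF L.rep_lattice, of v h] L.phi_psi[OF L.rep_lattice, of v h] that by (metis L.cl_rep)
  have "g v \<in> gr' h" if h: "h \<in> Gk k" and v: "v \<in> gr h" for h v
  proof -
    obtain x where x: "x \<in> L.M.Wt (L.rep h)" "v = \<phi> (L.rep h) x" using surj[OF h v] by blast
    then show ?thesis using corr[OF L.rep_lattice x(1)] L'.phi_in[OF L.rep_lattice whom_Wt[OF f x(1)]] h by simp
  qed
  moreover have "g (th j v) = th' j (g v)" if j: "j \<in> {1..k}" and v: "v \<in> carrier V" for j v
  proof (rule L.V.eq_on_W[OF L'.Vcs _ _ _ v])
    show "lin_on (carrier V) V sd V' sd' (\<lambda>v. g (th j v))"
      by (rule lin_on_comp[OF L.V.th_lin[OF j] g(1)]) (use j in simp)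
    show "lin_on (carrier V) V sd V' sd' (\<lambda>v. th' j (g v))"
      by (rule lin_on_comp[OF g(1) L'.V.th_lin[OF j]]) (use lin_onD(1)[OF g(1)] in simp)
    fix h v assume h: "h \<in> Gk k" and v: "v \<in> gr h"
    let ?\<mu> = "L.rep h" and ?i = "idx j"
    obtain x where x: "x \<in> L.M.Wt ?\<mu>" "v = \<phi> ?\<mu> x" using surj[OF h v] by blast
    have i: "?i \<le> n" by (rule L.idx_le[OF j])
    note xc = L.M.Wt_carrier[OF x(1)] and fx = whom_Wt[OF f x(1)]
    have gv: "g v = \<phi>' ?\<mu> (f x)" using corr[OF L.rep_lattice x(1)] x(2) by simp
    \<comment> \<open>At the representative, \<theta>_j is t_i or \<partial>_i according to the bit,
      and \<open>f\<close> commutes with both.\<close>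
    show "g (th j v) = th' j (g v)"
    proof (cases "Poly_Mapping.lookup h j = 1")
      case True
      then have e: "?\<mu> ?i = -1" using L.rep_idx[OF j] by simp
      let ?\<mu>' = "?\<mu>(?i := ?\<mu> ?i + 1)"
      have up: "?\<mu>' \<in> L.\<Lambda>" by (rule lattice_up[OF L.rep_lattice i])
      have "g (th j v) = g (\<phi> ?\<mu>' (T ?i x))" using L.phi_T[OF L.rep_lattice i x(1)] e x(2) j by simp
      also have "\<dots> = \<phi>' ?\<mu>' (T' ?i (f x))" using corr[OF up L.M.T_Wt[OF i x(1)]] fT[OF i xc] by simp
      also have "\<dots> = th' j (g v)" using L'.phi_T[OF L.rep_lattice i fx] e gv j by simp
      finally show ?thesis .
    next
      case False
      then have e: "?\<mu> ?i = 0" using L.rep_idx[OF j] by simp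
      let ?\<mu>' = "?\<mu>(?i := ?\<mu> ?i - 1)"
      have up: "?\<mu>' \<in> L.\<Lambda>" by (rule lattice_down[OF L.rep_lattice i])
      have "g (th j v) = g (\<phi> ?\<mu>' (D ?i x))" using L.phi_D[OF L.rep_lattice i x(1)] e x(2) j by simp
      also have "\<dots> = \<phi>' ?\<mu>' (D' ?i (f x))" using corr[OF up L.M.D_Wt[OF i x(1)]] fD[OF i xc] by simp
      also have "\<dots> = th' j (g v)" using L'.phi_D[OF L.rep_lattice i fx] e gv j by simp
      finally show ?thesis .
    qed
  qed
  moreover have "g (z v) = z' (g v)" if v: "v \<in> carrier V" for v
  proof (rule L.V.eq_on_W[OF L'.Vcs _ _ _ v])
    show "lin_on (carrier V) V sd V' sd' (\<lambda>v. g (z v))"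
      by (rule lin_on_comp[OF L.V.z_lin g(1)]) simp
    show "lin_on (carrier V) V sd V' sd' (\<lambda>v. z' (g v))"
      by (rule lin_on_comp[OF g(1) L'.V.z_lin]) (use lin_onD(1)[OF g(1)] in simp)
    fix h v assume h: "h \<in> Gk k" and v: "v \<in> gr h"
    obtain x where x: "x \<in> L.M.Wt (L.rep h)" "v = \<phi> (L.rep h) x" using surj[OF h v] by blast
    note r = L.rep_lattice[of h]
    \<comment> \<open>\<open>z\<close> can be read off from any coordinate; coordinate 0 always
      exists.\<close>
    have "g (z v) = g (\<phi> (L.rep h) (L.M.A 0 (L.rep h 0) x))" using L.phi_z[OF r _ x(1), of 0] x(2) by simp
    also have "\<dots> = \<phi>' (L.rep h) (L'.M.A 0 (L.rep h 0) (f x))"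
      using corr[OF r L.M.A_Wt[OF _ x(1)], of 0] whom_A[OF f _ L.M.Wt_carrier[OF x(1)], of 0] by simp
    also have "\<dots> = z' (g v)" using L'.phi_z[OF r _ whom_Wt[OF f x(1)], of 0] corr[OF r x(1)] x(2) by simp
    finally show "g (z v) = z' (g v)" .
  qed
  ultimately show ?thesis using g(1) corr unfolding ghom_def corr_def by blast
qed

text \<open>\<open>g\<close> is transported to each weight space by the comparison maps; commutation
  with t_i and \<partial>_i is checked after applying the injective \<open>\<phi>'\<close>.\<close>

lemma corr_ex_whom:
  assumes g: "ghom g" shows "\<exists>f. whom f \<and> corr f g"
proof -
  have gl: "lin_on (carrier V) V sd V' sd' g" and gg: "\<And>h v. h \<in> Gk k \<Longrightarrow> v \<in> gr h \<Longrightarrow> g v \<in> gr' h"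
    and gth: "\<And>j v. j \<in> {1..k} \<Longrightarrow> v \<in> carrier V \<Longrightarrow> g (th j v) = th' j (g v)"
    and gz: "\<And>v. v \<in> carrier V \<Longrightarrow> g (z v) = z' (g v)" using g by (auto simp: ghom_def)
  \<comment> \<open>Off the lattice the weight spaces of \<open>M\<close> are zero, and the zero map
    is a linear choice there.\<close>
  define F where "F \<mu> x = (if \<mu> \<in> L.\<Lambda> then L'.psi \<mu> (g (\<phi> \<mu> x)) else \<zero>\<^bsub>M'\<^esub>)" for \<mu> x
  have gphi: "g (\<phi> \<mu> x) \<in> gr' (L.cl \<mu>)" if "\<mu> \<in> L.\<Lambda>" "x \<in> L.M.Wt \<mu>" for \<mu> x
    using gg L.phi_in that by simp
  have "lin_on (L.M.Wt \<mu>) M sc M' sc' (F \<mu>)" for \<mu>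
  proof (cases "\<mu> \<in> L.\<Lambda>")
    case True
    have "lin_on (L.M.Wt \<mu>) M sc V' sd' (\<lambda>x. g (\<phi> \<mu> x))"
      by (rule lin_on_comp[OF L.phi_lin[OF True] gl]) (use lin_onD(1)[OF L.phi_lin[OF True]] in blast)
    then have "lin_on (L.M.Wt \<mu>) M sc M' sc' (\<lambda>x. L'.psi \<mu> (g (\<phi> \<mu> x)))"
      by (rule lin_on_comp[OF _ L'.psi_lin[OF True]]) (rule gphi[OF True])
    moreover have "F \<mu> = (\<lambda>x. L'.psi \<mu> (g (\<phi> \<mu> x)))" using True by (simp add: F_def fun_eq_iff)
    ultimately show ?thesis by simp
  next
    case False
    then show ?thesis by (auto intro!: lin_onI simp: F_def)
  qed
  then obtain f where f: "lin_on (carrier M) M sc M' sc' f" "\<And>\<mu> x. \<mu> \<in> weights n \<Longrightarrow> x \<in> L.M.Wt \<mu> \<Longrightarrow> f x = F \<mu> x"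
    using L.M.linear_extension[OF L'.Mcs, of F] by auto
  have fL: "f x = L'.psi \<mu> (g (\<phi> \<mu> x))" if "\<mu> \<in> L.\<Lambda>" "x \<in> L.M.Wt \<mu>" for \<mu> x
    using f(2)[OF lattice_weights[OF that(1)] that(2)] that by (simp add: F_def)
  have fW: "f x \<in> L'.M.Wt \<mu>" and corr: "\<phi>' \<mu> (f x) = g (\<phi> \<mu> x)" if "\<mu> \<in> L.\<Lambda>" "x \<in> L.M.Wt \<mu>" for \<mu> x
    using fL[OF that] L'.psi_in[OF that(1) gphi[OF that]] L'.phi_psi[OF that(1) gphi[OF that]] by simp_all
  have fz: "f \<zero>\<^bsub>M\<^esub> = \<zero>\<^bsub>M'\<^esub>" by (rule L.M.lin_zero[OF L'.Mcs f(1) L.M.csub_carrier])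
  have "f (T i x) = T' i (f x)" if i: "i \<le> n" and x: "x \<in> carrier M" for i x
  proof (rule L.M.eq_on_W[OF L'.Mcs _ _ _ x])
    show "lin_on (carrier M) M sc M' sc' (\<lambda>x. f (T i x))"
      by (rule lin_on_comp[OF L.M.T_lin[OF i] f(1)]) (use i in simp)
    show "lin_on (carrier M) M sc M' sc' (\<lambda>x. T' i (f x))"
      by (rule lin_on_comp[OF f(1) L'.M.T_lin[OF i]]) (use lin_onD(1)[OF f(1)] in simp)
    fix \<mu> x assume \<mu>w: "\<mu> \<in> weights n" and x: "x \<in> L.M.Wt \<mu>"
    show "f (T i x) = T' i (f x)"
    proof (cases "\<mu> \<in> L.\<Lambda>")
      case True
      let ?\<mu> = "\<mu>(i := \<mu> i + 1)"
      have up: "?\<mu> \<in> L.\<Lambda>" using True i by simp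
      have pc: "\<phi> \<mu> x \<in> carrier V" using lin_onD(1)[OF L.phi_lin[OF True] x] .
      have jj: "\<mu> i = -1 \<Longrightarrow> L.jx i \<in> {1..k}" using L.cross_Int[OF True i] by simp
      have "\<phi>' ?\<mu> (f (T i x)) = g (\<phi> ?\<mu> (T i x))" by (rule corr[OF up L.M.T_Wt[OF i x]])
      also have "\<dots> = \<phi>' ?\<mu> (T' i (f x))"
        using L.phi_T[OF True i x] L'.phi_T[OF True i fW[OF True x]] corr[OF True x] gth[OF jj pc] by simp
      finally show ?thesis by (rule L'.phi_inj[OF up fW[OF up L.M.T_Wt[OF i x]] L'.M.T_Wt[OF i fW[OF True x]]])
    next
      case False
      then have "x = \<zero>\<^bsub>M\<^esub>" using L.Wt_off_lattice[OF \<mu>w _ x] by blast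
      then show ?thesis using i by (simp add: fz L.M.T_zero L'.M.T_zero)
    qed
  qed
  moreover have "f (D i x) = D' i (f x)" if i: "i \<le> n" and x: "x \<in> carrier M" for i x
  proof (rule L.M.eq_on_W[OF L'.Mcs _ _ _ x])
    show "lin_on (carrier M) M sc M' sc' (\<lambda>x. f (D i x))"
      by (rule lin_on_comp[OF L.M.D_lin[OF i] f(1)]) (use i in simp)
    show "lin_on (carrier M) M sc M' sc' (\<lambda>x. D' i (f x))"
      by (rule lin_on_comp[OF f(1) L'.M.D_lin[OF i]]) (use lin_onD(1)[OF f(1)] in simp)
    fix \<mu> x assume \<mu>w: "\<mu> \<in> weights n" and x: "x \<in> L.M.Wt \<mu>"
    show "f (D i x) = D' i (f x)"
    proof (cases "\<mu> \<in> L.\<Lambda>")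
      case True
      let ?\<mu> = "\<mu>(i := \<mu> i - 1)"
      have up: "?\<mu> \<in> L.\<Lambda>" using True i by simp
      have pc: "\<phi> \<mu> x \<in> carrier V" using lin_onD(1)[OF L.phi_lin[OF True] x] .
      have jj: "\<mu> i = 0 \<Longrightarrow> L.jx i \<in> {1..k}" using L.cross_Int[OF True i] by simp
      have "\<phi>' ?\<mu> (f (D i x)) = g (\<phi> ?\<mu> (D i x))" by (rule corr[OF up L.M.D_Wt[OF i x]])
      also have "\<dots> = \<phi>' ?\<mu> (D' i (f x))"
        using L.phi_D[OF True i x] L'.phi_D[OF True i fW[OF True x]] corr[OF True x] gth[OF jj pc] gz[OF pc]
          lin_onD(2,3)[OF gl] pc by simp
      finally show ?thesis by (rule L'.phi_inj[OF up fW[OF up L.M.D_Wt[OF i x]] L'.M.D_Wt[OF i fW[OF True x]]])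
    next
      case False
      then have "x = \<zero>\<^bsub>M\<^esub>" using L.Wt_off_lattice[OF \<mu>w _ x] by blast
      then show ?thesis using i by (simp add: fz L.M.D_zero L'.M.D_zero)
    qed
  qed
  ultimately show ?thesis using f(1) corr unfolding whom_def corr_def by blast
qed

text \<open>Every homogeneous vector is a value of \<open>\<phi>\<close> at a representative weight,
  so \<open>corr\<close> determines \<open>g\<close>.\<close>

lemma corr_unique_ghom:
  assumes g: "ghom g" "ghom g'" and c: "corr f g" "corr f g'" and v: "v \<in> carrier V"
  shows "g v = g' v"
proof (rule L.V.eq_on_W[OF L'.Vcs _ _ _ v])
  show "lin_on (carrier V) V sd V' sd' g" "lin_on (carrier V) V sd V' sd' g'" using g by (auto simp: ghom_def)
  fix h v assume h: "h \<in> Gk k" and v: "v \<in> gr h"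
  have v': "v \<in> gr (L.cl (L.rep h))" using h v by simp
  show "g v = g' v"
    using c L.psi_in[OF L.rep_lattice v'] L.phi_psi[OF L.rep_lattice v'] unfolding corr_def by (metis L.rep_lattice)
qed

text \<open>\<open>\<phi>'\<close> is injective on weight spaces, so \<open>corr\<close> determines
  \<open>f\<close>.\<close>

lemma corr_unique_whom:
  assumes f: "whom f" "whom f'" and c: "corr f g" "corr f' g" and x: "x \<in> carrier M"
  shows "f x = f' x"
proof (rule L.M.eq_on_W[OF L'.Mcs _ _ _ x])
  show l: "lin_on (carrier M) M sc M' sc' f" "lin_on (carrier M) M sc M' sc' f'" using f by (auto simp: whom_def)
  fix \<mu> x assume \<mu>: "\<mu> \<in> weights n" and x: "x \<in> L.M.Wt \<mu>"
  show "f x = f' x"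
  proof (cases "\<mu> \<in> L.\<Lambda>")
    case True
    then show ?thesis
      using c x by (intro L'.phi_inj[OF True whom_Wt[OF f(1) x] whom_Wt[OF f(2) x]]) (simp add: corr_def)
  next
    case False
    then have "x = \<zero>\<^bsub>M\<^esub>" using L.Wt_off_lattice[OF \<mu> _ x] by blast
    then show ?thesis using L.M.lin_zero[OF L'.Mcs l(1) L.M.csub_carrier] L.M.lin_zero[OF L'.Mcs l(2) L.M.csub_carrier] by simp
  qed
qed

end

section \<open>From weight modules to graded data\<close>

text \<open>A function with values in \<open>bit\<close> is determined by its support.\<close>

lemma finite_Gk: "finite (Gk k)"
proof (rule inj_on_finite)
  show "inj_on Poly_Mapping.keys (Gk k)"
  proof (rule inj_onI)
    fix g h :: "nat \<Rightarrow>\<^sub>0 bit" assume e: "Poly_Mapping.keys g = Poly_Mapping.keys h"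
    show "g = h"
    proof (rule poly_mapping_eqI)
      fix i
      have "Poly_Mapping.lookup g i = 0 \<longleftrightarrow> Poly_Mapping.lookup h i = 0" using e by (metis in_keys_iff)
      then show "Poly_Mapping.lookup g i = Poly_Mapping.lookup h i" by (metis bit_not_zero_iff)
    qed
  qed
  show "Poly_Mapping.keys ` Gk k \<subseteq> Pow {1..k}" by (auto simp: Gk_def)
qed simp

lemma finite_inj_complex: "finite A \<Longrightarrow> \<exists>h :: 'a \<Rightarrow> complex. inj_on h A"
proof -
  assume "finite A"
  then obtain f :: "'a \<Rightarrow> nat" where "inj_on f A" using finite_imp_inj_to_nat_seg by blast
  then have "inj_on (\<lambda>x. of_nat (f x) :: complex) A" by (auto simp: inj_on_def)
  then show ?thesis by blast
qed

context int_index begin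

lemma rep_flip: "j \<in> {1..k} \<Longrightarrow> rep (h + Poly_Mapping.single j 1) =
  (rep h)(idx j := if Poly_Mapping.lookup h j = 1 then rep h (idx j) + 1 else rep h (idx j) - 1)"
proof
  fix i assume j: "j \<in> {1..k}"
  show "rep (h + Poly_Mapping.single j 1) i = ((rep h)(idx j := if Poly_Mapping.lookup h j = 1 then rep h (idx j) + 1 else rep h (idx j) - 1)) i"
  proof (cases "i = idx j")
    case True
    have "Poly_Mapping.lookup (h + Poly_Mapping.single j 1) j = Poly_Mapping.lookup h j + 1" by (simp add: lookup_add)
    then show ?thesis unfolding True using j by (cases "Poly_Mapping.lookup h j") (simp_all add: rep_idx)
  next
    case False
    have "j \<noteq> jx i" if "i \<in> Int_indices n \<nu>" using idx_jx[OF that] False by auto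
    then show ?thesis using False by (auto simp: rep_def lookup_add lookup_single)
  qed
qed

lemma off_up:
  assumes "\<mu> \<in> \<Lambda>" "i \<le> n" "\<mu> i \<noteq> -1"
  shows "off (\<mu>(i := \<mu> i + 1)) = (off \<mu>)(i := off \<mu> i + 1)"
proof
  fix j
  have "Re (\<mu> i + 1 - rep (cl \<mu>) i) = Re (\<mu> i - rep (cl \<mu>) i) + 1" by simp
  then show "off (\<mu>(i := \<mu> i + 1)) j = ((off \<mu>)(i := off \<mu> i + 1)) j"
    unfolding off_def cl_up[OF assms] by (simp del: minus_complex.simps plus_complex.simps)
qed

text \<open>When \<mu> crosses from -1 to 0 its representative makes the same step, so the
  displacement is unchanged.\<close>

lemma cross_facts:
  assumes "\<mu> \<in> \<Lambda>" "i \<le> n" "\<mu> i = -1"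
  shows "off \<mu> i = 0" "rep (cl \<mu>) i = -1" "rep (cl (\<mu>(i := \<mu> i + 1))) = (rep (cl \<mu>))(i := rep (cl \<mu>) i + 1)"
    "off (\<mu>(i := \<mu> i + 1)) = off \<mu>" "Poly_Mapping.lookup (cl \<mu>) (jx i) = 1" "jx i \<in> {1..k}" "idx (jx i) = i"
proof -
  have J: "jx i \<in> {1..k} \<and> idx (jx i) = i" by (rule cross_Int[OF assms(1,2)]) (simp add: assms)
  then show J': "jx i \<in> {1..k}" "idx (jx i) = i" by auto
  have I: "i \<in> Int_indices n \<nu>" using idx_in J by metis
  show l: "Poly_Mapping.lookup (cl \<mu>) (jx i) = 1" using J assms by (simp add: lookup_cl)
  show r: "rep (cl \<mu>) i = -1" using rep_idx[OF J'(1), of "cl \<mu>"] J' l by simp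
  show o: "off \<mu> i = 0" using r assms by (simp add: off_def)
  show r': "rep (cl (\<mu>(i := \<mu> i + 1))) = (rep (cl \<mu>))(i := rep (cl \<mu>) i + 1)"
    unfolding cl_cross[OF assms] rep_flip[OF J'(1)] J'(2) using l by simp
  show "off (\<mu>(i := \<mu> i + 1)) = off \<mu>"
  proof
    fix j show "off (\<mu>(i := \<mu> i + 1)) j = off \<mu> j"
      unfolding off_def r' by (cases "j = i") (simp_all add: r assms)
  qed
qed

end

context weyl_ops begin

lemma A_mop_T:
  assumes i: "i \<le> n" and x: "x \<in> carrier V" and K: "K \<le> Suc n"
  shows "A i (wplus \<mu> a K i) (mop T K a x) = mop T K a (A i (\<mu> i) x)"
  using K
proof (induction K)
  case 0 then show ?case by (simp add: wplus_def)
next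
  case (Suc K)
  have K: "K \<le> n" using Suc by simp
  have pw: "A i ((\<kappa>(K := \<kappa> K + of_nat N)) i) ((T K ^^ N) y) = (T K ^^ N) (A i (\<kappa> i) y)" if y: "y \<in> carrier V" for \<kappa> N y
  proof (induction N)
    case 0 then show ?case by simp
  next
    case (Suc N)
    have e: "\<kappa>(K := \<kappa> K + of_nat (Suc N)) = (\<kappa>(K := \<kappa> K + of_nat N))(K := (\<kappa>(K := \<kappa> K + of_nat N)) K + 1)"
      by (simp add: algebra_simps)
    have c: "(T K ^^ N) y \<in> carrier V" using y K by (intro funpow_closed) auto
    show ?case unfolding e funpow.simps comp_apply A_T[OF i K c] Suc.IH ..
  qed
  have e: "wplus \<mu> a (Suc K) = (wplus \<mu> a K)(K := wplus \<mu> a K K + of_nat (a K))" by (auto simp: wplus_def)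
  have c: "mop T K a x \<in> carrier V" using x K by (intro mop_closed) auto
  show ?case unfolding e mop.simps pw[OF c] using Suc by simp
qed

end

locale weight_classes = int_index n k \<nu> idx + weight_ops M sc n T D \<nu>
  for n k \<nu> idx and M :: "('m, 'x) ring_scheme" (structure) and sc T D
begin

abbreviation "upm \<mu> \<equiv> mop T (Suc n) (\<lambda>i. nat (off \<mu> i))"
abbreviation "dnm \<mu> \<equiv> mop T (Suc n) (\<lambda>i. nat (- off \<mu> i))"

text \<open>\<open>\<sigma> \<mu> x\<close> is the vector \<open>y\<close> over the representative weight with \<open>t\<^sup>a y = t\<^sup>b x\<close>, where \<open>a - b\<close> is
  the displacement of \<open>\<mu>\<close> from that representative.\<close>

definition \<sigma> :: "(nat \<Rightarrow> complex) \<Rightarrow> 'm \<Rightarrow> 'm" where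
  "\<sigma> \<mu> x = inv_into (Wt (rep (cl \<mu>))) (upm \<mu>) (dnm \<mu> x)"

lemma mcs: "cspace M sc" by unfold_locales

text \<open>Split the displacement as a - b into positive and negative part: t^a applied at the
  representative and t^b applied at \<mu> end in the same weight.\<close>

lemma top_eq: "\<mu> \<in> \<Lambda> \<Longrightarrow> wplus (rep (cl \<mu>)) (\<lambda>i. nat (off \<mu> i)) (Suc n) = wplus \<mu> (\<lambda>i. nat (- off \<mu> i)) (Suc n)"
proof
  fix i assume \<mu>: "\<mu> \<in> \<Lambda>"
  show "wplus (rep (cl \<mu>)) (\<lambda>i. nat (off \<mu> i)) (Suc n) i = wplus \<mu> (\<lambda>i. nat (- off \<mu> i)) (Suc n) i"
  proof (cases "i < Suc n")
    case True
    then have "\<mu> i = rep (cl \<mu>) i + of_int (off \<mu> i)" using off[OF \<mu>] by simp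
    then show ?thesis using True by (cases "off \<mu> i \<ge> 0") (simp_all add: wplus_def)
  next
    case False
    then have "\<mu> i = undefined" "rep (cl \<mu>) i = undefined"
      using lattice_weights[OF \<mu>] by (auto simp: weights_def PiE_def extensional_def rep_def)
    then show ?thesis using False by (simp add: wplus_def)
  qed
qed

lemma up_bij: "\<mu> \<in> \<Lambda> \<Longrightarrow> bij_betw (upm \<mu>) (Wt (rep (cl \<mu>))) (Wt (wplus \<mu> (\<lambda>i. nat (- off \<mu> i)) (Suc n)))"
  unfolding top_eq[symmetric] by (rule mop_T_bij) (auto dest: no_cross_above)

lemma dn_bij: "\<mu> \<in> \<Lambda> \<Longrightarrow> bij_betw (dnm \<mu>) (Wt \<mu>) (Wt (wplus \<mu> (\<lambda>i. nat (- off \<mu> i)) (Suc n)))"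
  by (rule mop_T_bij) (auto dest: no_cross_below)

lemma endo_mop_T: "endo (mop T (Suc n) a)"
  by (rule endo_mop) (simp add: T_lin)

lemma \<sigma>_bij: "\<mu> \<in> \<Lambda> \<Longrightarrow> bij_betw (\<sigma> \<mu>) (Wt \<mu>) (Wt (rep (cl \<mu>)))"
proof -
  assume \<mu>: "\<mu> \<in> \<Lambda>"
  have "inv_into (Wt (rep (cl \<mu>))) (upm \<mu>) \<circ> dnm \<mu> = \<sigma> \<mu>" by (rule ext) (simp add: \<sigma>_def)
  then show ?thesis using bij_betw_trans[OF dn_bij[OF \<mu>] bij_betw_inv_into[OF up_bij[OF \<mu>]]] by (simp only:)
qed

lemma \<sigma>_in: "\<mu> \<in> \<Lambda> \<Longrightarrow> x \<in> Wt \<mu> \<Longrightarrow> \<sigma> \<mu> x \<in> Wt (rep (cl \<mu>))"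
  using \<sigma>_bij by (auto simp: bij_betw_def)

lemma up_\<sigma>: "\<mu> \<in> \<Lambda> \<Longrightarrow> x \<in> Wt \<mu> \<Longrightarrow> upm \<mu> (\<sigma> \<mu> x) = dnm \<mu> x"
  unfolding \<sigma>_def using up_bij[of \<mu>] dn_bij[of \<mu>] by (auto simp: bij_betw_def intro!: f_inv_into_f simp del: mop.simps)

text \<open>Identities for \<open>\<sigma>\<close> are proved from its defining equation t^a y = t^b
  x, whose solution is unique.\<close>

lemma \<sigma>_eqI:
  assumes "\<mu> \<in> \<Lambda>" "x \<in> Wt \<mu>" "y \<in> Wt (rep (cl \<mu>))" "upm \<mu> y = dnm \<mu> x" shows "\<sigma> \<mu> x = y"
proof -
  have "inj_on (upm \<mu>) (Wt (rep (cl \<mu>)))" using up_bij[OF assms(1)] by (simp add: bij_betw_def)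
  moreover have "upm \<mu> (\<sigma> \<mu> x) = upm \<mu> y" using up_\<sigma>[OF assms(1,2)] assms(4) by simp
  ultimately show ?thesis using \<sigma>_in[OF assms(1,2)] assms(3) by (meson inj_onD)
qed

lemma \<sigma>_lin: assumes \<mu>: "\<mu> \<in> \<Lambda>" shows "lin_on (Wt \<mu>) M sc M sc (\<sigma> \<mu>)"
proof -
  have W: "Wt \<kappa> \<subseteq> carrier M" for \<kappa> using Wt_carrier by blast
  have "lin_on (upm \<mu> ` Wt (rep (cl \<mu>))) M sc M sc (inv_into (Wt (rep (cl \<mu>))) (upm \<mu>))"
    by (rule lin_inv_into[OF mcs lin_on_subset[OF endo_mop_T W] csub_Wt])
      (use up_bij[OF \<mu>] in \<open>simp add: bij_betw_def del: mop.simps\<close>)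
  then have i: "lin_on (Wt (wplus \<mu> (\<lambda>i. nat (- off \<mu> i)) (Suc n))) M sc M sc (inv_into (Wt (rep (cl \<mu>))) (upm \<mu>))"
    using up_bij[OF \<mu>] by (simp add: bij_betw_def del: mop.simps)
  show ?thesis
    unfolding \<sigma>_def[abs_def]
    by (rule lin_on_comp[OF lin_on_subset[OF endo_mop_T W] i])
      (use dn_bij[OF \<mu>] in \<open>auto simp: bij_betw_def simp del: mop.simps\<close>)
qed

lemma mop_T_closed: "x \<in> carrier M \<Longrightarrow> mop T (Suc n) a x \<in> carrier M"
  using lin_onD(1)[OF endo_mop_T] .

lemma T_mop: "i \<le> n \<Longrightarrow> x \<in> carrier M \<Longrightarrow> T i (mop T (Suc n) a x) = mop T (Suc n) a (T i x)"
  by (rule mop_commute[where S="carrier M"]) (auto simp: TT)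

lemma T_mop_upd: "i \<le> n \<Longrightarrow> x \<in> carrier M \<Longrightarrow> T i (mop T (Suc n) a x) = mop T (Suc n) (a(i := Suc (a i))) x"
  by (rule mop_upd[where S="carrier M"]) (auto simp: TT)

text \<open>A step by t_i either lengthens a, or shortens b, or is a crossing that leaves both
  unchanged and commutes with both monomials.\<close>

lemma \<sigma>_T:
  assumes \<mu>: "\<mu> \<in> \<Lambda>" and i: "i \<le> n" and x: "x \<in> Wt \<mu>"
  shows "\<sigma> (\<mu>(i := \<mu> i + 1)) (T i x) = (if \<mu> i = -1 then T i (\<sigma> \<mu> x) else \<sigma> \<mu> x)"
proof -
  let ?\<mu> = "\<mu>(i := \<mu> i + 1)"
  have up: "?\<mu> \<in> \<Lambda>" using \<mu> i by simp
  have Tx: "T i x \<in> Wt ?\<mu>" by (rule T_Wt[OF i x])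
  have xc: "x \<in> carrier M" and sW: "\<sigma> \<mu> x \<in> Wt (rep (cl \<mu>))" using Wt_carrier[OF x] \<sigma>_in[OF \<mu> x] by auto
  then have sc: "\<sigma> \<mu> x \<in> carrier M" using Wt_carrier by blast
  note us = up_\<sigma>[OF \<mu> x]
  show ?thesis
  proof (cases "\<mu> i = -1")
    case True
    note cf = cross_facts[OF \<mu> i True]
    have "\<sigma> ?\<mu> (T i x) = T i (\<sigma> \<mu> x)"
    proof (rule \<sigma>_eqI[OF up Tx])
      show "T i (\<sigma> \<mu> x) \<in> Wt (rep (cl ?\<mu>))" unfolding cf(3) by (rule T_Wt[OF i sW])
      show "mop T (Suc n) (\<lambda>j. nat (off ?\<mu> j)) (T i (\<sigma> \<mu> x)) = mop T (Suc n) (\<lambda>j. nat (- off ?\<mu> j)) (T i x)"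
        unfolding cf(4) T_mop[OF i sc, symmetric] T_mop[OF i xc, symmetric] us ..
    qed
    then show ?thesis using True by simp
  next
    case False
    note o = off_up[OF \<mu> i False]
    have "\<sigma> ?\<mu> (T i x) = \<sigma> \<mu> x"
    proof (rule \<sigma>_eqI[OF up Tx])
      show "\<sigma> \<mu> x \<in> Wt (rep (cl ?\<mu>))" unfolding cl_up[OF \<mu> i False] by (rule sW)
      show "mop T (Suc n) (\<lambda>j. nat (off ?\<mu> j)) (\<sigma> \<mu> x) = mop T (Suc n) (\<lambda>j. nat (- off ?\<mu> j)) (T i x)"
      proof (cases "off \<mu> i \<ge> 0")
        case True
        have a: "(\<lambda>j. nat (off ?\<mu> j)) = (\<lambda>j. nat (off \<mu> j))(i := Suc (nat (off \<mu> i)))"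
          and b: "(\<lambda>j. nat (- off ?\<mu> j)) = (\<lambda>j. nat (- off \<mu> j))"
          unfolding o using True by (auto simp: fun_eq_iff)
        have "T i (upm \<mu> (\<sigma> \<mu> x)) = mop T (Suc n) ((\<lambda>j. nat (off \<mu> j))(i := Suc (nat (off \<mu> i)))) (\<sigma> \<mu> x)"
          using T_mop_upd[OF i sc, of "\<lambda>j. nat (off \<mu> j)"] .
        then show ?thesis unfolding a b us T_mop[OF i xc] by simp
      next
        case False
        have a: "(\<lambda>j. nat (off ?\<mu> j)) = (\<lambda>j. nat (off \<mu> j))"
          and b: "(\<lambda>j. nat (- off \<mu> j)) = (\<lambda>j. nat (- off ?\<mu> j))(i := Suc (nat (- off ?\<mu> i)))"
          unfolding o using False by (auto simp: fun_eq_iff)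
        have "T i (dnm ?\<mu> x) = mop T (Suc n) ((\<lambda>j. nat (- off ?\<mu> j))(i := Suc (nat (- off ?\<mu> i)))) x"
          using T_mop_upd[OF i xc, of "\<lambda>j. nat (- off ?\<mu> j)"] .
        then show ?thesis unfolding a us b[symmetric] T_mop[OF i xc] by simp
      qed
    qed
    then show ?thesis using False by simp
  qed
qed

text \<open>Here the displacement at \<open>i\<close> is zero, so the two monomials contain no t_i
  and commute with \<partial>_i.\<close>

lemma \<sigma>_D_cross:
  assumes \<mu>: "\<mu> \<in> \<Lambda>" and i: "i \<le> n" and x: "x \<in> Wt \<mu>" and z: "\<mu> i = 0"
  shows "\<sigma> (\<mu>(i := \<mu> i - 1)) (D i x) = D i (\<sigma> \<mu> x)"
proof -
  let ?\<mu> = "\<mu>(i := \<mu> i - 1)"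
  have dL: "?\<mu> \<in> \<Lambda>" using \<mu> i by simp
  have e: "?\<mu> i = -1" "?\<mu>(i := ?\<mu> i + 1) = \<mu>" using z by auto
  note cf = cross_facts[OF dL i e(1), unfolded e(2)]
  have sW: "\<sigma> \<mu> x \<in> Wt (rep (cl \<mu>))" by (rule \<sigma>_in[OF \<mu> x])
  note xc = Wt_carrier[OF x] and sc = Wt_carrier[OF sW]
  have o: "off \<mu> i = 0" using cf(1,4) by simp
  have Dm: "D i (mop T (Suc n) a y) = mop T (Suc n) a (D i y)" if "a i = 0" "y \<in> carrier M" for a y
    using D_mop_T[OF i that(2) order_refl, of a] that i mop_T_closed[of "D i y" a]
      mop_T_closed[OF that(2), of "a(i := a i - 1)"] by (simp del: mop.simps fun_upd_apply)
  show ?thesis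
  proof (rule \<sigma>_eqI[OF dL D_Wt[OF i x]])
    have "D i (\<sigma> \<mu> x) \<in> Wt ((rep (cl \<mu>))(i := rep (cl \<mu>) i - 1))" by (rule D_Wt[OF i sW])
    then show "D i (\<sigma> \<mu> x) \<in> Wt (rep (cl ?\<mu>))" unfolding cf(3) by simp
    show "mop T (Suc n) (\<lambda>j. nat (off ?\<mu> j)) (D i (\<sigma> \<mu> x)) = mop T (Suc n) (\<lambda>j. nat (- off ?\<mu> j)) (D i x)"
      unfolding cf(4)[symmetric] using Dm[of "\<lambda>j. nat (off \<mu> j)" "\<sigma> \<mu> x"] Dm[of "\<lambda>j. nat (- off \<mu> j)" x] o xc sc up_\<sigma>[OF \<mu> x]
      by (simp del: mop.simps)
  qed
qed

lemma \<sigma>_A: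
  assumes \<mu>: "\<mu> \<in> \<Lambda>" and i: "i \<le> n" and x: "x \<in> Wt \<mu>"
  shows "\<sigma> \<mu> (A i (\<mu> i) x) = A 0 (rep (cl \<mu>) 0) (\<sigma> \<mu> x)"
proof -
  have sW: "\<sigma> \<mu> x \<in> Wt (rep (cl \<mu>))" by (rule \<sigma>_in[OF \<mu> x])
  have "\<sigma> \<mu> (A i (\<mu> i) x) = A i (rep (cl \<mu>) i) (\<sigma> \<mu> x)"
  proof (rule \<sigma>_eqI[OF \<mu> A_Wt[OF i x] A_Wt[OF i sW]])
    show "upm \<mu> (A i (rep (cl \<mu>) i) (\<sigma> \<mu> x)) = dnm \<mu> (A i (\<mu> i) x)"
      unfolding A_mop_T[OF i Wt_carrier[OF sW] order_refl, symmetric] A_mop_T[OF i Wt_carrier[OF x] order_refl, symmetric]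
        top_eq[OF \<mu>] up_\<sigma>[OF \<mu> x] ..
  qed
  \<comment> \<open>\<open>W_eq\<close> replaces the coordinate \<open>i\<close> by the fixed
    coordinate 0.\<close>
  also have "\<dots> = A 0 (rep (cl \<mu>) 0) (\<sigma> \<mu> x)" by (rule W_eq[OF lattice_weights[OF rep_lattice] sW i]) simp
  finally show ?thesis .
qed

text \<open>The graded space is a copy of the direct sum of the representative weight spaces;
  finiteness of \<open>Gk k\<close> makes it finite-dimensional.\<close>

theorem link_from_module:
  assumes universe: "\<exists>u :: complex \<Rightarrow> 'b. inj u"
  shows "\<exists>(Y :: ('r, 'b) module) sd gr th z \<phi>. weight_link n k \<nu> idx M sc T D Y sd gr th z \<phi>"
proof -
  have sub: "csub M sc (Wt (rep h))" for h by (rule csub_Wt)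
  obtain u :: "((nat \<Rightarrow>\<^sub>0 bit) \<Rightarrow> 'm) \<Rightarrow> 'b" where u: "inj_on u (ext_sum M (Gk k) (\<lambda>h. Wt (rep h)))"
    using ext_sum_embeds[OF finite_inj_complex[OF finite_Gk] _ universe, of k "\<lambda>h. Wt (rep h)" M]
      fd_inj_list[OF csub_Wt W_fd[OF lattice_weights[OF rep_lattice]]] by blast
  obtain Y :: "('r, 'b) module" and sd \<iota> where Y: "dsum Y sd (Gk k) (\<lambda>h. \<iota> h ` Wt (rep h))"
    and \<iota>: "\<And>h. h \<in> Gk k \<Longrightarrow> lin_on (Wt (rep h)) M sc Y sd (\<iota> h)" "\<And>h. h \<in> Gk k \<Longrightarrow> inj_on (\<iota> h) (Wt (rep h))"
    using external_direct_sum[where W="\<lambda>h. Wt (rep h)" and I="Gk k", OF sub u] by blast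
  interpret Y: dsum Y sd "Gk k" "\<lambda>h. \<iota> h ` Wt (rep h)" by (rule Y)
  have Ycs: "cspace Y sd" by unfold_locales
  let ?gr = "\<lambda>h. \<iota> h ` Wt (rep h)"
  define \<kappa> where "\<kappa> h = inv_into (Wt (rep h)) (\<iota> h)" for h
  have \<kappa>\<iota>: "\<kappa> h (\<iota> h w) = w" if "h \<in> Gk k" "w \<in> Wt (rep h)" for h w
    unfolding \<kappa>_def using \<iota>(2)[OF that(1)] that(2) by simp
  have \<kappa>lin: "lin_on (?gr h) Y sd M sc (\<kappa> h)" if "h \<in> Gk k" for h
    unfolding \<kappa>_def by (rule lin_inv_into[OF Ycs \<iota>(1)[OF that] sub \<iota>(2)[OF that]])
  have \<kappa>in: "\<kappa> h y \<in> Wt (rep h)" if "h \<in> Gk k" "y \<in> ?gr h" for h y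
    using that \<kappa>\<iota> by auto
  \<comment> \<open>If bit \<open>j\<close> is set, the coordinate is -1 and t moves it to 0;
    otherwise it is 0 and \<partial> moves it to -1.\<close>
  define op where "op j h = (if Poly_Mapping.lookup h j = 1 then T (idx j) else D (idx j))" for j and h :: "nat \<Rightarrow>\<^sub>0 bit"
  have op_endo: "endo (op j h)" if "j \<in> {1..k}" for j h
    unfolding op_def using T_lin D_lin idx_le[OF that] by simp
  have op_in: "op j h w \<in> Wt (rep (h + Poly_Mapping.single j 1))" if "j \<in> {1..k}" "w \<in> Wt (rep h)" for j h w
    unfolding op_def rep_flip[OF that(1)] using T_Wt[OF idx_le[OF that(1)] that(2)] D_Wt[OF idx_le[OF that(1)] that(2)] by simp
  have opc: "w \<in> carrier M \<Longrightarrow> op j h w \<in> carrier M" if "j \<in> {1..k}" for w j h using lin_onD(1)[OF op_endo[OF that]] .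
  have Wsub: "Wt \<mu> \<subseteq> carrier M" for \<mu> using Wt_carrier by blast
  have "\<exists>f. lin_on (carrier Y) Y sd Y sd f \<and> (\<forall>h\<in>Gk k. \<forall>y\<in>?gr h. f y = \<iota> (h + Poly_Mapping.single j 1) (op j h (\<kappa> h y)))"
    if j: "j \<in> {1..k}" for j
  proof (rule Y.linear_extension[OF Ycs])
    fix h assume h: "h \<in> Gk k"
    have 1: "lin_on (?gr h) Y sd M sc (\<lambda>y. op j h (\<kappa> h y))"
      by (rule lin_on_comp[OF \<kappa>lin[OF h] op_endo[OF j]]) (use \<kappa>in[OF h] Wsub in blast)
    show "lin_on (?gr h) Y sd Y sd (\<lambda>y. \<iota> (h + Poly_Mapping.single j 1) (op j h (\<kappa> h y)))"
      by (rule lin_on_comp[OF 1 \<iota>(1)[OF Gk_single[OF h j]]]) (rule op_in[OF j \<kappa>in[OF h]])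
  qed
  then obtain th where thl: "\<And>j. j \<in> {1..k} \<Longrightarrow> lin_on (carrier Y) Y sd Y sd (th j)"
    and th\<kappa>: "\<And>j h y. j \<in> {1..k} \<Longrightarrow> h \<in> Gk k \<Longrightarrow> y \<in> ?gr h \<Longrightarrow> th j y = \<iota> (h + Poly_Mapping.single j 1) (op j h (\<kappa> h y))"
    by metis
  have th: "th j (\<iota> h w) = \<iota> (h + Poly_Mapping.single j 1) (op j h w)" if "j \<in> {1..k}" "h \<in> Gk k" "w \<in> Wt (rep h)" for j h w
    using th\<kappa>[OF that(1,2)] \<kappa>\<iota>[OF that(2,3)] that(3) by simp
  have "\<exists>f. lin_on (carrier Y) Y sd Y sd f \<and> (\<forall>h\<in>Gk k. \<forall>y\<in>?gr h. f y = \<iota> h (A 0 (rep h 0) (\<kappa> h y)))"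
  proof (rule Y.linear_extension[OF Ycs])
    fix h assume h: "h \<in> Gk k"
    have 1: "lin_on (?gr h) Y sd M sc (\<lambda>y. A 0 (rep h 0) (\<kappa> h y))"
      by (rule lin_on_comp[OF \<kappa>lin[OF h] endo_A]) (use \<kappa>in[OF h] Wsub in auto)
    show "lin_on (?gr h) Y sd Y sd (\<lambda>y. \<iota> h (A 0 (rep h 0) (\<kappa> h y)))"
      by (rule lin_on_comp[OF 1 \<iota>(1)[OF h]]) (rule A_Wt[OF _ \<kappa>in[OF h]], auto)
  qed
  then obtain z where zl: "lin_on (carrier Y) Y sd Y sd z"
    and z\<kappa>: "\<And>h y. h \<in> Gk k \<Longrightarrow> y \<in> ?gr h \<Longrightarrow> z y = \<iota> h (A 0 (rep h 0) (\<kappa> h y))" by blast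
  have z: "z (\<iota> h w) = \<iota> h (A 0 (rep h 0) w)" if "h \<in> Gk k" "w \<in> Wt (rep h)" for h w
    using z\<kappa>[OF that(1)] \<kappa>\<iota>[OF that] that(2) by simp
  have \<iota>c: "\<iota> h w \<in> carrier Y" if "h \<in> Gk k" "w \<in> Wt (rep h)" for h w using lin_onD(1)[OF \<iota>(1)[OF that(1)] that(2)] .
  \<comment> \<open>For different coordinates the operators commute, and neither flip affects the
    other bit.\<close>
  have op_op: "op i (h + Poly_Mapping.single j 1) (op j h w) = op j (h + Poly_Mapping.single i 1) (op i h w)"
    if ij: "i \<in> {1..k}" "j \<in> {1..k}" "i \<noteq> j" and w: "w \<in> carrier M" for i j h w
  proof -
    have ne: "idx i \<noteq> idx j" using idx_inj ij by simp
    have l: "Poly_Mapping.lookup (h + Poly_Mapping.single j 1) i = Poly_Mapping.lookup h i"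
      "Poly_Mapping.lookup (h + Poly_Mapping.single i 1) j = Poly_Mapping.lookup h j"
      using ij by (auto simp: lookup_add lookup_single)
    show ?thesis
      using TT[OF idx_le[OF ij(1)] idx_le[OF ij(2)] w] DD[OF idx_le[OF ij(1)] idx_le[OF ij(2)] w]
        DT[OF idx_le[OF ij(1)] idx_le[OF ij(2)] ne w] DT[OF idx_le[OF ij(2)] idx_le[OF ij(1)] ne[symmetric] w]
      unfolding op_def l by simp
  qed
  \<comment> \<open>At coordinate 0 the square is t \<partial>, at coordinate -1 it is \<partial> t
    = t \<partial> + 1; both are the shifted Euler operator of that weight.\<close>
  have op_sq: "op j (h + Poly_Mapping.single j 1) (op j h w) = A 0 (rep h 0) w" if j: "j \<in> {1..k}" and w: "w \<in> Wt (rep h)" for j h w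
  proof -
    have wc: "w \<in> carrier M" using Wt_carrier[OF w] .
    have jn: "idx j \<le> n" by (rule idx_le[OF j])
    have "Poly_Mapping.lookup (h + Poly_Mapping.single j 1) j = Poly_Mapping.lookup h j + 1" by (simp add: lookup_add)
    then have "op j (h + Poly_Mapping.single j 1) (op j h w) = A (idx j) (rep h (idx j)) w"
      unfolding rep_idx[OF j] op_def A_def using wc jn by (cases "Poly_Mapping.lookup h j") (simp_all add: DTi)
    also have "\<dots> = A 0 (rep h 0) w" by (rule W_eq[OF lattice_weights[OF rep_lattice] w jn]) simp
    finally show ?thesis .
  qed
  have A_op: "op j h (A 0 (rep h 0) w) = A 0 (rep (h + Poly_Mapping.single j 1) 0) (op j h w)"
    if j: "j \<in> {1..k}" and w: "w \<in> carrier M" for j h w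
    using A_T[OF _ idx_le[OF j] w, of 0 "rep h"] A_D[OF _ idx_le[OF j] w, of 0 "rep h"]
    unfolding rep_flip[OF j] op_def by (cases "Poly_Mapping.lookup h j = 1") (simp_all del: fun_upd_apply)
  have G: "graded_data Y sd k ?gr th z"
  proof unfold_locales
    fix j assume j: "j \<in> {1..k}"
    show "lin_on (carrier Y) Y sd Y sd (th j)" by (rule thl[OF j])
    show "th j v \<in> ?gr (h + Poly_Mapping.single j 1)" if "h \<in> Gk k" "v \<in> ?gr h" for h v
      using th\<kappa>[OF j that] op_in[OF j \<kappa>in[OF that]] by simp
    fix v assume v: "v \<in> carrier Y"
    show "th j (th j v) = z v"
    proof (rule Y.eq_on_W[OF Ycs _ zl _ v])
      show "lin_on (carrier Y) Y sd Y sd (\<lambda>v. th j (th j v))" by (rule Y.endo_comp[OF thl[OF j] thl[OF j]])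
      fix h x assume h: "h \<in> Gk k" and "x \<in> ?gr h"
      then obtain w where w: "w \<in> Wt (rep h)" "x = \<iota> h w" by blast
      show "th j (th j x) = z x"
        unfolding w(2) th[OF j h w(1)] th[OF j Gk_single[OF h j] op_in[OF j w(1)]] z[OF h w(1)] op_sq[OF j w(1)] bit_single_twice ..
    qed
    show "z (th j v) = th j (z v)"
    proof (rule Y.eq_on_W[OF Ycs _ _ _ v])
      show "lin_on (carrier Y) Y sd Y sd (\<lambda>v. z (th j v))" by (rule Y.endo_comp[OF thl[OF j] zl])
      show "lin_on (carrier Y) Y sd Y sd (\<lambda>v. th j (z v))" by (rule Y.endo_comp[OF zl thl[OF j]])
      fix h x assume h: "h \<in> Gk k" and "x \<in> ?gr h"
      then obtain w where w: "w \<in> Wt (rep h)" "x = \<iota> h w" by blast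
      show "z (th j x) = th j (z x)"
        unfolding w(2) th[OF j h w(1)] z[OF h w(1)] z[OF Gk_single[OF h j] op_in[OF j w(1)]]
          th[OF j h A_Wt[OF le0 w(1)]] A_op[OF j Wt_carrier[OF w(1)]] ..
    qed
    fix i assume i: "i \<in> {1..k}"
    show "th j (th i v) = th i (th j v)"
    proof (cases "i = j")
      case False
      show ?thesis
      proof (rule Y.eq_on_W[OF Ycs _ _ _ v])
        show "lin_on (carrier Y) Y sd Y sd (\<lambda>v. th j (th i v))" by (rule Y.endo_comp[OF thl[OF i] thl[OF j]])
        show "lin_on (carrier Y) Y sd Y sd (\<lambda>v. th i (th j v))" by (rule Y.endo_comp[OF thl[OF j] thl[OF i]])
        fix h x assume h: "h \<in> Gk k" and "x \<in> ?gr h"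
        then obtain w where w: "w \<in> Wt (rep h)" "x = \<iota> h w" by blast
        have s: "h + Poly_Mapping.single j 1 + Poly_Mapping.single i 1 = h + Poly_Mapping.single i 1 + Poly_Mapping.single j 1"
          by (simp only: ac_simps)
        show "th j (th i x) = th i (th j x)"
          unfolding w(2) th[OF j h w(1)] th[OF i h w(1)] th[OF i Gk_single[OF h j] op_in[OF j w(1)]]
            th[OF j Gk_single[OF h i] op_in[OF i w(1)]] op_op[OF i j False Wt_carrier[OF w(1)]] s ..
      qed
    qed simp
  next
    show "lin_on (carrier Y) Y sd Y sd z" by (rule zl)
    show "z v \<in> ?gr h" if "h \<in> Gk k" "v \<in> ?gr h" for h v
      using z\<kappa>[OF that] A_Wt[OF le0 \<kappa>in[OF that]] by simp
    show "Y.nil z v" if v: "v \<in> carrier Y" for v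
    proof (rule Y.dsum_induct[OF v, of "Y.nil z"])
      show "Y.nil z \<zero>\<^bsub>Y\<^esub>" by (rule Y.nil_zero)
      show "Y.nil z (x \<oplus>\<^bsub>Y\<^esub> y)" if "x \<in> carrier Y" "y \<in> carrier Y" "Y.nil z x" "Y.nil z y" for x y
        using Y.nil_add[OF zl that] .
      fix h x assume h: "h \<in> Gk k" and "x \<in> ?gr h"
      then obtain w where w: "w \<in> Wt (rep h)" "x = \<iota> h w" by blast
      have inW: "(A 0 (rep h 0) ^^ N) w \<in> Wt (rep h)" for N
        by (rule funpow_closed[OF A_Wt[OF le0] w(1)])
      have "(z ^^ N) x = \<iota> h ((A 0 (rep h 0) ^^ N) w)" for N
        by (induction N) (use w z[OF h inW] in auto)
      moreover obtain N where "(A 0 (rep h 0) ^^ N) w = \<zero>" using Wt_nil[OF w(1), of 0] by (auto simp: nil_def)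
      moreover have "\<iota> h \<zero> = \<zero>\<^bsub>Y\<^esub>" by (rule lin_zero[OF Ycs \<iota>(1)[OF h] sub])
      ultimately show "Y.nil z x" unfolding Y.nil_def by metis
    qed
    show "fd Y sd (carrier Y)"
      by (rule Y.fd_finite_sum[OF finite_Gk fd_image[OF Ycs \<iota>(1) sub W_fd[OF lattice_weights[OF rep_lattice]]]])
  qed
  define \<phi> where "\<phi> \<mu> x = \<iota> (cl \<mu>) (\<sigma> \<mu> x)" for \<mu> x
  have phiL: "lin_on (Wt \<mu>) M sc Y sd (\<phi> \<mu>)" if "\<mu> \<in> \<Lambda>" for \<mu>
    unfolding \<phi>_def[abs_def] by (rule lin_on_comp[OF \<sigma>_lin[OF that] \<iota>(1)[OF cl_Gk] \<sigma>_in[OF that]])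
  have phiT: "\<phi> (\<mu>(i := \<mu> i + 1)) (T i x) = (if \<mu> i = -1 then th (jx i) (\<phi> \<mu> x) else \<phi> \<mu> x)"
    if \<mu>: "\<mu> \<in> \<Lambda>" and i: "i \<le> n" and x: "x \<in> Wt \<mu>" for \<mu> i x
  proof (cases "\<mu> i = -1")
    case True
    note cf = cross_facts[OF \<mu> i True]
    show ?thesis
      unfolding \<phi>_def \<sigma>_T[OF \<mu> i x] cl_cross[OF \<mu> i True] th[OF cf(6) cl_Gk \<sigma>_in[OF \<mu> x]] op_def
      using True cf by simp
  next
    case False
    then show ?thesis unfolding \<phi>_def \<sigma>_T[OF \<mu> i x] cl_up[OF \<mu> i False] by simp
  qed
  have phiz: "\<phi> \<mu> (A i (\<mu> i) x) = z (\<phi> \<mu> x)" if \<mu>: "\<mu> \<in> \<Lambda>" and i: "i \<le> n" and x: "x \<in> Wt \<mu>" for \<mu> i x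
    unfolding \<phi>_def \<sigma>_A[OF \<mu> i x] z[OF cl_Gk \<sigma>_in[OF \<mu> x]] ..
  have "weight_link n k \<nu> idx M sc T D Y sd ?gr th z \<phi>"
  proof (intro weight_link.intro int_index_axioms weight_ops_axioms G weight_link_axioms.intro)
    fix \<mu> assume \<mu>: "\<mu> \<in> \<Lambda>"
    show "lin_on (Wt \<mu>) M sc Y sd (\<phi> \<mu>)" by (rule phiL[OF \<mu>])
    have "bij_betw (\<iota> (cl \<mu>)) (Wt (rep (cl \<mu>))) (?gr (cl \<mu>))" using \<iota>(2)[OF cl_Gk] by (simp add: bij_betw_def)
    moreover have "\<iota> (cl \<mu>) \<circ> \<sigma> \<mu> = \<phi> \<mu>" by (rule ext) (simp add: \<phi>_def)
    ultimately show "bij_betw (\<phi> \<mu>) (Wt \<mu>) (?gr (cl \<mu>))"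
      using bij_betw_trans[OF \<sigma>_bij[OF \<mu>]] by metis
    fix i x assume i: "i \<le> n" and x: "x \<in> Wt \<mu>"
    show "\<phi> (\<mu>(i := \<mu> i + 1)) (T i x) = (if \<mu> i = -1 then th (jx i) (\<phi> \<mu> x) else \<phi> \<mu> x)" by (rule phiT[OF \<mu> i x])
    show "\<phi> \<mu> (A i (\<mu> i) x) = z (\<phi> \<mu> x)" by (rule phiz[OF \<mu> i x])
    let ?\<mu> = "\<mu>(i := \<mu> i - 1)"
    have dL: "?\<mu> \<in> \<Lambda>" using \<mu> i by simp
    have e2: "?\<mu>(i := ?\<mu> i + 1) = \<mu>" by simp
    show "\<phi> ?\<mu> (D i x) = (if \<mu> i = 0 then th (jx i) (\<phi> \<mu> x) else sd (\<mu> i) (\<phi> \<mu> x) \<oplus>\<^bsub>Y\<^esub> z (\<phi> \<mu> x))"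
    proof (cases "\<mu> i = 0")
      case True
      then have e1: "?\<mu> i = -1" by simp
      note cf = cross_facts[OF dL i e1, unfolded e2]
      have "Poly_Mapping.lookup (cl \<mu>) (jx i) = 0" using cf(6,7) True by (simp add: lookup_cl)
      then show ?thesis
        unfolding \<phi>_def \<sigma>_D_cross[OF \<mu> i x True] cl_cross_down[OF \<mu> i True] th[OF cf(6) cl_Gk \<sigma>_in[OF \<mu> x]] op_def
        using True cf by simp
    next
      case False
      then have e1: "?\<mu> i \<noteq> -1" by simp
      \<comment> \<open>The step back up from \<open>?\<mu>\<close> does not cross, so applying t_i
        does not change the value under the comparison map.\<close>
      have "\<phi> ?\<mu> (D i x) = \<phi> \<mu> (T i (D i x))" using phiT[OF dL i D_Wt[OF i x], unfolded e2] e1 by simp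
      also have "\<dots> = \<phi> \<mu> (A i (\<mu> i) x \<oplus> sc (\<mu> i) x)" using TD_A[OF i Wt_carrier[OF x]] by simp
      also have "\<dots> = z (\<phi> \<mu> x) \<oplus>\<^bsub>Y\<^esub> sd (\<mu> i) (\<phi> \<mu> x)"
        using lin_onD(2,3)[OF phiL[OF \<mu>]] A_Wt[OF i x] x csubD(5)[OF csub_Wt x] phiz[OF \<mu> i x] by simp
      also have "\<dots> = sd (\<mu> i) (\<phi> \<mu> x) \<oplus>\<^bsub>Y\<^esub> z (\<phi> \<mu> x)"
        using lin_onD(1)[OF phiL[OF \<mu>] x] lin_onD(1)[OF zl] by (intro Y.a_comm) auto
      finally show ?thesis using False by simp
    qed
  qed
  then show ?thesis by blast
qed

end

section \<open>From graded data to weight modules\<close>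

lemma inj_weights: "\<exists>h :: (nat \<Rightarrow> complex) \<Rightarrow> complex. inj_on h (weights n)"
proof -
  obtain e :: "complex list \<Rightarrow> complex" where e: "inj e" using inj_list_complex by blast
  have "inj_on (\<lambda>\<mu>. e (map \<mu> [0..<Suc n])) (weights n)"
  proof (rule inj_onI)
    fix \<mu> \<mu>' assume \<mu>: "\<mu> \<in> weights n" "\<mu>' \<in> weights n" and "e (map \<mu> [0..<Suc n]) = e (map \<mu>' [0..<Suc n])"
    then have "map \<mu> [0..<Suc n] = map \<mu>' [0..<Suc n]" using e by (auto dest: injD)
    then have "\<mu> i = \<mu>' i" if "i \<in> {0..n}" for i using that by (auto simp: map_eq_conv simp del: upt_Suc)
    then show "\<mu> = \<mu>'" using \<mu> unfolding weights_def by (rule_tac PiE_ext) auto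
  qed
  then show ?thesis by blast
qed

lemma internal_direct_sum_cong:
  assumes "\<And>i. i \<in> I \<Longrightarrow> W i = W' i" shows "internal_direct_sum M I W \<longleftrightarrow> internal_direct_sum M I W'"
proof -
  have "(\<Pi>\<^sub>E i\<in>I. W i) = (\<Pi>\<^sub>E i\<in>I. W' i)" using assms by (rule PiE_cong)
  then show ?thesis using assms unfolding internal_direct_sum_def by simp
qed

lemma finsum_smult_update: "finsum (Y\<lparr>smult := s\<rparr>) f A = finsum Y f A"
  by (simp add: finsum_def)

lemma additive_subgroup_smult_update: "additive_subgroup U (Y\<lparr>smult := s\<rparr>) \<longleftrightarrow> additive_subgroup U Y"
  by (simp add: additive_subgroup_def)

lemma dsum_smult_update:
  fixes Y :: "('r, 'a) module"
  assumes Y: "dsum Y sc I W" and cs: "cspace (Y\<lparr>smult := s\<rparr>) sc'"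
    and eq: "\<And>c x. x \<in> carrier Y \<Longrightarrow> sc' c x = sc c x"
  shows "dsum (Y\<lparr>smult := s\<rparr>) sc' I W"
proof (intro dsum.intro cs dsum_axioms.intro)
  interpret Y: dsum Y sc I W by fact
  show "csub (Y\<lparr>smult := s\<rparr>) sc' (W i)" if "i \<in> I" for i
    using Y.sub[OF that] csubD(6)[OF Y.sub[OF that]] eq unfolding csub_def additive_subgroup_smult_update by simp
  show "internal_direct_sum (Y\<lparr>smult := s\<rparr>) I W"
    using Y.ids unfolding internal_direct_sum_def finsum_smult_update additive_subgroup_smult_update by simp
qed

context int_index begin

text \<open>\<open>internal_direct_sum\<close> runs over all weights, hence the zero block off the
  lattice; the argument \<open>z\<close> stands for the zero vector.\<close>

definition blk :: "'v \<Rightarrow> ((nat \<Rightarrow>\<^sub>0 bit) \<Rightarrow> 'v set) \<Rightarrow> (nat \<Rightarrow> complex) \<Rightarrow> 'v set" where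
  "blk z gr \<mu> = (if \<mu> \<in> \<Lambda> then gr (cl \<mu>) else {z})"

end

locale induced_module = int_index n k \<nu> idx + V: graded_data V sd k gr th z +
  Y: dsum Y sc "weights n" "\<lambda>\<mu>. \<iota> \<mu> ` int_index.blk n k \<nu> idx \<zero>\<^bsub>V\<^esub> gr \<mu>"
  for n k \<nu> idx and V :: "('v, 'y) ring_scheme" and sd gr th z and Y :: "('m, 'x) ring_scheme" and sc \<iota> +
  fixes T D :: "nat \<Rightarrow> 'm \<Rightarrow> 'm"
  assumes iota_lin: "\<mu> \<in> \<Lambda> \<Longrightarrow> lin_on (gr (cl \<mu>)) V sd Y sc (\<iota> \<mu>)"
    and iota_inj: "\<mu> \<in> \<Lambda> \<Longrightarrow> inj_on (\<iota> \<mu>) (gr (cl \<mu>))"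
    and iota_zero: "\<mu> \<in> weights n \<Longrightarrow> \<iota> \<mu> \<zero>\<^bsub>V\<^esub> = \<zero>\<^bsub>Y\<^esub>"
    and T_lin: "i \<le> n \<Longrightarrow> lin_on (carrier Y) Y sc Y sc (T i)"
    and D_lin: "i \<le> n \<Longrightarrow> lin_on (carrier Y) Y sc Y sc (D i)"
    and T_iota: "\<mu> \<in> \<Lambda> \<Longrightarrow> i \<le> n \<Longrightarrow> v \<in> gr (cl \<mu>) \<Longrightarrow>
      T i (\<iota> \<mu> v) = \<iota> (\<mu>(i := \<mu> i + 1)) (if \<mu> i = -1 then th (jx i) v else v)"
    and D_iota: "\<mu> \<in> \<Lambda> \<Longrightarrow> i \<le> n \<Longrightarrow> v \<in> gr (cl \<mu>) \<Longrightarrow>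
      D i (\<iota> \<mu> v) = \<iota> (\<mu>(i := \<mu> i - 1)) (if \<mu> i = 0 then th (jx i) v else sd (\<mu> i) v \<oplus>\<^bsub>V\<^esub> z v)"
begin

definition tt :: "nat \<Rightarrow> complex \<Rightarrow> 'v \<Rightarrow> 'v" where "tt i c v = (if c = -1 then th (jx i) v else v)"
definition dd :: "nat \<Rightarrow> complex \<Rightarrow> 'v \<Rightarrow> 'v" where "dd i c v = (if c = 0 then th (jx i) v else sd c v \<oplus>\<^bsub>V\<^esub> z v)"

lemma blk_in [simp]: "\<mu> \<in> \<Lambda> \<Longrightarrow> blk \<zero>\<^bsub>V\<^esub> gr \<mu> = gr (cl \<mu>)"
  and blk_out: "\<mu> \<notin> \<Lambda> \<Longrightarrow> blk \<zero>\<^bsub>V\<^esub> gr \<mu> = {\<zero>\<^bsub>V\<^esub>}"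
  by (auto simp: blk_def)

lemma gr_car: "v \<in> gr (cl \<mu>) \<Longrightarrow> v \<in> carrier V" using V.W_carrier[OF cl_Gk] .

lemma gr_sub: "csub V sd (gr (cl \<mu>))" by (rule V.sub[OF cl_Gk])

lemma jx_in: "\<mu> \<in> \<Lambda> \<Longrightarrow> i \<le> n \<Longrightarrow> \<mu> i = -1 \<or> \<mu> i = 0 \<Longrightarrow> jx i \<in> {1..k}"
  using cross_Int[of \<mu> i] by auto

lemma tt_in:
  assumes \<mu>: "\<mu> \<in> \<Lambda>" and i: "i \<le> n" and v: "v \<in> gr (cl \<mu>)"
  shows "tt i (\<mu> i) v \<in> gr (cl (\<mu>(i := \<mu> i + 1)))"
proof (cases "\<mu> i = -1")
  case True
  then have "jx i \<in> {1..k}" using jx_in[OF \<mu> i] by simp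
  from V.th_gr[OF this cl_Gk v] show ?thesis unfolding cl_cross[OF \<mu> i True] using True by (simp add: tt_def)
next
  case False
  then show ?thesis unfolding cl_up[OF \<mu> i False] using v by (simp add: tt_def)
qed

lemma dd_in:
  assumes \<mu>: "\<mu> \<in> \<Lambda>" and i: "i \<le> n" and v: "v \<in> gr (cl \<mu>)"
  shows "dd i (\<mu> i) v \<in> gr (cl (\<mu>(i := \<mu> i - 1)))"
proof (cases "\<mu> i = 0")
  case True
  then have "jx i \<in> {1..k}" using jx_in[OF \<mu> i] by simp
  from V.th_gr[OF this cl_Gk v] show ?thesis unfolding cl_cross_down[OF \<mu> i True] using True by (simp add: dd_def)
next
  case False
  then show ?thesis unfolding cl_down[OF \<mu> i False]
    using csubD(2)[OF gr_sub csubD(5)[OF gr_sub v] V.z_gr[OF cl_Gk v]] by (simp add: dd_def)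
qed

lemma T_iota': "\<mu> \<in> \<Lambda> \<Longrightarrow> i \<le> n \<Longrightarrow> v \<in> gr (cl \<mu>) \<Longrightarrow> T i (\<iota> \<mu> v) = \<iota> (\<mu>(i := \<mu> i + 1)) (tt i (\<mu> i) v)"
  using T_iota by (simp add: tt_def)

lemma D_iota': "\<mu> \<in> \<Lambda> \<Longrightarrow> i \<le> n \<Longrightarrow> v \<in> gr (cl \<mu>) \<Longrightarrow> D i (\<iota> \<mu> v) = \<iota> (\<mu>(i := \<mu> i - 1)) (dd i (\<mu> i) v)"
  using D_iota by (simp add: dd_def)

lemma Ycs: "cspace Y sc" by unfold_locales

text \<open>Blocks off the lattice are zero, so linear maps are determined by their values on
  lattice blocks.\<close>

lemma eq_endo:
  assumes f: "Y.endo f" and g: "Y.endo g" and eq: "\<And>\<mu> v. \<mu> \<in> \<Lambda> \<Longrightarrow> v \<in> gr (cl \<mu>) \<Longrightarrow> f (\<iota> \<mu> v) = g (\<iota> \<mu> v)"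
    and x: "x \<in> carrier Y"
  shows "f x = g x"
proof (rule Y.eq_on_W[OF Ycs f g _ x])
  fix \<mu> y assume \<mu>: "\<mu> \<in> weights n" and y: "y \<in> \<iota> \<mu> ` blk \<zero>\<^bsub>V\<^esub> gr \<mu>"
  show "f y = g y"
  proof (cases "\<mu> \<in> \<Lambda>")
    case True then show ?thesis using y eq by auto
  next
    case False
    then have "y = \<zero>\<^bsub>Y\<^esub>" using y iota_zero[OF \<mu>] by (auto simp: blk_out)
    then show ?thesis using Y.endo_zero[OF f] Y.endo_zero[OF g] by simp
  qed
qed

lemma iota_closed: "\<mu> \<in> \<Lambda> \<Longrightarrow> v \<in> gr (cl \<mu>) \<Longrightarrow> \<iota> \<mu> v \<in> carrier Y" using lin_onD(1)[OF iota_lin] .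

lemma upd_swap: "i \<noteq> j \<Longrightarrow> (\<mu>(i := a))(j := b) = (\<mu>(j := b))(i := a)" by (rule fun_upd_twist)

lemma tt_tt: "\<mu> \<in> \<Lambda> \<Longrightarrow> i \<le> n \<Longrightarrow> j \<le> n \<Longrightarrow> v \<in> carrier V \<Longrightarrow> tt i (\<mu> i) (tt j (\<mu> j) v) = tt j (\<mu> j) (tt i (\<mu> i) v)"
  using jx_in[of \<mu> i] jx_in[of \<mu> j] V.th_th[of "jx i" "jx j" v] by (auto simp: tt_def)

lemma dd_tt: "\<mu> \<in> \<Lambda> \<Longrightarrow> i \<le> n \<Longrightarrow> j \<le> n \<Longrightarrow> v \<in> carrier V \<Longrightarrow> dd i (\<mu> i) (tt j (\<mu> j) v) = tt j (\<mu> j) (dd i (\<mu> i) v)"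
  using jx_in[of \<mu> i] jx_in[of \<mu> j] V.th_th[of "jx i" "jx j" v]
  by (auto simp: tt_def dd_def V.th_add V.th_sc V.z_th simp del: atLeastAtMost_iff)

lemma dd_dd: "\<mu> \<in> \<Lambda> \<Longrightarrow> i \<le> n \<Longrightarrow> j \<le> n \<Longrightarrow> v \<in> carrier V \<Longrightarrow> dd i (\<mu> i) (dd j (\<mu> j) v) = dd j (\<mu> j) (dd i (\<mu> i) v)"
  using jx_in[of \<mu> i] jx_in[of \<mu> j] V.th_th[of "jx i" "jx j" v]
  by (auto simp: dd_def V.th_add V.th_sc V.z_th V.z_add V.z_sc V.sc_r V.a_ac mult.commute simp del: atLeastAtMost_iff)

text \<open>If \<mu>_i = 0 both steps cross and give \<theta>^2 = z; otherwise neither does. The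
  formula \<mu>_i + z covers both cases.\<close>

lemma TD_iota:
  assumes \<mu>: "\<mu> \<in> \<Lambda>" and i: "i \<le> n" and v: "v \<in> gr (cl \<mu>)"
  shows "T i (D i (\<iota> \<mu> v)) = \<iota> \<mu> (sd (\<mu> i) v \<oplus>\<^bsub>V\<^esub> z v)"
proof -
  let ?\<mu> = "\<mu>(i := \<mu> i - 1)"
  have dL: "?\<mu> \<in> \<Lambda>" using \<mu> i by simp
  have "T i (D i (\<iota> \<mu> v)) = \<iota> \<mu> (tt i (\<mu> i - 1) (dd i (\<mu> i) v))"
    unfolding D_iota'[OF \<mu> i v] T_iota'[OF dL i dd_in[OF \<mu> i v]] by simp
  also have "tt i (\<mu> i - 1) (dd i (\<mu> i) v) = sd (\<mu> i) v \<oplus>\<^bsub>V\<^esub> z v"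
    using jx_in[OF \<mu> i] gr_car[OF v] V.th_sq[of "jx i" v] by (cases "\<mu> i = 0") (auto simp: tt_def dd_def)
  finally show ?thesis .
qed

lemma weyl: "weyl_ops Y sc n T D"
proof (intro weyl_ops.intro Ycs weyl_ops_axioms.intro T_lin D_lin)
  fix i j x assume i: "i \<le> n" and j: "j \<le> n" and x: "x \<in> carrier Y"
  note Ti = T_lin[OF i] and Tj = T_lin[OF j] and Di = D_lin[OF i] and Dj = D_lin[OF j]
  show "T i (T j x) = T j (T i x)"
  proof (cases "i = j")
    case False
    show ?thesis
    proof (rule eq_endo[OF Y.endo_comp[OF Tj Ti] Y.endo_comp[OF Ti Tj] _ x])
      fix \<mu> v assume \<mu>: "\<mu> \<in> \<Lambda>" and v: "v \<in> gr (cl \<mu>)"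
      show "T i (T j (\<iota> \<mu> v)) = T j (T i (\<iota> \<mu> v))"
        unfolding T_iota'[OF \<mu> i v] T_iota'[OF \<mu> j v] T_iota'[OF lattice_up[OF \<mu> j] i tt_in[OF \<mu> j v]]
          T_iota'[OF lattice_up[OF \<mu> i] j tt_in[OF \<mu> i v]]
        using False tt_tt[OF \<mu> i j gr_car[OF v]] by (simp add: upd_swap[of j i])
    qed
  qed simp
  show "D i (D j x) = D j (D i x)"
  proof (cases "i = j")
    case False
    show ?thesis
    proof (rule eq_endo[OF Y.endo_comp[OF Dj Di] Y.endo_comp[OF Di Dj] _ x])
      fix \<mu> v assume \<mu>: "\<mu> \<in> \<Lambda>" and v: "v \<in> gr (cl \<mu>)"
      show "D i (D j (\<iota> \<mu> v)) = D j (D i (\<iota> \<mu> v))"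
        unfolding D_iota'[OF \<mu> i v] D_iota'[OF \<mu> j v] D_iota'[OF lattice_down[OF \<mu> j] i dd_in[OF \<mu> j v]]
          D_iota'[OF lattice_down[OF \<mu> i] j dd_in[OF \<mu> i v]]
        using False dd_dd[OF \<mu> i j gr_car[OF v]] by (simp add: upd_swap[of j i])
    qed
  qed simp
  show "D i (T j x) = T j (D i x)" if ne: "i \<noteq> j"
  proof (rule eq_endo[OF Y.endo_comp[OF Tj Di] Y.endo_comp[OF Di Tj] _ x])
    fix \<mu> v assume \<mu>: "\<mu> \<in> \<Lambda>" and v: "v \<in> gr (cl \<mu>)"
    show "D i (T j (\<iota> \<mu> v)) = T j (D i (\<iota> \<mu> v))"
      unfolding D_iota'[OF \<mu> i v] T_iota'[OF \<mu> j v] D_iota'[OF lattice_up[OF \<mu> j] i tt_in[OF \<mu> j v]]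
        T_iota'[OF lattice_down[OF \<mu> i] j dd_in[OF \<mu> i v]]
      using ne dd_tt[OF \<mu> i j gr_car[OF v]] by (simp add: upd_swap[of j i])
  qed
  show "D i (T i x) = T i (D i x) \<oplus>\<^bsub>Y\<^esub> x"
  proof (rule eq_endo[OF Y.endo_comp[OF Ti Di] Y.endo_add[OF Y.endo_comp[OF Di Ti] Y.endo_id] _ x])
    fix \<mu> v assume \<mu>: "\<mu> \<in> \<Lambda>" and v: "v \<in> gr (cl \<mu>)"
    let ?\<mu> = "\<mu>(i := \<mu> i + 1)"
    have vc: "v \<in> carrier V" by (rule gr_car[OF v])
    have w: "sd (\<mu> i) v \<oplus>\<^bsub>V\<^esub> z v \<in> gr (cl \<mu>)"
      by (rule csubD(2)[OF gr_sub csubD(5)[OF gr_sub v] V.z_gr[OF cl_Gk v]])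
    have "D i (T i (\<iota> \<mu> v)) = \<iota> \<mu> (dd i (\<mu> i + 1) (tt i (\<mu> i) v))"
      unfolding T_iota'[OF \<mu> i v] D_iota'[OF lattice_up[OF \<mu> i] i tt_in[OF \<mu> i v]] by simp
    \<comment> \<open>The cases are whether t_i crosses; at \<mu>_i = -1 the terms -v and v cancel
      and \<theta>^2 = z remains.\<close>
    also have "dd i (\<mu> i + 1) (tt i (\<mu> i) v) = sd (\<mu> i) v \<oplus>\<^bsub>V\<^esub> z v \<oplus>\<^bsub>V\<^esub> v"
    proof (cases "\<mu> i = -1")
      case True
      then show ?thesis using jx_in[OF \<mu> i] vc V.th_sq[of "jx i" v]
        by (simp add: tt_def dd_def V.a_ac V.sc_collect V.sc_collect_mid)
    next
      case False
      then have "\<mu> i + 1 \<noteq> 0" by (simp add: eq_neg_iff_add_eq_0)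
      then show ?thesis using False vc by (simp add: tt_def dd_def V.sc_l V.a_ac)
    qed
    also have "\<iota> \<mu> (sd (\<mu> i) v \<oplus>\<^bsub>V\<^esub> z v \<oplus>\<^bsub>V\<^esub> v) = T i (D i (\<iota> \<mu> v)) \<oplus>\<^bsub>Y\<^esub> \<iota> \<mu> v"
      unfolding TD_iota[OF \<mu> i v] by (rule lin_onD(2)[OF iota_lin[OF \<mu>] w v])
    finally show "D i (T i (\<iota> \<mu> v)) = T i (D i (\<iota> \<mu> v)) \<oplus>\<^bsub>Y\<^esub> \<iota> \<mu> v" .
  qed
qed

end

sublocale induced_module \<subseteq> O: weyl_ops Y sc n T D by (rule weyl)

context induced_module begin

lemma A_iota: "\<mu> \<in> \<Lambda> \<Longrightarrow> i \<le> n \<Longrightarrow> v \<in> gr (cl \<mu>) \<Longrightarrow> O.A i (\<mu> i) (\<iota> \<mu> v) = \<iota> \<mu> (z v)"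
proof -
  assume \<mu>: "\<mu> \<in> \<Lambda>" and i: "i \<le> n" and v: "v \<in> gr (cl \<mu>)"
  have zv: "z v \<in> gr (cl \<mu>)" by (rule V.z_gr[OF cl_Gk v])
  have "O.A i (\<mu> i) (\<iota> \<mu> v) = \<iota> \<mu> (sd (\<mu> i) v \<oplus>\<^bsub>V\<^esub> z v) \<oplus>\<^bsub>Y\<^esub> sc (- \<mu> i) (\<iota> \<mu> v)"
    by (simp add: O.A_def TD_iota[OF \<mu> i v])
  also have "\<iota> \<mu> (sd (\<mu> i) v \<oplus>\<^bsub>V\<^esub> z v) = sc (\<mu> i) (\<iota> \<mu> v) \<oplus>\<^bsub>Y\<^esub> \<iota> \<mu> (z v)"
    using lin_onD(2)[OF iota_lin[OF \<mu>] csubD(5)[OF gr_sub v] zv] lin_onD(3)[OF iota_lin[OF \<mu>] v] by simp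
  finally show ?thesis using iota_closed[OF \<mu> v] iota_closed[OF \<mu> zv]
    by (simp add: Y.a_ac Y.sc_collect Y.sc_collect_mid)
qed

text \<open>The blocks lie in the weight spaces because \<open>z\<close> is nilpotent. Conversely, a
  vector of weight \<mu> has no component in another block: at a coordinate where the weights
  differ, two shifted Euler operators are nilpotent on that component while their difference is a
  nonzero scalar.\<close>

lemma Wt_iota: assumes \<mu>: "\<mu> \<in> weights n" shows "O.Wt \<mu> = \<iota> \<mu> ` blk \<zero>\<^bsub>V\<^esub> gr \<mu>"
proof (intro subset_antisym subsetI)
  have ge: "y \<in> O.Wt \<kappa>" if \<kappa>: "\<kappa> \<in> weights n" and y: "y \<in> \<iota> \<kappa> ` blk \<zero>\<^bsub>V\<^esub> gr \<kappa>" for \<kappa> y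
  proof (cases "\<kappa> \<in> \<Lambda>")
    case True
    then obtain v where v: "v \<in> gr (cl \<kappa>)" "y = \<iota> \<kappa> v" using y by auto
    have zN: "(z ^^ N) v \<in> gr (cl \<kappa>)" for N by (rule funpow_closed[OF V.z_gr[OF cl_Gk] v(1)])
    have "Y.nil (O.A i (\<kappa> i)) y" if i: "i \<le> n" for i
    proof -
      have "(O.A i (\<kappa> i) ^^ N) y = \<iota> \<kappa> ((z ^^ N) v)" for N
        by (induction N) (use v A_iota[OF True i zN] in auto)
      moreover obtain N where "(z ^^ N) v = \<zero>\<^bsub>V\<^esub>" using V.z_nil[OF gr_car[OF v(1)]] by (auto simp: V.nil_def)
      ultimately show ?thesis using iota_zero[OF \<kappa>] unfolding Y.nil_def by metis
    qed
    then show ?thesis using v iota_closed[OF True v(1)] by (simp add: O.Wt_def)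
  next
    case False
    then show ?thesis using y iota_zero[OF \<kappa>] csubD(3)[OF O.csub_Wt] by (auto simp: blk_out)
  qed
  {
    fix x assume "x \<in> \<iota> \<mu> ` blk \<zero>\<^bsub>V\<^esub> gr \<mu>"
    then show "x \<in> O.Wt \<mu>" by (rule ge[OF \<mu>])
  next
    fix x assume x: "x \<in> O.Wt \<mu>"
    have xc: "x \<in> carrier Y" by (rule O.Wt_carrier[OF x])
    have "Y.comp x \<kappa> = \<zero>\<^bsub>Y\<^esub>" if \<kappa>: "\<kappa> \<in> weights n" and ne: "\<kappa> \<noteq> \<mu>" for \<kappa>
    proof -
      have "\<exists>i\<in>{0..n}. \<kappa> i \<noteq> \<mu> i"
      proof (rule ccontr)
        assume "\<not> (\<exists>i\<in>{0..n}. \<kappa> i \<noteq> \<mu> i)"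
        then have "\<kappa> = \<mu>" using \<kappa> \<mu> unfolding weights_def by (rule_tac PiE_ext) auto
        then show False using ne by simp
      qed
      then obtain i where i: "i \<le> n" "\<kappa> i \<noteq> \<mu> i" by auto
      let ?y = "Y.comp x \<kappa>"
      have yin: "?y \<in> \<iota> \<kappa> ` blk \<zero>\<^bsub>V\<^esub> gr \<kappa>" by (rule Y.comp_in[OF xc \<kappa>])
      have yW: "?y \<in> O.Wt \<kappa>" by (rule ge[OF \<kappa> yin])
      have yc: "?y \<in> carrier Y" by (rule O.Wt_carrier[OF yW])
      \<comment> \<open>The operator shifted by the foreign weight still preserves every block, so
        it commutes with the projections.\<close>
      have pres: "O.A i (\<mu> i) y \<in> \<iota> \<eta> ` blk \<zero>\<^bsub>V\<^esub> gr \<eta>" if l: "\<eta> \<in> weights n" and y: "y \<in> \<iota> \<eta> ` blk \<zero>\<^bsub>V\<^esub> gr \<eta>" for \<eta> y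
      proof (cases "\<eta> \<in> \<Lambda>")
        case True
        then obtain v where v: "v \<in> gr (cl \<eta>)" "y = \<iota> \<eta> v" using y by auto
        have yc: "y \<in> carrier Y" using v iota_closed[OF True v(1)] by simp
        have "O.A i (\<mu> i) y = O.A i (\<eta> i) y \<oplus>\<^bsub>Y\<^esub> sc (\<eta> i - \<mu> i) y"
          using i yc by (simp add: O.A_def Y.a_assoc Y.sc_collect)
        also have "O.A i (\<eta> i) y = \<iota> \<eta> (z v)" unfolding v(2) by (rule A_iota[OF True i(1) v(1)])
        finally show ?thesis
          using csubD(2,5)[OF Y.sub[OF l]] y V.z_gr[OF cl_Gk v(1)] True by simp
      next
        case False
        then have "y = \<zero>\<^bsub>Y\<^esub>" using y iota_zero[OF l] by (auto simp: blk_out)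
        then show ?thesis using Y.endo_zero[OF O.endo_A[OF i(1)]] csubD(3)[OF Y.sub[OF l]] by simp
      qed
      have presN: "(O.A i (\<mu> i) ^^ N) y \<in> \<iota> \<eta> ` blk \<zero>\<^bsub>V\<^esub> gr \<eta>" if "\<eta> \<in> weights n" "y \<in> \<iota> \<eta> ` blk \<zero>\<^bsub>V\<^esub> gr \<eta>" for \<eta> y N
        by (rule funpow_closed[OF pres[OF that(1)] that(2)])
      obtain N where N: "(O.A i (\<mu> i) ^^ N) x = \<zero>\<^bsub>Y\<^esub>" using O.Wt_nil[OF x i(1)] by (auto simp: Y.nil_def)
      have "(O.A i (\<mu> i) ^^ N) ?y = Y.comp ((O.A i (\<mu> i) ^^ N) x) \<kappa>"
        by (rule Y.comp_commute[OF Y.endo_funpow[OF O.endo_A[OF i(1)]] presN xc \<kappa>, symmetric])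
      then have "Y.nil (O.A i (\<mu> i)) ?y" unfolding N Y.comp_zero[OF \<kappa>] Y.nil_def by blast
      then have "Y.nil (\<lambda>x. O.A i (\<kappa> i) x \<oplus>\<^bsub>Y\<^esub> sc (-1) (O.A i (\<mu> i) x)) ?y"
        by (intro Y.nil_diff O.endo_A i O.A_A yc O.Wt_nil[OF yW])
      moreover have "O.A i (\<kappa> i) ?y \<oplus>\<^bsub>Y\<^esub> sc (-1) (O.A i (\<mu> i) ?y) = sc (\<mu> i - \<kappa> i) ?y"
      proof -
        have t: "T i (D i ?y) \<in> carrier Y" using i yc by simp
        show ?thesis using yc t
          by (simp add: O.A_def Y.sc_r Y.a_ac Y.sc_collect Y.sc_collect_mid)
      qed
      moreover have "Y.endo (\<lambda>x. O.A i (\<kappa> i) x \<oplus>\<^bsub>Y\<^esub> sc (-1) (O.A i (\<mu> i) x))"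
        by (rule Y.endo_add[OF O.endo_A[OF i(1)] Y.endo_comp[OF O.endo_A[OF i(1)] Y.endo_sc]])
      ultimately show ?thesis using Y.nil_eigen[of "\<lambda>x. O.A i (\<kappa> i) x \<oplus>\<^bsub>Y\<^esub> sc (-1) (O.A i (\<mu> i) x)", OF _ yc] i(2) by simp
    qed
    then have "Y.supp x \<subseteq> {\<mu>}" by (auto simp: Y.supp_def)
    then have "x = (\<Oplus>\<^bsub>Y\<^esub>\<kappa>\<in>{\<mu>}. Y.comp x \<kappa>)" using \<mu> by (intro Y.comp_sum[OF xc]) auto
    then have "x = Y.comp x \<mu>" using Y.comp_closed[OF xc \<mu>] by simp
    then show "x \<in> \<iota> \<mu> ` blk \<zero>\<^bsub>V\<^esub> gr \<mu>" using Y.comp_in[OF xc \<mu>] by simp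
  }
qed

lemma Wt_in: "\<mu> \<in> \<Lambda> \<Longrightarrow> O.Wt \<mu> = \<iota> \<mu> ` gr (cl \<mu>)"
  using Wt_iota[OF lattice_weights] by simp

lemma Wt_out: "\<mu> \<in> weights n \<Longrightarrow> \<mu> \<notin> \<Lambda> \<Longrightarrow> O.Wt \<mu> = {\<zero>\<^bsub>Y\<^esub>}"
  using Wt_iota[of \<mu>] iota_zero by (simp add: blk_out)

lemma weight: "weight_ops Y sc n T D \<nu>"
proof (intro weight_ops.intro weyl weight_ops_axioms.intro)
  show "internal_direct_sum Y (weights n) O.Wt"
    using Y.ids internal_direct_sum_cong[of "weights n" O.Wt "\<lambda>\<mu>. \<iota> \<mu> ` blk \<zero>\<^bsub>V\<^esub> gr \<mu>" Y, OF Wt_iota] by simp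
  fix \<mu> assume \<mu>: "\<mu> \<in> weights n"
  show "\<mu> \<in> \<Lambda>" if "O.Wt \<mu> \<noteq> {\<zero>\<^bsub>Y\<^esub>}" using that Wt_out[OF \<mu>] by blast
  show "fd Y sc (O.Wt \<mu>)"
  proof (cases "\<mu> \<in> \<Lambda>")
    case True
    show ?thesis unfolding Wt_in[OF True]
      by (rule V.fd_image[OF Ycs iota_lin[OF True] gr_sub V.fd_summand[OF V.V_fd cl_Gk]])
  next
    case False
    show ?thesis unfolding Wt_out[OF \<mu> False] by (rule Y.fd_zero)
  qed
  fix x i j assume x: "x \<in> O.Wt \<mu>" and i: "i \<le> n" and j: "j \<le> n"
  show "O.A i (\<mu> i) x = O.A j (\<mu> j) x"
  proof (cases "\<mu> \<in> \<Lambda>")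
    case True
    then show ?thesis using x A_iota[OF True i] A_iota[OF True j] unfolding Wt_in[OF True] by auto
  next
    case False
    then have "x = \<zero>\<^bsub>Y\<^esub>" using x Wt_out[OF \<mu>] by simp
    then show ?thesis using Y.endo_zero[OF O.endo_A] i j by simp
  qed
qed

theorem link: "weight_link n k \<nu> idx Y sc T D V sd gr th z (\<lambda>\<mu>. inv_into (gr (cl \<mu>)) (\<iota> \<mu>))"
proof (intro weight_link.intro int_index_axioms weight V.graded_data_axioms weight_link_axioms.intro)
  fix \<mu> assume \<mu>: "\<mu> \<in> \<Lambda>"
  show "lin_on (O.Wt \<mu>) Y sc V sd (inv_into (gr (cl \<mu>)) (\<iota> \<mu>))"
    unfolding Wt_in[OF \<mu>] by (rule V.lin_inv_into[OF Ycs iota_lin[OF \<mu>] gr_sub iota_inj[OF \<mu>]])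
  show "bij_betw (inv_into (gr (cl \<mu>)) (\<iota> \<mu>)) (O.Wt \<mu>) (gr (cl \<mu>))"
    unfolding Wt_in[OF \<mu>] by (rule bij_betw_inv_into) (use iota_inj[OF \<mu>] in \<open>simp add: bij_betw_def\<close>)
  fix i x assume i: "i \<le> n" and "x \<in> O.Wt \<mu>"
  then obtain v where v: "v \<in> gr (cl \<mu>)" "x = \<iota> \<mu> v" unfolding Wt_in[OF \<mu>] by blast
  have inv: "inv_into (gr (cl \<kappa>)) (\<iota> \<kappa>) (\<iota> \<kappa> w) = w" if "\<kappa> \<in> \<Lambda>" "w \<in> gr (cl \<kappa>)" for \<kappa> w
    using iota_inj[OF that(1)] that(2) by simp
  have e: "inv_into (gr (cl \<mu>)) (\<iota> \<mu>) x = v" unfolding v(2) by (rule inv[OF \<mu> v(1)])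
  show "inv_into (gr (cl (\<mu>(i := \<mu> i + 1)))) (\<iota> (\<mu>(i := \<mu> i + 1))) (T i x) =
    (if \<mu> i = -1 then th (jx i) (inv_into (gr (cl \<mu>)) (\<iota> \<mu>) x) else inv_into (gr (cl \<mu>)) (\<iota> \<mu>) x)"
    unfolding e unfolding v(2) T_iota'[OF \<mu> i v(1)] inv[OF lattice_up[OF \<mu> i] tt_in[OF \<mu> i v(1)]] by (simp add: tt_def)
  show "inv_into (gr (cl (\<mu>(i := \<mu> i - 1)))) (\<iota> (\<mu>(i := \<mu> i - 1))) (D i x) =
    (if \<mu> i = 0 then th (jx i) (inv_into (gr (cl \<mu>)) (\<iota> \<mu>) x)
     else sd (\<mu> i) (inv_into (gr (cl \<mu>)) (\<iota> \<mu>) x) \<oplus>\<^bsub>V\<^esub> z (inv_into (gr (cl \<mu>)) (\<iota> \<mu>) x))"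
    unfolding e unfolding v(2) D_iota'[OF \<mu> i v(1)] inv[OF lattice_down[OF \<mu> i] dd_in[OF \<mu> i v(1)]] by (simp add: dd_def)
  show "inv_into (gr (cl \<mu>)) (\<iota> \<mu>) (O.A i (\<mu> i) x) = z (inv_into (gr (cl \<mu>)) (\<iota> \<mu>) x)"
    unfolding e unfolding v(2) A_iota[OF \<mu> i v(1)] by (rule inv[OF \<mu> V.z_gr[OF cl_Gk v(1)]])
qed

end

text \<open>The blocks are summed inside \<open>'a\<close>, t_i and \<partial>_i are defined
  blockwise, and the relations then yield the ring action by
  \<open>weyl_module_of_ops\<close>.\<close>

theorem (in int_index) link_to_module:
  assumes V: "graded_data V sd k gr th z" and universe: "\<exists>u :: complex \<Rightarrow> 'a. inj u"
  shows "\<exists>(M :: (cpoly \<Rightarrow> cpoly, 'a) module) \<phi>. left_module (weyl n) M \<and>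
    weight_link n k \<nu> idx M (wsc n M) (wt n M) (wd n M) V sd gr th z \<phi>"
proof -
  interpret V: graded_data V sd k gr th z by (rule V)
  let ?B = "blk \<zero>\<^bsub>V\<^esub> gr"
  have B_in: "?B \<mu> = gr (cl \<mu>)" if "\<mu> \<in> \<Lambda>" for \<mu> using that by (simp add: blk_def)
  have subB: "csub V sd (?B \<mu>)" for \<mu> using V.sub[OF cl_Gk] V.csub_zero by (simp add: blk_def)
  have fdB: "fd V sd (?B \<mu>)" for \<mu> using V.fd_summand[OF V.V_fd cl_Gk] V.fd_zero by (simp add: blk_def)
  obtain u :: "((nat \<Rightarrow> complex) \<Rightarrow> _) \<Rightarrow> 'a" where u: "inj_on u (ext_sum V (weights n) ?B)"
    using ext_sum_embeds[OF inj_weights _ universe, of n ?B V] V.fd_inj_list[OF subB fdB] by blast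
  obtain Y :: "(cpoly \<Rightarrow> cpoly, 'a) module" and sc \<iota> where Y: "dsum Y sc (weights n) (\<lambda>\<mu>. \<iota> \<mu> ` ?B \<mu>)"
    and \<iota>: "\<And>\<mu>. \<mu> \<in> weights n \<Longrightarrow> lin_on (?B \<mu>) V sd Y sc (\<iota> \<mu>)" "\<And>\<mu>. \<mu> \<in> weights n \<Longrightarrow> inj_on (\<iota> \<mu>) (?B \<mu>)"
    using V.external_direct_sum[where W="?B" and I="weights n", OF subB u] by blast
  interpret Y: dsum Y sc "weights n" "\<lambda>\<mu>. \<iota> \<mu> ` ?B \<mu>" by (rule Y)
  have Ycs: "cspace Y sc" by unfold_locales
  define \<kappa> where "\<kappa> \<mu> = inv_into (?B \<mu>) (\<iota> \<mu>)" for \<mu>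
  have \<kappa>\<iota>: "\<kappa> \<mu> (\<iota> \<mu> w) = w" if "\<mu> \<in> weights n" "w \<in> ?B \<mu>" for \<mu> w
    unfolding \<kappa>_def using \<iota>(2)[OF that(1)] that(2) by simp
  have \<kappa>lin: "lin_on (\<iota> \<mu> ` ?B \<mu>) Y sc V sd (\<kappa> \<mu>)" if "\<mu> \<in> weights n" for \<mu>
    unfolding \<kappa>_def by (rule V.lin_inv_into[OF Ycs \<iota>(1)[OF that] subB \<iota>(2)[OF that]])
  \<comment> \<open>Extends a rule that moves the block of \<mu> to that of \<open>s \<mu>\<close>;
    blocks off the lattice are zero and go to zero.\<close>
  have ext: "\<exists>f. lin_on (carrier Y) Y sc Y sc f \<and> (\<forall>\<mu>\<in>\<Lambda>. \<forall>v\<in>gr (cl \<mu>). f (\<iota> \<mu> v) = \<iota> (s \<mu>) (op \<mu> v))"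
    if s: "\<And>\<mu>. \<mu> \<in> \<Lambda> \<Longrightarrow> s \<mu> \<in> \<Lambda>" and op: "\<And>\<mu>. \<mu> \<in> \<Lambda> \<Longrightarrow> lin_on (carrier V) V sd V sd (op \<mu>)"
      "\<And>\<mu> v. \<mu> \<in> \<Lambda> \<Longrightarrow> v \<in> gr (cl \<mu>) \<Longrightarrow> op \<mu> v \<in> gr (cl (s \<mu>))" for s op
  proof -
    have "\<exists>f. lin_on (carrier Y) Y sc Y sc f \<and> (\<forall>\<mu>\<in>weights n. \<forall>y\<in>\<iota> \<mu> ` ?B \<mu>. f y =
      (if \<mu> \<in> \<Lambda> then \<iota> (s \<mu>) (op \<mu> (\<kappa> \<mu> y)) else \<zero>\<^bsub>Y\<^esub>))"
    proof (rule Y.linear_extension[OF Ycs])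
      fix \<mu> assume \<mu>: "\<mu> \<in> weights n"
      show "lin_on (\<iota> \<mu> ` ?B \<mu>) Y sc Y sc (\<lambda>y. if \<mu> \<in> \<Lambda> then \<iota> (s \<mu>) (op \<mu> (\<kappa> \<mu> y)) else \<zero>\<^bsub>Y\<^esub>)"
      proof (cases "\<mu> \<in> \<Lambda>")
        case True
        have 1: "lin_on (\<iota> \<mu> ` ?B \<mu>) Y sc V sd (\<lambda>y. op \<mu> (\<kappa> \<mu> y))"
          by (rule lin_on_comp[OF \<kappa>lin[OF \<mu>] op(1)[OF True]]) (use lin_onD(1)[OF \<kappa>lin[OF \<mu>]] in blast)
        have "lin_on (\<iota> \<mu> ` ?B \<mu>) Y sc Y sc (\<lambda>y. \<iota> (s \<mu>) (op \<mu> (\<kappa> \<mu> y)))"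
        proof (rule lin_on_comp[OF 1 \<iota>(1)[OF lattice_weights[OF s[OF True]]]])
          fix y assume "y \<in> \<iota> \<mu> ` ?B \<mu>"
          then have "\<kappa> \<mu> y \<in> gr (cl \<mu>)" using \<kappa>\<iota>[OF \<mu>] B_in[OF True] by auto
          then show "op \<mu> (\<kappa> \<mu> y) \<in> ?B (s \<mu>)" using op(2)[OF True] B_in[OF s[OF True]] by simp
        qed
        then show ?thesis using True by simp
      qed (auto intro!: lin_onI)
    qed
    then obtain f where f: "lin_on (carrier Y) Y sc Y sc f" "\<forall>\<mu>\<in>weights n. \<forall>y\<in>\<iota> \<mu> ` ?B \<mu>. f y =
      (if \<mu> \<in> \<Lambda> then \<iota> (s \<mu>) (op \<mu> (\<kappa> \<mu> y)) else \<zero>\<^bsub>Y\<^esub>)" by blast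
    have "f (\<iota> \<mu> v) = \<iota> (s \<mu>) (op \<mu> v)" if \<mu>: "\<mu> \<in> \<Lambda>" and v: "v \<in> gr (cl \<mu>)" for \<mu> v
      using f(2) lattice_weights[OF \<mu>] \<mu> v B_in[OF \<mu>] \<kappa>\<iota>[OF lattice_weights[OF \<mu>]] by auto
    then show ?thesis using f(1) by blast
  qed
  have jx_in: "jx i \<in> {1..k}" if "\<mu> \<in> \<Lambda>" "i \<le> n" "\<mu> i = -1 \<or> \<mu> i = 0" for \<mu> i
    using cross_Int[of \<mu> i] that by auto
  have "\<exists>f. lin_on (carrier Y) Y sc Y sc f \<and> (\<forall>\<mu>\<in>\<Lambda>. \<forall>v\<in>gr (cl \<mu>).
      f (\<iota> \<mu> v) = \<iota> (\<mu>(i := \<mu> i + 1)) (if \<mu> i = -1 then th (jx i) v else v))" if i: "i \<le> n" for i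
  proof (rule ext[of "\<lambda>\<mu>. \<mu>(i := \<mu> i + 1)" "\<lambda>\<mu> v. if \<mu> i = -1 then th (jx i) v else v"])
    fix \<mu> assume \<mu>: "\<mu> \<in> \<Lambda>"
    show "\<mu>(i := \<mu> i + 1) \<in> \<Lambda>" using \<mu> i by simp
    show "lin_on (carrier V) V sd V sd (\<lambda>v. if \<mu> i = -1 then th (jx i) v else v)"
      using V.th_lin[OF jx_in[OF \<mu> i]] V.endo_id by (cases "\<mu> i = -1") (simp_all add: lin_on_def)
    show "(if \<mu> i = -1 then th (jx i) v else v) \<in> gr (cl (\<mu>(i := \<mu> i + 1)))" if "v \<in> gr (cl \<mu>)" for v
    proof (cases "\<mu> i = -1")
      case True
      then have "jx i \<in> {1..k}" using jx_in[OF \<mu> i] by simp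
      from V.th_gr[OF this cl_Gk that] show ?thesis unfolding cl_cross[OF \<mu> i True] using True by simp
    next
      case False
      then show ?thesis unfolding cl_up[OF \<mu> i False] using that by simp
    qed
  qed
  then obtain T where T: "\<And>i. i \<le> n \<Longrightarrow> lin_on (carrier Y) Y sc Y sc (T i)"
    "\<And>i \<mu> v. i \<le> n \<Longrightarrow> \<mu> \<in> \<Lambda> \<Longrightarrow> v \<in> gr (cl \<mu>) \<Longrightarrow> T i (\<iota> \<mu> v) = \<iota> (\<mu>(i := \<mu> i + 1)) (if \<mu> i = -1 then th (jx i) v else v)"
    by metis
  have "\<exists>f. lin_on (carrier Y) Y sc Y sc f \<and> (\<forall>\<mu>\<in>\<Lambda>. \<forall>v\<in>gr (cl \<mu>).
      f (\<iota> \<mu> v) = \<iota> (\<mu>(i := \<mu> i - 1)) (if \<mu> i = 0 then th (jx i) v else sd (\<mu> i) v \<oplus>\<^bsub>V\<^esub> z v))" if i: "i \<le> n" for i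
  proof (rule ext[of "\<lambda>\<mu>. \<mu>(i := \<mu> i - 1)" "\<lambda>\<mu> v. if \<mu> i = 0 then th (jx i) v else sd (\<mu> i) v \<oplus>\<^bsub>V\<^esub> z v"])
    fix \<mu> assume \<mu>: "\<mu> \<in> \<Lambda>"
    show "\<mu>(i := \<mu> i - 1) \<in> \<Lambda>" using \<mu> i by simp
    show "lin_on (carrier V) V sd V sd (\<lambda>v. if \<mu> i = 0 then th (jx i) v else sd (\<mu> i) v \<oplus>\<^bsub>V\<^esub> z v)"
      using V.th_lin[OF jx_in[OF \<mu> i]] V.endo_add[OF V.endo_sc V.z_lin, of "\<mu> i"] by (cases "\<mu> i = 0") (simp_all add: lin_on_def)
    show "(if \<mu> i = 0 then th (jx i) v else sd (\<mu> i) v \<oplus>\<^bsub>V\<^esub> z v) \<in> gr (cl (\<mu>(i := \<mu> i - 1)))" if v: "v \<in> gr (cl \<mu>)" for v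
    proof (cases "\<mu> i = 0")
      case True
      then have "jx i \<in> {1..k}" using jx_in[OF \<mu> i] by simp
      from V.th_gr[OF this cl_Gk v] show ?thesis unfolding cl_cross_down[OF \<mu> i True] using True by simp
    next
      case False
      then show ?thesis unfolding cl_down[OF \<mu> i False]
        using csubD(2)[OF V.sub[OF cl_Gk] csubD(5)[OF V.sub[OF cl_Gk] v] V.z_gr[OF cl_Gk v]] by simp
    qed
  qed
  then obtain D where D: "\<And>i. i \<le> n \<Longrightarrow> lin_on (carrier Y) Y sc Y sc (D i)"
    "\<And>i \<mu> v. i \<le> n \<Longrightarrow> \<mu> \<in> \<Lambda> \<Longrightarrow> v \<in> gr (cl \<mu>) \<Longrightarrow> D i (\<iota> \<mu> v) = \<iota> (\<mu>(i := \<mu> i - 1)) (if \<mu> i = 0 then th (jx i) v else sd (\<mu> i) v \<oplus>\<^bsub>V\<^esub> z v)"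
    by metis
  have \<iota>L: "lin_on (gr (cl \<mu>)) V sd Y sc (\<iota> \<mu>)" "inj_on (\<iota> \<mu>) (gr (cl \<mu>))" if "\<mu> \<in> \<Lambda>" for \<mu>
    using \<iota>[OF lattice_weights[OF that]] B_in[OF that] by auto
  have \<iota>0: "\<iota> \<mu> \<zero>\<^bsub>V\<^esub> = \<zero>\<^bsub>Y\<^esub>" if "\<mu> \<in> weights n" for \<mu> by (rule V.lin_zero[OF Ycs \<iota>(1)[OF that] subB])
  interpret I: induced_module n k \<nu> idx V sd gr th z Y sc \<iota> T D
    by (intro induced_module.intro int_index_axioms V Y induced_module_axioms.intro) (use \<iota>L \<iota>0 T D in auto)
  obtain s where s: "left_module (weyl n) (Y\<lparr>smult := s\<rparr>)" "\<And>x c. x \<in> carrier Y \<Longrightarrow> s (scalar_op n c) x = sc c x"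
    "\<And>x i. x \<in> carrier Y \<Longrightarrow> i \<le> n \<Longrightarrow> s (t_op n i) x = T i x" "\<And>x i. x \<in> carrier Y \<Longrightarrow> i \<le> n \<Longrightarrow> s (d_op n i) x = D i x"
    using weyl_module_of_ops[OF I.weyl] by blast
  let ?M = "Y\<lparr>smult := s\<rparr>"
  have wo: "weyl_ops ?M (wsc n ?M) n (wt n ?M) (wd n ?M)" by (rule weyl_module_ops[OF s(1)])
  then have cs: "cspace ?M (wsc n ?M)" by (simp add: weyl_ops_def)
  have dM: "dsum ?M (wsc n ?M) (weights n) (\<lambda>\<mu>. \<iota> \<mu> ` ?B \<mu>)"
    by (rule dsum_smult_update[OF Y cs]) (simp add: s)
  have \<iota>M: "lin_on (gr (cl \<mu>)) V sd ?M (wsc n ?M) (\<iota> \<mu>)" if "\<mu> \<in> \<Lambda>" for \<mu>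
    using \<iota>L(1)[OF that] by (auto simp: lin_on_def s)
  have \<iota>c: "\<iota> \<mu> v \<in> carrier Y" if "\<mu> \<in> \<Lambda>" "v \<in> gr (cl \<mu>)" for \<mu> v using lin_onD(1)[OF \<iota>L(1)[OF that(1)] that(2)] .
  \<comment> \<open>The same facts for the record with its new \<open>smult\<close>, whose actions
    of the generators agree with the operators on the carrier.\<close>
  interpret J: induced_module n k \<nu> idx V sd gr th z ?M "wsc n ?M" \<iota> "wt n ?M" "wd n ?M"
  proof (intro induced_module.intro int_index_axioms V dM induced_module_axioms.intro \<iota>M \<iota>L(2) weyl_ops.T_lin[OF wo] weyl_ops.D_lin[OF wo])
    show "\<iota> \<mu> \<zero>\<^bsub>V\<^esub> = \<zero>\<^bsub>?M\<^esub>" if "\<mu> \<in> weights n" for \<mu> using \<iota>0[OF that] by simp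
    fix \<mu> i v assume \<mu>: "\<mu> \<in> \<Lambda>" and i: "i \<le> n" and v: "v \<in> gr (cl \<mu>)"
    show "wt n ?M i (\<iota> \<mu> v) = \<iota> (\<mu>(i := \<mu> i + 1)) (if \<mu> i = -1 then th (jx i) v else v)"
      using s(3)[OF \<iota>c[OF \<mu> v] i] T(2)[OF i \<mu> v] by simp
    show "wd n ?M i (\<iota> \<mu> v) = \<iota> (\<mu>(i := \<mu> i - 1)) (if \<mu> i = 0 then th (jx i) v else sd (\<mu> i) v \<oplus>\<^bsub>V\<^esub> z v)"
      using s(4)[OF \<iota>c[OF \<mu> v] i] D(2)[OF i \<mu> v] by simp
  qed
  show ?thesis using s(1) J.link by blast
qed

section \<open>Modules over polynomial quotients, and the two equivalences\<close>

section \<open>Modules over quotients of polynomial rings\<close>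

text \<open>The bound \<open>K\<close> lets a monomial in variables from \<open>I\<close> be a
  product over an initial segment of the naturals.\<close>

locale commuting_ops = cspace V sc for V :: "('v, 'x) ring_scheme" (structure) and sc +
  fixes I :: "nat set" and K :: nat and X :: "nat \<Rightarrow> 'v \<Rightarrow> 'v"
  assumes X_lin: "i \<in> I \<Longrightarrow> lin_on (carrier V) V sc V sc (X i)"
    and X_X: "i \<in> I \<Longrightarrow> j \<in> I \<Longrightarrow> v \<in> carrier V \<Longrightarrow> X i (X j v) = X j (X i v)"
    and I_sub: "I \<subseteq> {..<K}"
begin

text \<open>Indices outside \<open>I\<close>, such as 0 for \<open>I = {1..k}\<close>, contribute
  the identity.\<close>

definition Xt :: "nat \<Rightarrow> 'v \<Rightarrow> 'v" where "Xt i = (if i \<in> I then X i else (\<lambda>v. v))"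

definition pm :: "(nat \<Rightarrow>\<^sub>0 nat) \<Rightarrow> 'v \<Rightarrow> 'v" where "pm m = mop Xt K (Poly_Mapping.lookup m)"

definition evp :: "cpoly \<Rightarrow> 'v \<Rightarrow> 'v" where "evp = ev pm"

lemma Xt_lin: "endo (Xt i)" using X_lin endo_id by (simp add: Xt_def)

lemma Xt_closed [simp]: "v \<in> carrier V \<Longrightarrow> Xt i v \<in> carrier V" using lin_onD(1)[OF Xt_lin] .

lemma Xt_Xt: "v \<in> carrier V \<Longrightarrow> Xt i (Xt j v) = Xt j (Xt i v)" by (simp add: Xt_def X_X)

lemma endo_pm: "endo (pm m)" unfolding pm_def by (rule endo_mop) (rule Xt_lin)

lemma pm_closed [simp]: "v \<in> carrier V \<Longrightarrow> pm m v \<in> carrier V" using lin_onD(1)[OF endo_pm] .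

lemma pm_add: "v \<in> carrier V \<Longrightarrow> pm (m + m') v = pm m (pm m' v)"
proof -
  assume v: "v \<in> carrier V"
  have "Poly_Mapping.lookup (m + m') = (\<lambda>i. Poly_Mapping.lookup m i + Poly_Mapping.lookup m' i)"
    by (rule ext) (rule lookup_add)
  then show ?thesis unfolding pm_def using v by (simp only:) (rule mop_add[where S="carrier V"]; simp add: Xt_Xt)
qed

lemma pm_0 [simp]: "pm 0 v = v" by (simp add: pm_def)

lemma pm_single: "i \<in> I \<Longrightarrow> v \<in> carrier V \<Longrightarrow> pm (Poly_Mapping.single i 1) v = X i v"
proof -
  assume i: "i \<in> I" and v: "v \<in> carrier V"
  have e: "Poly_Mapping.lookup (Poly_Mapping.single i 1) = (\<lambda>_. 0 :: nat)(i := Suc ((\<lambda>_. 0) i))"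
    by (auto simp: lookup_single when_def)
  have "mop Xt K (\<lambda>_. 0) (Xt i v) = mop Xt K ((\<lambda>_. 0)(i := Suc ((\<lambda>_. 0) i))) v"
    by (rule mop_swap_upd[where S="carrier V"]) (use i v I_sub Xt_Xt in auto)
  then show ?thesis unfolding pm_def e using i by (simp add: Xt_def del: fun_upd_apply)
qed

lemma endo_evp: "endo (evp p)" unfolding evp_def by (rule endo_ev[OF endo_pm])

lemma evp_closed [simp]: "v \<in> carrier V \<Longrightarrow> evp p v \<in> carrier V" using lin_onD(1)[OF endo_evp] .

lemma evp_add: "v \<in> carrier V \<Longrightarrow> evp (p + q) v = evp p v \<oplus> evp q v"
  unfolding evp_def by (rule ev_add) simp

lemma evp_single: "v \<in> carrier V \<Longrightarrow> evp (Poly_Mapping.single m c) v = sc c (pm m v)"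
  unfolding evp_def by (rule ev_single) simp

lemma evp_0 [simp]: "evp 0 v = \<zero>" by (simp add: evp_def)

lemma evp_mult: "v \<in> carrier V \<Longrightarrow> evp (p * q) v = evp p (evp q v)"
proof (induction p rule: poly_mapping_induct_add)
  case 1 then show ?case by simp
next
  case (2 m c)
  then have v: "v \<in> carrier V" by simp
  show ?case
  proof (induction q rule: poly_mapping_induct_add)
    case 1 show ?case using endo_zero[OF endo_evp] by simp
  next
    case (2 m' c')
    show ?case using v lin_onD(3)[OF endo_pm] by (simp add: mult_single evp_single pm_add)
  next
    case (3 q q')
    then show ?case using v lin_onD(2)[OF endo_evp] by (simp add: distrib_left evp_add)
  qed
next
  case (3 p p')
  then show ?case by (simp add: distrib_right evp_add)
qed

lemma evp_Const: "v \<in> carrier V \<Longrightarrow> evp (Const c) v = sc c v"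
  by (simp add: Const_def evp_single)

lemma evp_Var: "i \<in> I \<Longrightarrow> v \<in> carrier V \<Longrightarrow> evp (Var i) v = X i v"
  using pm_single X_lin lin_onD(1)[OF X_lin] by (simp add: Var_def evp_single)

end

text \<open>A ring presented as a quotient of a polynomial ring; it serves for \<complex>[z] with
  the identity map and for the algebra B(k) with \<open>B_class\<close>.\<close>

locale poly_quot = ring R for R :: "('r, 'x) ring_scheme" (structure) +
  fixes I :: "nat set" and K :: nat and \<psi> :: "cpoly \<Rightarrow> 'r"
  assumes psi_hom: "\<psi> \<in> ring_hom (poly_ring_on I) R"
    and psi_surj: "carrier R = \<psi> ` polys I"
    and I_sub: "I \<subseteq> {..<K}"
begin

lemma psi_closed [simp]: "p \<in> polys I \<Longrightarrow> \<psi> p \<in> carrier R" using psi_surj by blast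

lemma psi_add: "p \<in> polys I \<Longrightarrow> q \<in> polys I \<Longrightarrow> \<psi> (p + q) = \<psi> p \<oplus> \<psi> q"
  and psi_mult: "p \<in> polys I \<Longrightarrow> q \<in> polys I \<Longrightarrow> \<psi> (p * q) = \<psi> p \<otimes> \<psi> q"
  and psi_1: "\<psi> 1 = \<one>"
  using psi_hom by (auto simp: ring_hom_def poly_ring_on_def)

end

locale poly_quot_module = poly_quot R I K \<psi> + left_module R N
  for R :: "('r, 'x) ring_scheme" (structure) and I K \<psi> and N :: "('r, 'a) module" (structure)
begin

abbreviation nsc :: "complex \<Rightarrow> 'a \<Rightarrow> 'a" where "nsc c \<equiv> smult N (\<psi> (Const c))"
abbreviation nX :: "nat \<Rightarrow> 'a \<Rightarrow> 'a" where "nX i \<equiv> smult N (\<psi> (Var i))"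

lemma smult_psi_mult: "p \<in> polys I \<Longrightarrow> q \<in> polys I \<Longrightarrow> x \<in> carrier N \<Longrightarrow>
  smult N (\<psi> p) (smult N (\<psi> q) x) = smult N (\<psi> (p * q)) x"
  by (simp add: psi_mult smult_assoc1)

lemma psi_zero: "\<psi> 0 = \<zero>\<^bsub>R\<^esub>"
  using ring_hom_zero[OF psi_hom cring.axioms(1)[OF cring_poly_ring_on] ring_axioms] by (simp add: poly_ring_on_def)

lemma comm_ops: "commuting_ops N nsc I K nX"
proof (intro commuting_ops.intro cspace.intro cspace_axioms.intro commuting_ops_axioms.intro lin_onI I_sub)
  show "abelian_group N" by (rule M.abelian_group_axioms)
  fix x and c d :: complex assume x: "x \<in> carrier N"
  show "nsc c x \<in> carrier N" using x by (simp add: smult_closed)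
  show "nsc (c + d) x = nsc c x \<oplus>\<^bsub>N\<^esub> nsc d x" using x by (simp add: Const_add psi_add smult_l_distr)
  show "nsc c (nsc d x) = nsc (c * d) x" using x by (simp add: smult_psi_mult Const_mult)
  show "nsc 1 x = x" using x by (simp add: psi_1 smult_one)
  fix y assume "y \<in> carrier N"
  then show "nsc c (x \<oplus>\<^bsub>N\<^esub> y) = nsc c x \<oplus>\<^bsub>N\<^esub> nsc c y" using x by (simp add: smult_r_distr)
next
  fix i x assume i: "i \<in> I" and x: "x \<in> carrier N"
  show "nX i x \<in> carrier N" using i x by (simp add: smult_closed)
  show "nX i (nsc c x) = nsc c (nX i x)" for c using i x by (simp add: smult_psi_mult mult.commute)
  show "nX i (nX j x) = nX j (nX i x)" if "j \<in> I" for j using i that x by (simp add: smult_psi_mult mult.commute)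
  fix y assume "y \<in> carrier N"
  then show "nX i (x \<oplus>\<^bsub>N\<^esub> y) = nX i x \<oplus>\<^bsub>N\<^esub> nX i y" using i x by (simp add: smult_r_distr)
qed

end

sublocale poly_quot_module \<subseteq> O: commuting_ops N nsc I K nX by (rule comm_ops)

context poly_quot_module begin

lemma smult_mop_Var:
  assumes a: "\<And>i. i \<notin> I \<Longrightarrow> a i = 0" and q: "q \<in> polys I" and x: "x \<in> carrier N"
  shows "mop (\<lambda>i p. Var i * p) L a q \<in> polys I \<and>
    smult N (\<psi> (mop (\<lambda>i p. Var i * p) L a q)) x = mop O.Xt L a (smult N (\<psi> q) x)"
proof (induction L)
  case 0 then show ?case using q by simp
next
  case (Suc L)
  let ?q = "mop (\<lambda>i p. Var i * p) L a q"
  have "((\<lambda>p. Var L * p) ^^ r) ?q \<in> polys I \<and>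
    smult N (\<psi> (((\<lambda>p. Var L * p) ^^ r) ?q)) x = (O.Xt L ^^ r) (smult N (\<psi> ?q) x)" if "L \<in> I \<or> r = 0" for r
    using that
  proof (induction r)
    case 0 then show ?case using Suc by simp
  next
    case (Suc r)
    then have L: "L \<in> I" by simp
    then have IH: "((\<lambda>p. Var L * p) ^^ r) ?q \<in> polys I"
      "smult N (\<psi> (((\<lambda>p. Var L * p) ^^ r) ?q)) x = (O.Xt L ^^ r) (smult N (\<psi> ?q) x)" using Suc by auto
    show ?case using IH L x smult_psi_mult[OF polys_Var[OF L] IH(1) x, symmetric] by (simp add: O.Xt_def)
  qed
  then show ?case using a[of L] Suc by auto
qed

text \<open>Reduces the action of an arbitrary ring element to the operators of the variables, by
  writing a polynomial as a sum of scaled products of variables.\<close>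

lemma smult_psi: "p \<in> polys I \<Longrightarrow> x \<in> carrier N \<Longrightarrow> smult N (\<psi> p) x = O.evp p x"
proof -
  assume p: "p \<in> polys I" and x: "x \<in> carrier N"
  have "p \<in> polys I \<longrightarrow> smult N (\<psi> p) x = O.evp p x" if sub: "Poly_Mapping.keys p \<subseteq> {m. Poly_Mapping.keys m \<subseteq> I}" for p
  proof -
    \<comment> \<open>Membership in \<open>polys I\<close> is proved along, since
      \<open>psi_add\<close> needs it for the partial sums.\<close>
    have "p \<in> polys I \<and> smult N (\<psi> p) x = O.evp p x"
    proof (induction p rule: poly_mapping_induct_add)
      case 1 show ?case using smult_zero_l[OF x] by (simp add: psi_zero)
    next
      case (2 m c)
      then have m: "Poly_Mapping.keys m \<subseteq> I" using sub by auto
      then have mK: "Poly_Mapping.keys m \<subseteq> {..<K}" using I_sub by blast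
      have "m = (\<Sum>i<K. Poly_Mapping.single i (Poly_Mapping.lookup m i))"
        by (rule poly_mapping_eqI, subst lookup_sum_single) (use mK in \<open>force simp: in_keys_iff\<close>)
      then have e: "mop (\<lambda>i p. Var i * p) K (Poly_Mapping.lookup m) 1 = Poly_Mapping.single m 1"
        using mop_Var_single[of K "Poly_Mapping.lookup m" 0 1] by simp
      have s1: "Poly_Mapping.single m 1 \<in> polys I" by (rule polys_single[OF m])
      have "smult N (\<psi> (Poly_Mapping.single m 1)) x = O.pm m x"
      proof -
        have "Poly_Mapping.lookup m i = 0" if "i \<notin> I" for i using m that by (auto simp: in_keys_iff)
        from smult_mop_Var[of "Poly_Mapping.lookup m" 1 x K, OF this] show ?thesis
          using x unfolding e O.pm_def by (simp add: psi_1 smult_one)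
      qed
      moreover have "smult N (\<psi> (Poly_Mapping.single m c)) x = nsc c (smult N (\<psi> (Poly_Mapping.single m 1)) x)"
        using smult_psi_mult[OF polys_Const s1 x] by (simp add: Const_def mult_single)
      ultimately show ?case using x polys_single[OF m] by (simp add: O.evp_single)
    next
      case (3 p q)
      then show ?case using x by (simp add: psi_add smult_l_distr O.evp_add)
    qed
    then show ?thesis by blast
  qed
  then show ?thesis using p x by (auto simp: polys_def)
qed

end

text \<open>Compatibility with the variables passes to monomials, then to polynomials, hence to
  every element of the quotient.\<close>

lemma (in poly_quot) module_maps_iff:
  assumes N: "left_module R N" and N': "left_module R N'"
  shows "f \<in> module_maps R N N' \<longleftrightarrow> f \<in> carrier N \<rightarrow>\<^sub>E carrier N' \<and>
    lin_on (carrier N) N (\<lambda>c. smult N (\<psi> (Const c))) N' (\<lambda>c. smult N' (\<psi> (Const c))) f \<and>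
    (\<forall>i\<in>I. \<forall>x\<in>carrier N. f (smult N (\<psi> (Var i)) x) = smult N' (\<psi> (Var i)) (f x))"
proof
  assume "f \<in> module_maps R N N'"
  then show "f \<in> carrier N \<rightarrow>\<^sub>E carrier N' \<and>
    lin_on (carrier N) N (\<lambda>c. smult N (\<psi> (Const c))) N' (\<lambda>c. smult N' (\<psi> (Const c))) f \<and>
    (\<forall>i\<in>I. \<forall>x\<in>carrier N. f (smult N (\<psi> (Var i)) x) = smult N' (\<psi> (Var i)) (f x))"
    by (auto simp: module_maps_def lin_on_def)
next
  interpret N: left_module R N by fact
  interpret N': left_module R N' by fact
  interpret N: poly_quot_module R I K \<psi> N by unfold_locales
  interpret N': poly_quot_module R I K \<psi> N' by unfold_locales
  assume f: "f \<in> carrier N \<rightarrow>\<^sub>E carrier N' \<and>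
    lin_on (carrier N) N N.nsc N' N'.nsc f \<and>
    (\<forall>i\<in>I. \<forall>x\<in>carrier N. f (smult N (\<psi> (Var i)) x) = smult N' (\<psi> (Var i)) (f x))"
  then have fl: "lin_on (carrier N) N N.nsc N' N'.nsc f" by blast
  have fc: "f x \<in> carrier N'" if "x \<in> carrier N" for x using lin_onD(1)[OF fl that] .
  have fX: "f (N.O.Xt i x) = N'.O.Xt i (f x)" if "x \<in> carrier N" for i x
    using f that by (simp add: N.O.Xt_def N'.O.Xt_def)
  have fp: "f (N.O.pm m x) = N'.O.pm m (f x)" if x: "x \<in> carrier N" for m x
  proof -
    have "mop N.O.Xt L a x \<in> carrier N \<and> f (mop N.O.Xt L a x) = mop N'.O.Xt L a (f x)" for L a
    proof (induction L)
      case (Suc L)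
      have "(N.O.Xt L ^^ r) y \<in> carrier N \<and> f ((N.O.Xt L ^^ r) y) = (N'.O.Xt L ^^ r) (f y)" if "y \<in> carrier N" for r y
        by (induction r) (use that fX in auto)
      then show ?case using Suc by simp
    qed (use x in simp)
    then show ?thesis by (simp add: N.O.pm_def N'.O.pm_def)
  qed
  have fe: "f (N.O.evp p x) = N'.O.evp p (f x)" if x: "x \<in> carrier N" for p x
  proof (induction p rule: poly_mapping_induct_add)
    case 1
    show ?case using N.O.lin_zero[OF N'.O.cspace_axioms fl N.O.csub_carrier] by simp
  next
    case (2 m c)
    show ?case using x fc fp lin_onD(3)[OF fl] by (simp add: N.O.evp_single N'.O.evp_single)
  next
    case (3 p q)
    then show ?case using x fc lin_onD(2)[OF fl] by (simp add: N.O.evp_add N'.O.evp_add)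
  qed
  have "f (smult N a x) = smult N' a (f x)" if "a \<in> carrier R" "x \<in> carrier N" for a x
  proof -
    obtain p where p: "p \<in> polys I" "a = \<psi> p" using \<open>a \<in> carrier R\<close> psi_surj by blast
    then show ?thesis using N.smult_psi[OF p(1) that(2)] N'.smult_psi[OF p(1) fc[OF that(2)]] fe[OF that(2)] by simp
  qed
  then show "f \<in> module_maps R N N'" using f lin_onD(2)[OF fl] by (auto simp: module_maps_def)
qed

text \<open>The action is defined through a chosen polynomial preimage; \<open>ker\<close> makes the
  choice irrelevant.\<close>

lemma (in poly_quot) module_of_ops:
  fixes V :: "('r, 'a) module"
  assumes V: "commuting_ops V sc I K X"
    and ker: "\<And>p q v. p \<in> polys I \<Longrightarrow> q \<in> polys I \<Longrightarrow> \<psi> p = \<psi> q \<Longrightarrow> v \<in> carrier V \<Longrightarrow>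
      commuting_ops.evp V sc I K X p v = commuting_ops.evp V sc I K X q v"
  shows "\<exists>s. left_module R (V\<lparr>smult := s\<rparr>) \<and>
    (\<forall>p\<in>polys I. \<forall>v\<in>carrier V. s (\<psi> p) v = commuting_ops.evp V sc I K X p v)"
proof -
  interpret V: commuting_ops V sc I K X by fact
  define s where "s a v = V.evp (SOME p. p \<in> polys I \<and> \<psi> p = a) v" for a v
  have s: "s (\<psi> p) v = V.evp p v" if p: "p \<in> polys I" and v: "v \<in> carrier V" for p v
  proof -
    have "(SOME q. q \<in> polys I \<and> \<psi> q = \<psi> p) \<in> polys I \<and> \<psi> (SOME q. q \<in> polys I \<and> \<psi> q = \<psi> p) = \<psi> p"
      by (rule someI[of _ p]) (use p in simp)
    then show ?thesis unfolding s_def using p v by (intro ker) auto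
  qed
  have "left_module R (V\<lparr>smult := s\<rparr>)"
  proof (intro left_module.intro ring_axioms left_module_axioms.intro)
    show "abelian_group (V\<lparr>smult := s\<rparr>)"
      using V.abelian_group_axioms by (simp add: abelian_group_def abelian_monoid_def abelian_group_axioms_def)
    fix a x assume a: "a \<in> carrier R" and "x \<in> carrier (V\<lparr>smult := s\<rparr>)"
    then have x: "x \<in> carrier V" by simp
    obtain p where p: "p \<in> polys I" "a = \<psi> p" using a psi_surj by blast
    show "a \<odot>\<^bsub>V\<lparr>smult := s\<rparr>\<^esub> x \<in> carrier (V\<lparr>smult := s\<rparr>)" using p x by (simp add: s)
    { fix y assume "y \<in> carrier (V\<lparr>smult := s\<rparr>)"
      then show "a \<odot>\<^bsub>V\<lparr>smult := s\<rparr>\<^esub> (x \<oplus>\<^bsub>V\<lparr>smult := s\<rparr>\<^esub> y) = a \<odot>\<^bsub>V\<lparr>smult := s\<rparr>\<^esub> x \<oplus>\<^bsub>V\<lparr>smult := s\<rparr>\<^esub> a \<odot>\<^bsub>V\<lparr>smult := s\<rparr>\<^esub> y"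
        using p x lin_onD(2)[OF V.endo_evp] by (simp add: s) }
    fix b assume b: "b \<in> carrier R"
    then obtain q where q: "q \<in> polys I" "b = \<psi> q" using psi_surj by blast
    show "(a \<oplus> b) \<odot>\<^bsub>V\<lparr>smult := s\<rparr>\<^esub> x = a \<odot>\<^bsub>V\<lparr>smult := s\<rparr>\<^esub> x \<oplus>\<^bsub>V\<lparr>smult := s\<rparr>\<^esub> b \<odot>\<^bsub>V\<lparr>smult := s\<rparr>\<^esub> x"
      unfolding p(2) q(2) psi_add[OF p(1) q(1), symmetric] using p q x by (simp add: s V.evp_add)
    show "(a \<otimes> b) \<odot>\<^bsub>V\<lparr>smult := s\<rparr>\<^esub> x = a \<odot>\<^bsub>V\<lparr>smult := s\<rparr>\<^esub> (b \<odot>\<^bsub>V\<lparr>smult := s\<rparr>\<^esub> x)"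
      unfolding p(2) q(2) psi_mult[OF p(1) q(1), symmetric] using p q x by (simp add: s V.evp_mult)
  next
    fix x assume "x \<in> carrier (V\<lparr>smult := s\<rparr>)"
    then show "\<one> \<odot>\<^bsub>V\<lparr>smult := s\<rparr>\<^esub> x = x"
      using s[of 1 x] V.evp_Const[of x 1] by (simp flip: psi_1)
  qed
  then show ?thesis using s by blast
qed

section \<open>The equivalences\<close>

lemma is_category_module_category:
  fixes R :: "('r, 'x) ring_scheme" and P :: "('r, 'a) module \<Rightarrow> bool"
  shows "is_category (module_category R P)"
proof -
  have id: "restrict id (carrier M) \<in> module_maps R M M" if "left_module R M" for M :: "('r, 'a) module"
  proof -
    interpret left_module R M by fact
    show ?thesis by (auto simp: module_maps_def smult_closed)
  qed
  have comp: "compose (carrier L) g f \<in> module_maps R L N"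
    if "left_module R L" "f \<in> module_maps R L M" "g \<in> module_maps R M N" for L M N :: "('r, 'a) module" and f g
  proof -
    interpret left_module R L by fact
    show ?thesis using that(2,3) by (auto simp: module_maps_def compose_def smult_closed PiE_def Pi_def)
  qed
  show ?thesis
    unfolding is_category_def module_category_def category.simps
  proof (intro conjI ballI)
    fix X Y f assume "f \<in> module_maps R X Y"
    then have f: "f \<in> carrier X \<rightarrow>\<^sub>E carrier Y" by (simp add: module_maps_def)
    show "compose (carrier X) (restrict id (carrier Y)) f = f" "compose (carrier X) f (restrict id (carrier X)) = f"
      using f by (auto simp: compose_def fun_eq_iff PiE_def extensional_def Pi_def)
  next
    fix W X Y Z f g h assume "f \<in> module_maps R W X"
    then have f: "f \<in> carrier W \<rightarrow>\<^sub>E carrier X" by (simp add: module_maps_def)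
    show "compose (carrier W) h (compose (carrier W) g f) = compose (carrier W) (compose (carrier X) h g) f"
      using f by (auto simp: compose_def fun_eq_iff PiE_def extensional_def Pi_def)
  qed (use id comp in auto)
qed

text \<open>The common form of the two cases: \<open>D\<close> may be any category whose objects
  carry graded data, into which every link can be redirected (\<open>real\<close>), and whose
  morphisms are the maps respecting the data (\<open>hom\<close>).\<close>

theorem equivalence_with_graded_data:
  fixes D :: "('y, 'b \<Rightarrow> 'b) category" and rc :: "'y \<Rightarrow> ('r, 'b) module"
  assumes idx: "int_index n k \<nu> idx"
    and universe_a: "\<exists>u :: complex \<Rightarrow> 'a. inj u" and universe_b: "\<exists>u :: complex \<Rightarrow> 'b. inj u"
    and catD: "is_category D"
    and data: "\<And>Y. Y \<in> Obj D \<Longrightarrow> graded_data (rc Y) (ds Y) k (dg Y) (dt Y) (dz Y)"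
    and real: "\<And>(M :: (cpoly \<Rightarrow> cpoly, 'a) module) sc T D' (V :: ('r, 'b) module) sd gr th z \<phi>.
      weight_link n k \<nu> idx M sc T D' V sd gr th z \<phi> \<Longrightarrow>
      \<exists>Y\<in>Obj D. weight_link n k \<nu> idx M sc T D' (rc Y) (ds Y) (dg Y) (dt Y) (dz Y) \<phi>"
    and hom: "\<And>Y Y' g. Y \<in> Obj D \<Longrightarrow> Y' \<in> Obj D \<Longrightarrow> g \<in> Hom D Y Y' \<longleftrightarrow>
      g \<in> carrier (rc Y) \<rightarrow>\<^sub>E carrier (rc Y') \<and> lin_on (carrier (rc Y)) (rc Y) (ds Y) (rc Y') (ds Y') g \<and>
      (\<forall>h\<in>Gk k. g ` dg Y h \<subseteq> dg Y' h) \<and>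
      (\<forall>v\<in>carrier (rc Y). (\<forall>j\<in>{1..k}. g (dt Y j v) = dt Y' j (g v)) \<and> g (dz Y v) = dz Y' (g v))"
    and idm: "\<And>Y. Y \<in> Obj D \<Longrightarrow> Idm D Y = restrict id (carrier (rc Y))"
    and comp: "\<And>X Y Z g f. X \<in> Obj D \<Longrightarrow> Y \<in> Obj D \<Longrightarrow> Z \<in> Obj D \<Longrightarrow>
      Comp D X Y Z g f = compose (carrier (rc X)) g f"
  shows "equivalent_categories (sb_weight_category n \<nu> :: ((cpoly \<Rightarrow> cpoly, 'a) module, 'a \<Rightarrow> 'a) category) D"
proof -
  interpret int_index n k \<nu> idx by (rule idx)
  let ?C = "sb_weight_category n \<nu> :: ((cpoly \<Rightarrow> cpoly, 'a) module, 'a \<Rightarrow> 'a) category"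
  let ?link = "\<lambda>(M :: (cpoly \<Rightarrow> cpoly, 'a) module) Y \<phi>.
    weight_link n k \<nu> idx M (wsc n M) (wt n M) (wd n M) (rc Y) (ds Y) (dg Y) (dt Y) (dz Y) \<phi>"
  define E where "E = {(M, Y, \<phi>). M \<in> Obj ?C \<and> Y \<in> Obj D \<and> ?link M Y \<phi>}"
  define wts where "wts M \<mu> = weyl_ops.Wt M (wsc n M) n (wt n M) (wd n M) \<mu>" for M :: "(cpoly \<Rightarrow> cpoly, 'a) module" and \<mu>
  define R where "R = (\<lambda>(M, Y :: 'y, \<phi>) (M' :: (cpoly \<Rightarrow> cpoly, 'a) module, Y' :: 'y, \<phi>') (f :: 'a \<Rightarrow> 'a) (g :: 'b \<Rightarrow> 'b).
    \<forall>\<mu>\<in>\<Lambda>. \<forall>x\<in>wts M \<mu>. \<phi>' \<mu> (f x) = g (\<phi> \<mu> x :: 'b))"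
  have CHom: "Hom ?C = module_maps (weyl n)" "Idm ?C M = restrict id (carrier M)" "Comp ?C X Y Z g f = compose (carrier X) g f" for M X Y Z g f
    by (simp_all add: sb_weight_category_def module_category_def)
  have wc: "x \<in> carrier M" "\<phi> \<mu> x \<in> carrier (rc Y)" if "(M, Y, \<phi>) \<in> E" "\<mu> \<in> \<Lambda>" "x \<in> wts M \<mu>" for M Y \<phi> \<mu> x
  proof -
    interpret L: weight_link n k \<nu> idx M "wsc n M" "wt n M" "wd n M" "rc Y" "ds Y" "dg Y" "dt Y" "dz Y" \<phi>
      using that by (simp add: E_def)
    show "x \<in> carrier M" using that L.M.Wt_carrier by (simp add: wts_def)
    show "\<phi> \<mu> x \<in> carrier (rc Y)" using that lin_onD(1)[OF L.phi_lin] by (simp add: wts_def)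
  qed
  \<comment> \<open>All comparisons of morphisms for a pair of links are collected, so that
    \<open>weight_link_pair\<close> is interpreted only once.\<close>
  have two: "(f \<in> Hom ?C M M' \<longrightarrow> (\<exists>g\<in>Hom D Y Y'. R (M, Y, \<phi>) (M', Y', \<phi>') f g)) \<and>
      (g \<in> Hom D Y Y' \<longrightarrow> (\<exists>f\<in>Hom ?C M M'. R (M, Y, \<phi>) (M', Y', \<phi>') f g)) \<and>
      (f \<in> Hom ?C M M' \<longrightarrow> g \<in> Hom D Y Y' \<longrightarrow> g' \<in> Hom D Y Y' \<longrightarrow>
        R (M, Y, \<phi>) (M', Y', \<phi>') f g \<longrightarrow> R (M, Y, \<phi>) (M', Y', \<phi>') f g' \<longrightarrow> g = g') \<and>
      (f \<in> Hom ?C M M' \<longrightarrow> f' \<in> Hom ?C M M' \<longrightarrow> g \<in> Hom D Y Y' \<longrightarrow>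
        R (M, Y, \<phi>) (M', Y', \<phi>') f g \<longrightarrow> R (M, Y, \<phi>) (M', Y', \<phi>') f' g \<longrightarrow> f = f') \<and>
      (f \<in> Hom ?C M M' \<longrightarrow> (\<forall>\<mu>. \<forall>x\<in>wts M \<mu>. f x \<in> wts M' \<mu>))"
    if e: "(M, Y, \<phi>) \<in> E" "(M', Y', \<phi>') \<in> E" for M Y \<phi> M' Y' \<phi>' f f' g g'
  proof -
    interpret P: weight_link_pair n k \<nu> idx M "wsc n M" "wt n M" "wd n M" "rc Y" "ds Y" "dg Y" "dt Y" "dz Y" \<phi>
      M' "wsc n M'" "wt n M'" "wd n M'" "rc Y'" "ds Y'" "dg Y'" "dt Y'" "dz Y'" \<phi>'
      using e by (simp add: E_def weight_link_pair_def)
    have lm: "left_module (weyl n) M" "left_module (weyl n) M'" using e by (auto simp: E_def sb_Obj_iff)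
    have whom: "f \<in> Hom ?C M M' \<longleftrightarrow> f \<in> carrier M \<rightarrow>\<^sub>E carrier M' \<and> P.whom f" for f
      unfolding CHom weyl_module_maps_iff[OF lm] P.whom_def by blast
    have ghom: "g \<in> Hom D Y Y' \<longleftrightarrow> g \<in> carrier (rc Y) \<rightarrow>\<^sub>E carrier (rc Y') \<and> P.ghom g" for g
      using hom[of Y Y' g] e unfolding E_def P.ghom_def by blast
    have R: "R (M, Y, \<phi>) (M', Y', \<phi>') f g \<longleftrightarrow> P.corr f g" for f g
      unfolding R_def P.corr_def wts_def by simp
    \<comment> \<open>Morphisms of the categories are extensional, those produced by
      \<open>corr_ex_whom\<close> need not be; restriction to the carrier repairs this without
      affecting \<open>corr\<close>.\<close>
    have whom_r: "P.whom (restrict f (carrier M))" if "P.whom f" for f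
    proof -
      have l: "lin_on (carrier M) M (wsc n M) M' (wsc n M') (restrict f (carrier M))"
        by (rule lin_on_cong[OF _ _ P.L.M.csub_carrier, of _ _ f]) (use that in \<open>simp_all add: P.whom_def\<close>)
      have "f (wt n M i x) = wt n M' i (f x)" "f (wd n M i x) = wd n M' i (f x)" if "i \<le> n" "x \<in> carrier M" for i x
        using \<open>P.whom f\<close> that by (simp_all add: P.whom_def)
      then show ?thesis using l P.L.M.T_closed P.L.M.D_closed unfolding P.whom_def by simp
    qed
    have ghom_r: "P.ghom (restrict g (carrier (rc Y)))" if "P.ghom g" for g
    proof -
      have l: "lin_on (carrier (rc Y)) (rc Y) (ds Y) (rc Y') (ds Y') (restrict g (carrier (rc Y)))"
        by (rule lin_on_cong[OF _ _ P.L.V.csub_carrier, of _ _ g]) (use that in \<open>simp_all add: P.ghom_def\<close>)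
      have a: "g (dt Y j x) = dt Y' j (g x)" "g (dz Y x) = dz Y' (g x)" if "j \<in> {1..k}" "x \<in> carrier (rc Y)" for j x
        using \<open>P.ghom g\<close> that by (simp_all add: P.ghom_def)
      have z: "g (dz Y x) = dz Y' (g x)" if "x \<in> carrier (rc Y)" for x
        using \<open>P.ghom g\<close> that by (simp add: P.ghom_def)
      have b: "restrict g (carrier (rc Y)) ` dg Y h \<subseteq> dg Y' h" if "h \<in> Gk k" for h
        using \<open>P.ghom g\<close> that P.L.V.W_carrier[OF that] by (auto simp: P.ghom_def)
      show ?thesis using l a z b P.L.V.th_closed P.L.V.z_closed unfolding P.ghom_def by simp
    qed
    have corr_r: "P.corr (restrict f (carrier M)) g \<longleftrightarrow> P.corr f g" "P.corr f (restrict g (carrier (rc Y))) \<longleftrightarrow> P.corr f g" for f g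
      unfolding P.corr_def using wc[OF e(1)] by (simp_all add: wts_def)
    have 1: "\<exists>g\<in>Hom D Y Y'. R (M, Y, \<phi>) (M', Y', \<phi>') f g" if f: "f \<in> Hom ?C M M'"
    proof -
      have "P.whom f" using f whom by blast
      from P.corr_ex_ghom[OF this] obtain g where g: "P.ghom g" "P.corr f g" by blast
      have "restrict g (carrier (rc Y)) \<in> Hom D Y Y'"
        unfolding ghom using ghom_r[OF g(1)] g(1) by (auto simp: P.ghom_def lin_on_def)
      then show ?thesis using g(2) corr_r R by blast
    qed
    have 2: "\<exists>f\<in>Hom ?C M M'. R (M, Y, \<phi>) (M', Y', \<phi>') f g" if g: "g \<in> Hom D Y Y'"
    proof -
      have "P.ghom g" using g ghom by blast
      from P.corr_ex_whom[OF this] obtain f where f: "P.whom f" "P.corr f g" by blast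
      have "restrict f (carrier M) \<in> Hom ?C M M'"
        unfolding whom using whom_r[OF f(1)] f(1) by (auto simp: P.whom_def lin_on_def)
      then show ?thesis using f(2) corr_r R by blast
    qed
    have 3: "g = g'" if "g \<in> Hom D Y Y'" "g' \<in> Hom D Y Y'" "R (M, Y, \<phi>) (M', Y', \<phi>') f g" "R (M, Y, \<phi>) (M', Y', \<phi>') f g'"
      by (rule PiE_ext[of _ "carrier (rc Y)" "\<lambda>_. carrier (rc Y')"])
        (use that P.corr_unique_ghom[of g g' f] in \<open>auto simp: ghom R\<close>)
    have 4: "f = f'" if "f \<in> Hom ?C M M'" "f' \<in> Hom ?C M M'" "R (M, Y, \<phi>) (M', Y', \<phi>') f g" "R (M, Y, \<phi>) (M', Y', \<phi>') f' g"
      by (rule PiE_ext[of _ "carrier M" "\<lambda>_. carrier M'"])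
        (use that P.corr_unique_whom[of f f' g] in \<open>auto simp: whom R\<close>)
    have 5: "f x \<in> wts M' \<mu>" if "f \<in> Hom ?C M M'" "x \<in> wts M \<mu>" for \<mu> x
      using that P.whom_Wt whom unfolding wts_def by blast
    show ?thesis using 1 2 3 4 5 by blast
  qed
  interpret S: category_span ?C D E fst "\<lambda>e. fst (snd e)" R
  proof (unfold_locales)
    show "is_category ?C" unfolding sb_weight_category_def by (rule is_category_module_category)
    show "is_category D" by (rule catD)
    fix e assume e: "e \<in> E"
    then show "fst e \<in> Obj ?C" "fst (snd e) \<in> Obj D" by (auto simp: E_def)
    obtain M Y \<phi> where eq: "e = (M, Y, \<phi>)" by (cases e)
    have Y: "Y \<in> Obj D" using e eq by (simp add: E_def)
    show "R e e (Idm ?C (fst e)) (Idm D (fst (snd e)))"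
      using wc[OF e[unfolded eq]] Y by (simp add: eq R_def CHom idm)
    fix e' assume e': "e' \<in> E"
    obtain M' Y' \<phi>' where eq': "e' = (M', Y', \<phi>')" by (cases e')
    note two' = two[OF e[unfolded eq] e'[unfolded eq']]
    { fix f assume "f \<in> Hom ?C (fst e) (fst e')"
      then show "\<exists>g\<in>Hom D (fst (snd e)) (fst (snd e')). R e e' f g" using two' by (simp add: eq eq') }
    { fix g assume "g \<in> Hom D (fst (snd e)) (fst (snd e'))"
      then show "\<exists>f\<in>Hom ?C (fst e) (fst e'). R e e' f g" using two' by (simp add: eq eq') }
    { fix f g g' assume "f \<in> Hom ?C (fst e) (fst e')" "g \<in> Hom D (fst (snd e)) (fst (snd e'))"
        "g' \<in> Hom D (fst (snd e)) (fst (snd e'))" "R e e' f g" "R e e' f g'"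
      then show "g = g'" using two' unfolding eq eq' fst_conv snd_conv by blast }
    { fix f f' g assume "f \<in> Hom ?C (fst e) (fst e')" "f' \<in> Hom ?C (fst e) (fst e')"
        "g \<in> Hom D (fst (snd e)) (fst (snd e'))" "R e e' f g" "R e e' f' g"
      then show "f = f'" using two' unfolding eq eq' fst_conv snd_conv by blast }
    fix e'' f g f' g' assume e'': "e'' \<in> E" and h: "f \<in> Hom ?C (fst e) (fst e')" "g \<in> Hom D (fst (snd e)) (fst (snd e'))"
      "f' \<in> Hom ?C (fst e') (fst e'')" "g' \<in> Hom D (fst (snd e')) (fst (snd e''))" "R e e' f g" "R e' e'' f' g'"
    obtain M'' Y'' \<phi>'' where eq'': "e'' = (M'', Y'', \<phi>'')" by (cases e'')
    have Y': "Y' \<in> Obj D" "Y'' \<in> Obj D" using e' e'' eq' eq'' by (simp_all add: E_def)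
    have fw: "f x \<in> wts M' \<mu>" if "x \<in> wts M \<mu>" for x \<mu>
    proof -
      have "f \<in> Hom ?C M M'" using h(1) by (simp add: eq eq')
      then show ?thesis using two[OF e[unfolded eq] e'[unfolded eq']] that by blast
    qed
    show "R e e'' (Comp ?C (fst e) (fst e') (fst e'') f' f) (Comp D (fst (snd e)) (fst (snd e')) (fst (snd e'')) g' g)"
      using h(5,6) fw wc[OF e[unfolded eq]] Y Y'
      unfolding eq eq' eq'' R_def CHom by (simp add: comp compose_eq)
  next
    fix M assume M: "M \<in> Obj ?C"
    then interpret w: weight_ops M "wsc n M" n "wt n M" "wd n M" \<nu> by (simp add: sb_Obj_iff)
    interpret w: weight_classes n k \<nu> idx M "wsc n M" "wt n M" "wd n M" by unfold_locales
    obtain Y :: "('r, 'b) module" and sd gr th z \<phi> where "weight_link n k \<nu> idx M (wsc n M) (wt n M) (wd n M) Y sd gr th z \<phi>"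
      using w.link_from_module[OF universe_b] by blast
    from real[OF this] obtain Y where "Y \<in> Obj D" "?link M Y \<phi>" by blast
    then show "\<exists>e\<in>E. fst e = M" using M by (intro bexI[of _ "(M, Y, \<phi>)"]) (auto simp: E_def)
  next
    fix Y assume Y: "Y \<in> Obj D"
    obtain M :: "(cpoly \<Rightarrow> cpoly, 'a) module" and \<phi> where M: "left_module (weyl n) M" "?link M Y \<phi>"
      using link_to_module[OF data[OF Y] universe_a] by blast
    then have "M \<in> Obj ?C" by (simp add: sb_Obj_iff weight_link_def)
    then show "\<exists>e\<in>E. fst (snd e) = Y" using M Y by (intro bexI[of _ "(M, Y, \<phi>)"]) (auto simp: E_def)
  qed
  show ?thesis by (rule S.equivalent)
qed

lemma weight_link_target_cong:
  fixes V :: "('r, 'b) module"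
  assumes L: "weight_link n k \<nu> idx M sc T D V sd gr th z \<phi>"
    and cs: "cspace (V\<lparr>smult := s\<rparr>) sd'"
    and sd: "\<And>c x. x \<in> carrier V \<Longrightarrow> sd' c x = sd c x"
    and th: "\<And>j x. j \<in> {1..k} \<Longrightarrow> x \<in> carrier V \<Longrightarrow> th' j x = th j x"
    and z: "\<And>x. x \<in> carrier V \<Longrightarrow> z' x = z x"
    and gr: "\<And>h. h \<in> Gk k \<Longrightarrow> gr' h = gr h"
  shows "weight_link n k \<nu> idx M sc T D (V\<lparr>smult := s\<rparr>) sd' gr' th' z' \<phi>"
proof -
  interpret L: weight_link n k \<nu> idx M sc T D V sd gr th z \<phi> by (rule L)
  let ?V = "V\<lparr>smult := s\<rparr>"
  interpret W: cspace ?V sd' by (rule cs)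
  have "dsum ?V sd' (Gk k) gr" by (rule dsum_smult_update[OF L.V.dsum_axioms cs sd])
  then interpret W: dsum ?V sd' "Gk k" gr .
  have ds: "dsum ?V sd' (Gk k) gr'"
    by unfold_locales (use W.sub W.ids gr internal_direct_sum_cong[of "Gk k" gr' gr ?V] in auto)
  have G: "graded_data ?V sd' k gr' th' z'"
  proof (intro graded_data.intro ds graded_data_axioms.intro)
    have zc: "L.V.endo z" by (rule L.V.z_lin)
    show "lin_on (carrier ?V) ?V sd' ?V sd' z'"
      using L.V.z_lin sd z by (simp add: lin_on_def)
    show "z' v \<in> gr' h" if "h \<in> Gk k" "v \<in> gr' h" for h v
      using that L.V.z_gr gr z L.V.W_carrier by simp
    show "W.nil z' v" if "v \<in> carrier ?V" for v
    proof -
      have v: "v \<in> carrier V" using that by simp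
      have "(z' ^^ N) v = (z ^^ N) v" for N
        by (induction N) (use z L.V.endo_pow_closed[OF zc v] in auto)
      then show ?thesis using L.V.z_nil[OF v] by (simp add: W.nil_def L.V.nil_def)
    qed
    show "fd ?V sd' (carrier ?V)"
    proof -
      obtain B where B: "finite B" "B \<subseteq> carrier V" "\<And>w. w \<in> carrier V \<Longrightarrow> \<exists>c. w = (\<Oplus>\<^bsub>V\<^esub>b\<in>B. sd (c b) b)"
        using L.V.V_fd unfolding fd_def by blast
      have "(\<Oplus>\<^bsub>?V\<^esub>b\<in>B. sd' (c b) b) = (\<Oplus>\<^bsub>V\<^esub>b\<in>B. sd (c b) b)" for c
        unfolding finsum_smult_update using B(2) sd by (intro L.V.finsum_cong') auto
      then show ?thesis unfolding fd_def using B by (intro exI[of _ B]) simp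
    qed
    fix j assume j: "j \<in> {1..k}"
    show "lin_on (carrier ?V) ?V sd' ?V sd' (th' j)"
      using L.V.th_lin[OF j] sd th[OF j] by (simp add: lin_on_def)
    show "th' j v \<in> gr' (h + Poly_Mapping.single j 1)" if "h \<in> Gk k" "v \<in> gr' h" for h v
      using that L.V.th_gr[OF j that(1)] gr th[OF j] L.V.W_carrier Gk_single[OF that(1) j] by simp
    fix v assume "v \<in> carrier ?V"
    then have v: "v \<in> carrier V" by simp
    show "th' j (th' j v) = z' v" using v j th[OF j] z L.V.th_sq[OF j v] by simp
    show "z' (th' j v) = th' j (z' v)" using v j th[OF j] z L.V.z_th[OF j v] by simp
    show "th' i (th' j v) = th' j (th' i v)" if i: "i \<in> {1..k}" for i
      using v i j th[OF j] th[OF i] L.V.th_th[OF i j v] by simp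
  qed
  have pc: "\<phi> \<mu> x \<in> carrier V" if "\<mu> \<in> L.\<Lambda>" "x \<in> L.M.Wt \<mu>" for \<mu> x using lin_onD(1)[OF L.phi_lin[OF that(1)] that(2)] .
  show ?thesis
  proof (intro weight_link.intro L.int_index_axioms L.M.weight_ops_axioms G weight_link_axioms.intro)
    fix \<mu> assume \<mu>: "\<mu> \<in> L.\<Lambda>"
    show "lin_on (L.M.Wt \<mu>) M sc ?V sd' (\<phi> \<mu>)" using L.phi_lin[OF \<mu>] sd by (simp add: lin_on_def)
    show "bij_betw (\<phi> \<mu>) (L.M.Wt \<mu>) (gr' (L.cl \<mu>))" using L.phi_bij[OF \<mu>] gr by simp
    fix i x assume i: "i \<le> n" and x: "x \<in> L.M.Wt \<mu>"
    have J: "\<mu> i = -1 \<or> \<mu> i = 0 \<Longrightarrow> L.jx i \<in> {1..k}" using L.cross_Int[OF \<mu> i] by auto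
    show "\<phi> (\<mu>(i := \<mu> i + 1)) (T i x) = (if \<mu> i = -1 then th' (L.jx i) (\<phi> \<mu> x) else \<phi> \<mu> x)"
      using L.phi_T[OF \<mu> i x] th[OF J pc[OF \<mu> x]] by simp
    show "\<phi> (\<mu>(i := \<mu> i - 1)) (D i x) = (if \<mu> i = 0 then th' (L.jx i) (\<phi> \<mu> x) else sd' (\<mu> i) (\<phi> \<mu> x) \<oplus>\<^bsub>?V\<^esub> z' (\<phi> \<mu> x))"
      using L.phi_D[OF \<mu> i x] th[OF J pc[OF \<mu> x]] z[OF pc[OF \<mu> x]] sd[OF pc[OF \<mu> x]] by simp
    show "\<phi> \<mu> (L.M.A i (\<mu> i) x) = z' (\<phi> \<mu> x)" using L.phi_z[OF \<mu> i x] z[OF pc[OF \<mu> x]] by simp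
  qed
qed

text \<open>The target categories ask for one exponent valid on the whole module, while
  \<open>nil\<close> provides one per vector; a finite spanning set bridges the two.\<close>

lemma (in cspace) nil_uniform:
  assumes fd: "fd V sc (carrier V)" and f: "endo f" and nil: "\<And>v. v \<in> carrier V \<Longrightarrow> nil f v"
  shows "\<exists>N. \<forall>v\<in>carrier V. (f ^^ N) v = \<zero>"
proof -
  obtain B where B: "finite B" "B \<subseteq> carrier V" "\<And>w. w \<in> carrier V \<Longrightarrow> \<exists>c. w = (\<Oplus>b\<in>B. sc (c b) b)"
    using fd unfolding fd_def by blast
  have "\<forall>b\<in>B. \<exists>N. (f ^^ N) b = \<zero>" using nil B(2) by (auto simp: nil_def)
  from bchoice[OF this] obtain N where N: "\<And>b. b \<in> B \<Longrightarrow> (f ^^ N b) b = \<zero>" by blast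
  let ?N = "\<Sum>b\<in>B. N b"
  have Nb: "(f ^^ ?N) b = \<zero>" if "b \<in> B" for b
    by (rule pow_zero_mono[OF f N[OF that]]) (rule member_le_sum[OF that _ B(1)], simp)
  have "(f ^^ ?N) v = \<zero>" if v: "v \<in> carrier V" for v
  proof -
    obtain c where c: "v = (\<Oplus>b\<in>B. sc (c b) b)" using B(3)[OF v] by blast
    have "(f ^^ ?N) v = (\<Oplus>b\<in>B. (f ^^ ?N) (sc (c b) b))"
      unfolding c using B(1,2) cspace_axioms by (intro lin_finsum[OF _ endo_funpow[OF f] csub_carrier]) auto
    also have "\<dots> = (\<Oplus>b\<in>B. \<zero>)"
      using B(2) Nb lin_onD(3)[OF endo_funpow[OF f]] by (intro finsum_cong') auto
    finally show ?thesis by simp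
  qed
  then show ?thesis by blast
qed

declare One_nat_def [simp del]

section \<open>The case of no integral coordinate\<close>

lemma Gk_0: "Gk 0 = {0}" by (auto simp: Gk_def)

lemma poly_quot_poly: "I \<subseteq> {..<K} \<Longrightarrow> poly_quot (poly_ring_on I) I K (\<lambda>p. p)"
  using cring.axioms(1)[OF cring_poly_ring_on[of I]]
  by (auto simp: poly_quot_def poly_quot_axioms_def ring_hom_def poly_ring_on_def)

text \<open>For k = 0 the group \<open>Gk 0\<close> is trivial: the grading has the single piece
  \<open>carrier Y\<close>, there are no \<theta>_j, and the variable acts as
  \<open>z\<close>.\<close>

theorem nilpotent_Cz_equivalence:
  assumes idx: "int_index n 0 \<nu> idx"
    and universe_a: "\<exists>u :: complex \<Rightarrow> 'a. inj u" and universe_b: "\<exists>u :: complex \<Rightarrow> 'b. inj u"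
  shows "equivalent_categories
    (sb_weight_category n \<nu> :: ((cpoly \<Rightarrow> cpoly, 'a) module, 'a \<Rightarrow> 'a) category)
    (nilpotent_Cz_category :: ((cpoly, 'b) module, 'b \<Rightarrow> 'b) category)"
proof -
  let ?R = "poly_ring_on {0}"
  let ?D = "nilpotent_Cz_category :: ((cpoly, 'b) module, 'b \<Rightarrow> 'b) category"
  interpret Q: poly_quot ?R "{0}" 1 "\<lambda>p. p" by (rule poly_quot_poly) simp
  have Obj: "Y \<in> Obj ?D \<longleftrightarrow> left_module ?R Y \<and> fd Y (\<lambda>c. smult Y (Const c)) (carrier Y) \<and>
    (\<exists>N::nat. \<forall>v\<in>carrier Y. (Var 0 [^]\<^bsub>?R\<^esub> N) \<odot>\<^bsub>Y\<^esub> v = \<zero>\<^bsub>Y\<^esub>)" for Y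
    by (simp add: nilpotent_Cz_category_def module_category_def finite_dimensional_iff)
  have V0: "Var 0 \<in> carrier ?R" by (simp add: poly_ring_on_def)
  have pow: "(Var 0 [^]\<^bsub>?R\<^esub> N) \<odot>\<^bsub>Y\<^esub> v = (smult Y (Var 0) ^^ N) v" if "left_module ?R Y" "v \<in> carrier Y" for Y :: "(cpoly, 'b) module" and v and N :: nat
    using left_module.smult_pow[OF that(1) V0 that(2)] by simp
  show ?thesis
  proof (rule equivalence_with_graded_data[where rc="\<lambda>Y. Y" and ds="\<lambda>Y c. smult Y (Const c)"
        and dg="\<lambda>Y h. carrier Y" and dt="\<lambda>Y j v. v" and dz="\<lambda>Y. smult Y (Var 0)", OF idx universe_a universe_b])
    show "is_category ?D" unfolding nilpotent_Cz_category_def by (rule is_category_module_category)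
    fix Y assume Y: "Y \<in> Obj ?D"
    then interpret left_module ?R Y by (simp add: Obj)
    interpret Q: poly_quot_module ?R "{0}" 1 "\<lambda>p. p" Y by unfold_locales
    have "dsum Y Q.nsc (Gk 0) (\<lambda>h. carrier Y)"
    proof (rule Q.O.dsumI)
      show "csub Y Q.nsc (carrier Y)" by (rule Q.O.csub_carrier)
      show "\<exists>J f. finite J \<and> J \<subseteq> Gk 0 \<and> (\<forall>i\<in>J. f i \<in> carrier Y) \<and> m = finsum Y f J" if "m \<in> carrier Y" for m
        using that by (intro exI[of _ "{0}"] exI[of _ "\<lambda>_. m"]) (simp add: Gk_0)
      fix J and f :: "(nat \<Rightarrow>\<^sub>0 bit) \<Rightarrow> 'b" assume J: "finite J" "J \<subseteq> Gk 0" "\<And>i. i \<in> J \<Longrightarrow> f i \<in> carrier Y" "finsum Y f J = \<zero>\<^bsub>Y\<^esub>"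
      then consider "J = {}" | "J = {0}" by (auto simp: Gk_0)
      then show "\<forall>i\<in>J. f i = \<zero>\<^bsub>Y\<^esub>" using J(3,4) by cases auto
    qed
    then show "graded_data Y Q.nsc 0 (\<lambda>h. carrier Y) (\<lambda>j v. v) (smult Y (Var 0))"
    proof (intro graded_data.intro graded_data_axioms.intro)
      show "lin_on (carrier Y) Y Q.nsc Y Q.nsc (smult Y (Var 0))" by (rule Q.O.X_lin) simp
      show "smult Y (Var 0) v \<in> carrier Y" if "v \<in> carrier Y" for v using V0 that by (simp add: smult_closed)
      show "Q.O.nil (smult Y (Var 0)) v" if "v \<in> carrier Y" for v
        using Y pow[OF left_module_axioms that] that unfolding Obj Q.O.nil_def by metis
      show "fd Y Q.nsc (carrier Y)" using Y by (simp add: Obj)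
    qed simp_all
    show "Idm ?D Y = restrict id (carrier Y)" by (simp add: nilpotent_Cz_category_def module_category_def)
    fix Y' g assume Y': "Y' \<in> Obj ?D"
    have lm: "left_module ?R Y" "left_module ?R Y'" using Y Y' by (auto simp: Obj)
    show "g \<in> Hom ?D Y Y' \<longleftrightarrow> g \<in> carrier Y \<rightarrow>\<^sub>E carrier Y' \<and>
      lin_on (carrier Y) Y Q.nsc Y' (\<lambda>c. smult Y' (Const c)) g \<and>
      (\<forall>h\<in>Gk 0. g ` carrier Y \<subseteq> carrier Y') \<and>
      (\<forall>v\<in>carrier Y. (\<forall>j\<in>{1..0}. g v = g v) \<and> g (smult Y (Var 0) v) = smult Y' (Var 0) (g v))"
      using Q.module_maps_iff[OF lm] by (auto simp: nilpotent_Cz_category_def module_category_def lin_on_def)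
  next
    show "Comp ?D X Y Z g f = compose (carrier X) g f" for X Y Z g f
      by (simp add: nilpotent_Cz_category_def module_category_def)
  next
    fix M :: "(cpoly \<Rightarrow> cpoly, 'a) module" and sc T D' and V :: "(cpoly, 'b) module" and sd gr th z \<phi>
    assume L: "weight_link n 0 \<nu> idx M sc T D' V sd gr th z \<phi>"
    then interpret L: weight_link n 0 \<nu> idx M sc T D' V sd gr th z \<phi> .
    \<comment> \<open>A link may come with any family \<open>gr\<close>; over the one-element group
      its only component is the whole space.\<close>
    have gr: "carrier V = gr h" if "h \<in> Gk 0" for h
    proof (intro subset_antisym subsetI)
      fix v assume v: "v \<in> carrier V"
      have "v = (\<Oplus>\<^bsub>V\<^esub>i\<in>{0}. L.V.comp v i)"
        using L.V.supp_sub[of v] by (intro L.V.comp_sum[OF v]) (auto simp: Gk_0)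
      then show "v \<in> gr h" using L.V.comp_in[OF v that] L.V.comp_closed[OF v that] that by (simp add: Gk_0)
    next
      fix v assume "v \<in> gr h" then show "v \<in> carrier V" using L.V.W_carrier[OF that] by blast
    qed
    interpret X: commuting_ops V sd "{0}" 1 "\<lambda>_. z"
      by unfold_locales (auto simp: L.V.z_lin)
    obtain s where s: "left_module ?R (V\<lparr>smult := s\<rparr>)" "\<And>p v. p \<in> polys {0} \<Longrightarrow> v \<in> carrier V \<Longrightarrow> s p v = X.evp p v"
      using Q.module_of_ops[OF X.commuting_ops_axioms] by auto
    let ?Y = "V\<lparr>smult := s\<rparr>"
    interpret Y: left_module ?R ?Y by (rule s(1))
    interpret Y: poly_quot_module ?R "{0}" 1 "\<lambda>p. p" ?Y by unfold_locales
    have "weight_link n 0 \<nu> idx M sc T D' ?Y (\<lambda>c. smult ?Y (Const c)) (\<lambda>h. carrier ?Y) (\<lambda>j v. v) (smult ?Y (Var 0)) \<phi>"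
      by (rule weight_link_target_cong[OF L Y.O.cspace_axioms]) (simp_all add: s(2) gr X.evp_Const X.evp_Var)
    moreover from this interpret N: weight_link n 0 \<nu> idx M sc T D' ?Y "\<lambda>c. smult ?Y (Const c)" "\<lambda>h. carrier ?Y" "\<lambda>j v. v" "smult ?Y (Var 0)" \<phi> .
    have "?Y \<in> Obj ?D"
      unfolding Obj using s(1) N.V.V_fd Y.O.nil_uniform[OF N.V.V_fd N.V.z_lin N.V.z_nil] pow[OF s(1)] by simp
    ultimately show "\<exists>Y\<in>Obj ?D. weight_link n 0 \<nu> idx M sc T D' Y (\<lambda>c. smult Y (Const c)) (\<lambda>h. carrier Y) (\<lambda>j v. v) (smult Y (Var 0)) \<phi>"
      by blast
  qed
qed

section \<open>The algebra \<open>\<B>(k)\<close>\<close>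

lemma ideal_B: "ideal (B_ideal k) (poly_ring_on {1..k})"
  unfolding B_ideal_def
  by (rule ring.genideal_ideal[OF cring.axioms(1)[OF cring_poly_ring_on]])
    (auto simp: poly_ring_on_def power2_eq_square)

lemma poly_quot_B: "poly_quot (B_algebra k) {1..k} (Suc k) (B_class k)"
proof -
  interpret I: ideal "B_ideal k" "poly_ring_on {1..k}" by (rule ideal_B)
  have "B_class k = (+>\<^bsub>poly_ring_on {1..k}\<^esub>) (B_ideal k)" by (rule ext) (simp add: B_class_def)
  then have hom: "B_class k \<in> ring_hom (poly_ring_on {1..k}) (B_algebra k)"
    using I.rcos_ring_hom by (simp add: B_algebra_def)
  have "ring (B_algebra k)" unfolding B_algebra_def by (rule I.quotient_is_ring)
  moreover have "carrier (B_algebra k) = B_class k ` polys {1..k}"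
    by (auto simp: B_algebra_def FactRing_def A_RCOSETS_def' B_class_def poly_ring_on_def)
  ultimately show ?thesis using hom by (auto simp: poly_quot_def poly_quot_axioms_def)
qed

lemma B_class_eqD:
  assumes "B_class k p = B_class k q" "p \<in> polys {1..k}"
  shows "\<exists>h\<in>B_ideal k. p = h + q"
proof -
  have "0 \<in> B_ideal k"
    using additive_subgroup.zero_closed[OF ideal.axioms(1)[OF ideal_B[of k]]] by (simp add: poly_ring_on_def)
  then have "p \<in> B_class k p" unfolding B_class_def a_r_coset_def' by (force simp: poly_ring_on_def)
  then show ?thesis unfolding assms(1) unfolding B_class_def a_r_coset_def' by (auto simp: poly_ring_on_def)
qed

lemma B_class_eqI:
  assumes "q - p \<in> B_ideal k" "p \<in> polys {1..k}" "q \<in> polys {1..k}"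
  shows "B_class k p = B_class k q"
proof -
  interpret I: ideal "B_ideal k" "poly_ring_on {1..k}" by (rule ideal_B)
  have "q \<in> B_class k p" unfolding B_class_def a_r_coset_def'
    using assms(1) by (force simp: poly_ring_on_def)
  moreover have "p \<in> carrier (poly_ring_on {1..k})" using assms(2) by (simp add: poly_ring_on_def)
  ultimately show ?thesis unfolding B_class_def by (intro I.a_repr_independence I.a_subgroup)
qed

lemma B_class_squares: "i \<in> {1..k} \<Longrightarrow> j \<in> {1..k} \<Longrightarrow> B_class k (Var i * Var i) = B_class k (Var j * Var j)"
proof (rule B_class_eqI)
  assume ij: "i \<in> {1..k}" "j \<in> {1..k}"
  let ?S = "{Var i ^ 2 - Var j ^ 2 | i j. i \<in> {1..k} \<and> j \<in> {1..k}}"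
  have "?S \<subseteq> carrier (poly_ring_on {1..k})" by (auto simp: poly_ring_on_def power2_eq_square)
  from ring.genideal_self[OF cring.axioms(1)[OF cring_poly_ring_on] this]
  show "Var j * Var j - Var i * Var i \<in> B_ideal k"
    unfolding B_ideal_def using ij by (auto simp: power2_eq_square)
qed auto

lemma monomial_degree_0 [simp]: "monomial_degree 0 = 0" by (simp add: monomial_degree_def)

lemma monomial_degree_single: "monomial_degree (Poly_Mapping.single i 1) = Poly_Mapping.single i 1"
  by (simp add: monomial_degree_def)

lemma monomial_degree_sum:
  assumes "Poly_Mapping.keys m \<subseteq> {..<K}"
  shows "monomial_degree m = (\<Sum>i<K. Poly_Mapping.single i (of_nat (Poly_Mapping.lookup m i)))"
  unfolding monomial_degree_def using assms by (intro sum.mono_neutral_left) (auto simp: in_keys_iff)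

lemma Const_component: "B_class k (Const c) \<in> B_component k 0"
  unfolding B_component_def by (rule imageI) (auto simp: Const_def polys_def split: if_splits)

lemma Var_component: "i \<in> {1..k} \<Longrightarrow> B_class k (Var i) \<in> B_component k (Poly_Mapping.single i 1)"
  unfolding B_component_def by (rule imageI) (auto simp: Var_def polys_def monomial_degree_single simp del: One_nat_def)

lemma zero_Gk [simp]: "0 \<in> Gk k" by (simp add: Gk_def)

lemma single_Gk: "i \<in> {1..k} \<Longrightarrow> Poly_Mapping.single i 1 \<in> Gk k" using Gk_single[OF zero_Gk] by simp

context graded_data begin

lemma comm_ops: "commuting_ops V sc {1..k} (Suc k) th"
  proof (unfold_locales)
  show "{1..k} \<subseteq> {..<Suc k}" by auto
qed (use th_lin th_th in blast)+

text \<open>The polynomials acting as zero form an ideal, and it contains the generators because all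
  squares act as \<open>z\<close>.\<close>

lemma evp_ideal:
  assumes h: "h \<in> B_ideal k" and v: "v \<in> carrier V"
  shows "commuting_ops.evp V sc {1..k} (Suc k) th h v = \<zero>"
proof -
  interpret X: commuting_ops V sc "{1..k}" "Suc k" th by (rule comm_ops)
  interpret P: cring "poly_ring_on {1..k}" by (rule cring_poly_ring_on)
  let ?J = "{p \<in> polys {1..k}. \<forall>v\<in>carrier V. X.evp p v = \<zero>}"
  have "csub (poly_ring_on {1..k}) (\<lambda>c p. Const c * p) ?J"
    by (rule cspace.csubI[OF cspace_poly])
      (auto simp: poly_ring_on_def X.evp_add X.evp_mult X.evp_Const)
  then have "subgroup ?J (add_monoid (poly_ring_on {1..k}))" by (simp add: csub_def additive_subgroup_def)
  then have "ideal ?J (poly_ring_on {1..k})"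
  proof (rule idealI[OF P.ring_axioms])
    fix a x assume "a \<in> ?J" "x \<in> carrier (poly_ring_on {1..k})"
    then show "x \<otimes>\<^bsub>poly_ring_on {1..k}\<^esub> a \<in> ?J" "a \<otimes>\<^bsub>poly_ring_on {1..k}\<^esub> x \<in> ?J"
      using endo_zero[OF X.endo_evp] by (auto simp: poly_ring_on_def X.evp_mult)
  qed
  moreover have "{Var i ^ 2 - Var j ^ 2 | i j. i \<in> {1..k} \<and> j \<in> {1..k}} \<subseteq> ?J"
  proof
    fix p assume "p \<in> {Var i ^ 2 - Var j ^ 2 | i j. i \<in> {1..k} \<and> j \<in> {1..k}}"
    then obtain i j where p: "p = Var i ^ 2 - Var j ^ 2" and ij: "i \<in> {1..k}" "j \<in> {1..k}" by blast
    have "X.evp (Var i ^ 2 - Var j ^ 2) v = \<zero>" if v: "v \<in> carrier V" for v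
    proof -
      have sq: "X.evp (Var l * Var l) v = z v" if "l \<in> {1..k}" for l
        using that v th_sq[OF that v] by (simp add: X.evp_mult X.evp_Var del: atLeastAtMost_iff)
      \<comment> \<open>\<open>evp\<close> is additive; writing one square as the other plus the
        difference isolates the latter.\<close>
      have "X.evp (Var i * Var i) v = X.evp (Var j * Var j) v \<oplus> X.evp (Var i ^ 2 - Var j ^ 2) v"
        using X.evp_add[OF v, of "Var j * Var j" "Var i ^ 2 - Var j ^ 2"] by (simp add: power2_eq_square)
      then show ?thesis using sq[OF ij(1)] sq[OF ij(2)] v add.l_cancel_one[of "z v"] by simp
    qed
    then show "p \<in> ?J" using ij by (simp add: p power2_eq_square)
  qed
  ultimately have "B_ideal k \<subseteq> ?J" unfolding B_ideal_def by (rule P.genideal_minimal)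
  then show ?thesis using h v by blast
qed

text \<open>Each variable shifts the degree by its own generator of \<open>Gk k\<close>; exponents
  enter modulo 2 through \<open>of_nat\<close> into \<open>bit\<close>.\<close>

lemma pm_graded:
  assumes m: "Poly_Mapping.keys m \<subseteq> {1..k}" and h: "h \<in> Gk k" and v: "v \<in> gr h"
  shows "commuting_ops.pm {1..k} (Suc k) th m v \<in> gr (monomial_degree m + h)"
proof -
  interpret X: commuting_ops V sc "{1..k}" "Suc k" th by (rule comm_ops)
  let ?a = "Poly_Mapping.lookup m"
  have pw: "Poly_Mapping.single L (of_nat r) + h' \<in> Gk k \<and> (X.Xt L ^^ r) w \<in> gr (Poly_Mapping.single L (of_nat r) + h')"
    if "L \<in> {1..k} \<or> r = 0" "h' \<in> Gk k" "w \<in> gr h'" for L r h' w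
    using that(1)
  proof (induction r)
    case 0 then show ?case using that by simp
  next
    case (Suc r)
    then have L: "L \<in> {1..k}" by simp
    have e: "Poly_Mapping.single L (of_nat (Suc r)) + h' = Poly_Mapping.single L (of_nat r) + h' + Poly_Mapping.single L 1"
      by (simp only: of_nat_Suc single_add ac_simps)
    have IH: "Poly_Mapping.single L (of_nat r) + h' \<in> Gk k" "(X.Xt L ^^ r) w \<in> gr (Poly_Mapping.single L (of_nat r) + h')"
      using Suc L by auto
    show ?case unfolding e using Gk_single[OF IH(1) L] th_gr[OF L IH] L by (simp add: X.Xt_def)
  qed
  have "(\<Sum>i<L. Poly_Mapping.single i (of_nat (?a i))) + h \<in> Gk k \<and>
    mop X.Xt L ?a v \<in> gr ((\<Sum>i<L. Poly_Mapping.single i (of_nat (?a i))) + h)" for L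
  proof (induction L)
    case 0 then show ?case using h v by simp
  next
    case (Suc L)
    have "L \<in> {1..k} \<or> ?a L = 0" using m by (cases "L \<in> Poly_Mapping.keys m") (blast, simp add: in_keys_iff)
    from pw[OF this conjunct1[OF Suc] conjunct2[OF Suc]] show ?case by (simp add: ac_simps)
  qed
  then have "X.pm m v \<in> gr ((\<Sum>i<Suc k. Poly_Mapping.single i (of_nat (?a i))) + h)" unfolding X.pm_def by blast
  moreover have "Poly_Mapping.keys m \<subseteq> {..<Suc k}" using m by auto
  ultimately show ?thesis using monomial_degree_sum[of m "Suc k"] by simp
qed

lemma evp_graded:
  assumes p: "p \<in> polys {1..k}" "\<And>m. m \<in> Poly_Mapping.keys p \<Longrightarrow> monomial_degree m = g"
    and g: "g \<in> Gk k" and h: "h \<in> Gk k" and v: "v \<in> gr h"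
  shows "commuting_ops.evp V sc {1..k} (Suc k) th p v \<in> gr (g + h)"
proof -
  interpret X: commuting_ops V sc "{1..k}" "Suc k" th by (rule comm_ops)
  have gh: "g + h \<in> Gk k" using g h Poly_Mapping.keys_add[of g h] by (auto simp: Gk_def)
  show ?thesis
    unfolding X.evp_def ev_def
  proof (rule csub_finsum[OF sub[OF gh]])
    fix m assume m: "m \<in> Poly_Mapping.keys p"
    then have "Poly_Mapping.keys m \<subseteq> {1..k}" using p by (auto simp: polys_def)
    from pm_graded[OF this h v] show "sc (Poly_Mapping.lookup p m) (X.pm m v) \<in> gr (g + h)"
      using p(2)[OF m] csubD(5)[OF sub[OF gh]] by simp
  qed simp
qed

end

lemma is_category_graded_B: "is_category (graded_B_category k)"
  unfolding is_category_def
proof (intro conjI ballI)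
  fix X :: "(cpoly set, 'a) module \<times> ((nat \<Rightarrow>\<^sub>0 bit) \<Rightarrow> 'a set)" assume "X \<in> Obj (graded_B_category k)"
  then obtain V gr where X: "X = (V, gr)" "graded_B_module k (V, gr)" by (auto simp: graded_B_category_def)
  then interpret left_module "B_algebra k" V by (simp add: graded_B_module_def)
  have "gr g \<subseteq> carrier V" if "g \<in> Gk k" for g
    using X(2) that additive_subgroup.a_subset by (auto simp: graded_B_module_def internal_direct_sum_def)
  then show "Idm (graded_B_category k) X \<in> Hom (graded_B_category k) X X"
    using X(1) by (auto simp: graded_B_category_def module_maps_def smult_closed)
next
  fix X Y Z :: "(cpoly set, 'a) module \<times> ((nat \<Rightarrow>\<^sub>0 bit) \<Rightarrow> 'a set)" and f g
  assume "X \<in> Obj (graded_B_category k)" "f \<in> Hom (graded_B_category k) X Y" "g \<in> Hom (graded_B_category k) Y Z"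
  moreover obtain V gr V' gr' V'' gr'' where e: "X = (V, gr)" "Y = (V', gr')" "Z = (V'', gr'')" by (cases X; cases Y; cases Z) auto
  ultimately have X: "graded_B_module k (V, gr)" and f: "f \<in> module_maps (B_algebra k) V V'" "\<And>h. h \<in> Gk k \<Longrightarrow> f ` gr h \<subseteq> gr' h"
    and g: "g \<in> module_maps (B_algebra k) V' V''" "\<And>h. h \<in> Gk k \<Longrightarrow> g ` gr' h \<subseteq> gr'' h"
    by (auto simp: graded_B_category_def)
  interpret left_module "B_algebra k" V using X by (simp add: graded_B_module_def)
  have "gr h \<subseteq> carrier V" if "h \<in> Gk k" for h
    using X that additive_subgroup.a_subset by (auto simp: graded_B_module_def internal_direct_sum_def)
  then have "compose (carrier V) g f ` gr h \<subseteq> gr'' h" if "h \<in> Gk k" for h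
    using f(2)[OF that] g(2)[OF that] that by (fastforce simp: compose_def)
  moreover have "compose (carrier V) g f \<in> module_maps (B_algebra k) V V''"
    using f(1) g(1) by (auto simp: module_maps_def compose_def smult_closed PiE_def Pi_def)
  ultimately show "Comp (graded_B_category k) X Y Z g f \<in> Hom (graded_B_category k) X Z"
    by (simp add: graded_B_category_def e)
next
  fix X Y :: "(cpoly set, 'a) module \<times> ((nat \<Rightarrow>\<^sub>0 bit) \<Rightarrow> 'a set)" and f
  assume "f \<in> Hom (graded_B_category k) X Y"
  moreover obtain V gr V' gr' where e: "X = (V, gr)" "Y = (V', gr')" by (cases X; cases Y) auto
  ultimately have f: "f \<in> carrier V \<rightarrow>\<^sub>E carrier V'" by (auto simp: graded_B_category_def module_maps_def)
  show "Comp (graded_B_category k) X Y Y (Idm (graded_B_category k) Y) f = f"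
    "Comp (graded_B_category k) X X Y f (Idm (graded_B_category k) X) = f"
    using f by (auto simp: graded_B_category_def e compose_def fun_eq_iff PiE_def extensional_def Pi_def)
next
  fix W X Y Z :: "(cpoly set, 'a) module \<times> ((nat \<Rightarrow>\<^sub>0 bit) \<Rightarrow> 'a set)" and f g h
  assume "f \<in> Hom (graded_B_category k) W X"
  moreover obtain V gr V' gr' where e: "W = (V, gr)" "X = (V', gr')" by (cases W; cases X) auto
  ultimately have f: "f \<in> carrier V \<rightarrow>\<^sub>E carrier V'" by (auto simp: graded_B_category_def module_maps_def)
  show "Comp (graded_B_category k) W Y Z h (Comp (graded_B_category k) W X Y g f) =
    Comp (graded_B_category k) W X Z (Comp (graded_B_category k) X Y Z h g) f"
    using f by (cases Y; cases Z) (auto simp: graded_B_category_def e compose_def fun_eq_iff PiE_def extensional_def Pi_def)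
qed

text \<open>For k > 0 the operator \<open>z\<close> is recovered as the square of \<theta>_1, which
  is the square of every \<theta>_j by the relations of B(k).\<close>

theorem graded_B_equivalence:
  assumes idx: "int_index n k \<nu> idx" and k: "k > 0"
    and universe_a: "\<exists>u :: complex \<Rightarrow> 'a. inj u" and universe_b: "\<exists>u :: complex \<Rightarrow> 'b. inj u"
  shows "equivalent_categories
    (sb_weight_category n \<nu> :: ((cpoly \<Rightarrow> cpoly, 'a) module, 'a \<Rightarrow> 'a) category)
    (graded_B_category k :: ((cpoly set, 'b) module \<times> ((nat \<Rightarrow>\<^sub>0 bit) \<Rightarrow> 'b set), 'b \<Rightarrow> 'b) category)"
proof -
  let ?R = "B_algebra k" and ?c = "B_class k"
  let ?D = "graded_B_category k :: ((cpoly set, 'b) module \<times> ((nat \<Rightarrow>\<^sub>0 bit) \<Rightarrow> 'b set), 'b \<Rightarrow> 'b) category"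
  interpret Q: poly_quot ?R "{1..k}" "Suc k" ?c by (rule poly_quot_B)
  have one: "1 \<in> {1..k}" using k by simp
  have Obj: "(V, gr) \<in> Obj ?D \<longleftrightarrow> left_module ?R V \<and> internal_direct_sum V (Gk k) gr \<and>
     (\<forall>g\<in>Gk k. \<forall>h\<in>Gk k. \<forall>a\<in>B_component k g. \<forall>v\<in>gr h. a \<odot>\<^bsub>V\<^esub> v \<in> gr (g + h)) \<and>
     fd V (\<lambda>c. smult V (?c (Const c))) (carrier V) \<and>
     (\<forall>i\<in>{1..k}. \<exists>N::nat. \<forall>v\<in>carrier V. (?c (Var i) [^]\<^bsub>?R\<^esub> N) \<odot>\<^bsub>V\<^esub> v = \<zero>\<^bsub>V\<^esub>)" for V gr
    by (auto simp: graded_B_category_def graded_B_module_def finite_dimensional_iff)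
  have pow: "(?c (Var i) [^]\<^bsub>?R\<^esub> N) \<odot>\<^bsub>V\<^esub> v = (smult V (?c (Var i)) ^^ N) v"
    if "left_module ?R V" "i \<in> {1..k}" "v \<in> carrier V" for V :: "(cpoly set, 'b) module" and v i and N :: nat
    using left_module.smult_pow[OF that(1) Q.psi_closed[OF polys_Var[OF that(2)]] that(3)] by simp
  let ?z = "\<lambda>V :: (cpoly set, 'b) module. \<lambda>v. smult V (?c (Var 1)) (smult V (?c (Var 1)) v)"
  show ?thesis
  proof (rule equivalence_with_graded_data[where rc="fst" and ds="\<lambda>Y c. smult (fst Y) (?c (Const c))"
        and dg="snd" and dt="\<lambda>Y j. smult (fst Y) (?c (Var j))" and dz="\<lambda>Y. ?z (fst Y)", OF idx universe_a universe_b])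
    show "is_category ?D" by (rule is_category_graded_B)
    fix Y assume YO: "Y \<in> Obj ?D"
    obtain V gr where Y: "Y = (V, gr)" by (cases Y)
    note O = YO[unfolded Y Obj]
    show "Idm ?D Y = restrict id (carrier (fst Y))" by (simp add: graded_B_category_def Y)
    interpret left_module ?R V using O by blast
    interpret M: poly_quot_module ?R "{1..k}" "Suc k" ?c V by unfold_locales
    have ids: "internal_direct_sum V (Gk k) gr" using O by blast
    have act: "smult V a v \<in> gr (g + h)" if "g \<in> Gk k" "h \<in> Gk k" "a \<in> B_component k g" "v \<in> gr h" for g h a v
      using O that by blast
    have "dsum V M.nsc (Gk k) gr"
    proof (intro dsum.intro M.O.cspace_axioms dsum_axioms.intro ids)
      show "csub V M.nsc (gr h)" if "h \<in> Gk k" for h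
        using ids that act[OF zero_Gk that Const_component] by (simp add: csub_def internal_direct_sum_def)
    qed
    then interpret S: dsum V M.nsc "Gk k" gr .
    have thg: "smult V (?c (Var j)) v \<in> gr (h + Poly_Mapping.single j 1)" if "j \<in> {1..k}" "h \<in> Gk k" "v \<in> gr h" for j h v
      using act[OF single_Gk[OF that(1)] that(2) Var_component[OF that(1)] that(3)] by (simp only: add.commute)
    have sq: "smult V (?c (Var j)) (smult V (?c (Var j)) v) = ?z V v" if "j \<in> {1..k}" "v \<in> carrier V" for j v
      unfolding M.smult_psi_mult[OF polys_Var[OF that(1)] polys_Var[OF that(1)] that(2)]
        M.smult_psi_mult[OF polys_Var[OF one] polys_Var[OF one] that(2)] B_class_squares[OF that(1) one] ..
    note X1 = M.O.X_lin[OF one]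
    show "graded_data (fst Y) (\<lambda>c. smult (fst Y) (?c (Const c))) k (snd Y) (\<lambda>j. smult (fst Y) (?c (Var j))) (?z (fst Y))"
      unfolding Y fst_conv snd_conv
    proof (intro graded_data.intro S.dsum_axioms graded_data_axioms.intro M.O.X_lin M.O.X_X thg sq)
      show "M.O.endo (?z V)" by (rule M.O.endo_comp[OF X1 X1])
      show "?z V v \<in> gr h" if "h \<in> Gk k" "v \<in> gr h" for h v
        using thg[OF one Gk_single[OF that(1) one] thg[OF one that]] by (simp only: int_index.bit_single_twice[OF idx])
      show "?z V (smult V (?c (Var j)) v) = smult V (?c (Var j)) (?z V v)" if "j \<in> {1..k}" "v \<in> carrier V" for j v
        using that one M.O.X_X[OF one that(1)] lin_onD(1)[OF X1] by simp
      show "fd V M.nsc (carrier V)" using O by blast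
      show "M.O.nil (?z V) v" if v: "v \<in> carrier V" for v
      proof -
        obtain N :: nat where N: "(?c (Var 1) [^]\<^bsub>?R\<^esub> N) \<odot>\<^bsub>V\<^esub> v = \<zero>\<^bsub>V\<^esub>" using O one v by blast
        then have "(smult V (?c (Var 1)) ^^ N) v = \<zero>\<^bsub>V\<^esub>" using pow[OF left_module_axioms one v] by simp
        \<comment> \<open>If \<theta>_1^N kills \<open>v\<close>, so does \<theta>_1^(2N), which is
          z^N.\<close>
        then have "(smult V (?c (Var 1)) ^^ (2 * N)) v = \<zero>\<^bsub>V\<^esub>" by (rule M.O.pow_zero_mono[OF X1]) simp
        moreover have "?z V = smult V (?c (Var 1)) ^^ 2" by (simp add: fun_eq_iff numeral_2_eq_2)
        ultimately have "(?z V ^^ N) v = \<zero>\<^bsub>V\<^esub>" by (simp add: funpow_mult)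
        then show ?thesis unfolding M.O.nil_def by blast
      qed
    qed
    fix Y' g assume YO': "Y' \<in> Obj ?D"
    obtain V' gr' where Y': "Y' = (V', gr')" by (cases Y')
    have lm: "left_module ?R V'" using YO' unfolding Y' Obj by blast
    have H: "g \<in> Hom ?D Y Y' \<longleftrightarrow> g \<in> module_maps ?R V V' \<and> (\<forall>h\<in>Gk k. g ` gr h \<subseteq> gr' h)"
      by (simp add: graded_B_category_def Y Y')
    have zz: "g (?z V v) = ?z V' (g v)" if "\<forall>i\<in>{1..k}. \<forall>x\<in>carrier V. g (smult V (?c (Var i)) x) = smult V' (?c (Var i)) (g x)" "v \<in> carrier V" for v
      using that one lin_onD(1)[OF X1] by simp
    show "g \<in> Hom ?D Y Y' \<longleftrightarrow> g \<in> carrier (fst Y) \<rightarrow>\<^sub>E carrier (fst Y') \<and>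
      lin_on (carrier (fst Y)) (fst Y) (\<lambda>c. smult (fst Y) (?c (Const c))) (fst Y') (\<lambda>c. smult (fst Y') (?c (Const c))) g \<and>
      (\<forall>h\<in>Gk k. g ` snd Y h \<subseteq> snd Y' h) \<and>
      (\<forall>v\<in>carrier (fst Y). (\<forall>j\<in>{1..k}. g (smult (fst Y) (?c (Var j)) v) = smult (fst Y') (?c (Var j)) (g v)) \<and>
        g (?z (fst Y) v) = ?z (fst Y') (g v))"
      unfolding H Q.module_maps_iff[OF left_module_axioms lm] unfolding Y Y' fst_conv snd_conv using zz by blast
  next
    fix X Y Z and g f :: "'b \<Rightarrow> 'b"
    assume "X \<in> Obj ?D"
    show "Comp ?D X Y Z g f = compose (carrier (fst X)) g f"
      by (cases X; cases Y; cases Z) (simp add: graded_B_category_def)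
  next
    fix M :: "(cpoly \<Rightarrow> cpoly, 'a) module" and sc T D' and V :: "(cpoly set, 'b) module" and sd gr th z \<phi>
    assume L: "weight_link n k \<nu> idx M sc T D' V sd gr th z \<phi>"
    then interpret L: weight_link n k \<nu> idx M sc T D' V sd gr th z \<phi> .
    interpret X: commuting_ops V sd "{1..k}" "Suc k" th by (rule L.V.comm_ops)
    \<comment> \<open>Congruent polynomials differ by an element of \<open>B_ideal k\<close>, which
      acts as zero.\<close>
    have ker: "X.evp p v = X.evp q v" if p: "p \<in> polys {1..k}" and pq: "?c p = ?c q" and v: "v \<in> carrier V" for p q v
    proof -
      obtain h where h: "h \<in> B_ideal k" "p = h + q" using B_class_eqD[OF pq p] by blast
      then show ?thesis using v L.V.evp_ideal[OF h(1) v] by (simp add: X.evp_add)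
    qed
    obtain s where s: "left_module ?R (V\<lparr>smult := s\<rparr>)" "\<And>p v. p \<in> polys {1..k} \<Longrightarrow> v \<in> carrier V \<Longrightarrow> s (?c p) v = X.evp p v"
      using Q.module_of_ops[OF X.commuting_ops_axioms ker] by blast
    let ?V = "V\<lparr>smult := s\<rparr>"
    interpret Y: left_module ?R ?V by (rule s(1))
    interpret Y: poly_quot_module ?R "{1..k}" "Suc k" ?c ?V by unfold_locales
    have L': "weight_link n k \<nu> idx M sc T D' ?V (\<lambda>c. smult ?V (?c (Const c))) gr (\<lambda>j. smult ?V (?c (Var j))) (?z ?V) \<phi>"
    proof (rule weight_link_target_cong[OF L Y.O.cspace_axioms])
      show "Y.nsc c x = sd c x" if "x \<in> carrier V" for c x using that by (simp add: s X.evp_Const)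
      show t: "smult ?V (?c (Var j)) x = th j x" if "j \<in> {1..k}" "x \<in> carrier V" for j x
        using s(2)[OF polys_Var[OF that(1)] that(2)] X.evp_Var[OF that] by simp
      show "?z ?V x = z x" if x: "x \<in> carrier V" for x
        using t[OF one x] t[OF one L.V.th_closed[OF one x]] L.V.th_sq[OF one x] by simp
    qed simp
    then interpret N: weight_link n k \<nu> idx M sc T D' ?V "\<lambda>c. smult ?V (?c (Const c))" gr "\<lambda>j. smult ?V (?c (Var j))" "?z ?V" \<phi> .
    have "(?V, gr) \<in> Obj ?D"
      unfolding Obj
    proof (intro conjI ballI s(1) N.V.ids N.V.V_fd)
      fix g h a v assume g: "g \<in> Gk k" and h: "h \<in> Gk k" and a: "a \<in> B_component k g" and v: "v \<in> gr h"
      obtain p where p: "a = ?c p" "p \<in> polys {1..k}" "\<And>m. m \<in> Poly_Mapping.keys p \<Longrightarrow> monomial_degree m = g"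
        using a unfolding B_component_def by blast
      show "a \<odot>\<^bsub>?V\<^esub> v \<in> gr (g + h)"
        using L.V.evp_graded[OF p(2,3) g h v] s(2)[OF p(2) L.V.W_carrier[OF h v]] by (simp add: p(1))
    next
      fix i assume i: "i \<in> {1..k}"
      \<comment> \<open>Conversely, z^N v = 0 means that \<theta>_i^(2N) kills \<open>v\<close>; the
        exponent is made uniform afterwards.\<close>
      have "Y.O.nil (smult ?V (?c (Var i))) v" if v: "v \<in> carrier ?V" for v
      proof -
        let ?t = "smult ?V (?c (Var i))"
        obtain N where N: "(?z ?V ^^ N) v = \<zero>\<^bsub>?V\<^esub>" using N.V.z_nil[OF v] unfolding Y.O.nil_def by blast
        have "((?t ^^ 2) ^^ r) v = (?z ?V ^^ r) v" for r
        proof (induction r)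
          case (Suc r)
          have c: "(?z ?V ^^ r) v \<in> carrier ?V" by (rule Y.O.endo_pow_closed[OF N.V.z_lin v])
          show ?case using Suc N.V.th_sq[OF i c] by (simp add: numeral_2_eq_2)
        qed simp
        then have "(?t ^^ (2 * N)) v = \<zero>\<^bsub>?V\<^esub>" using N by (simp add: funpow_mult)
        then show ?thesis unfolding Y.O.nil_def by blast
      qed
      from Y.O.nil_uniform[OF N.V.V_fd N.V.th_lin[OF i] this]
      show "\<exists>N::nat. \<forall>v\<in>carrier ?V. (?c (Var i) [^]\<^bsub>?R\<^esub> N) \<odot>\<^bsub>?V\<^esub> v = \<zero>\<^bsub>?V\<^esub>"
        using pow[OF s(1) i] by simp
    qed
    then show "\<exists>Y\<in>Obj ?D. weight_link n k \<nu> idx M sc T D' (fst Y) (\<lambda>c. smult (fst Y) (?c (Const c))) (snd Y)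
        (\<lambda>j. smult (fst Y) (?c (Var j))) (?z (fst Y)) \<phi>"
      using L' by (intro bexI[of _ "(?V, gr)"]) simp_all
  qed
qed

theorem proposition5p13:
  fixes n k :: nat and \<nu> :: "nat \<Rightarrow> complex"
  assumes nu: "\<nu> \<in> weights n"
    and k: "k = card (Int_indices n \<nu>)"
    and universe_a: "\<exists>u :: complex \<Rightarrow> 'a. inj u"
    and universe_b: "\<exists>u :: complex \<Rightarrow> 'b. inj u"
  shows "(k > 0 \<longrightarrow> equivalent_categories
            (sb_weight_category n \<nu> :: ((cpoly \<Rightarrow> cpoly, 'a) module, 'a \<Rightarrow> 'a) category)
            (graded_B_category k ::
              ((cpoly set, 'b) module \<times> ((nat \<Rightarrow>\<^sub>0 bit) \<Rightarrow> 'b set), 'b \<Rightarrow> 'b) category)) \<and>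
         (k = 0 \<longrightarrow> equivalent_categories
            (sb_weight_category n \<nu> :: ((cpoly \<Rightarrow> cpoly, 'a) module, 'a \<Rightarrow> 'a) category)
            (nilpotent_Cz_category :: ((cpoly, 'b) module, 'b \<Rightarrow> 'b) category))"
proof -
  have "finite (Int_indices n \<nu>)" by (simp add: Int_indices_def)
  \<comment> \<open>Any enumeration of the integral coordinates serves; it decides which coordinate
    \<theta>_j belongs to.\<close>
  then obtain idx where "bij_betw idx {1..k} (Int_indices n \<nu>)"
    using ex_bij_betw_nat_finite_1 k by blast
  then have "int_index n k \<nu> idx" using nu by (simp add: int_index_def)
  then show ?thesis
    using graded_B_equivalence[OF _ _ universe_a universe_b] nilpotent_Cz_equivalence[OF _ universe_a universe_b] by blast
qed

end
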